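(* Let $0<s<1$ or $1<s<\infty$, and let $m\in\mathbb{R}$, $(p,q)\in\mathrm{I}\cup\mathrm{II}\cup\mathrm{IV}\cup\mathrm{VI}$, and $1/r=1/p+1/q$. Suppose that all $T^{s}_{\sigma}$ with $\sigma\in S^{m}_{1,0}(\mathbb{R}^{2n})$ are bounded from $H^{p}\times H^{q}$ to $L^{r}$, with $L^{r}$ replaced by $BMO$ when $r=\infty$. Then $m\le m_s(p,q)$.
   Context: $n$ is a positive integer; all function spaces without indicated domain are on $\mathbb{R}^n$; $\mathcal{S}$ is the Schwartz class; $\mathbb{N}_0=\{0,1,2,\dots\}$; $1/\infty=0$. The Fourier transform is $\widehat f(\xi)=\int_{\mathbb{R}^n}e^{-i\xi\cdot x}f(x)\,dx$. For $0<p\le\infty$, $H^p=H^p(\mathbb{R}^n)$ is the (real) Hardy space; $H^p=L^p$ for $1<p\le\infty$ and $H^1\hookrightarrow L^1$. $BMO$ is the space of functions of bounded mean oscillation on $\mathbb{R}^n$. $L^r$ may have $r<1$, in which case $\|\cdot\|_{L^r}$ is a quasi-norm. For $m\in\mathbb{R}$, $S^{m}_{1,0}(\mathbb{R}^{2n})$ is the set of all $C^\infty$ functions $\sigma=\sigma(\xi,\eta)$ on $\mathbb{R}^{2n}$ ($\xi,\eta\in\mathbb{R}^n$) such that for all multi-indices $\alpha,\beta\in(\mathbb{N}_0)^n$ there is $C_{\alpha,\beta}$ with $|\partial_\xi^\alpha\partial_\eta^\beta\sigma(\xi,\eta)|\le C_{\alpha,\beta}(1+|\xi|+|\eta|)^{m-|\alpha|-|\beta|}$.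 For $0<s<\infty$ and $f,g\in\mathcal{S}(\mathbb{R}^n)$, $$T^{s}_{\sigma}(f,g)(x)=\frac{1}{(2\pi)^{2n}}\iint_{\mathbb{R}^n\times\mathbb{R}^n}e^{ix\cdot(\xi+\eta)}e^{i(|\xi|^s+|\eta|^s)}\sigma(\xi,\eta)\widehat f(\xi)\widehat g(\eta)\,d\xi d\eta,\quad x\in\mathbb{R}^n.$$ For function spaces $X,Y,Z$ with quasi-norms, "$T$ is bounded from $X\times Y$ to $Z$" means: there is $C>0$ such that $\|T(f,g)\|_Z\le C\|f\|_X\|g\|_Y$ for all $f\in\mathcal{S}\cap X$ and all $g\in\mathcal{S}\cap Y$. The set $\{1\le p,q\le\infty\}$ is divided into $\mathrm{I}=\{2\le p,q\le\infty\}$; $\mathrm{II}=\{1\le p,q\le2\}$; $\mathrm{III}=\{1\le p\le2\le q\le\infty,\ 1/p+1/q\le1\}$; $\mathrm{IV}=\{1\le p\le2\le q\le\infty,\ 1/p+1/q\ge1\}$; $\mathrm{V}=\{1\le q\le2\le p\le\infty,\ 1/p+1/q\le1\}$; $\mathrm{VI}=\{1\le q\le2\le p\le\infty,\ 1/p+1/q\ge1\}$. The number $m_s(p,q)$ is defined as follows. When $0<s<1$: $$m_s(p,q)=\begin{cases}-ns\big(|\tfrac1p-\tfrac12|+|\tfrac1q-\tfrac12|\big)&\text{for }(p,q)\in\mathrm{I}\cup\mathrm{II},\\ -ns(1-s)|\tfrac1p-\tfrac12|-ns|\tfrac1q-\tfrac12|&\text{for }(p,q)\in\mathrm{III}\cup\mathrm{VI},\\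 -ns|\tfrac1p-\tfrac12|-ns(1-s)|\tfrac1q-\tfrac12|&\text{for }(p,q)\in\mathrm{IV}\cup\mathrm{V}.\end{cases}$$ When $1<s<\infty$: $$m_s(p,q)=\begin{cases}-ns\big(|\tfrac1p-\tfrac12|+|\tfrac1q-\tfrac12|\big)&\text{for }(p,q)\in\mathrm{I}\cup\mathrm{II},\\ -ns|\tfrac1q-\tfrac12|&\text{for }(p,q)\in\mathrm{III}\cup\mathrm{VI},\\ -ns|\tfrac1p-\tfrac12|&\text{for }(p,q)\in\mathrm{IV}\cup\mathrm{V}.\end{cases}$$ (The definitions agree on overlaps of the regions.) *)

theory Defs
  imports "HOL-Probability.Essential_Supremum"
begin

section \<open>Partial derivatives and smooth functions\<close>

definition dir_deriv :: "'a::euclidean_space \<Rightarrow> ('a \<Rightarrow> complex) \<Rightarrow> 'a \<Rightarrow> complex" where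
  "dir_deriv v f = (\<lambda>x. frechet_derivative f (at x) v)"

text \<open>
  A function is \<open>C\<^sup>\<infinity>\<close> iff all its iterated partial derivatives, of every order and in every order
  of differentiation, are differentiable everywhere. Continuity of the partial derivatives follows,
  since differentiable functions are continuous.
\<close>
definition smooth :: "('a::euclidean_space \<Rightarrow> complex) \<Rightarrow> bool" where
  "smooth f \<longleftrightarrow> (\<forall>vs. set vs \<subseteq> Basis \<longrightarrow> (\<forall>x. foldr dir_deriv vs f differentiable (at x)))"

text \<open>
  Multi-indices are functions \<open>\<alpha> :: 'n \<Rightarrow> nat\<close>. The operator \<open>\<partial>\<^sup>\<alpha>\<close> is applied along the vectors
  \<open>e i\<close>, so that one definition serves for \<open>\<partial>\<^sub>x\<^sup>\<alpha>\<close> on \<open>\<real>\<^sup>n\<close> and for \<open>\<partial>\<^sub>\<xi>\<^sup>\<alpha>\<close>, \<open>\<partial>\<^sub>\<eta>\<^sup>\<beta>\<close> on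
  \<open>\<real>\<^sup>n \<times> \<real>\<^sup>n\<close>. The index type carries no order, so some enumeration of it is chosen; for smooth
  functions the result does not depend on this choice.
\<close>
definition index_enum :: "'n::finite list" where
  "index_enum = (SOME is. distinct is \<and> set is = UNIV)"

definition multi_deriv ::
  "('n::finite \<Rightarrow> 'a) \<Rightarrow> ('n \<Rightarrow> nat) \<Rightarrow> ('a::euclidean_space \<Rightarrow> complex) \<Rightarrow> 'a \<Rightarrow> complex" where
  "multi_deriv e \<alpha> f = foldr (\<lambda>i. dir_deriv (e i) ^^ \<alpha> i) index_enum f"

definition mi_size :: "('n::finite \<Rightarrow> nat) \<Rightarrow> nat" where
  "mi_size \<alpha> = (\<Sum>i\<in>UNIV. \<alpha> i)"

definition schwartz :: "(real^'n \<Rightarrow> complex) \<Rightarrow> bool" where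
  "schwartz f \<longleftrightarrow> smooth f \<and>
     (\<forall>N \<alpha>. \<exists>C. \<forall>x. (1 + norm x) ^ N * norm (multi_deriv (\<lambda>i. axis i 1) \<alpha> f x) \<le> C)"

definition symbol_class :: "real \<Rightarrow> ((real^'n) \<times> (real^'n) \<Rightarrow> complex) set" where
  "symbol_class m = {\<sigma>. smooth \<sigma> \<and>
     (\<forall>\<alpha> \<beta>. \<exists>C. \<forall>\<xi> \<eta>.
        norm (multi_deriv (\<lambda>i. (axis i 1, 0)) \<alpha> (multi_deriv (\<lambda>i. (0, axis i 1)) \<beta> \<sigma>) (\<xi>, \<eta>))
          \<le> C * (1 + norm \<xi> + norm \<eta>) powr (m - real (mi_size \<alpha>) - real (mi_size \<beta>)))}"


section \<open>The bilinear Fourier integral operator\<close>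

definition fourier :: "(real^'n \<Rightarrow> complex) \<Rightarrow> real^'n \<Rightarrow> complex" where
  "fourier f \<xi> = (\<integral>x. exp (- \<i> * complex_of_real (\<xi> \<bullet> x)) * f x \<partial>lborel)"

definition bilinear_fio ::
  "real \<Rightarrow> ((real^'n) \<times> (real^'n) \<Rightarrow> complex) \<Rightarrow>
     (real^'n \<Rightarrow> complex) \<Rightarrow> (real^'n \<Rightarrow> complex) \<Rightarrow> real^'n \<Rightarrow> complex" where
  "bilinear_fio s \<sigma> f g x =
     complex_of_real (1 / (2 * pi) ^ (2 * CARD('n))) *
     (\<integral>(\<xi>, \<eta>). exp (\<i> * complex_of_real (x \<bullet> (\<xi> + \<eta>))) *
                exp (\<i> * complex_of_real (norm \<xi> powr s + norm \<eta> powr s)) *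
                \<sigma> (\<xi>, \<eta>) * fourier f \<xi> * fourier g \<eta> \<partial>lborel)"


section \<open>Function spaces\<close>

text \<open>
  A function space is given by its (quasi-)norm with values in \<open>[0, \<infinity>]\<close>; the space consists of the
  functions of finite norm. Exponents range over \<open>ennreal\<close>, where \<open>1 / \<infinity> = 0\<close>.
\<close>

text \<open>The \<open>a\<close>-th power for \<open>a > 0\<close>, with \<open>\<infinity>\<^sup>a = \<infinity>\<close>.\<close>
definition ennreal_powr :: "ennreal \<Rightarrow> real \<Rightarrow> ennreal" where
  "ennreal_powr u a = (if u = \<infinity> then \<infinity> else ennreal (enn2real u powr a))"

text \<open>
  The \<open>L\<^sup>p\<close> quasi-norm, \<open>0 < p \<le> \<infinity>\<close>, of a nonnegative extended real valued function (the maximal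
  function below may take the value \<open>\<infinity>\<close>).
\<close>
definition Lp_norm_nonneg :: "ennreal \<Rightarrow> ('a::euclidean_space \<Rightarrow> ennreal) \<Rightarrow> ennreal" where
  "Lp_norm_nonneg p u =
     (if p = \<infinity> then esssup lborel u
      else ennreal_powr (\<integral>\<^sup>+x. ennreal_powr (u x) (enn2real p) \<partial>lborel) (1 / enn2real p))"

definition Lp_norm :: "ennreal \<Rightarrow> ('a::euclidean_space \<Rightarrow> complex) \<Rightarrow> ennreal" where
  "Lp_norm p f = Lp_norm_nonneg p (\<lambda>x. ennreal (norm (f x)))"

text \<open>
  The maximal function \<open>sup\<^bsub>t>0\<^esub> |\<phi>\<^sub>t * f|\<close>, \<open>\<phi>\<^sub>t = t\<^sup>-\<^sup>n \<phi>(\<cdot>/t)\<close>, with the Gaussian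
  \<open>\<phi>(x) = exp(-|x|\<^sup>2)\<close>. Replacing \<open>\<phi>\<close> by another Schwartz function of nonzero integral
  gives an equivalent Hardy quasi-norm.
\<close>
definition maximal_function :: "(real^'n \<Rightarrow> complex) \<Rightarrow> real^'n \<Rightarrow> ennreal" where
  "maximal_function f x =
     (SUP t\<in>{0::real<..}. ennreal (norm
        (\<integral>y. complex_of_real (exp (- (norm (y /\<^sub>R t))\<^sup>2) / t ^ CARD('n)) * f (x - y) \<partial>lborel)))"

text \<open>
  The real Hardy space: \<open>H\<^sup>p = L\<^sup>p\<close> for \<open>1 < p \<le> \<infinity>\<close>. For \<open>p \<le> 1\<close> the definition is only meant for
  functions for which the convolutions above exist, in particular for Schwartz functions.
\<close>
definition Hp_norm :: "ennreal \<Rightarrow> (real^'n \<Rightarrow> complex) \<Rightarrow> ennreal" where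
  "Hp_norm p f = (if p \<le> 1 then Lp_norm_nonneg p (maximal_function f) else Lp_norm p f)"

text \<open>
  The supremum is over all cubes with sides parallel to the axes. If \<open>f\<close> is measurable but not
  integrable over some cube then its mean there is the default value 0 of the Bochner integral and
  the norm is \<open>\<infinity>\<close>.
\<close>
definition mean_on :: "(real^'n) set \<Rightarrow> (real^'n \<Rightarrow> complex) \<Rightarrow> complex" where
  "mean_on Q f = (LINT y:Q|lborel. f y) /\<^sub>R measure lborel Q"

definition BMO_norm :: "(real^'n \<Rightarrow> complex) \<Rightarrow> ennreal" where
  "BMO_norm f =
     (SUP Q\<in>{cbox a (a + l *\<^sub>R One) |a l. 0 < l}.
        (\<integral>\<^sup>+x\<in>Q. ennreal (norm (f x - mean_on Q f)) \<partial>lborel) / emeasure lborel Q)"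

definition bounded_from_to ::
  "((real^'n \<Rightarrow> complex) \<Rightarrow> (real^'n \<Rightarrow> complex) \<Rightarrow> (real^'n \<Rightarrow> complex)) \<Rightarrow>
     ((real^'n \<Rightarrow> complex) \<Rightarrow> ennreal) \<Rightarrow> ((real^'n \<Rightarrow> complex) \<Rightarrow> ennreal) \<Rightarrow>
     ((real^'n \<Rightarrow> complex) \<Rightarrow> ennreal) \<Rightarrow> bool" where
  "bounded_from_to T X Y Z \<longleftrightarrow>
     (\<exists>C>0. \<forall>f g. schwartz f \<and> X f < \<infinity> \<and> schwartz g \<and> Y g < \<infinity> \<longrightarrow>
        Z (T f g) \<le> ennreal C * X f * Y g)"


section \<open>The critical order\<close>

definition region_I :: "(ennreal \<times> ennreal) set" where
  "region_I = {(p, q). 2 \<le> p \<and> 2 \<le> q}"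

definition region_II :: "(ennreal \<times> ennreal) set" where
  "region_II = {(p, q). 1 \<le> p \<and> p \<le> 2 \<and> 1 \<le> q \<and> q \<le> 2}"

definition region_III :: "(ennreal \<times> ennreal) set" where
  "region_III = {(p, q). 1 \<le> p \<and> p \<le> 2 \<and> 2 \<le> q \<and> 1 / p + 1 / q \<le> 1}"

definition region_IV :: "(ennreal \<times> ennreal) set" where
  "region_IV = {(p, q). 1 \<le> p \<and> p \<le> 2 \<and> 2 \<le> q \<and> 1 / p + 1 / q \<ge> 1}"

definition region_V :: "(ennreal \<times> ennreal) set" where
  "region_V = {(p, q). 1 \<le> q \<and> q \<le> 2 \<and> 2 \<le> p \<and> 1 / p + 1 / q \<le> 1}"

definition region_VI :: "(ennreal \<times> ennreal) set" where
  "region_VI = {(p, q). 1 \<le> q \<and> q \<le> 2 \<and> 2 \<le> p \<and> 1 / p + 1 / q \<ge> 1}"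

text \<open>
  \<open>m\<^sub>s(p, q)\<close> in dimension \<open>n\<close>, for \<open>0 < s \<noteq> 1\<close> and \<open>1 \<le> p, q \<le> \<infinity>\<close>. The formulas agree where the
  regions overlap, and the last branch is that of the regions IV and V.
\<close>
definition crit_order :: "nat \<Rightarrow> real \<Rightarrow> ennreal \<Rightarrow> ennreal \<Rightarrow> real" where
  "crit_order n s p q =
     (let a = \<bar>enn2real (1 / p) - 1 / 2\<bar>; b = \<bar>enn2real (1 / q) - 1 / 2\<bar> in
      if s < 1 then
        (if (p, q) \<in> region_I \<union> region_II then - real n * s * (a + b)
         else if (p, q) \<in> region_III \<union> region_VI then
           - real n * s * (1 - s) * a - real n * s * b
         else - real n * s * a - real n * s * (1 - s) * b)
      else
        (if (p, q) \<in> region_I \<union> region_II then - real n * s * (a + b)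
         else if (p, q) \<in> region_III \<union> region_VI then - real n * s * b
         else - real n * s * a))"

end

theory Submission
  imports Defs "HOL-Probability.Characteristic_Functions"
begin

text \<open>
  The series \<open>\<Sum>\<^sub>k 2\<^bsup>k(m-\<epsilon>)\<^esup> b\<^sub>k h(2\<^bsup>-k\<^esup>\<zeta>)\<close> with bounded \<open>b\<close> and a product \<open>h\<close> of Gaussian cutoffs is a symbol
  of order \<open>m\<close>. By Baire's theorem the hypothesis bounds the operators of its single terms uniformly,
  and these are \<open>R\<^sup>m U\<^sub>R f \<cdot> U\<^sub>R g\<close> with \<open>R = 2\<^sup>k\<close> and the linear operator \<open>U\<^sub>R\<close> which multiplies the Fourier
  transform by \<open>e\<^bsup>i|\<xi>|^s\<^esup>\<close> and a cutoff to \<open>|\<xi>| \<lesssim> R\<close>. It remains to choose \<open>f\<close> and \<open>g\<close>.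

  In region I both are sums of wave packets that the propagation focuses at the origin. In region II
  both are bumps of width \<open>1/R\<close> and mean zero, which are spread over a ball of radius \<open>R\<^bsup>s-1\<^esup>\<close>. In region IV
  \<open>f\<close> is such a bump, and \<open>g\<close> is of frequency about \<open>R\<^bsup>1-s\<^esup>\<close>, so that \<open>U\<^sub>R g\<close> is of constant size on that
  ball: focusing packets for \<open>s < 1\<close>, a Gaussian for \<open>s > 1\<close>. Region VI is symmetric to region IV.
\<close>

section \<open>Gaussian functions and their derivatives\<close>

text \<open>Cutoffs and test functions are built from Gaussians: their Fourier transforms are
  explicit, so that neither Fourier inversion nor Plancherel's theorem enters. The price is that the
  dilates of a cutoff overlap. The factor 2^(-\<epsilon>k) restores summability, and every bound on
  m carries a loss \<epsilon> that finally tends to 0.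

  Two demands on the cutoff conflict. At p = q = 2 the critical order is 0, so that positive orders
  have to be refuted, and at the origin 2^(mk) h(2^(-k)\<zeta>) stays bounded for m > 0 only if h
  vanishes there. In regions IV and VI one test function has frequency R^(1-s), far below R, where
  such a cutoff would make it negligible. Outside regions I and II, however, the critical order is
  negative, orders m \<le> 0 suffice, and the cutoff may be 1 at the origin. Hence the parameter
  \<open>j\<close>.

  The frequency R^(1-s) is the inverse of the radius R^(s-1) over which a bump spreads, so that a
  wave of this frequency need not oscillate on that ball.\<close>

inductive gauss_poly :: "('a::euclidean_space \<Rightarrow> complex) \<Rightarrow> bool" where
  gauss: "c > 0 \<Longrightarrow>
    gauss_poly (\<lambda>x. exp (complex_of_real (b \<bullet> x - c * (x \<bullet> x)) + \<i> * complex_of_real (d \<bullet> x)))"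
| add: "gauss_poly f \<Longrightarrow> gauss_poly g \<Longrightarrow> gauss_poly (\<lambda>x. f x + g x)"
| cmult: "gauss_poly f \<Longrightarrow> gauss_poly (\<lambda>x. a * f x)"
| inner: "gauss_poly f \<Longrightarrow> gauss_poly (\<lambda>x. complex_of_real (x \<bullet> v) * f x)"

lemma gauss_poly_zero: "gauss_poly (\<lambda>x. 0)"
  using gauss_poly.cmult[OF gauss_poly.gauss[of 1 0 0], of 0] by simp

lemma gauss_poly_sum:
  "finite A \<Longrightarrow> (\<And>i. i \<in> A \<Longrightarrow> gauss_poly (f i)) \<Longrightarrow> gauss_poly (\<lambda>x. \<Sum>i\<in>A. f i x)"
  by (induction A rule: finite_induct) (auto intro: gauss_poly_zero gauss_poly.add)

text \<open>The constructors are made for this closure: the exponent of a Gaussian has an affine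
  derivative, whose linear part is supplied by \<open>inner\<close>. A full Frechet derivative with
  every directional slice in the class is produced, because \<open>dir_deriv\<close> is defined
  through it.\<close>

lemma gauss_poly_has_derivative:
  assumes "gauss_poly f"
  shows "\<exists>f'. (\<forall>x. (f has_derivative f' x) (at x)) \<and> (\<forall>v. gauss_poly (\<lambda>x. f' x v))"
  using assms
proof induction
  case (gauss c b d)
  let ?f = "\<lambda>x::'a. exp (complex_of_real (b \<bullet> x - c * (x \<bullet> x)) + \<i> * complex_of_real (d \<bullet> x))"
  let ?f' = "\<lambda>x v. (complex_of_real (b \<bullet> v) + \<i> * complex_of_real (d \<bullet> v)) * ?f x
    + (- 2 * complex_of_real c) * (complex_of_real (x \<bullet> v) * ?f x)"
  have "(?f has_derivative ?f' x) (at x)" for x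
  proof -
    let ?g = "\<lambda>x::'a. complex_of_real (b \<bullet> x - c * (x \<bullet> x)) + \<i> * complex_of_real (d \<bullet> x)"
    let ?g' = "\<lambda>v. complex_of_real (b \<bullet> v - c * (x \<bullet> v + v \<bullet> x)) + \<i> * complex_of_real (d \<bullet> v)"
    have "(?g has_derivative ?g') (at x)"
      by (auto intro!: derivative_eq_intros)
    from has_derivative_compose[OF this DERIV_exp[unfolded has_field_derivative_def]]
    show ?thesis by (rule has_derivative_eq_rhs) (simp add: fun_eq_iff algebra_simps inner_commute)
  qed
  moreover have "gauss_poly (\<lambda>x. ?f' x v)" for v
    by (intro gauss_poly.add gauss_poly.cmult gauss_poly.inner gauss_poly.gauss gauss)
  ultimately show ?case by (intro exI[of _ ?f']) blast
next
  case (add f g)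
  then obtain f' g' where
    "\<forall>x. (f has_derivative f' x) (at x)" "\<forall>v. gauss_poly (\<lambda>x. f' x v)"
    "\<forall>x. (g has_derivative g' x) (at x)" "\<forall>v. gauss_poly (\<lambda>x. g' x v)" by blast
  then show ?case
    by (intro exI[of _ "\<lambda>x v. f' x v + g' x v"]) (auto intro: has_derivative_add gauss_poly.add)
next
  case (cmult f a)
  then obtain f' where
    "\<forall>x. (f has_derivative f' x) (at x)" "\<forall>v. gauss_poly (\<lambda>x. f' x v)" by blast
  then show ?case
    by (intro exI[of _ "\<lambda>x v. a * f' x v"]) (auto intro: has_derivative_mult_right gauss_poly.cmult)
next
  case (inner f v)
  then obtain f' where f':
    "\<forall>x. (f has_derivative f' x) (at x)" "\<forall>v. gauss_poly (\<lambda>x. f' x v)" by blast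
  let ?g' = "\<lambda>x w. complex_of_real (x \<bullet> v) * f' x w + complex_of_real (w \<bullet> v) * f x"
  have "((\<lambda>x. complex_of_real (x \<bullet> v) * f x) has_derivative ?g' x) (at x)" for x
    by (rule has_derivative_eq_rhs, (rule derivative_intros f'(1)[rule_format] | simp)+)
  moreover have "gauss_poly (\<lambda>x. ?g' x w)" for w
    using f'(2) inner by (intro gauss_poly.add gauss_poly.cmult gauss_poly.inner) auto
  ultimately show ?case by (intro exI[of _ ?g']) blast
qed

lemma gauss_poly_dir_deriv:
  assumes "gauss_poly f"
  shows "gauss_poly (dir_deriv v f)" "f differentiable (at x)"
proof -
  obtain f' where f': "\<And>x. (f has_derivative f' x) (at x)" "\<And>v. gauss_poly (\<lambda>x. f' x v)"
    using gauss_poly_has_derivative[OF assms] by blast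
  have "dir_deriv v f = (\<lambda>x. f' x v)"
    unfolding dir_deriv_def using frechet_derivative_at[OF f'(1)] by metis
  then show "gauss_poly (dir_deriv v f)" using f'(2) by simp
  show "f differentiable (at x)" using f'(1) by (rule differentiableI)
qed

lemma gauss_poly_foldr: "gauss_poly f \<Longrightarrow> gauss_poly (foldr dir_deriv vs f)"
  by (induction vs) (auto intro: gauss_poly_dir_deriv)

lemma gauss_poly_smooth: "gauss_poly f \<Longrightarrow> smooth f"
  unfolding smooth_def using gauss_poly_foldr gauss_poly_dir_deriv(2) by blast

lemma power_div_fact_le_exp:
  fixes y :: real
  assumes "0 \<le> y"
  shows "y ^ N / fact N \<le> exp y"
proof -
  have "(\<Sum>k\<in>{N}. y ^ k / fact k) \<le> (\<Sum>k. y ^ k / fact k)"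
    using assms summable_exp_generic[of y] by (intro sum_le_suminf) (auto simp: divide_inverse mult.commute)
  then show ?thesis by (simp add: exp_def divide_inverse mult.commute)
qed

text \<open>N is generalized in the induction, since a factor \<open>x \<bullet> v\<close> is paid
  for with one more power of 1 + |x|.\<close>

lemma gauss_poly_decay:
  assumes "gauss_poly f"
  shows "\<exists>C. \<forall>x. (1 + norm x) ^ N * norm (f x) \<le> C"
  using assms
proof (induction arbitrary: N)
  case (gauss c b d)
  define B where "B = norm b"
  have "(1 + norm x) ^ N * exp (b \<bullet> x - c * (x \<bullet> x)) \<le> fact N * exp (1 + (1 + B)\<^sup>2 / (4 * c))" for x
  proof -
    let ?y = "norm x"
    have "(1 + ?y) ^ N / fact N \<le> exp (1 + ?y)"
      by (rule power_div_fact_le_exp) simp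
    then have 1: "(1 + ?y) ^ N \<le> fact N * exp (1 + ?y)" by (simp add: field_simps)
    have "b \<bullet> x \<le> B * ?y" unfolding B_def by (rule norm_cauchy_schwarz)
    moreover have "(1 + B) * ?y - c * ?y\<^sup>2 \<le> (1 + B)\<^sup>2 / (4 * c)"
    proof -
      \<comment> \<open>Completing the square. The coefficient 1 + B collects the growth of
        \<open>b \<bullet> x\<close> and of exp(1 + |x|), the majorant of the polynomial
        factor.\<close>
      have "0 \<le> (2 * c * ?y - (1 + B))\<^sup>2" by simp
      then show ?thesis using gauss by (simp add: field_simps power2_eq_square)
    qed
    ultimately have "1 + ?y + (b \<bullet> x - c * (x \<bullet> x)) \<le> 1 + (1 + B)\<^sup>2 / (4 * c)"
      by (simp add: power2_norm_eq_inner algebra_simps)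
    then have 2: "exp (1 + ?y) * exp (b \<bullet> x - c * (x \<bullet> x)) \<le> exp (1 + (1 + B)\<^sup>2 / (4 * c))"
      by (simp flip: exp_add)
    have "(1 + ?y) ^ N * exp (b \<bullet> x - c * (x \<bullet> x))
        \<le> fact N * exp (1 + ?y) * exp (b \<bullet> x - c * (x \<bullet> x))"
      using 1 by (intro mult_right_mono) auto
    also have "\<dots> \<le> fact N * exp (1 + (1 + B)\<^sup>2 / (4 * c))"
      using 2 by (simp add: mult.assoc)
    finally show ?thesis .
  qed
  then show ?case by (intro exI[of _ "fact N * exp (1 + (1 + B)\<^sup>2 / (4 * c))"]) simp
next
  case (add f g)
  obtain C D where C: "\<And>x. (1 + norm x) ^ N * norm (f x) \<le> C"
    and D: "\<And>x. (1 + norm x) ^ N * norm (g x) \<le> D"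
    using add.IH by blast
  have "(1 + norm x) ^ N * norm (f x + g x) \<le> C + D" for x
  proof -
    have "(1 + norm x) ^ N * norm (f x + g x) \<le> (1 + norm x) ^ N * (norm (f x) + norm (g x))"
      by (intro mult_left_mono norm_triangle_ineq) simp
    then show ?thesis using C[of x] D[of x] by (simp add: distrib_left)
  qed
  then show ?case by blast
next
  case (cmult f a)
  obtain C where C: "\<And>x. (1 + norm x) ^ N * norm (f x) \<le> C" using cmult.IH by blast
  have "(1 + norm x) ^ N * norm (a * f x) \<le> norm a * C" for x
    using mult_left_mono[OF C[of x], of "norm a"] by (simp add: norm_mult mult_ac)
  then show ?case by blast
next
  case (inner f v)
  obtain C where C: "\<And>x. (1 + norm x) ^ Suc N * norm (f x) \<le> C" using inner.IH by blast
  have "(1 + norm x) ^ N * norm (complex_of_real (x \<bullet> v) * f x) \<le> norm v * C" for x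
  proof -
    have "\<bar>x \<bullet> v\<bar> \<le> norm v * (1 + norm x)"
      using Cauchy_Schwarz_ineq2[of x v] norm_ge_zero[of v]
      unfolding distrib_left mult.commute[of "norm x"] by linarith
    then have "(1 + norm x) ^ N * (\<bar>x \<bullet> v\<bar> * norm (f x))
        \<le> (1 + norm x) ^ N * (norm v * (1 + norm x) * norm (f x))"
      by (intro mult_left_mono mult_right_mono) auto
    also have "\<dots> = norm v * ((1 + norm x) ^ Suc N * norm (f x))" by simp
    also have "\<dots> \<le> norm v * C" using C[of x] by (intro mult_left_mono) auto
    finally show ?thesis by (simp add: norm_mult)
  qed
  then show ?case by blast
qed

text \<open>Lists of directions replace multi-indices from here on: smoothness is defined by them,
  the order of a derivative is the length of its list, and the mixed derivatives of a symbol
  correspond to concatenated lists.\<close>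

lemma multi_deriv_eq_foldr:
  "multi_deriv e \<alpha> f = foldr dir_deriv (concat (map (\<lambda>i. replicate (\<alpha> i) (e i)) index_enum)) f"
proof -
  have *: "foldr dir_deriv (replicate n v) f = (dir_deriv v ^^ n) f" for n v and f :: "'a \<Rightarrow> complex"
    by (induction n) auto
  have "foldr (\<lambda>i. dir_deriv (e i) ^^ \<alpha> i) is f
      = foldr dir_deriv (concat (map (\<lambda>i. replicate (\<alpha> i) (e i)) is)) f" for "is"
    by (induction "is") (auto simp: *)
  then show ?thesis unfolding multi_deriv_def .
qed

lemma index_enum: "distinct (index_enum :: 'n::finite list)" "set (index_enum :: 'n list) = UNIV"
proof -
  have "\<exists>xs::'n list. distinct xs \<and> set xs = UNIV"
    using finite_distinct_list[of "UNIV :: 'n set"] by auto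
  from someI_ex[OF this] show "distinct (index_enum :: 'n::finite list)" "set (index_enum :: 'n list) = UNIV"
    unfolding index_enum_def by auto
qed

lemma length_multi_deriv_list:
  "length (concat (map (\<lambda>i. replicate (\<alpha> i) (e i)) index_enum)) = mi_size \<alpha>"
  by (simp add: length_concat comp_def sum_list_distinct_conv_sum_set index_enum mi_size_def)

lemma set_multi_deriv_list:
  "set (concat (map (\<lambda>i. replicate (\<alpha> i) (e i)) index_enum)) \<subseteq> range e"
  by auto

lemma gauss_poly_schwartz:
  fixes f :: "real^'n \<Rightarrow> complex"
  assumes "gauss_poly f"
  shows "schwartz f"
  unfolding schwartz_def multi_deriv_eq_foldr
  using assms gauss_poly_smooth gauss_poly_decay gauss_poly_foldr by blast

section \<open>Lacunary symbols\<close>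

lemma has_derivative_dir_deriv_eq:
  assumes "(f has_derivative f') (at x)"
  shows "dir_deriv v f x = f' v"
  using frechet_derivative_at[OF assms] by (simp add: dir_deriv_def)

lemma has_derivative_sum_dir_deriv:
  fixes f :: "'a::euclidean_space \<Rightarrow> complex"
  assumes "f differentiable (at x)"
  shows "(f has_derivative (\<lambda>v. \<Sum>b\<in>Basis. complex_of_real (v \<bullet> b) * dir_deriv b f x)) (at x)"
proof -
  obtain f' where f': "(f has_derivative f') (at x)"
    using assms by (auto simp: differentiable_def)
  then interpret linear f' by (rule has_derivative_linear)
  have "f' v = (\<Sum>b\<in>Basis. complex_of_real (v \<bullet> b) * dir_deriv b f x)" for v
  proof -
    have "f' v = f' (\<Sum>b\<in>Basis. (v \<bullet> b) *\<^sub>R b)" by (simp add: euclidean_representation)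
    also have "\<dots> = (\<Sum>b\<in>Basis. (v \<bullet> b) *\<^sub>R f' b)" by (simp add: sum scale)
    finally show ?thesis by (simp add: has_derivative_dir_deriv_eq[OF f'] scaleR_conv_of_real)
  qed
  then have "f' = (\<lambda>v. \<Sum>b\<in>Basis. complex_of_real (v \<bullet> b) * dir_deriv b f x)" by (rule ext)
  with f' show ?thesis by simp
qed

text \<open>The operator norm of a derivative is at most the sum of the moduli of the partial
  derivatives, so summable bounds on the latter make the series of Frechet derivatives converge
  uniformly.\<close>

lemma has_derivative_suminf_dir_deriv:
  fixes F :: "nat \<Rightarrow> 'a::euclidean_space \<Rightarrow> complex"
  assumes diff: "\<And>k x. F k differentiable (at x)"
    and M: "\<And>b k x. b \<in> Basis \<Longrightarrow> norm (dir_deriv b (F k) x) \<le> M b k"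
    and sumM: "\<And>b. b \<in> Basis \<Longrightarrow> summable (M b)"
    and sumF: "\<And>x. summable (\<lambda>k. F k x)"
  shows "((\<lambda>x. \<Sum>k. F k x) has_derivative
    (\<lambda>v. \<Sum>b\<in>Basis. complex_of_real (v \<bullet> b) * (\<Sum>k. dir_deriv b (F k) x))) (at x)"
proof -
  let ?f' = "\<lambda>k x v. \<Sum>b\<in>Basis. complex_of_real (v \<bullet> b) * dir_deriv b (F k) x"
  let ?g' = "\<lambda>x v. \<Sum>b\<in>Basis. complex_of_real (v \<bullet> b) * (\<Sum>k. dir_deriv b (F k) x)"
  have sumD: "summable (\<lambda>k. dir_deriv b (F k) x)" if "b \<in> Basis" for b x
    by (rule summable_comparison_test'[OF sumM[OF that], where N = 0]) (rule M[OF that])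
  define L where "L k = (\<Sum>b\<in>Basis. M b k)" for k
  have sumL: "summable L" unfolding L_def by (intro summable_sum sumM)
  have tail: "norm ((\<Sum>i<n. ?f' i x v) - ?g' x v) \<le> (\<Sum>k. L (k + n)) * norm v" for n x v
  proof -
    have b: "norm ((\<Sum>i<n. dir_deriv b (F i) x) - (\<Sum>k. dir_deriv b (F k) x)) \<le> (\<Sum>k. M b (k + n))"
      if "b \<in> Basis" for b
    proof -
      have "norm ((\<Sum>k. dir_deriv b (F k) x) - (\<Sum>i<n. dir_deriv b (F i) x))
        = norm (\<Sum>k. dir_deriv b (F (k + n)) x)"
        using suminf_minus_initial_segment[OF sumD[OF that, of x], of n] by simp
      also have "\<dots> \<le> (\<Sum>k. M b (k + n))"
        by (rule norm_suminf_le[OF M[OF that]]) (simp add: summable_iff_shift sumM[OF that])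
      finally show ?thesis by (simp add: norm_minus_commute)
    qed
    have "(\<Sum>i<n. ?f' i x v) - ?g' x v = (\<Sum>b\<in>Basis. complex_of_real (v \<bullet> b) *
        ((\<Sum>i<n. dir_deriv b (F i) x) - (\<Sum>k. dir_deriv b (F k) x)))"
      by (subst sum.swap) (simp add: sum_distrib_left[symmetric] sum_subtractf right_diff_distrib)
    also have "norm \<dots> \<le> (\<Sum>b\<in>Basis. norm v * (\<Sum>k. M b (k + n)))"
      using b by (intro order_trans[OF norm_sum] sum_mono)
        (auto simp: norm_mult Basis_le_norm intro!: mult_mono)
    also have "\<dots> = (\<Sum>k. L (k + n)) * norm v"
      unfolding L_def
      by (subst suminf_sum) (auto simp: summable_iff_shift sumM sum_distrib_left mult.commute)
    finally show ?thesis .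
  qed
  have "\<exists>g. \<forall>x\<in>UNIV. (\<lambda>n. F n x) sums (g x) \<and> (g has_derivative ?g' x) (at x within UNIV)"
  proof (rule has_derivative_series[where f' = ?f'])
    show "(F n has_derivative ?f' n x) (at x within UNIV)" for n x
      using has_derivative_sum_dir_deriv[OF diff] by simp
    show "\<forall>\<^sub>F n in sequentially. \<forall>x\<in>UNIV. \<forall>h. norm ((\<Sum>i<n. ?f' i x h) - ?g' x h) \<le> e * norm h"
      if "e > 0" for e :: real
    proof -
      have "(\<lambda>n. \<Sum>k. L (k + n)) \<longlonglongrightarrow> 0" by (rule suminf_exist_split2[OF sumL])
      then have "\<forall>\<^sub>F n in sequentially. (\<Sum>k. L (k + n)) < e"
        using that by (auto simp: order_tendsto_iff)
      then show ?thesis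
      proof eventually_elim
        case (elim n)
        show ?case
        proof (intro ballI allI)
          fix x h :: 'a
          have "(\<Sum>k. L (k + n)) * norm h \<le> e * norm h"
            using elim by (intro mult_right_mono) auto
          with tail[where n = n and x = x and v = h] show "norm ((\<Sum>i<n. ?f' i x h) - ?g' x h) \<le> e * norm h" by linarith
        qed
      qed
    qed
    show "(\<lambda>n. F n 0) sums (\<Sum>n. F n 0)" using sumF by (rule summable_sums)
  qed auto
  then obtain g where g: "\<And>x. (\<lambda>n. F n x) sums (g x)" "\<And>x. (g has_derivative ?g' x) (at x)"
    by auto
  have "g = (\<lambda>x. \<Sum>k. F k x)" using g(1) by (auto simp: sums_iff)
  with g(2) show ?thesis by blast
qed

text \<open>Uniform bounds are asked for nonempty lists only. A symbol of order m in (0, 1] may be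
  unbounded, and pointwise convergence has to be enough for the series itself; its derivatives have
  order at most m - 1 \<le> 0 and are bounded.\<close>

lemma foldr_dir_deriv_suminf:
  fixes F :: "nat \<Rightarrow> 'a::euclidean_space \<Rightarrow> complex"
  assumes smooth: "\<And>k. smooth (F k)"
    and bound: "\<And>vs. set vs \<subseteq> Basis \<Longrightarrow> vs \<noteq> [] \<Longrightarrow>
      \<exists>M. summable M \<and> (\<forall>k x. norm (foldr dir_deriv vs (F k) x) \<le> M k)"
    and sumF: "\<And>x. summable (\<lambda>k. F k x)"
    and vs: "set vs \<subseteq> Basis"
  shows "foldr dir_deriv vs (\<lambda>x. \<Sum>k. F k x) = (\<lambda>x. \<Sum>k. foldr dir_deriv vs (F k) x)
    \<and> (\<forall>x. foldr dir_deriv vs (\<lambda>x. \<Sum>k. F k x) differentiable (at x))"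
  using vs
proof (induction vs)
  case Nil
  then show ?case
  proof -
    have "\<exists>M. \<forall>b\<in>Basis. summable (M b) \<and> (\<forall>k x. norm (dir_deriv b (F k) x) \<le> M b k)"
    proof (rule bchoice, rule ballI)
      fix b :: 'a assume "b \<in> Basis"
      then show "\<exists>M. summable M \<and> (\<forall>k x. norm (dir_deriv b (F k) x) \<le> M k)"
        using bound[of "[b]"] by simp
    qed
    then obtain M where M0:
      "\<forall>b\<in>Basis. summable (M b) \<and> (\<forall>k x. norm (dir_deriv b (F k) x) \<le> M b k)" ..
    have M: "\<And>b. b \<in> Basis \<Longrightarrow> summable (M b)"
      "\<And>b k x. b \<in> Basis \<Longrightarrow> norm (dir_deriv b (F k) x) \<le> M b k"
      using M0 by simp_all
    have "F k differentiable (at x)" for k x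
      using smooth[of k] unfolding smooth_def by (auto dest: spec[of _ "[]"])
    from has_derivative_suminf_dir_deriv[OF this M(2) M(1) sumF]
    show ?thesis by (auto simp: differentiable_def)
  qed
next
  case (Cons v vs)
  then have IH: "foldr dir_deriv vs (\<lambda>x. \<Sum>k. F k x) = (\<lambda>x. \<Sum>k. foldr dir_deriv vs (F k) x)"
    and vs: "set vs \<subseteq> Basis" "v \<in> Basis" by auto
  let ?G = "\<lambda>vs k. foldr dir_deriv vs (F k)"
  have sumG: "summable (\<lambda>k. ?G vs k x)" if vs: "set vs \<subseteq> Basis" for vs x
  proof (cases "vs = []")
    case False
    then obtain M where M: "summable M" "\<And>k x. norm (?G vs k x) \<le> M k"
      using bound[OF vs] by metis
    show ?thesis by (rule summable_comparison_test'[OF M(1), where N = 0]) (rule M(2))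
  qed (use sumF in simp)
  have deriv: "((\<lambda>x. \<Sum>k. ?G vs k x) has_derivative
    (\<lambda>w. \<Sum>b\<in>Basis. complex_of_real (w \<bullet> b) * (\<Sum>k. dir_deriv b (?G vs k) x))) (at x)"
    if "set vs \<subseteq> Basis" for vs x
  proof -
    have "\<exists>M. \<forall>b\<in>Basis. summable (M b) \<and> (\<forall>k x. norm (dir_deriv b (?G vs k) x) \<le> M b k)"
    proof (rule bchoice, rule ballI)
      fix b :: 'a assume "b \<in> Basis"
      then show "\<exists>M. summable M \<and> (\<forall>k x. norm (dir_deriv b (?G vs k) x) \<le> M k)"
        using bound[of "b # vs"] that by simp
    qed
    then obtain M where M0:
      "\<forall>b\<in>Basis. summable (M b) \<and> (\<forall>k x. norm (dir_deriv b (?G vs k) x) \<le> M b k)" ..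
    have M: "\<And>b. b \<in> Basis \<Longrightarrow> summable (M b)"
      "\<And>b k x. b \<in> Basis \<Longrightarrow> norm (dir_deriv b (?G vs k) x) \<le> M b k"
      using M0 by simp_all
    have "?G vs k differentiable (at x)" for k x
      using smooth[of k] that unfolding smooth_def by blast
    from has_derivative_suminf_dir_deriv[OF this M(2) M(1) sumG[OF that]] show ?thesis .
  qed
  have eq: "foldr dir_deriv (v # vs) (\<lambda>x. \<Sum>k. F k x) x = (\<Sum>k. ?G (v # vs) k x)" for x
  proof -
    have "foldr dir_deriv (v # vs) (\<lambda>x. \<Sum>k. F k x) x
        = (\<Sum>b\<in>Basis. complex_of_real (v \<bullet> b) * (\<Sum>k. dir_deriv b (?G vs k) x))"
      by (simp add: IH has_derivative_dir_deriv_eq[OF deriv[OF vs(1)]])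
    also have "\<dots> = (\<Sum>b\<in>Basis. if b = v then (\<Sum>k. dir_deriv b (?G vs k) x) else 0)"
      using vs(2) by (intro sum.cong) (auto simp: inner_Basis)
    finally show ?thesis using vs(2) by simp
  qed
  have "(\<lambda>x. \<Sum>k. ?G (v # vs) k x) differentiable (at x)" for x
    using deriv[of "v # vs" x] vs by (auto simp: differentiable_def)
  then show ?case unfolding ext[OF eq] by blast
qed

lemma foldr_dir_deriv_scale:
  fixes h :: "'a::euclidean_space \<Rightarrow> complex"
  assumes h: "smooth h" and vs: "set vs \<subseteq> Basis"
  shows "foldr dir_deriv vs (\<lambda>z. a * h (t *\<^sub>R z)) = (\<lambda>z. (a * of_real t ^ length vs) * foldr dir_deriv vs h (t *\<^sub>R z))
    \<and> (\<forall>z. foldr dir_deriv vs (\<lambda>z. a * h (t *\<^sub>R z)) differentiable (at z))"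
  using vs
proof (induction vs)
  case Nil
  obtain h' where h': "\<And>x. (h has_derivative h' x) (at x)"
  proof -
    have "\<forall>x. \<exists>h'. (h has_derivative h') (at x)"
      using h unfolding smooth_def differentiable_def by (auto dest: spec[of _ "[]"])
    then show ?thesis using that by metis
  qed
  have "((\<lambda>z. a * h (t *\<^sub>R z)) has_derivative (\<lambda>v. a * h' (t *\<^sub>R z) (t *\<^sub>R v))) (at z)" for z
    by (intro has_derivative_mult_right has_derivative_compose[OF _ h'] has_derivative_scaleR_right
        has_derivative_ident)
  then show ?case by (auto simp: differentiable_def)
next
  case (Cons v vs)
  let ?c = "a * of_real t ^ length vs"
  have vs: "set vs \<subseteq> Basis" "v \<in> Basis" using Cons.prems by auto
  have D: "((\<lambda>z. c * foldr dir_deriv us h (t *\<^sub>R z)) has_derivative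
      (\<lambda>v. c * frechet_derivative (foldr dir_deriv us h) (at (t *\<^sub>R z)) (t *\<^sub>R v))) (at z)"
    if "set us \<subseteq> Basis" for us c z
  proof -
    have "(foldr dir_deriv us h has_derivative frechet_derivative (foldr dir_deriv us h) (at x)) (at x)" for x
      using h that unfolding smooth_def by (simp add: frechet_derivative_works)
    from has_derivative_compose[OF has_derivative_scaleR_right[OF has_derivative_ident] this]
    show ?thesis by (rule has_derivative_mult_right)
  qed
  have lin: "frechet_derivative (foldr dir_deriv vs h) (at (t *\<^sub>R z)) (t *\<^sub>R v)
      = of_real t * dir_deriv v (foldr dir_deriv vs h) (t *\<^sub>R z)" for z
  proof -
    have "linear (frechet_derivative (foldr dir_deriv vs h) (at (t *\<^sub>R z)))"
      using h vs unfolding smooth_def by (intro linear_frechet_derivative) blast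
    then show ?thesis by (simp add: linear_scale scaleR_conv_of_real dir_deriv_def)
  qed
  have eq: "foldr dir_deriv (v # vs) (\<lambda>z. a * h (t *\<^sub>R z))
      = (\<lambda>z. (a * of_real t ^ length (v # vs)) * foldr dir_deriv (v # vs) h (t *\<^sub>R z))"
  proof
    fix z
    have "foldr dir_deriv (v # vs) (\<lambda>z. a * h (t *\<^sub>R z)) z
        = dir_deriv v (\<lambda>z. ?c * foldr dir_deriv vs h (t *\<^sub>R z)) z"
      using Cons.IH[OF vs(1)] by simp
    also have "\<dots> = (a * of_real t ^ length (v # vs)) * foldr dir_deriv (v # vs) h (t *\<^sub>R z)"
      unfolding has_derivative_dir_deriv_eq[OF D[OF vs(1)]] lin by simp
    finally show "foldr dir_deriv (v # vs) (\<lambda>z. a * h (t *\<^sub>R z)) z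
      = (a * of_real t ^ length (v # vs)) * foldr dir_deriv (v # vs) h (t *\<^sub>R z)" .
  qed
  have "foldr dir_deriv (v # vs) (\<lambda>z. a * h (t *\<^sub>R z)) differentiable (at z)" for z
    unfolding eq using D[of "v # vs"] vs by (auto simp: differentiable_def)
  with eq show ?case by blast
qed

definition lacunary_term :: "real \<Rightarrow> ('a::euclidean_space \<Rightarrow> complex) \<Rightarrow> nat \<Rightarrow> 'a \<Rightarrow> complex" where
  "lacunary_term m h k z = of_real (2 powr (m * real k)) * h ((1 / 2) ^ k *\<^sub>R z)"

definition lacunary_symbol ::
  "real \<Rightarrow> real \<Rightarrow> ('a::euclidean_space \<Rightarrow> complex) \<Rightarrow> (nat \<Rightarrow> real) \<Rightarrow> 'a \<Rightarrow> complex" where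
  "lacunary_symbol m \<epsilon> h b z = (\<Sum>k. of_real (b k * 2 powr (- \<epsilon> * real k)) * lacunary_term m h k z)"

lemma norm_Pair_ge_half: "(norm x + norm y) / 2 \<le> norm (x, y)"
  using norm_fst_le[of x y] norm_snd_le[of y x] by simp

lemma half_power: "(1 / 2 :: real) ^ k = 2 powr - real k"
  by (simp add: powr_minus powr_realpow power_one_over inverse_eq_divide)

lemma lacunary_term_foldr:
  assumes "smooth h" "set vs \<subseteq> Basis"
  shows "foldr dir_deriv vs (\<lambda>z. of_real a * lacunary_term m h k z) z
    = of_real (a * 2 powr ((m - real (length vs)) * real k)) * foldr dir_deriv vs h ((1 / 2) ^ k *\<^sub>R z)"
proof -
  have "2 powr ((m - real (length vs)) * real k) = 2 powr (m * real k) * ((1 / 2 :: real) ^ k) ^ length vs"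
  proof -
    have "((1 / 2 :: real) ^ k) ^ length vs = 2 powr - (real k * real (length vs))"
      by (simp add: half_power powr_power mult.commute)
    moreover have "(m - real (length vs)) * real k = m * real k + - (real k * real (length vs))"
      by (simp add: algebra_simps)
    ultimately show ?thesis by (simp only: powr_add)
  qed
  then have "a * 2 powr (m * real k) * ((1 / 2) ^ k) ^ length vs
      = a * 2 powr ((m - real (length vs)) * real k)"
    by simp
  then have "complex_of_real (a * 2 powr (m * real k)) * of_real ((1 / 2) ^ k) ^ length vs
      = of_real (a * 2 powr ((m - real (length vs)) * real k))"
    by (metis of_real_mult of_real_power)
  moreover have "(\<lambda>z. of_real a * lacunary_term m h k z)
      = (\<lambda>z. of_real (a * 2 powr (m * real k)) * h ((1 / 2) ^ k *\<^sub>R z))"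
    by (simp add: lacunary_term_def mult.assoc)
  ultimately show ?thesis
    using foldr_dir_deriv_scale[OF assms, of "of_real (a * 2 powr (m * real k))" "(1 / 2) ^ k"]
    by simp
qed

text \<open>If m - |vs| \<le> 0, the decay of h suffices: with w = 2^(-k)(\<xi>, \<eta>), the
  quantity 2^k (1 + |w|) is at least (1 + |\<xi>| + |\<eta>|) / 2. A positive order leaves only vs =
  [], as m \<le> 1. Decay is of no help there, but the vanishing of h at the origin bounds the term
  by a multiple of 2^(mk) |w|^m = |(\<xi>, \<eta>)|^m.\<close>

lemma lacunary_term_bound:
  fixes h :: "'a::euclidean_space \<times> 'b::euclidean_space \<Rightarrow> complex"
  assumes h: "gauss_poly h" and m: "m \<le> 1"
    and vanish: "0 < m \<Longrightarrow> \<exists>C. \<forall>z. norm (h z) \<le> C * norm z powr m"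
  shows "\<exists>C\<ge>0. \<forall>k \<xi> \<eta>. 2 powr ((m - real (length vs)) * real k) *
      norm (foldr dir_deriv vs h ((1 / 2) ^ k *\<^sub>R (\<xi>, \<eta>)))
    \<le> C * (1 + norm \<xi> + norm \<eta>) powr (m - real (length vs))"
proof (cases "m - real (length vs) \<le> 0")
  case True
  define e where "e = real (length vs) - m"
  have e: "e \<ge> 0" using True by (simp add: e_def)
  obtain N :: nat where N: "e \<le> real N" using real_arch_simple by blast
  obtain C where C: "\<And>w. (1 + norm w) ^ N * norm (foldr dir_deriv vs h w) \<le> C"
    using gauss_poly_decay[OF gauss_poly_foldr[OF h]] by blast
  have C0: "C \<ge> 0" using C[of 0] by (smt (verit) norm_ge_zero mult_nonneg_nonneg zero_le_power)
  have "2 powr (- e * real k) * norm (foldr dir_deriv vs h ((1 / 2) ^ k *\<^sub>R (\<xi>, \<eta>)))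
      \<le> (C * 2 powr e) * (1 + norm \<xi> + norm \<eta>) powr - e" for k \<xi> \<eta>
  proof -
    define w where "w = (1 / 2 :: real) ^ k *\<^sub>R (\<xi>, \<eta>)"
    define S where "S = norm \<xi> + norm \<eta>"
    have S: "S \<ge> 0" by (simp add: S_def)
    have nw: "norm w \<ge> S / 2 / 2 ^ k"
      using divide_right_mono[OF norm_Pair_ge_half[of \<xi> \<eta>], of "2 ^ k"] unfolding w_def norm_scaleR S_def
      by (simp add: power_one_over)
    have "(2 ^ k + S) / (2 * 2 ^ k) \<le> 1 + norm w"
    proof -
      have "(2 ^ k + S) / (2 * 2 ^ k) = 1 / 2 + S / 2 / 2 ^ k" by (simp add: add_divide_distrib)
      then show ?thesis using nw by linarith
    qed
    then have "(1 + norm w) powr - e \<le> ((2 ^ k + S) / (2 * 2 ^ k)) powr - e"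
      using S e by (intro powr_mono2') (auto intro!: divide_pos_pos add_pos_nonneg)
    also have "\<dots> = (2 ^ k + S) powr - e * (2 powr e * 2 powr (e * real k))"
    proof -
      have "((2 ^ k + S) / (2 * 2 ^ k)) powr - e = (2 ^ k + S) powr - e / (2 * 2 powr real k) powr - e"
        using S by (simp add: powr_divide powr_realpow)
      also have "(2 * 2 powr real k) powr - e = 1 / (2 powr e * 2 powr (e * real k))"
        by (simp add: powr_mult powr_powr powr_minus_divide mult.commute)
      finally show ?thesis by simp
    qed
    also have "\<dots> \<le> (1 + S) powr - e * (2 powr e * 2 powr (e * real k))"
      using S e by (intro mult_right_mono powr_mono2') (auto simp: one_le_power)
    finally have 1: "(1 + norm w) powr - e \<le> (1 + S) powr - e * (2 powr e * 2 powr (e * real k))" .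
    have "norm (foldr dir_deriv vs h w) * (1 + norm w) powr e \<le> norm (foldr dir_deriv vs h w) * (1 + norm w) ^ N"
      using N by (intro mult_left_mono) (auto simp: powr_realpow[symmetric] add_pos_nonneg intro!: powr_mono)
    also have "\<dots> \<le> C" using C[of w] by (simp add: mult.commute)
    finally have le: "norm (foldr dir_deriv vs h w) * (1 + norm w) powr e \<le> C" .
    have "norm (foldr dir_deriv vs h w) \<le> C * (1 + norm w) powr - e"
    proof -
      have "(1 + norm w) powr e > 0" using norm_ge_zero[of w] by (simp add: add_nonneg_eq_0_iff)
      then show ?thesis using le by (simp add: powr_minus_divide pos_le_divide_eq)
    qed
    also have "\<dots> \<le> C * ((1 + S) powr - e * (2 powr e * 2 powr (e * real k)))"
      using 1 C0 by (intro mult_left_mono) auto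
    finally have "norm (foldr dir_deriv vs h w) \<le> C * ((1 + S) powr - e * (2 powr e * 2 powr (e * real k)))" .
    from mult_left_mono[OF this, of "2 powr (- e * real k)"]
    show ?thesis unfolding w_def[symmetric] S_def
      by (simp add: powr_minus field_simps)
  qed
  then show ?thesis using C0
    by (intro exI[of _ "C * 2 powr e"]) (auto simp: e_def)
next
  case False
  then have 0: "vs = []" "0 < m" using m by (cases vs; simp)+
  then obtain C where C: "\<And>z. norm (h z) \<le> C * norm z powr m" using vanish by blast
  have "2 powr (m * real k) * norm (h ((1 / 2) ^ k *\<^sub>R (\<xi>, \<eta>))) \<le> \<bar>C\<bar> * (1 + norm \<xi> + norm \<eta>) powr m" for k \<xi> \<eta>
  proof -
    have "norm (h ((1 / 2) ^ k *\<^sub>R (\<xi>, \<eta>))) \<le> \<bar>C\<bar> * norm ((1 / 2 :: real) ^ k *\<^sub>R (\<xi>, \<eta>)) powr m"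
      by (rule order_trans[OF C]) (auto intro: mult_right_mono)
    also have "\<dots> = \<bar>C\<bar> * (2 powr - (m * real k) * norm (\<xi>, \<eta>) powr m)"
      unfolding norm_scaleR by (simp add: half_power powr_mult powr_powr mult.commute[of m])
    finally have "norm (h ((1 / 2) ^ k *\<^sub>R (\<xi>, \<eta>))) \<le> \<bar>C\<bar> * (2 powr - (m * real k) * norm (\<xi>, \<eta>) powr m)" .
    from mult_left_mono[OF this, of "2 powr (m * real k)"]
    have "2 powr (m * real k) * norm (h ((1 / 2) ^ k *\<^sub>R (\<xi>, \<eta>))) \<le> \<bar>C\<bar> * norm (\<xi>, \<eta>) powr m"
      by (simp add: powr_minus field_simps)
    also have "\<dots> \<le> \<bar>C\<bar> * (1 + norm \<xi> + norm \<eta>) powr m"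
      using 0 norm_Pair_le[of \<xi> \<eta>] by (intro mult_left_mono powr_mono2) auto
    finally show ?thesis .
  qed
  then show ?thesis using 0 by (intro exI[of _ "\<bar>C\<bar>"]) auto
qed

lemma summable_powr_nat: "\<epsilon> > 0 \<Longrightarrow> summable (\<lambda>k. 2 powr (- \<epsilon> * real k))"
proof -
  assume "\<epsilon> > 0"
  then have "(2::real) powr - \<epsilon> < 1" by (simp add: powr_less_one)
  then have "summable (\<lambda>k. (2 powr - \<epsilon>) ^ k)" by (intro summable_geometric) simp
  then show ?thesis by (simp add: powr_power mult.commute)
qed

context
  fixes h :: "'a::euclidean_space \<times> 'b::euclidean_space \<Rightarrow> complex" and m \<epsilon> :: real
  assumes h: "gauss_poly h" and m: "m \<le> 1" and eps: "\<epsilon> > 0"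
    and vanish: "0 < m \<Longrightarrow> \<exists>C. \<forall>z. norm (h z) \<le> C * norm z powr m"
begin

text \<open>The constant is independent of b and the bound is linear in B: this is the continuity of
  the symbol in b that the Baire argument relies on.\<close>

lemma lacunary_symbol_bound:
  "\<exists>C\<ge>0. \<forall>b B \<xi> \<eta>. (\<forall>k. \<bar>b k\<bar> \<le> B) \<longrightarrow>
    summable (\<lambda>k. of_real (b k * 2 powr (- \<epsilon> * real k)) * lacunary_term m h k (\<xi>, \<eta>)) \<and>
    norm (lacunary_symbol m \<epsilon> h b (\<xi>, \<eta>)) \<le> C * B * (1 + norm \<xi> + norm \<eta>) powr m"
proof -
  obtain C where C: "C \<ge> 0" "\<And>k \<xi> \<eta>. norm (lacunary_term m h k (\<xi>, \<eta>)) \<le> C * (1 + norm \<xi> + norm \<eta>) powr m"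
    using lacunary_term_bound[OF h m vanish, of "[]"] by (auto simp: lacunary_term_def norm_mult)
  let ?S = "\<Sum>k. 2 powr (- \<epsilon> * real k)"
  show ?thesis
  proof (intro exI[of _ "?S * C"] conjI allI impI)
    show "?S * C \<ge> 0" using C(1) by (intro mult_nonneg_nonneg suminf_nonneg summable_powr_nat[OF eps]) auto
    fix b :: "nat \<Rightarrow> real" and B and \<xi> :: 'a and \<eta> :: 'b
    assume b: "\<forall>k. \<bar>b k\<bar> \<le> B"
    let ?t = "\<lambda>k. of_real (b k * 2 powr (- \<epsilon> * real k)) * lacunary_term m h k (\<xi>, \<eta>)"
    let ?M = "\<lambda>k. 2 powr (- \<epsilon> * real k) * (C * B * (1 + norm \<xi> + norm \<eta>) powr m)"
    have B: "B \<ge> 0" using b abs_ge_zero order_trans by blast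
    have le: "norm (?t k) \<le> ?M k" for k
    proof -
      have "norm (?t k) = 2 powr (- \<epsilon> * real k) * (\<bar>b k\<bar> * norm (lacunary_term m h k (\<xi>, \<eta>)))"
        by (simp add: norm_mult)
      also have "\<dots> \<le> 2 powr (- \<epsilon> * real k) * (B * (C * (1 + norm \<xi> + norm \<eta>) powr m))"
        using b B C by (intro mult_left_mono mult_mono) auto
      finally show ?thesis by (simp add: mult_ac)
    qed
    have sM: "summable ?M" by (intro summable_mult2 summable_powr_nat eps)
    show "summable ?t" by (rule summable_comparison_test'[OF sM, where N = 0]) (rule le)
    have "norm (lacunary_symbol m \<epsilon> h b (\<xi>, \<eta>)) \<le> suminf ?M"
      unfolding lacunary_symbol_def by (rule norm_suminf_le[OF le sM])
    also have "\<dots> = ?S * C * B * (1 + norm \<xi> + norm \<eta>) powr m"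
      by (subst suminf_mult2[OF summable_powr_nat[OF eps], symmetric]) (simp add: mult.assoc)
    finally show "norm (lacunary_symbol m \<epsilon> h b (\<xi>, \<eta>)) \<le> ?S * C * B * (1 + norm \<xi> + norm \<eta>) powr m" .
  qed
qed

lemma lacunary_symbol_foldr:
  assumes b: "\<And>k. \<bar>b k\<bar> \<le> B"
  shows "smooth (lacunary_symbol m \<epsilon> h b)"
    and "set vs \<subseteq> Basis \<Longrightarrow> \<exists>C. \<forall>\<xi> \<eta>. norm (foldr dir_deriv vs (lacunary_symbol m \<epsilon> h b) (\<xi>, \<eta>))
      \<le> C * (1 + norm \<xi> + norm \<eta>) powr (m - real (length vs))"
proof -
  define F where "F k z = of_real (b k * 2 powr (- \<epsilon> * real k)) * lacunary_term m h k z" for k z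
  have B: "B \<ge> 0" using b[of 0] abs_ge_zero order_trans by blast
  have sh: "smooth h" by (rule gauss_poly_smooth[OF h])
  have smF: "smooth (F k)" for k
  proof -
    have "F k = (\<lambda>z. (of_real (b k * 2 powr (- \<epsilon> * real k)) * of_real (2 powr (m * real k)))
        * h ((1 / 2) ^ k *\<^sub>R z))"
      by (simp add: F_def lacunary_term_def fun_eq_iff)
    then show ?thesis using foldr_dir_deriv_scale[OF sh] unfolding smooth_def by metis
  qed
  have bound: "\<exists>C\<ge>0. \<forall>k \<xi> \<eta>. norm (foldr dir_deriv vs (F k) (\<xi>, \<eta>))
      \<le> 2 powr (- \<epsilon> * real k) * (C * (1 + norm \<xi> + norm \<eta>) powr (m - real (length vs)))"
    if vs: "set vs \<subseteq> Basis" for vs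
  proof -
    obtain C where C: "C \<ge> 0" "\<And>k \<xi> \<eta>. 2 powr ((m - real (length vs)) * real k) *
        norm (foldr dir_deriv vs h ((1 / 2) ^ k *\<^sub>R (\<xi>, \<eta>)))
      \<le> C * (1 + norm \<xi> + norm \<eta>) powr (m - real (length vs))"
      using lacunary_term_bound[OF h m vanish, of vs] by blast
    have "norm (foldr dir_deriv vs (F k) (\<xi>, \<eta>))
      \<le> 2 powr (- \<epsilon> * real k) * (B * C * (1 + norm \<xi> + norm \<eta>) powr (m - real (length vs)))" for k \<xi> \<eta>
    proof -
      have "norm (foldr dir_deriv vs (F k) (\<xi>, \<eta>)) = 2 powr (- \<epsilon> * real k) * (\<bar>b k\<bar> *
        (2 powr ((m - real (length vs)) * real k) * norm (foldr dir_deriv vs h ((1 / 2) ^ k *\<^sub>R (\<xi>, \<eta>)))))"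
        unfolding F_def lacunary_term_foldr[OF sh vs] by (simp add: norm_mult abs_mult)
      also have "\<dots> \<le> 2 powr (- \<epsilon> * real k) * (B * (C * (1 + norm \<xi> + norm \<eta>) powr (m - real (length vs))))"
        using B by (intro mult_left_mono mult_mono[OF b C(2)]) auto
      finally show ?thesis by (simp add: mult.assoc)
    qed
    then show ?thesis using B C(1) by (intro exI[of _ "B * C"]) auto
  qed
  have sumM: "summable (\<lambda>k. 2 powr (- \<epsilon> * real k) * C)" for C
    by (intro summable_mult2 summable_powr_nat eps)
  have bound': "\<exists>M. summable M \<and> (\<forall>k z. norm (foldr dir_deriv vs (F k) z) \<le> M k)"
    if vs: "set vs \<subseteq> Basis" "vs \<noteq> []" for vs
  proof -
    obtain C where C: "C \<ge> 0" "\<And>k \<xi> \<eta>. norm (foldr dir_deriv vs (F k) (\<xi>, \<eta>))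
      \<le> 2 powr (- \<epsilon> * real k) * (C * (1 + norm \<xi> + norm \<eta>) powr (m - real (length vs)))"
      using bound[OF vs(1)] by blast
    have "norm (foldr dir_deriv vs (F k) z) \<le> 2 powr (- \<epsilon> * real k) * C" for k z
    proof -
      obtain \<xi> \<eta> where z: "z = (\<xi>, \<eta>)" by (cases z)
      \<comment> \<open>Here m \<le> 1 enters: every proper derivative has a weight with nonpositive
        exponent, hence is bounded.\<close>
      have "m - real (length vs) \<le> 0" using m vs(2) by (cases vs) auto
      then have "(1 + norm \<xi> + norm \<eta>) powr (m - real (length vs)) \<le> 1 powr (m - real (length vs))"
        by (intro powr_mono2') auto
      then have "2 powr (- \<epsilon> * real k) * (C * (1 + norm \<xi> + norm \<eta>) powr (m - real (length vs)))
          \<le> 2 powr (- \<epsilon> * real k) * (C * 1)"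
        using C(1) by (intro mult_left_mono) auto
      with C(2)[of k \<xi> \<eta>] show ?thesis unfolding z mult_1_right by (rule order_trans)
    qed
    with sumM[of C] show ?thesis by blast
  qed
  have sumF: "summable (\<lambda>k. F k z)" for z
    using lacunary_symbol_bound b unfolding F_def by (cases z) blast
  have eq: "lacunary_symbol m \<epsilon> h b = (\<lambda>z. \<Sum>k. F k z)"
    by (simp add: lacunary_symbol_def F_def fun_eq_iff)
  note fs = foldr_dir_deriv_suminf[of F, OF smF bound' sumF]
  show "smooth (lacunary_symbol m \<epsilon> h b)"
    unfolding smooth_def eq using fs by blast
  assume vs: "set vs \<subseteq> Basis"
  obtain C where C: "C \<ge> 0" "\<And>k \<xi> \<eta>. norm (foldr dir_deriv vs (F k) (\<xi>, \<eta>))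
      \<le> 2 powr (- \<epsilon> * real k) * (C * (1 + norm \<xi> + norm \<eta>) powr (m - real (length vs)))"
    using bound[OF vs] by blast
  let ?S = "\<Sum>k. 2 powr (- \<epsilon> * real k)"
  have "norm (foldr dir_deriv vs (lacunary_symbol m \<epsilon> h b) (\<xi>, \<eta>))
      \<le> (?S * C) * (1 + norm \<xi> + norm \<eta>) powr (m - real (length vs))" for \<xi> \<eta>
  proof -
    have "norm (\<Sum>k. foldr dir_deriv vs (F k) (\<xi>, \<eta>))
      \<le> (\<Sum>k. 2 powr (- \<epsilon> * real k) * (C * (1 + norm \<xi> + norm \<eta>) powr (m - real (length vs))))"
      by (rule norm_suminf_le[OF C(2) sumM])
    also have "\<dots> = ?S * C * (1 + norm \<xi> + norm \<eta>) powr (m - real (length vs))"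
      by (subst suminf_mult2[OF summable_powr_nat[OF eps], symmetric]) (simp add: mult.assoc)
    finally show ?thesis using fs vs unfolding eq by simp
  qed
  then show "\<exists>C. \<forall>\<xi> \<eta>. norm (foldr dir_deriv vs (lacunary_symbol m \<epsilon> h b) (\<xi>, \<eta>))
      \<le> C * (1 + norm \<xi> + norm \<eta>) powr (m - real (length vs))" by blast
qed

end

lemma lacunary_symbol_symbol_class:
  fixes h :: "(real^'n) \<times> (real^'n) \<Rightarrow> complex"
  assumes "gauss_poly h" "m \<le> 1" "\<epsilon> > 0"
    and "0 < m \<Longrightarrow> \<exists>C. \<forall>z. norm (h z) \<le> C * norm z powr m"
    and "\<And>k. \<bar>b k\<bar> \<le> B"
  shows "lacunary_symbol m \<epsilon> h b \<in> symbol_class m"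
proof -
  note * = lacunary_symbol_foldr[OF assms(1-3) _ assms(5)]
  let ?L1 = "\<lambda>\<alpha>::'n \<Rightarrow> nat. concat (map (\<lambda>i. replicate (\<alpha> i) (axis i 1 :: real^'n, 0 :: real^'n)) index_enum)"
  let ?L2 = "\<lambda>\<beta>::'n \<Rightarrow> nat. concat (map (\<lambda>i. replicate (\<beta> i) (0 :: real^'n, axis i 1 :: real^'n)) index_enum)"
  have "\<exists>C. \<forall>\<xi> \<eta>. norm (foldr dir_deriv (?L1 \<alpha> @ ?L2 \<beta>) (lacunary_symbol m \<epsilon> h b) (\<xi>, \<eta>))
      \<le> C * (1 + norm \<xi> + norm \<eta>) powr (m - real (length (?L1 \<alpha> @ ?L2 \<beta>)))" for \<alpha> \<beta>
  proof (rule *(2))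
    have "range (\<lambda>i. (axis i 1 :: real^'n, 0 :: real^'n)) \<subseteq> Basis"
      "range (\<lambda>i. (0 :: real^'n, axis i 1 :: real^'n)) \<subseteq> Basis"
      by (auto simp: Basis_prod_def intro!: axis_in_Basis_iff[THEN iffD2])
    then show "set (?L1 \<alpha> @ ?L2 \<beta>) \<subseteq> Basis"
      using set_multi_deriv_list[of \<alpha> "\<lambda>i. (axis i 1 :: real^'n, 0 :: real^'n)"]
        set_multi_deriv_list[of \<beta> "\<lambda>i. (0 :: real^'n, axis i 1 :: real^'n)"] by auto
  qed (rule assms(4))
  moreover have "smooth (lacunary_symbol m \<epsilon> h b)" by (rule *(1)) (rule assms(4))
  ultimately show ?thesis
    unfolding symbol_class_def multi_deriv_eq_foldr mem_Collect_eq
    by (simp add: length_multi_deriv_list diff_diff_eq del: length_concat)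
qed

section \<open>Gaussian integrals\<close>

text \<open>Lebesgue measure is the image of a product measure under the map from coordinates to
  vectors. Gaussians are products over the coordinates and are thereby reduced to dimension
  one.\<close>

lemma lborel_integral_prod_coordinates:
  fixes f :: "'a::euclidean_space \<Rightarrow> real \<Rightarrow> 'b::{real_normed_field,banach,second_countable_topology}"
  assumes "\<And>b. b \<in> Basis \<Longrightarrow> integrable lborel (f b)"
  shows "integrable lborel (\<lambda>x. \<Prod>b\<in>Basis. f b (x \<bullet> b))"
    and "(\<integral>x. (\<Prod>b\<in>Basis. f b (x \<bullet> b)) \<partial>lborel) = (\<Prod>b\<in>Basis. \<integral>t. f b t \<partial>lborel)"
proof -
  interpret P: product_sigma_finite "\<lambda>_::'a. lborel :: real measure" by standard
  have [measurable]: "\<And>b. b \<in> Basis \<Longrightarrow> f b \<in> borel_measurable borel"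
    using borel_measurable_integrable[OF assms] by simp
  have [measurable]: "(\<lambda>f. \<Sum>b\<in>Basis. f b *\<^sub>R b) \<in> (\<Pi>\<^sub>M b\<in>Basis. lborel) \<rightarrow>\<^sub>M (borel :: 'a measure)"
    by measurable
  have eq: "(\<Prod>b\<in>Basis. f b ((\<Sum>c\<in>Basis. x c *\<^sub>R c) \<bullet> b)) = (\<Prod>b\<in>Basis. f b (x b))" for x :: "'a \<Rightarrow> real"
    by (intro prod.cong) (auto simp: inner_sum_left inner_Basis if_distrib cong: if_cong)
  show "integrable lborel (\<lambda>x. \<Prod>b\<in>Basis. f b (x \<bullet> b))"
    unfolding lborel_eq[where 'a = 'a]
    by (subst integrable_distr_eq) (auto simp: eq intro!: P.product_integrable_prod assms)
  show "(\<integral>x. (\<Prod>b\<in>Basis. f b (x \<bullet> b)) \<partial>lborel) = (\<Prod>b\<in>Basis. \<integral>t. f b t \<partial>lborel)"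
    unfolding lborel_eq[where 'a = 'a]
    by (subst integral_distr) (auto simp: eq intro!: P.product_integral_prod assms)
qed

lemma borel_measurable_cis [measurable (raw)]:
  "f \<in> borel_measurable M \<Longrightarrow> (\<lambda>x. cis (f x)) \<in> borel_measurable M"
  by (rule borel_measurable_continuous_on[of cis]) (auto intro!: continuous_intros)

text \<open>This is the characteristic function of the standard normal distribution, rescaled by the
  factor a with c a^2 = 1/2.\<close>

lemma gaussian_1d_fourier:
  fixes c t :: real
  assumes c: "c > 0"
  shows "integrable lborel (\<lambda>x. complex_of_real (exp (- c * x\<^sup>2)) * cis (t * x))"
    and "(\<integral>x. complex_of_real (exp (- c * x\<^sup>2)) * cis (t * x) \<partial>lborel)
      = complex_of_real (sqrt (pi / c) * exp (- t\<^sup>2 / (4 * c)))"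
proof -
  define a where "a = 1 / sqrt (2 * c)"
  have a: "a > 0" "a\<^sup>2 = 1 / (2 * c)" using c by (auto simp: a_def power_divide)
  let ?g = "\<lambda>x. std_normal_density x *\<^sub>R cis (a * t * x)"
  have int: "integrable lborel ?g"
    using integrable_normal_density[of 1 0]
    by (rule Bochner_Integration.integrable_bound) (auto simp: normal_density_nonneg)
  have val: "(\<integral>x. ?g x \<partial>lborel) = complex_of_real (exp (- ((a * t)\<^sup>2) / 2))"
  proof -
    have "char std_normal_distribution (a * t) = (\<integral>x. ?g x \<partial>lborel)"
      unfolding char_def by (subst integral_density) (auto simp: normal_density_nonneg cis_conv_exp)
    then show ?thesis by (simp add: char_std_normal_distribution)
  qed
  let ?f = "\<lambda>x. complex_of_real (exp (- c * x\<^sup>2)) * cis (t * x)"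
  have fg: "?f (0 + a * x) = complex_of_real (sqrt (2 * pi)) * ?g x" for x
  proof -
    have "- c * (a * x)\<^sup>2 = - x\<^sup>2 / 2" using a c by (simp add: power_mult_distrib)
    then show ?thesis by (simp add: std_normal_density_def scaleR_conv_of_real mult_ac)
  qed
  have int': "integrable lborel (\<lambda>x. ?f (0 + a * x))"
    unfolding fg using int by (rule integrable_mult_right)
  show "integrable lborel ?f"
    using lborel_integrable_real_affine_iff[of a ?f 0] int' a by simp
  have "(\<integral>x. ?f x \<partial>lborel) = a *\<^sub>R (\<integral>x. ?f (0 + a * x) \<partial>lborel)"
    using lborel_integral_real_affine[of a ?f 0] a by simp
  also have "(\<integral>x. ?f (0 + a * x) \<partial>lborel) = complex_of_real (sqrt (2 * pi)) * (\<integral>x. ?g x \<partial>lborel)"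
    unfolding fg by (rule integral_mult_right_zero)
  also have "a *\<^sub>R \<dots> = complex_of_real (a * sqrt (2 * pi) * exp (- ((a * t)\<^sup>2) / 2))"
    unfolding val by (simp add: scaleR_conv_of_real)
  also have "a * sqrt (2 * pi) = sqrt (pi / c)"
    using c by (simp add: a_def real_sqrt_divide real_sqrt_mult)
  also have "- ((a * t)\<^sup>2) / 2 = - t\<^sup>2 / (4 * c)"
    using a by (simp add: power_mult_distrib)
  finally show "(\<integral>x. ?f x \<partial>lborel) = complex_of_real (sqrt (pi / c) * exp (- t\<^sup>2 / (4 * c)))" .
qed

lemma norm_power2_eq_sum_Basis: "(norm x)\<^sup>2 = (\<Sum>b\<in>Basis. (x \<bullet> b)\<^sup>2)"
  for x :: "'a::euclidean_space"
  unfolding power2_norm_eq_inner by (subst euclidean_inner) (simp only: power2_eq_square)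

lemma gaussian_fourier:
  fixes \<xi> :: "'a::euclidean_space"
  assumes c: "c > 0"
  shows "integrable lborel (\<lambda>x::'a. complex_of_real (exp (- c * (norm x)\<^sup>2)) * cis (\<xi> \<bullet> x))" (is ?int)
    and "(\<integral>x. complex_of_real (exp (- c * (norm x)\<^sup>2)) * cis (\<xi> \<bullet> x) \<partial>lborel)
      = complex_of_real (sqrt (pi / c) ^ DIM('a) * exp (- (norm \<xi>)\<^sup>2 / (4 * c)))" (is ?val)
proof -
  let ?f = "\<lambda>b x. complex_of_real (exp (- c * x\<^sup>2)) * cis ((\<xi> \<bullet> b) * x)"
  have eq: "complex_of_real (exp (- c * (norm x)\<^sup>2)) * cis (\<xi> \<bullet> x) = (\<Prod>b\<in>Basis. ?f b (x \<bullet> b))" for x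
  proof -
    have "(\<Prod>b\<in>Basis. ?f b (x \<bullet> b))
      = complex_of_real (\<Prod>b\<in>Basis. exp (- c * (x \<bullet> b)\<^sup>2)) * (\<Prod>b\<in>Basis. cis ((\<xi> \<bullet> b) * (x \<bullet> b)))"
      by (simp add: prod.distrib)
    also have "(\<Prod>b\<in>Basis. exp (- c * (x \<bullet> b)\<^sup>2)) = exp (- c * (norm x)\<^sup>2)"
      by (simp add: exp_sum[symmetric] norm_power2_eq_sum_Basis sum_distrib_left sum_negf)
    also have "(\<Prod>b\<in>Basis. cis ((\<xi> \<bullet> b) * (x \<bullet> b))) = cis (\<xi> \<bullet> x)"
      by (simp add: cis_conv_exp exp_sum[symmetric] euclidean_inner[of \<xi> x] sum_distrib_left)
    finally show ?thesis by simp
  qed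
  have int: "integrable lborel (?f b)" for b by (rule gaussian_1d_fourier(1)[OF c])
  show ?int unfolding eq by (rule lborel_integral_prod_coordinates(1)[of ?f, OF int])
  have "(\<integral>x. (\<Prod>b\<in>Basis. ?f b (x \<bullet> b)) \<partial>lborel) = (\<Prod>b\<in>Basis. \<integral>t. ?f b t \<partial>lborel)"
    by (rule lborel_integral_prod_coordinates(2)[of ?f, OF int])
  also have "\<dots> = (\<Prod>b\<in>Basis. complex_of_real (sqrt (pi / c) * exp (- (\<xi> \<bullet> b)\<^sup>2 / (4 * c))))"
    by (simp only: gaussian_1d_fourier(2)[OF c])
  also have "\<dots> = complex_of_real (sqrt (pi / c) ^ DIM('a) * exp (- (norm \<xi>)\<^sup>2 / (4 * c)))"
    by (simp add: prod.distrib exp_sum[symmetric] norm_power2_eq_sum_Basis sum_divide_distrib sum_negf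
      flip: of_real_prod)
  finally show ?val unfolding eq .
qed

lemma integrable_lborel_translate:
  fixes f :: "'a::euclidean_space \<Rightarrow> 'b::{banach,second_countable_topology}"
  assumes f: "integrable lborel f"
  shows "integrable lborel (\<lambda>x. f (x + a))" "(\<integral>x. f (x + a) \<partial>lborel) = (\<integral>x. f x \<partial>lborel)"
proof -
  have [measurable]: "f \<in> borel_measurable borel" using borel_measurable_integrable[OF f] by simp
  have f': "integrable (distr lborel borel ((+) a)) f" using f by (simp add: lborel_distr_plus)
  then show "integrable lborel (\<lambda>x. f (x + a))"
    by (subst (asm) integrable_distr_eq) (auto simp: add.commute)
  have "(\<integral>x. f x \<partial>lborel) = (\<integral>x. f x \<partial>distr lborel borel ((+) a))" by (simp add: lborel_distr_plus)
  also have "\<dots> = (\<integral>x. f (a + x) \<partial>lborel)" by (rule integral_distr) auto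
  finally show "(\<integral>x. f (x + a) \<partial>lborel) = (\<integral>x. f x \<partial>lborel)" by (simp add: add.commute)
qed

lemma gaussian_fourier_translate:
  fixes \<xi> a :: "'a::euclidean_space"
  assumes c: "c > 0"
  shows "integrable lborel (\<lambda>x::'a. complex_of_real (exp (- c * (norm (x - a))\<^sup>2)) * cis (\<xi> \<bullet> x))" (is ?int)
    and "(\<integral>x. complex_of_real (exp (- c * (norm (x - a))\<^sup>2)) * cis (\<xi> \<bullet> x) \<partial>lborel)
      = cis (\<xi> \<bullet> a) * complex_of_real (sqrt (pi / c) ^ DIM('a) * exp (- (norm \<xi>)\<^sup>2 / (4 * c)))" (is ?val)
proof -
  let ?f = "\<lambda>x::'a. cis (\<xi> \<bullet> a) * (complex_of_real (exp (- c * (norm x)\<^sup>2)) * cis (\<xi> \<bullet> x))"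
  have int: "integrable lborel ?f" by (intro integrable_mult_right gaussian_fourier(1) c)
  have eq: "complex_of_real (exp (- c * (norm (x - a))\<^sup>2)) * cis (\<xi> \<bullet> x) = ?f (x + - a)" for x
    by (simp add: cis_mult inner_diff_right)
  show ?int unfolding eq by (rule integrable_lborel_translate(1)[OF int])
  show ?val unfolding eq integrable_lborel_translate(2)[OF int]
    unfolding integral_mult_right_zero gaussian_fourier(2)[OF c] ..
qed

lemma gaussian_integral:
  fixes a :: "'a::euclidean_space"
  assumes c: "c > 0"
  shows "integrable lborel (\<lambda>x::'a. exp (- c * (norm (x - a))\<^sup>2))"
    and "(\<integral>x. exp (- c * (norm (x - a))\<^sup>2) \<partial>lborel) = sqrt (pi / c) ^ DIM('a)"
proof -
  have "integrable lborel (\<lambda>x::'a. complex_of_real (exp (- c * (norm (x - a))\<^sup>2)))"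
    using gaussian_fourier_translate(1)[OF c, of a 0] by simp
  then show "integrable lborel (\<lambda>x::'a. exp (- c * (norm (x - a))\<^sup>2))"
    unfolding complex_of_real_integrable_eq .
  have "(\<integral>x. complex_of_real (exp (- c * (norm (x - a))\<^sup>2)) \<partial>lborel) = complex_of_real (sqrt (pi / c) ^ DIM('a))"
    using gaussian_fourier_translate(2)[OF c, of a 0] by simp
  then show "(\<integral>x. exp (- c * (norm (x - a))\<^sup>2) \<partial>lborel) = sqrt (pi / c) ^ DIM('a)"
    by (simp only: integral_complex_of_real of_real_eq_iff)
qed

lemma gaussian_nn_integral:
  fixes a :: "'a::euclidean_space"
  assumes c: "c > 0"
  shows "(\<integral>\<^sup>+x. ennreal (exp (- c * (norm (x - a))\<^sup>2)) \<partial>lborel) = ennreal (sqrt (pi / c) ^ DIM('a))"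
  by (subst nn_integral_eq_integral[OF gaussian_integral(1)[OF c, of a]])
     (simp_all only: gaussian_integral(2)[OF c, of a] exp_ge_zero AE_I2)

text \<open>The centre of the product of the two Gaussians is \<open>b x / (a + b)\<close>.\<close>

lemma gaussian_convolution:
  fixes x :: "'a::euclidean_space"
  assumes a: "a > 0" and b: "b > 0"
  shows "integrable lborel (\<lambda>y. exp (- a * (norm y)\<^sup>2) * exp (- b * (norm (x - y))\<^sup>2))"
    and "(\<integral>y. exp (- a * (norm y)\<^sup>2) * exp (- b * (norm (x - y))\<^sup>2) \<partial>lborel)
      = sqrt (pi / (a + b)) ^ DIM('a) * exp (- (a * b / (a + b)) * (norm x)\<^sup>2)"
proof -
  define p where "p = (b / (a + b)) *\<^sub>R x"
  have eq: "exp (- a * (norm y)\<^sup>2) * exp (- b * (norm (x - y))\<^sup>2)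
    = exp (- (a * b / (a + b)) * (norm x)\<^sup>2) * exp (- (a + b) * (norm (y - p))\<^sup>2)" for y
  proof -
    have "(a + b) * (norm (y - p))\<^sup>2
        = (a + b) * (y \<bullet> y) - 2 * ((a + b) * (b / (a + b))) * (x \<bullet> y) + (a + b) * (b / (a + b))\<^sup>2 * (x \<bullet> x)"
      unfolding p_def power2_norm_eq_inner
      by (simp add: inner_diff_left inner_diff_right inner_commute algebra_simps power2_eq_square)
    also have "(a + b) * (b / (a + b)) = b" using a b by simp
    also have "(a + b) * (b / (a + b))\<^sup>2 = b - a * b / (a + b)"
      using a b by (simp add: power2_eq_square divide_simps) (simp add: algebra_simps)
    finally have "- a * (norm y)\<^sup>2 + - b * (norm (x - y))\<^sup>2
        = - (a * b / (a + b)) * (norm x)\<^sup>2 + - (a + b) * (norm (y - p))\<^sup>2"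
      by (simp add: power2_norm_eq_inner inner_diff_left inner_diff_right inner_commute algebra_simps)
    then show ?thesis by (simp add: exp_add[symmetric])
  qed
  have ab: "a + b > 0" using a b by simp
  show "integrable lborel (\<lambda>y. exp (- a * (norm y)\<^sup>2) * exp (- b * (norm (x - y))\<^sup>2))"
    unfolding eq by (intro integrable_mult_right gaussian_integral ab)
  show "(\<integral>y. exp (- a * (norm y)\<^sup>2) * exp (- b * (norm (x - y))\<^sup>2) \<partial>lborel)
      = sqrt (pi / (a + b)) ^ DIM('a) * exp (- (a * b / (a + b)) * (norm x)\<^sup>2)"
    unfolding eq using gaussian_integral(2)[OF ab, of p] by simp
qed

section \<open>Fubini's theorem for tensor products and Fourier integrals\<close>

lemma integrable_lborel_pair_mult:
  fixes F :: "'a::euclidean_space \<Rightarrow> complex" and G :: "'b::euclidean_space \<Rightarrow> complex"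
  assumes F: "integrable lborel F" and G: "integrable lborel G"
  shows "integrable (lborel \<Otimes>\<^sub>M lborel) (\<lambda>(x, y). F x * G y)"
proof -
  have [measurable]: "F \<in> borel_measurable borel" "G \<in> borel_measurable borel"
    using borel_measurable_integrable[OF F] borel_measurable_integrable[OF G] by simp_all
  show ?thesis
    by (rule lborel_pair.Fubini_integrable)
       (auto simp: norm_mult intro!: integrable_mult_left integrable_mult_right integrable_norm F G)
qed

lemma integral_lborel_pair_mult:
  fixes F :: "'a::euclidean_space \<Rightarrow> complex" and G :: "'b::euclidean_space \<Rightarrow> complex"
  assumes F: "integrable lborel F" and G: "integrable lborel G"
  shows "integrable lborel (\<lambda>(x, y). F x * G y)"
    and "(\<integral>(x, y). F x * G y \<partial>lborel) = (\<integral>x. F x \<partial>lborel) * (\<integral>y. G y \<partial>lborel)"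
  using integrable_lborel_pair_mult[OF assms] lborel_pair.integral_fst'[OF integrable_lborel_pair_mult[OF assms]]
  by (simp_all add: lborel_prod)

text \<open>By Fubini's theorem. This multiplication formula does the work of Fourier inversion: an
  integral over x that involves an inexplicit Fourier integral becomes one over frequencies, where
  the transform of the other factor is explicit or can be estimated.\<close>

lemma fourier_pairing:
  fixes w k :: "'a::euclidean_space \<Rightarrow> complex"
  assumes w: "integrable lborel w" and k: "integrable lborel k"
  shows "(\<integral>x. (\<integral>\<xi>. cis (x \<bullet> \<xi>) * w \<xi> \<partial>lborel) * k x \<partial>lborel)
    = (\<integral>\<xi>. w \<xi> * (\<integral>x. cis (x \<bullet> \<xi>) * k x \<partial>lborel) \<partial>lborel)"
proof -
  have [measurable]: "w \<in> borel_measurable borel" "k \<in> borel_measurable borel"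
    using borel_measurable_integrable[OF w] borel_measurable_integrable[OF k] by simp_all
  have int: "integrable (lborel \<Otimes>\<^sub>M lborel) (\<lambda>(x, \<xi>). cis (x \<bullet> \<xi>) * w \<xi> * k x)"
    by (rule Bochner_Integration.integrable_bound[OF integrable_lborel_pair_mult[OF k w]])
       (auto simp: norm_mult)
  have "(\<integral>x. (\<integral>\<xi>. cis (x \<bullet> \<xi>) * w \<xi> \<partial>lborel) * k x \<partial>lborel)
    = (\<integral>x. (\<integral>\<xi>. cis (x \<bullet> \<xi>) * w \<xi> * k x \<partial>lborel) \<partial>lborel)"
    by (simp only: integral_mult_left_zero)
  also have "\<dots> = (\<integral>\<xi>. (\<integral>x. cis (x \<bullet> \<xi>) * w \<xi> * k x \<partial>lborel) \<partial>lborel)"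
    using lborel_pair.Fubini_integral[OF int] by simp
  also have "\<dots> = (\<integral>\<xi>. (\<integral>x. w \<xi> * (cis (x \<bullet> \<xi>) * k x) \<partial>lborel) \<partial>lborel)"
    by (simp add: mult_ac)
  finally show ?thesis by (simp only: integral_mult_right_zero)
qed

lemma fourier_integral_bound:
  fixes w :: "'a::euclidean_space \<Rightarrow> complex"
  shows "norm (\<integral>\<xi>. cis (x \<bullet> \<xi>) * w \<xi> \<partial>lborel) \<le> (\<integral>\<xi>. norm (w \<xi>) \<partial>lborel)"
  using integral_norm_bound[of lborel "\<lambda>\<xi>. cis (x \<bullet> \<xi>) * w \<xi>"] by (simp add: norm_mult)

lemma borel_measurable_fourier_integral [measurable]:
  fixes w :: "'a::euclidean_space \<Rightarrow> complex"
  assumes [measurable]: "w \<in> borel_measurable borel"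
  shows "(\<lambda>x. \<integral>\<xi>. cis (x \<bullet> \<xi>) * w \<xi> \<partial>lborel) \<in> borel_measurable borel"
  by measurable

lemma integrable_gaussian_weight:
  fixes u :: "'a::euclidean_space \<Rightarrow> complex"
  assumes [measurable]: "u \<in> borel_measurable borel" and "\<And>x. norm (u x) \<le> B" and "\<epsilon> > 0"
  shows "integrable lborel (\<lambda>x. u x * complex_of_real (exp (- \<epsilon> * (norm x)\<^sup>2)))"
proof (rule Bochner_Integration.integrable_bound)
  show "integrable lborel (\<lambda>x::'a. B * exp (- \<epsilon> * (norm x)\<^sup>2))"
    using gaussian_integral(1)[of \<epsilon> "0::'a"] assms(3) by (intro integrable_mult_right) simp
  show "AE x in lborel. norm (u x * complex_of_real (exp (- \<epsilon> * (norm x)\<^sup>2))) \<le> norm (B * exp (- \<epsilon> * (norm x)\<^sup>2))"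
    using assms(2) by (intro AE_I2) (auto simp: norm_mult abs_mult intro!: mult_right_mono order_trans[OF _ abs_ge_self])
qed simp

text \<open>A substitute for Plancherel's theorem. Bounding the weight from below on a ball by a
  constant gives a local \<open>L\<^sup>2\<close> bound.\<close>

lemma gaussian_weighted_L2:
  fixes w :: "'a::euclidean_space \<Rightarrow> complex"
  assumes w: "integrable lborel w" and K: "\<And>\<xi>. norm (w \<xi>) \<le> K" and e: "\<epsilon> > 0"
  defines "u \<equiv> \<lambda>x. \<integral>\<xi>. cis (x \<bullet> \<xi>) * w \<xi> \<partial>lborel"
  shows "integrable lborel (\<lambda>x. (norm (u x))\<^sup>2 * exp (- \<epsilon> * (norm x)\<^sup>2))"
    and "(\<integral>x. (norm (u x))\<^sup>2 * exp (- \<epsilon> * (norm x)\<^sup>2) \<partial>lborel)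
      \<le> K * (\<integral>\<xi>. norm (w \<xi>) \<partial>lborel) * (2 * pi) ^ DIM('a)"
proof -
  let ?B = "\<integral>\<xi>. norm (w \<xi>) \<partial>lborel"
  let ?g = "\<lambda>x::'a. complex_of_real (exp (- \<epsilon> * (norm x)\<^sup>2))"
  let ?G = "\<lambda>\<zeta>::'a. sqrt (pi / \<epsilon>) ^ DIM('a) * exp (- (1 / (4 * \<epsilon>)) * (norm \<zeta>)\<^sup>2)"
  have [measurable]: "w \<in> borel_measurable borel"
    using borel_measurable_integrable[OF w] by simp
  have [measurable]: "u \<in> borel_measurable borel" unfolding u_def by simp
  have [measurable]: "(\<lambda>x. cnj (u x)) \<in> borel_measurable borel"
    by (rule borel_measurable_continuous_on[of cnj]) (auto intro!: continuous_intros)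
  have uB: "norm (u x) \<le> ?B" for x unfolding u_def by (rule fourier_integral_bound)
  have B0: "?B \<ge> 0" by simp
  have K0: "K \<ge> 0" using K[of 0] norm_ge_zero order_trans by blast
  \<comment> \<open>The integral of \<open>u * k\<close> is the weighted square norm.
    \<open>fourier_pairing\<close> is applied to it twice: to the factor u, and then to the u hidden
    in k.\<close>
  define k where "k x = cnj (u x) * ?g x" for x
  have k: "integrable lborel k"
    unfolding k_def by (rule integrable_gaussian_weight[OF _ _ e, of _ ?B]) (auto simp: uB)
  have eq: "u x * k x = complex_of_real ((norm (u x))\<^sup>2 * exp (- \<epsilon> * (norm x)\<^sup>2))" for x
    unfolding k_def using complex_norm_square[of "u x"] by (simp add: mult.assoc[symmetric])
  have int: "integrable lborel (\<lambda>x. u x * k x)"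
    by (rule Bochner_Integration.integrable_bound[OF integrable_mult_right[OF integrable_norm[OF k], of ?B]])
       (use uB in \<open>auto simp: norm_mult k_def intro!: mult_right_mono borel_measurable_times\<close>)
  show "integrable lborel (\<lambda>x. (norm (u x))\<^sup>2 * exp (- \<epsilon> * (norm x)\<^sup>2))"
    using int unfolding eq complex_of_real_integrable_eq .
  \<comment> \<open>The transform of the weight is a Gaussian whose mass (2\<pi>)^n does not depend
    on \<epsilon>; this keeps \<epsilon> out of the final bound.\<close>
  have Gint: "integrable lborel (\<lambda>\<eta>. ?G (\<eta> - \<xi>))" "(\<integral>\<eta>. ?G (\<eta> - \<xi>) \<partial>lborel) = (2 * pi) ^ DIM('a)" for \<xi>
  proof -
    have c: "1 / (4 * \<epsilon>) > 0" using e by simp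
    show "integrable lborel (\<lambda>\<eta>. ?G (\<eta> - \<xi>))"
      by (intro integrable_mult_right gaussian_integral(1)[OF c])
    have "(\<integral>\<eta>. ?G (\<eta> - \<xi>) \<partial>lborel) = sqrt (pi / \<epsilon>) ^ DIM('a) * sqrt (pi / (1 / (4 * \<epsilon>))) ^ DIM('a)"
      using gaussian_integral(2)[OF c, of \<xi>] by simp
    also have "sqrt (pi / \<epsilon>) ^ DIM('a) * sqrt (pi / (1 / (4 * \<epsilon>))) ^ DIM('a) = (2 * pi) ^ DIM('a)"
    proof -
      have "sqrt (pi / \<epsilon>) * sqrt (pi / (1 / (4 * \<epsilon>))) = sqrt ((2 * pi)\<^sup>2)"
        unfolding real_sqrt_mult[symmetric] using e by (simp add: power2_eq_square field_simps)
      also have "\<dots> = 2 * pi" unfolding real_sqrt_abs by simp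
      finally show ?thesis by (simp only: power_mult_distrib[symmetric])
    qed
    finally show "(\<integral>\<eta>. ?G (\<eta> - \<xi>) \<partial>lborel) = (2 * pi) ^ DIM('a)" .
  qed
  \<comment> \<open>Up to conjugation this is w averaged against the transform of the weight, so
    that the bound K on w survives with the factor (2\<pi>)^n.\<close>
  have inner: "norm (\<integral>x. cis (x \<bullet> \<xi>) * k x \<partial>lborel) \<le> K * (2 * pi) ^ DIM('a)" for \<xi>
  proof -
    have "(\<integral>x. cis (x \<bullet> \<xi>) * k x \<partial>lborel) = cnj (\<integral>x. u x * (?g x * cis (- \<xi> \<bullet> x)) \<partial>lborel)"
    proof -
      have "integrable lborel (\<lambda>x. (u x * cis (- \<xi> \<bullet> x)) * ?g x)"
        by (rule integrable_gaussian_weight[OF _ _ e, of _ ?B]) (auto simp: uB norm_mult)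
      then have "integrable lborel (\<lambda>x. u x * (?g x * cis (- \<xi> \<bullet> x)))" by (simp add: mult_ac)
      from integral_bounded_linear[OF bounded_linear_cnj this]
      show ?thesis by (simp add: k_def cis_cnj inner_commute mult_ac)
    qed
    also have "(\<integral>x. u x * (?g x * cis (- \<xi> \<bullet> x)) \<partial>lborel)
        = (\<integral>\<eta>. w \<eta> * (\<integral>x. cis (x \<bullet> \<eta>) * (?g x * cis (- \<xi> \<bullet> x)) \<partial>lborel) \<partial>lborel)"
      unfolding u_def by (rule fourier_pairing[OF w gaussian_fourier(1)[OF e]])
    also have "\<dots> = (\<integral>\<eta>. w \<eta> * complex_of_real (?G (\<eta> - \<xi>)) \<partial>lborel)"
    proof (intro Bochner_Integration.integral_cong refl arg_cong2[where f = "(*)"])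
      fix \<eta>
      have "(\<integral>x. cis (x \<bullet> \<eta>) * (?g x * cis (- \<xi> \<bullet> x)) \<partial>lborel) = (\<integral>x. ?g x * cis ((\<eta> - \<xi>) \<bullet> x) \<partial>lborel)"
        by (intro Bochner_Integration.integral_cong refl)
           (simp add: cis_mult inner_diff_left inner_commute[of _ \<eta>] mult.left_commute)
      then show "(\<integral>x. cis (x \<bullet> \<eta>) * (?g x * cis (- \<xi> \<bullet> x)) \<partial>lborel) = complex_of_real (?G (\<eta> - \<xi>))"
        unfolding gaussian_fourier(2)[OF e] by simp
    qed
    finally have "norm (\<integral>x. cis (x \<bullet> \<xi>) * k x \<partial>lborel)
        = norm (\<integral>\<eta>. w \<eta> * complex_of_real (?G (\<eta> - \<xi>)) \<partial>lborel)"
      by (simp only: complex_mod_cnj)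
    also have "\<dots> \<le> (\<integral>\<eta>. norm (w \<eta> * complex_of_real (?G (\<eta> - \<xi>))) \<partial>lborel)"
      by (rule integral_norm_bound)
    also have "\<dots> \<le> (\<integral>\<eta>. K * ?G (\<eta> - \<xi>) \<partial>lborel)"
    proof (rule integral_mono_AE')
      show "integrable lborel (\<lambda>\<eta>. K * ?G (\<eta> - \<xi>))" by (intro integrable_mult_right Gint)
      show "AE \<eta> in lborel. norm (w \<eta> * complex_of_real (?G (\<eta> - \<xi>))) \<le> K * ?G (\<eta> - \<xi>)"
        unfolding norm_mult norm_of_real using K e by (intro AE_I2 mult_mono) (auto simp: K0 abs_mult)
    qed (use K0 e in \<open>auto intro!: mult_nonneg_nonneg\<close>)
    also have "\<dots> = K * (2 * pi) ^ DIM('a)" by (subst integral_mult_right_zero) (simp only: Gint(2))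
    finally show ?thesis .
  qed
  have "complex_of_real (\<integral>x. (norm (u x))\<^sup>2 * exp (- \<epsilon> * (norm x)\<^sup>2) \<partial>lborel) = (\<integral>x. u x * k x \<partial>lborel)"
    unfolding eq by (rule integral_complex_of_real[symmetric])
  also have "\<dots> = (\<integral>\<xi>. w \<xi> * (\<integral>x. cis (x \<bullet> \<xi>) * k x \<partial>lborel) \<partial>lborel)"
    unfolding u_def by (rule fourier_pairing[OF w k])
  finally have eq2: "complex_of_real (\<integral>x. (norm (u x))\<^sup>2 * exp (- \<epsilon> * (norm x)\<^sup>2) \<partial>lborel)
    = (\<integral>\<xi>. w \<xi> * (\<integral>x. cis (x \<bullet> \<xi>) * k x \<partial>lborel) \<partial>lborel)" .
  have "(\<integral>x. (norm (u x))\<^sup>2 * exp (- \<epsilon> * (norm x)\<^sup>2) \<partial>lborel)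
      \<le> norm (\<integral>\<xi>. w \<xi> * (\<integral>x. cis (x \<bullet> \<xi>) * k x \<partial>lborel) \<partial>lborel)"
    unfolding eq2[symmetric] norm_of_real by (rule abs_ge_self)
  also have "\<dots> \<le> (\<integral>\<xi>. norm (w \<xi> * (\<integral>x. cis (x \<bullet> \<xi>) * k x \<partial>lborel)) \<partial>lborel)"
    by (rule integral_norm_bound)
  also have "\<dots> \<le> (\<integral>\<xi>. norm (w \<xi>) * (K * (2 * pi) ^ DIM('a)) \<partial>lborel)"
    using inner K0
    by (intro integral_mono_AE' AE_I2 integrable_mult_left integrable_norm w)
       (auto simp: norm_mult intro!: mult_left_mono)
  also have "\<dots> = K * (\<integral>\<xi>. norm (w \<xi>) \<partial>lborel) * (2 * pi) ^ DIM('a)" by simp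
  finally show "(\<integral>x. (norm (u x))\<^sup>2 * exp (- \<epsilon> * (norm x)\<^sup>2) \<partial>lborel)
      \<le> K * (\<integral>\<xi>. norm (w \<xi>) \<partial>lborel) * (2 * pi) ^ DIM('a)" .
qed

section \<open>The phase\<close>

definition phase :: "real \<Rightarrow> 'a::euclidean_space \<Rightarrow> real" where
  "phase s \<xi> = norm \<xi> powr s"

definition phase_grad :: "real \<Rightarrow> 'a::euclidean_space \<Rightarrow> 'a" where
  "phase_grad s \<xi> = (s * norm \<xi> powr (s - 2)) *\<^sub>R \<xi>"

lemma powr_comparable:
  fixes x y K \<beta> :: real
  assumes "y > 0" "K \<ge> 1" "y / K \<le> x" "x \<le> K * y"
  shows "x powr \<beta> \<le> K powr \<bar>\<beta>\<bar> * y powr \<beta>" "K powr - \<bar>\<beta>\<bar> * y powr \<beta> \<le> x powr \<beta>"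
proof -
  have x: "x > 0" using assms by (smt (verit) divide_pos_pos)
  have q: "1 / K \<le> x / y" "x / y \<le> K" "x / y > 0" using assms x by (auto simp: field_simps)
  have eq: "x powr \<beta> = (x / y) powr \<beta> * y powr \<beta>" using assms x by (simp add: powr_divide)
  have K1: "(1 / K) powr c = K powr - c" for c using assms by (simp add: powr_divide powr_minus_divide)
  have "(x / y) powr \<beta> \<le> K powr \<bar>\<beta>\<bar> \<and> K powr - \<bar>\<beta>\<bar> \<le> (x / y) powr \<beta>"
  proof (cases "\<beta> \<ge> 0")
    case True
    then show ?thesis
      using powr_mono2[of \<beta> "x / y" K] powr_mono2[of \<beta> "1 / K" "x / y"] q assms by (auto simp: K1)
  next
    case False
    then show ?thesis
      using powr_mono2'[of \<beta> "1 / K" "x / y"] powr_mono2'[of \<beta> "x / y" K] q assms by (auto simp: K1)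
  qed
  then show "x powr \<beta> \<le> K powr \<bar>\<beta>\<bar> * y powr \<beta>" "K powr - \<bar>\<beta>\<bar> * y powr \<beta> \<le> x powr \<beta>"
    unfolding eq by (auto intro: mult_right_mono)
qed

lemma powr_taylor2:
  fixes a b y K \<alpha> :: real
  assumes y: "y > 0" and K: "K \<ge> 1" and a: "y / K \<le> a" "a \<le> K * y" and b: "y / K \<le> b" "b \<le> K * y"
  shows "\<bar>b powr \<alpha> - a powr \<alpha> - \<alpha> * a powr (\<alpha> - 1) * (b - a)\<bar>
    \<le> \<bar>\<alpha> * (\<alpha> - 1)\<bar> * K powr \<bar>\<alpha> - 2\<bar> * y powr (\<alpha> - 2) * (b - a)\<^sup>2"
proof (cases "a = b")
  case False
  let ?d = "\<lambda>(n::nat) t. if n = 0 then t powr \<alpha> else if n = 1 then \<alpha> * t powr (\<alpha> - 1)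
    else \<alpha> * (\<alpha> - 1) * t powr (\<alpha> - 2)"
  have yK: "y / K > 0" using y K by simp
  have d: "\<forall>m t. m < 2 \<and> y / K \<le> t \<and> t \<le> K * y \<longrightarrow> DERIV (?d m) t :> ?d (Suc m) t"
  proof (intro allI impI)
    fix m :: nat and t assume *: "m < 2 \<and> y / K \<le> t \<and> t \<le> K * y"
    then have t: "t > 0" using yK by linarith
    from * consider "m = 0" | "m = 1" by linarith
    then show "DERIV (?d m) t :> ?d (Suc m) t"
    proof cases
      case 1
      have "((\<lambda>t. t powr \<alpha>) has_real_derivative \<alpha> * t powr (\<alpha> - 1)) (at t)"
        by (rule has_real_derivative_powr[OF t])
      with 1 show ?thesis by simp
    next
      case 2
      have "((\<lambda>t. \<alpha> * t powr (\<alpha> - 1)) has_real_derivative \<alpha> * ((\<alpha> - 1) * t powr (\<alpha> - 1 - 1))) (at t)"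
        by (intro DERIV_cmult has_real_derivative_powr[OF t])
      with 2 show ?thesis by (simp add: mult.assoc)
    qed
  qed
  obtain t where t: "if b < a then b < t \<and> t < a else a < t \<and> t < b"
    and eq: "b powr \<alpha> = (\<Sum>m<2. ?d m a / fact m * (b - a) ^ m) + ?d 2 t / fact 2 * (b - a) ^ 2"
    using Taylor[of 2 ?d "\<lambda>t. t powr \<alpha>" "y / K" "K * y" a b] d a b False by auto
  have t': "y / K \<le> t" "t \<le> K * y" using t a b by (auto split: if_splits)
  have "(\<Sum>m<2. ?d m a / fact m * (b - a) ^ m) = a powr \<alpha> + \<alpha> * a powr (\<alpha> - 1) * (b - a)"
    by (simp add: numeral_2_eq_2)
  with eq have "b powr \<alpha> - a powr \<alpha> - \<alpha> * a powr (\<alpha> - 1) * (b - a) = \<alpha> * (\<alpha> - 1) * t powr (\<alpha> - 2) / 2 * (b - a)\<^sup>2"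
    by simp
  then have "\<bar>b powr \<alpha> - a powr \<alpha> - \<alpha> * a powr (\<alpha> - 1) * (b - a)\<bar>
      = \<bar>\<alpha> * (\<alpha> - 1) * t powr (\<alpha> - 2) / 2 * (b - a)\<^sup>2\<bar>" by (rule arg_cong)
  also have "\<dots> = \<bar>\<alpha> * (\<alpha> - 1)\<bar> * t powr (\<alpha> - 2) / 2 * (b - a)\<^sup>2"
    by (simp add: abs_mult)
  also have "\<dots> \<le> \<bar>\<alpha> * (\<alpha> - 1)\<bar> * t powr (\<alpha> - 2) * (b - a)\<^sup>2"
    by (intro mult_right_mono) (auto simp: field_simps)
  also have "\<dots> \<le> \<bar>\<alpha> * (\<alpha> - 1)\<bar> * (K powr \<bar>\<alpha> - 2\<bar> * y powr (\<alpha> - 2)) * (b - a)\<^sup>2"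
    using powr_comparable(1)[OF y K t'] by (intro mult_right_mono mult_left_mono) auto
  finally show ?thesis by (simp add: mult.assoc)
qed simp

text \<open>Writing |p|^s as (|p|^2)^(s/2) reduces the expansion to one variable:
  \<open>powr_taylor2\<close> is applied to the power s/2 at a = |p|^2 and b = |p + h|^2, and b - a
  is a polynomial in h. Its quadratic part |h|^2 is of the size of the error and is added to
  it.\<close>

lemma phase_taylor:
  assumes s: "s > 0"
  shows "\<exists>C>0. \<forall>R (p::'a::euclidean_space) h. R > 0 \<longrightarrow> R / 2 \<le> norm p \<longrightarrow> norm p \<le> 2 * R \<longrightarrow> norm h \<le> R / 4 \<longrightarrow>
    \<bar>phase s (p + h) - phase s p - phase_grad s p \<bullet> h\<bar> \<le> C * R powr (s - 2) * (norm h)\<^sup>2"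
proof -
  \<comment> \<open>For |h| \<le> R/4 the norms of p and p + h are at least R/4 and at most 9R/4, so
    that their squares are comparable to R^2 with the constant 16.\<close>
  define C1 where "C1 = \<bar>s / 2 * (s / 2 - 1)\<bar> * 16 powr \<bar>s / 2 - 2\<bar>"
  define C2 where "C2 = s / 2 * 16 powr \<bar>s / 2 - 1\<bar>"
  have C: "C1 \<ge> 0" "C2 > 0" using s by (auto simp: C1_def C2_def)
  show ?thesis
  proof (intro exI[of _ "25 * C1 + C2"] conjI allI impI)
    show "25 * C1 + C2 > 0" using C by simp
    fix R :: real and p h :: 'a
    assume R: "R > 0" and p: "R / 2 \<le> norm p" "norm p \<le> 2 * R" and h: "norm h \<le> R / 4"
    define a where "a = (norm p)\<^sup>2"
    define b where "b = (norm (p + h))\<^sup>2"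
    have ph: "R / 4 \<le> norm (p + h)" "norm (p + h) \<le> 9 / 4 * R"
      using norm_triangle_ineq[of p h] norm_diff_ineq[of p h] p h by linarith+
    have ab: "R\<^sup>2 / 16 \<le> a" "a \<le> 16 * R\<^sup>2" "R\<^sup>2 / 16 \<le> b" "b \<le> 16 * R\<^sup>2"
      using power_mono[OF p(1), of 2] power_mono[OF p(2), of 2] power_mono[OF ph(1), of 2] power_mono[OF ph(2), of 2]
        R zero_le_power2[of R] unfolding a_def b_def by (auto simp: power_divide power_mult_distrib)
    have pos: "norm p > 0" "norm (p + h) > 0" using p ph R by linarith+
    have pw: "phase s p = a powr (s / 2)" "phase s (p + h) = b powr (s / 2)"
      using pos by (auto simp: phase_def a_def b_def powr_powr simp flip: powr_numeral)
    have R2: "(R\<^sup>2) powr \<beta> = R powr (2 * \<beta>)" for \<beta>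
      using R by (simp add: powr_powr flip: powr_numeral)
    have ba: "b - a = 2 * (p \<bullet> h) + (norm h)\<^sup>2"
      by (simp add: a_def b_def power2_norm_eq_inner inner_add_left inner_add_right inner_commute)
    have "\<bar>b - a\<bar> \<le> 5 * R * norm h"
    proof -
      have "\<bar>p \<bullet> h\<bar> \<le> norm p * norm h" by (rule Cauchy_Schwarz_ineq2)
      also have "\<dots> \<le> 2 * R * norm h" using p by (intro mult_right_mono) auto
      finally have 1: "\<bar>p \<bullet> h\<bar> \<le> 2 * R * norm h" .
      have "(norm h)\<^sup>2 \<le> R * norm h"
        unfolding power2_eq_square using h R by (intro mult_right_mono) auto
      moreover have "\<bar>2 * (p \<bullet> h) + (norm h)\<^sup>2\<bar> \<le> 2 * \<bar>p \<bullet> h\<bar> + (norm h)\<^sup>2"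
        using abs_triangle_ineq[of "2 * (p \<bullet> h)" "(norm h)\<^sup>2"] by (simp add: abs_mult)
      ultimately show ?thesis unfolding ba using 1 h R mult_nonneg_nonneg[of R "norm h"] by linarith
    qed
    then have ba2: "(b - a)\<^sup>2 \<le> 25 * R\<^sup>2 * (norm h)\<^sup>2"
      using power_mono[of "\<bar>b - a\<bar>" "5 * R * norm h" 2] by (simp add: power_mult_distrib)
    have g: "phase_grad s p \<bullet> h = s / 2 * a powr (s / 2 - 1) * (2 * (p \<bullet> h))"
    proof -
      have "norm p powr (s - 2) = a powr (s / 2 - 1)"
        unfolding a_def using pos by (simp add: powr_powr algebra_simps flip: powr_numeral)
      then show ?thesis by (simp add: phase_grad_def)
    qed
    have "phase s (p + h) - phase s p - phase_grad s p \<bullet> h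
      = (b powr (s / 2) - a powr (s / 2) - s / 2 * a powr (s / 2 - 1) * (b - a)) + s / 2 * a powr (s / 2 - 1) * (norm h)\<^sup>2"
      unfolding pw g ba by (simp add: algebra_simps)
    also have "\<bar>\<dots>\<bar> \<le> \<bar>b powr (s / 2) - a powr (s / 2) - s / 2 * a powr (s / 2 - 1) * (b - a)\<bar>
        + s / 2 * a powr (s / 2 - 1) * (norm h)\<^sup>2"
      using s by (intro order_trans[OF abs_triangle_ineq] add_left_mono) (simp add: abs_mult)
    also have "\<bar>b powr (s / 2) - a powr (s / 2) - s / 2 * a powr (s / 2 - 1) * (b - a)\<bar>
        \<le> C1 * (R\<^sup>2) powr (s / 2 - 2) * (b - a)\<^sup>2"
      unfolding C1_def by (rule powr_taylor2) (use R ab in auto)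
    also have "\<dots> \<le> C1 * (R\<^sup>2) powr (s / 2 - 2) * (25 * R\<^sup>2 * (norm h)\<^sup>2)"
      using C by (intro mult_left_mono ba2) auto
    also have "\<dots> = 25 * C1 * R powr (s - 2) * (norm h)\<^sup>2"
    proof -
      have "(R\<^sup>2) powr (s / 2 - 2) * R\<^sup>2 = R powr (s - 4) * R powr 2"
        using R by (simp add: R2 algebra_simps)
      also have "\<dots> = R powr (s - 2)" by (simp flip: powr_add)
      finally show ?thesis by (simp add: mult_ac)
    qed
    also have "s / 2 * a powr (s / 2 - 1) * (norm h)\<^sup>2 \<le> C2 * R powr (s - 2) * (norm h)\<^sup>2"
    proof -
      have "a powr (s / 2 - 1) \<le> 16 powr \<bar>s / 2 - 1\<bar> * (R\<^sup>2) powr (s / 2 - 1)"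
        by (rule powr_comparable(1)) (use R ab in auto)
      also have "(R\<^sup>2) powr (s / 2 - 1) = R powr (s - 2)" by (simp add: R2 algebra_simps)
      finally have "s / 2 * a powr (s / 2 - 1) \<le> s / 2 * (16 powr \<bar>s / 2 - 1\<bar> * R powr (s - 2))"
        using s by (intro mult_left_mono) auto
      then show ?thesis unfolding C2_def by (intro mult_right_mono) (auto simp: mult.assoc)
    qed
    finally show "\<bar>phase s (p + h) - phase s p - phase_grad s p \<bullet> h\<bar> \<le> (25 * C1 + C2) * R powr (s - 2) * (norm h)\<^sup>2"
      by (simp add: algebra_simps)
  qed
qed

lemma norm_cis_diff_le: "norm (cis t - 1) \<le> \<bar>t\<bar>"
proof -
  have "norm (cis t - 1) = norm (cis (t / 2) - cis (- t / 2))"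
  proof -
    have "cis t - 1 = cis (t / 2) * (cis (t / 2) - cis (- t / 2))" by (simp add: right_diff_distrib cis_mult)
    then show ?thesis by (simp add: norm_mult)
  qed
  also have "cis (t / 2) - cis (- t / 2) = 2 * \<i> * complex_of_real (sin (t / 2))"
    by (simp add: complex_eq_iff)
  also have "norm \<dots> = 2 * \<bar>sin (t / 2)\<bar>" by (simp add: norm_mult)
  also have "\<dots> \<le> \<bar>t\<bar>" using abs_sin_x_le_abs_x[of "t / 2"] by simp
  finally show ?thesis .
qed

text \<open>For large \<open>h\<close> the Taylor expansion fails, but then the trivial bound 2 is better.\<close>

lemma cis_phase_taylor:
  assumes s: "s > 0"
  shows "\<exists>C>0. \<forall>R (p::'a::euclidean_space) h. R \<ge> 1 \<longrightarrow> R / 2 \<le> norm p \<longrightarrow> norm p \<le> 2 * R \<longrightarrow>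
    norm (cis (phase s (p + h) - phase s p - phase_grad s p \<bullet> h) - 1) \<le> C * R powr (s - 2) * (norm h)\<^sup>2"
proof -
  obtain C where C: "C > 0" "\<And>R (p::'a) h. R > 0 \<Longrightarrow> R / 2 \<le> norm p \<Longrightarrow> norm p \<le> 2 * R \<Longrightarrow> norm h \<le> R / 4 \<Longrightarrow>
    \<bar>phase s (p + h) - phase s p - phase_grad s p \<bullet> h\<bar> \<le> C * R powr (s - 2) * (norm h)\<^sup>2"
    using phase_taylor[OF s] by blast
  \<comment> \<open>The number 32 belongs to |h| > R/4: there 1 \<le> R^s \<le> 16 R^(s-2) |h|^2,
    and the trivial bound 2 is at most twice the right side.\<close>
  show ?thesis
  proof (intro exI[of _ "C + 32"] conjI allI impI)
    fix R :: real and p h :: 'a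
    assume R: "R \<ge> 1" and p: "R / 2 \<le> norm p" "norm p \<le> 2 * R"
    let ?E = "phase s (p + h) - phase s p - phase_grad s p \<bullet> h"
    have mono: "D * R powr (s - 2) * (norm h)\<^sup>2 \<le> (C + 32) * R powr (s - 2) * (norm h)\<^sup>2" if "D = C \<or> D = 32" for D
      using that C(1) by (intro mult_right_mono) auto
    show "norm (cis ?E - 1) \<le> (C + 32) * R powr (s - 2) * (norm h)\<^sup>2"
    proof (cases "norm h \<le> R / 4")
      case True
      then have "norm (cis ?E - 1) \<le> C * R powr (s - 2) * (norm h)\<^sup>2"
        using C(2)[of R p h] R p norm_cis_diff_le[of ?E] by linarith
      then show ?thesis using mono[of C] by simp
    next
      case False
      have "norm (cis ?E - 1) \<le> 2" using norm_triangle_ineq4[of "cis ?E" 1] by simp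
      also have "2 \<le> 32 * R powr (s - 2) * (norm h)\<^sup>2"
      proof -
        have "1 \<le> R powr s" using R s by (simp add: ge_one_powr_ge_zero)
        also have "\<dots> = R powr (s - 2) * R\<^sup>2" using R by (simp add: powr_diff)
        also have "\<dots> \<le> R powr (s - 2) * (4 * norm h)\<^sup>2"
          using False R by (intro mult_left_mono power_mono) auto
        finally show ?thesis by (simp add: power_mult_distrib mult_ac)
      qed
      also have "\<dots> \<le> (C + 32) * R powr (s - 2) * (norm h)\<^sup>2" by (rule mono) simp
      finally show ?thesis .
    qed
  qed (use C(1) in simp)
qed

lemma norm_scaleR_diff_power2:
  "(norm (\<alpha> *\<^sub>R a - \<beta> *\<^sub>R b))\<^sup>2 = \<alpha>\<^sup>2 * (norm a)\<^sup>2 + \<beta>\<^sup>2 * (norm b)\<^sup>2 - 2 * (\<alpha> * \<beta>) * (a \<bullet> b)"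
  unfolding power2_norm_eq_inner
  by (simp add: inner_diff_left inner_diff_right inner_commute algebra_simps power2_eq_square)

text \<open>Both squared distances are the sum of a radial part and a multiple of the angular defect
  d = |a||b| - a\<bullet>b \<ge> 0, and the parts are compared separately. The radial part rests on
  the derivative of t^(s-1), which is of size R^(s-2) unless s = 1. This is where s = 1 is excluded:
  there all frequencies of one direction travel with the same velocity.\<close>

lemma phase_grad_separation:
  assumes s: "s > 0" "s \<noteq> 1"
  shows "\<exists>c>0. \<forall>R (a::'a::euclidean_space) b. R > 0 \<longrightarrow> R / 2 \<le> norm a \<longrightarrow> norm a \<le> 2 * R \<longrightarrow>
    R / 2 \<le> norm b \<longrightarrow> norm b \<le> 2 * R \<longrightarrow>
    c * R powr (s - 2) * norm (a - b) \<le> norm (phase_grad s a - phase_grad s b)"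
proof -
  define l where "l = 2 powr - \<bar>s - 2\<bar>"
  \<comment> \<open>The radial comparison costs the factor |s - 1|, the angular one only l.\<close>
  define c where "c = min \<bar>s - 1\<bar> 1 * l"
  have l: "l > 0" and c: "c > 0" "c \<le> \<bar>s - 1\<bar> * l" "c \<le> l" using s by (auto simp: c_def l_def)
  show ?thesis
  proof (intro exI[of _ "s * c"] conjI allI impI)
    show "s * c > 0" using s c by simp
    fix R :: real and a b :: 'a
    assume R: "R > 0" and a: "R / 2 \<le> norm a" "norm a \<le> 2 * R" and b: "R / 2 \<le> norm b" "norm b \<le> 2 * R"
    define u v where "u = norm a" and "v = norm b"
    have uv: "u > 0" "v > 0" using a b R by (auto simp: u_def v_def)
    have low: "l * R powr (s - 2) \<le> t powr (s - 2)" if "R / 2 \<le> t" "t \<le> 2 * R" for t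
      unfolding l_def using powr_comparable(2)[OF R, of 2 t "s - 2"] that by simp
    have radial: "c * R powr (s - 2) * \<bar>u - v\<bar> \<le> \<bar>u powr (s - 1) - v powr (s - 1)\<bar>"
    proof -
      have *: "c * R powr (s - 2) * (y - x) \<le> \<bar>y powr (s - 1) - x powr (s - 1)\<bar>"
        if xy: "x < y" "R / 2 \<le> x" "y \<le> 2 * R" for x y
      proof -
        have "\<exists>z. x < z \<and> z < y \<and> y powr (s - 1) - x powr (s - 1) = (y - x) * ((s - 1) * z powr (s - 1 - 1))"
          using xy R by (intro MVT2 has_real_derivative_powr) auto
        then obtain z where z: "x < z" "z < y" "y powr (s - 1) - x powr (s - 1) = (y - x) * ((s - 1) * z powr (s - 1 - 1))"
          by blast
        have "c * R powr (s - 2) \<le> \<bar>s - 1\<bar> * (l * R powr (s - 2))"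
          using mult_right_mono[OF c(2), of "R powr (s - 2)"] by (simp add: mult.assoc)
        also have "\<dots> \<le> \<bar>s - 1\<bar> * z powr (s - 2)"
          using low[of z] z xy by (intro mult_left_mono) auto
        finally have "c * R powr (s - 2) * (y - x) \<le> \<bar>s - 1\<bar> * z powr (s - 2) * (y - x)"
          using xy by (intro mult_right_mono) auto
        then show ?thesis using xy z(3) by (simp add: abs_mult mult_ac)
      qed
      consider "u < v" | "u = v" | "v < u" by linarith
      then show ?thesis
        using *[of u v] *[of v u] a b unfolding u_def[symmetric] v_def[symmetric]
        by cases (auto simp: abs_minus_commute)
    qed
    define d where "d = u * v - a \<bullet> b"
    have d: "d \<ge> 0" using norm_cauchy_schwarz[of a b] by (simp add: d_def u_def v_def)
    have n1: "(norm (a - b))\<^sup>2 = (u - v)\<^sup>2 + 2 * d"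
      by (simp add: d_def u_def v_def power2_norm_eq_inner power2_diff inner_diff_left inner_diff_right inner_commute algebra_simps)
    have pu: "u powr (s - 2) * u = u powr (s - 1)" "v powr (s - 2) * v = v powr (s - 1)"
      using uv by (simp_all add: powr_diff power2_eq_square)
    have n2: "(norm (phase_grad s a - phase_grad s b))\<^sup>2
        = s\<^sup>2 * ((u powr (s - 1) - v powr (s - 1))\<^sup>2 + 2 * (u powr (s - 2) * v powr (s - 2)) * d)"
    proof -
      have "phase_grad s a - phase_grad s b = s *\<^sub>R (u powr (s - 2) *\<^sub>R a - v powr (s - 2) *\<^sub>R b)"
        by (simp add: phase_grad_def u_def v_def scaleR_diff_right)
      then have "(norm (phase_grad s a - phase_grad s b))\<^sup>2 = s\<^sup>2 * (norm (u powr (s - 2) *\<^sub>R a - v powr (s - 2) *\<^sub>R b))\<^sup>2"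
        by (simp add: power_mult_distrib)
      also have "(norm (u powr (s - 2) *\<^sub>R a - v powr (s - 2) *\<^sub>R b))\<^sup>2
        = (u powr (s - 2))\<^sup>2 * u\<^sup>2 + (v powr (s - 2))\<^sup>2 * v\<^sup>2 - 2 * (u powr (s - 2) * v powr (s - 2)) * (a \<bullet> b)"
        unfolding u_def v_def by (rule norm_scaleR_diff_power2)
      also have "\<dots> = (u powr (s - 1) - v powr (s - 1))\<^sup>2 + 2 * (u powr (s - 2) * v powr (s - 2)) * d"
      proof -
        have "(u powr (s - 2))\<^sup>2 * u\<^sup>2 = (u powr (s - 1))\<^sup>2" "(v powr (s - 2))\<^sup>2 * v\<^sup>2 = (v powr (s - 1))\<^sup>2"
          by (simp_all only: pu flip: power_mult_distrib)
        moreover have "u powr (s - 1) * v powr (s - 1) = u powr (s - 2) * v powr (s - 2) * (u * v)"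
          by (simp only: mult_ac flip: pu)
        ultimately show ?thesis by (simp add: d_def power2_diff algebra_simps)
      qed
      finally show ?thesis .
    qed
    have "(s * c * R powr (s - 2) * norm (a - b))\<^sup>2
        = s\<^sup>2 * ((c * R powr (s - 2) * \<bar>u - v\<bar>)\<^sup>2 + 2 * (c * R powr (s - 2))\<^sup>2 * d)"
      unfolding power_mult_distrib n1 by (simp add: algebra_simps)
    also have "\<dots> \<le> (norm (phase_grad s a - phase_grad s b))\<^sup>2"
      unfolding n2
    proof (intro mult_left_mono add_mono)
      show "(c * R powr (s - 2) * \<bar>u - v\<bar>)\<^sup>2 \<le> (u powr (s - 1) - v powr (s - 1))\<^sup>2"
        using power_mono[OF radial, of 2] c by simp
      have "c * R powr (s - 2) \<le> l * R powr (s - 2)" using c by (intro mult_right_mono) auto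
      then have "c * R powr (s - 2) \<le> u powr (s - 2)" "c * R powr (s - 2) \<le> v powr (s - 2)"
        using low[of u] low[of v] a b by (auto simp: u_def v_def)
      then show "2 * (c * R powr (s - 2))\<^sup>2 * d \<le> 2 * (u powr (s - 2) * v powr (s - 2)) * d"
        unfolding power2_eq_square using c d by (intro mult_right_mono mult_left_mono mult_mono) auto
    qed auto
    finally show "s * c * R powr (s - 2) * norm (a - b) \<le> norm (phase_grad s a - phase_grad s b)"
      by (rule power2_le_imp_le) simp
  qed
qed

lemma norm_phase_grad: "s > 0 \<Longrightarrow> p \<noteq> 0 \<Longrightarrow> norm (phase_grad s p) = s * norm p powr (s - 1)"
  by (simp add: phase_grad_def powr_diff power2_eq_square)

section \<open>Wave packets\<close>

text \<open>The position of the packet is chosen such that the group velocity at frequency \<open>p\<close> carries it to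
  the origin.\<close>

definition packet :: "real \<Rightarrow> real \<Rightarrow> real^'n \<Rightarrow> real^'n \<Rightarrow> complex" where
  "packet s c p x = complex_of_real (exp (- c * (norm (x - phase_grad s p))\<^sup>2)) * cis (p \<bullet> x - phase s p)"

lemma fourier_eq_cis: "fourier f \<xi> = (\<integral>x. f x * cis (- \<xi> \<bullet> x) \<partial>lborel)"
  by (simp add: fourier_def cis_conv_exp mult.commute)

lemma norm_packet: "norm (packet s c p x) = exp (- c * (norm (x - phase_grad s p))\<^sup>2)"
  by (simp add: packet_def norm_mult)

lemma gauss_poly_packet:
  assumes c: "c > 0"
  shows "gauss_poly (packet s c p)"
proof -
  let ?g = "phase_grad s p"
  have "packet s c p x = (exp (complex_of_real (- c * (?g \<bullet> ?g))) * cis (- phase s p)) *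
      exp (complex_of_real ((2 * c) *\<^sub>R ?g \<bullet> x - c * (x \<bullet> x)) + \<i> * complex_of_real (p \<bullet> x))" for x
  proof -
    have "- c * (norm (x - ?g))\<^sup>2 = - c * (?g \<bullet> ?g) + ((2 * c) *\<^sub>R ?g \<bullet> x - c * (x \<bullet> x))"
      by (simp add: power2_norm_eq_inner inner_diff_left inner_diff_right inner_commute algebra_simps)
    then have 1: "complex_of_real (exp (- c * (norm (x - ?g))\<^sup>2))
      = exp (complex_of_real (- c * (?g \<bullet> ?g))) * exp (complex_of_real ((2 * c) *\<^sub>R ?g \<bullet> x - c * (x \<bullet> x)))"
      by (simp only: exp_of_real exp_add of_real_mult[symmetric])
    have 2: "cis (p \<bullet> x - phase s p) = cis (- phase s p) * exp (\<i> * complex_of_real (p \<bullet> x))"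
      by (simp add: cis_mult flip: cis_conv_exp)
    show ?thesis unfolding packet_def 1 2 exp_add by (simp only: mult_ac)
  qed
  then have eq: "packet s c p = (\<lambda>x. (exp (complex_of_real (- c * (?g \<bullet> ?g))) * cis (- phase s p)) *
      exp (complex_of_real ((2 * c) *\<^sub>R ?g \<bullet> x - c * (x \<bullet> x)) + \<i> * complex_of_real (p \<bullet> x)))"
    by (rule ext)
  show ?thesis unfolding eq by (rule gauss_poly.cmult[OF gauss_poly.gauss[OF c]])
qed

lemma fourier_packet:
  fixes p :: "real^'n"
  assumes c: "c > 0"
  shows "integrable lborel (packet s c p)"
    and "fourier (packet s c p) \<xi> = cis (- phase s p - phase_grad s p \<bullet> (\<xi> - p)) *
      complex_of_real (sqrt (pi / c) ^ CARD('n) * exp (- (1 / (4 * c)) * (norm (\<xi> - p))\<^sup>2))"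
proof -
  let ?g = "phase_grad s p"
  let ?G = "\<lambda>x. complex_of_real (exp (- c * (norm (x - ?g))\<^sup>2))"
  have P: "packet s c p x = cis (- phase s p) * (?G x * cis (p \<bullet> x))" for x
  proof -
    have "cis (p \<bullet> x - phase s p) = cis (- phase s p) * cis (p \<bullet> x)" by (simp add: cis_mult)
    then show ?thesis unfolding packet_def by (simp only: mult.left_commute)
  qed
  show "integrable lborel (packet s c p)"
    unfolding P[abs_def] by (rule integrable_mult_right[OF gaussian_fourier_translate(1)[OF c]])
  have eq: "packet s c p x * cis (- \<xi> \<bullet> x) = cis (- phase s p) * (?G x * cis ((p - \<xi>) \<bullet> x))" for x
  proof -
    have "cis (p \<bullet> x) * cis (- \<xi> \<bullet> x) = cis ((p - \<xi>) \<bullet> x)" by (simp add: cis_mult inner_diff_left)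
    then show ?thesis unfolding P by (simp only: mult.assoc)
  qed
  have "fourier (packet s c p) \<xi> = cis (- phase s p) * (cis ((p - \<xi>) \<bullet> ?g) *
      complex_of_real (sqrt (pi / c) ^ DIM(real^'n) * exp (- (norm (p - \<xi>))\<^sup>2 / (4 * c))))"
    unfolding fourier_eq_cis eq integral_mult_right_zero gaussian_fourier_translate(2)[OF c] ..
  also have "cis (- phase s p) * (cis ((p - \<xi>) \<bullet> ?g) * z) = cis (- phase s p - ?g \<bullet> (\<xi> - p)) * z" for z
  proof -
    have "- phase s p + (p - \<xi>) \<bullet> ?g = - phase s p - ?g \<bullet> (\<xi> - p)"
      by (simp add: inner_diff_left inner_diff_right inner_commute)
    then show ?thesis by (simp only: mult.assoc[symmetric] cis_mult)
  qed
  finally show "fourier (packet s c p) \<xi> = cis (- phase s p - ?g \<bullet> (\<xi> - p)) *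
      complex_of_real (sqrt (pi / c) ^ CARD('n) * exp (- (1 / (4 * c)) * (norm (\<xi> - p))\<^sup>2))"
    by (simp add: norm_minus_commute)
qed

text \<open>The constant phase and the position of a packet cancel the Taylor polynomial of degree
  one of the phase at p; only the remainder is left. The form p + (\<xi> - p) matches
  \<open>cis_phase_taylor\<close>.\<close>

lemma cis_phase_fourier_packet:
  fixes p :: "real^'n"
  assumes c: "c > 0"
  shows "cis (phase s \<xi>) * fourier (packet s c p) \<xi>
    = cis (phase s (p + (\<xi> - p)) - phase s p - phase_grad s p \<bullet> (\<xi> - p)) *
      complex_of_real (sqrt (pi / c) ^ CARD('n) * exp (- (1 / (4 * c)) * (norm (\<xi> - p))\<^sup>2))"
proof -
  have "phase s \<xi> + (- phase s p - phase_grad s p \<bullet> (\<xi> - p))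
    = phase s (p + (\<xi> - p)) - phase s p - phase_grad s p \<bullet> (\<xi> - p)" by simp
  then show ?thesis unfolding fourier_packet(2)[OF c] mult.assoc[symmetric] cis_mult by (simp only:)
qed

text \<open>The transform of a packet, corrected by the phase, is nearly a positive Gaussian of mass
  \<open>(2\<pi>)\<^sup>n\<close> around \<open>p\<close>, up to a relative error that is small when \<open>A\<close> is large.\<close>

lemma packet_pairing:
  fixes s \<eta> c0 :: real
  assumes s: "s > 0" and eta: "\<eta> > 0" and c0: "c0 > 0"
  shows "\<exists>A>0. \<forall>R (p::real^'n) W. R \<ge> 1 \<longrightarrow> R / 2 \<le> norm p \<longrightarrow> norm p \<le> 2 * R \<longrightarrow>
    W \<in> borel_measurable borel \<longrightarrow> (\<forall>\<xi>. norm (W \<xi>) \<le> 1) \<longrightarrow>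
    (\<forall>\<xi>. norm (\<xi> - p) \<le> \<eta> * R \<longrightarrow> c0 \<le> Re (W \<xi>) \<and> \<bar>Im (W \<xi>)\<bar> \<le> c0 / 8) \<longrightarrow>
    integrable lborel (\<lambda>\<xi>. W \<xi> * (cis (phase s \<xi>) * fourier (packet s (R powr (2 - s) / A) p) \<xi>)) \<and>
    (2 * pi) ^ CARD('n) * (c0 / 2) \<le> Re (\<integral>\<xi>. W \<xi> * (cis (phase s \<xi>) * fourier (packet s (R powr (2 - s) / A) p) \<xi>) \<partial>lborel) \<and>
    \<bar>Im (\<integral>\<xi>. W \<xi> * (cis (phase s \<xi>) * fourier (packet s (R powr (2 - s) / A) p) \<xi>) \<partial>lborel)\<bar> \<le> (2 * pi) ^ CARD('n) * (c0 / 4)"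
proof -
  obtain C where C: "C > 0" "\<And>R (p::real^'n) h. R \<ge> 1 \<Longrightarrow> R / 2 \<le> norm p \<Longrightarrow> norm p \<le> 2 * R \<Longrightarrow>
    norm (cis (phase s (p + h) - phase s p - phase_grad s p \<bullet> h) - 1) \<le> C * R powr (s - 2) * (norm h)\<^sup>2"
    using cis_phase_taylor[OF s] by blast
  \<comment> \<open>C accounts for the Taylor remainder of the phase, the second term for the
    frequencies farther than \<eta>R from p, where nothing but |W| \<le> 1 is known.\<close>
  define C1 where "C1 = C + (1 + c0) / \<eta>\<^sup>2"
  have C1: "C1 > 0" using C(1) eta c0 by (auto simp: C1_def intro!: add_pos_nonneg)
  \<comment> \<open>Makes the total error, 8 C1 / A times the mass of \<open>G2\<close>, equal to c0
    / 8 times the mass (2\<pi>)^n of \<open>G\<close>.\<close>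
  define A where "A = 64 * C1 * sqrt 2 ^ CARD('n) / c0"
  have A: "A > 0" using C1 c0 by (simp add: A_def)
  show ?thesis
  proof (intro exI[of _ A] conjI allI impI)
    show "A > 0" by (rule A)
  next
    fix R :: real and p :: "real^'n" and W :: "real^'n \<Rightarrow> complex"
    assume R: "R \<ge> 1" and p: "R / 2 \<le> norm p" "norm p \<le> 2 * R"
      and [measurable]: "W \<in> borel_measurable borel" and W1: "\<forall>\<xi>. norm (W \<xi>) \<le> 1"
      and Wp: "\<forall>\<xi>. norm (\<xi> - p) \<le> \<eta> * R \<longrightarrow> c0 \<le> Re (W \<xi>) \<and> \<bar>Im (W \<xi>)\<bar> \<le> c0 / 8"
    define c where "c = R powr (2 - s) / A"
    define a where "a = 1 / (4 * c)"
    have c: "c > 0" using R A by (simp add: c_def)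
    have a: "a > 0" using c by (simp add: a_def)
    have aR: "R powr (s - 2) = 4 / A * a"
      using A R by (simp add: a_def c_def powr_diff field_simps)
    define S where "S = sqrt (pi / c) ^ CARD('n)"
    have S: "S > 0" using c by (simp add: S_def)
    define G where "G \<xi> = S * exp (- a * (norm (\<xi> - p))\<^sup>2)" for \<xi>
    define G2 where "G2 \<xi> = S * exp (- (a / 2) * (norm (\<xi> - p))\<^sup>2)" for \<xi>
    have Gint: "integrable lborel G" "integrable lborel G2"
      unfolding G_def[abs_def] G2_def[abs_def]
      by (intro integrable_mult_right gaussian_integral(1); use a in simp)+
    have sqc: "sqrt (pi / c) * sqrt (pi / a) = 2 * pi"
    proof -
      have "sqrt (pi / c) * sqrt (pi / a) = sqrt ((2 * pi)\<^sup>2)"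
        unfolding real_sqrt_mult[symmetric] using c by (simp add: a_def power2_eq_square)
      then show ?thesis by (simp only: real_sqrt_abs) simp
    qed
    have GI: "(\<integral>\<xi>. G \<xi> \<partial>lborel) = (2 * pi) ^ CARD('n)"
      unfolding G_def integral_mult_right_zero gaussian_integral(2)[OF a] S_def
      by (simp only: sqc DIM_cart DIM_real mult_1_right flip: power_mult_distrib)
    have G2I: "(\<integral>\<xi>. G2 \<xi> \<partial>lborel) = sqrt 2 ^ CARD('n) * (2 * pi) ^ CARD('n)"
    proof -
      have "(\<integral>\<xi>. G2 \<xi> \<partial>lborel) = S * sqrt (pi / (a / 2)) ^ CARD('n)"
        unfolding G2_def integral_mult_right_zero using gaussian_integral(2)[of "a / 2" p] a by simp
      also have "sqrt (pi / (a / 2)) = sqrt 2 * sqrt (pi / a)"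
        by (simp flip: real_sqrt_mult)
      also have "S * (sqrt 2 * sqrt (pi / a)) ^ CARD('n) = sqrt 2 ^ CARD('n) * (sqrt (pi / c) * sqrt (pi / a)) ^ CARD('n)"
        by (simp only: S_def power_mult_distrib mult_ac)
      finally show ?thesis unfolding sqc .
    qed
    define E where "E \<xi> = phase s (p + (\<xi> - p)) - phase s p - phase_grad s p \<bullet> (\<xi> - p)" for \<xi>
    have [measurable]: "E \<in> borel_measurable borel" unfolding E_def phase_def by measurable
    let ?f = "\<lambda>\<xi>. W \<xi> * (cis (phase s \<xi>) * fourier (packet s c p) \<xi>)"
    have f: "?f \<xi> = (W \<xi> * cis (E \<xi>)) * complex_of_real (G \<xi>)" for \<xi>
      unfolding cis_phase_fourier_packet[OF c] E_def G_def S_def a_def by (simp only: mult.assoc)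
    have G0: "G \<xi> \<ge> 0" for \<xi> using S by (simp add: G_def)
    have [measurable]: "G \<in> borel_measurable borel" unfolding G_def by measurable
    have int: "integrable lborel ?f"
      unfolding f by (rule Bochner_Integration.integrable_bound[OF Gint(1)])
        (use W1 G0 in \<open>auto simp: norm_mult intro!: mult_left_le_one_le\<close>)
    \<comment> \<open>A bound for both errors together. The part of q that comes from the second
      term of C1 is at least 1 + c0 for |\<xi> - p| > \<eta>R, enough to repair the lower bound even
      if Re W = -1.\<close>
    define q where "q \<xi> = C1 * R powr (s - 2) * (norm (\<xi> - p))\<^sup>2" for \<xi>
    have R2: "1 / R\<^sup>2 \<le> R powr (s - 2)"
    proof -
      have "1 / R\<^sup>2 = R powr - 2" using R by (simp add: powr_minus_divide)
      also have "\<dots> \<le> R powr (s - 2)" using R s by (intro powr_mono) auto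
      finally show ?thesis .
    qed
    have cisE: "norm (cis (E \<xi>) - 1) \<le> C * R powr (s - 2) * (norm (\<xi> - p))\<^sup>2" for \<xi>
      unfolding E_def by (rule C(2)[OF R p])
    have far: "1 + c0 \<le> (1 + c0) / \<eta>\<^sup>2 * R powr (s - 2) * (norm (\<xi> - p))\<^sup>2" if "\<not> norm (\<xi> - p) \<le> \<eta> * R" for \<xi>
    proof -
      have "(\<eta> * R)\<^sup>2 \<le> (norm (\<xi> - p))\<^sup>2" using that eta R by (intro power_mono) auto
      then have "1 \<le> (norm (\<xi> - p))\<^sup>2 * (1 / \<eta>\<^sup>2 * (1 / R\<^sup>2))"
        using eta R by (simp add: power_mult_distrib field_simps)
      also have "\<dots> \<le> (norm (\<xi> - p))\<^sup>2 * (1 / \<eta>\<^sup>2 * R powr (s - 2))"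
        by (intro mult_left_mono R2) auto
      finally have "(1 + c0) * 1 \<le> (1 + c0) * ((norm (\<xi> - p))\<^sup>2 * (1 / \<eta>\<^sup>2 * R powr (s - 2)))"
        using c0 by (intro mult_left_mono) auto
      then show ?thesis by (simp add: mult_ac)
    qed
    have qq: "C * R powr (s - 2) * (norm (\<xi> - p))\<^sup>2 + (1 + c0) / \<eta>\<^sup>2 * R powr (s - 2) * (norm (\<xi> - p))\<^sup>2 = q \<xi>" for \<xi>
      by (simp add: q_def C1_def algebra_simps)
    have near0: "0 \<le> (1 + c0) / \<eta>\<^sup>2 * R powr (s - 2) * (norm (\<xi> - p))\<^sup>2" for \<xi> using c0 by simp
    have WE: "norm (W \<xi> * cis (E \<xi>) - W \<xi>) \<le> C * R powr (s - 2) * (norm (\<xi> - p))\<^sup>2" for \<xi>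
    proof -
      have "norm (W \<xi> * cis (E \<xi>) - W \<xi>) = norm (W \<xi>) * norm (cis (E \<xi>) - 1)"
        by (simp add: right_diff_distrib flip: norm_mult)
      also have "\<dots> \<le> norm (cis (E \<xi>) - 1)" using W1 by (intro mult_left_le_one_le) auto
      finally show ?thesis using cisE[of \<xi>] by linarith
    qed
    have Re_low: "c0 - q \<xi> \<le> Re (W \<xi> * cis (E \<xi>))" for \<xi>
    proof -
      have "Re (W \<xi>) - C * R powr (s - 2) * (norm (\<xi> - p))\<^sup>2 \<le> Re (W \<xi> * cis (E \<xi>))"
        using abs_Re_le_cmod[of "W \<xi> * cis (E \<xi>) - W \<xi>"] WE[of \<xi>] by (simp del: times_complex.simps)
      moreover have "c0 - (1 + c0) / \<eta>\<^sup>2 * R powr (s - 2) * (norm (\<xi> - p))\<^sup>2 \<le> Re (W \<xi>)"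
      proof (cases "norm (\<xi> - p) \<le> \<eta> * R")
        case True
        then show ?thesis using Wp near0[of \<xi>] by (metis add.commute add_increasing2 diff_le_eq)
      next
        case False
        have "- 1 \<le> Re (W \<xi>)" using abs_Re_le_cmod[of "W \<xi>"] W1 by (smt (verit))
        with far[OF False] show ?thesis by linarith
      qed
      ultimately show ?thesis using qq[of \<xi>] by linarith
    qed
    have Im_up: "\<bar>Im (W \<xi> * cis (E \<xi>))\<bar> \<le> c0 / 8 + q \<xi>" for \<xi>
    proof -
      have "\<bar>Im (W \<xi> * cis (E \<xi>))\<bar> \<le> \<bar>Im (W \<xi>)\<bar> + C * R powr (s - 2) * (norm (\<xi> - p))\<^sup>2"
        using abs_Im_le_cmod[of "W \<xi> * cis (E \<xi>) - W \<xi>"] WE[of \<xi>] by (simp del: times_complex.simps)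
      moreover have "\<bar>Im (W \<xi>)\<bar> \<le> c0 / 8 + (1 + c0) / \<eta>\<^sup>2 * R powr (s - 2) * (norm (\<xi> - p))\<^sup>2"
      proof (cases "norm (\<xi> - p) \<le> \<eta> * R")
        case True
        then show ?thesis using Wp near0[of \<xi>] by (metis add_increasing2)
      next
        case False
        have "\<bar>Im (W \<xi>)\<bar> \<le> 1" using abs_Im_le_cmod[of "W \<xi>"] W1 by (smt (verit))
        with far[OF False] c0 show ?thesis by linarith
      qed
      ultimately show ?thesis using qq[of \<xi>] by linarith
    qed
    \<comment> \<open>The width of the packet matches the remainder: q is a constant multiple of y =
      a |\<xi> - p|^2, and y e^(-y) \<le> 2 e^(-y/2) leaves a Gaussian with half the
      exponent.\<close>
    have qG: "q \<xi> * G \<xi> \<le> 8 * C1 / A * G2 \<xi>" for \<xi>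
    proof -
      let ?y = "a * (norm (\<xi> - p))\<^sup>2"
      have "?y / 2 \<le> exp (?y / 2)" using exp_ge_add_one_self[of "?y / 2"] by linarith
      then have "?y * exp (- ?y) \<le> 2 * exp (?y / 2) * exp (- ?y)" by (intro mult_right_mono) auto
      also have "\<dots> = 2 * exp (- (?y / 2))" by (simp flip: exp_add)
      finally have y: "?y * exp (- ?y) \<le> 2 * exp (- (?y / 2))" .
      have "q \<xi> * G \<xi> = 4 * C1 / A * S * (?y * exp (- ?y))"
        unfolding q_def aR G_def by (simp add: mult_ac)
      also have "\<dots> \<le> 4 * C1 / A * S * (2 * exp (- (?y / 2)))"
        using C1 A S by (intro mult_left_mono y) auto
      finally show ?thesis by (simp add: G2_def mult_ac)
    qed
    have small: "8 * C1 / A * (sqrt 2 ^ CARD('n) * (2 * pi) ^ CARD('n)) = c0 / 8 * (2 * pi) ^ CARD('n)"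
      using C1 c0 by (simp add: A_def)
    let ?z = "\<integral>\<xi>. ?f \<xi> \<partial>lborel"
    have Re_z: "Re ?z = (\<integral>\<xi>. Re (?f \<xi>) \<partial>lborel)" "Im ?z = (\<integral>\<xi>. Im (?f \<xi>) \<partial>lborel)"
      by (simp_all only: integral_Re[OF int] integral_Im[OF int])
    have bounds_int: "integrable lborel (\<lambda>\<xi>. b * G \<xi> + d * G2 \<xi>)"
      "(\<integral>\<xi>. b * G \<xi> + d * G2 \<xi> \<partial>lborel) = (b * (2 * pi) ^ CARD('n) + d * (sqrt 2 ^ CARD('n) * (2 * pi) ^ CARD('n)))" for b d
      using Gint GI G2I by simp_all
    have intRI: "integrable lborel (\<lambda>\<xi>. Re (?f \<xi>))" "integrable lborel (\<lambda>\<xi>. Im (?f \<xi>))"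
      using int by (rule integrable_Re, rule integrable_Im)
    have ReG: "Re (?f \<xi>) = Re (W \<xi> * cis (E \<xi>)) * G \<xi>" "Im (?f \<xi>) = Im (W \<xi> * cis (E \<xi>)) * G \<xi>" for \<xi>
      unfolding f by simp_all
    have "(\<integral>\<xi>. c0 * G \<xi> + (- (8 * C1 / A)) * G2 \<xi> \<partial>lborel) \<le> Re ?z"
      unfolding Re_z
    proof (rule integral_mono[OF bounds_int(1) intRI(1)])
      fix \<xi>
      have "(c0 - q \<xi>) * G \<xi> \<le> Re (?f \<xi>)" unfolding ReG by (intro mult_right_mono Re_low G0)
      with qG[of \<xi>] show "c0 * G \<xi> + (- (8 * C1 / A)) * G2 \<xi> \<le> Re (?f \<xi>)" by (simp add: left_diff_distrib)
    qed
    then have 1: "c0 * (2 * pi) ^ CARD('n) - c0 / 8 * (2 * pi) ^ CARD('n) \<le> Re ?z"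
      unfolding bounds_int unfolding mult_minus_left small by linarith
    have up: "\<bar>Im (?f \<xi>)\<bar> \<le> c0 / 8 * G \<xi> + 8 * C1 / A * G2 \<xi>" for \<xi>
    proof -
      have "\<bar>Im (?f \<xi>)\<bar> \<le> (c0 / 8 + q \<xi>) * G \<xi>"
        unfolding ReG abs_mult using G0[of \<xi>] Im_up[of \<xi>] by (intro mult_mono) auto
      with qG[of \<xi>] show ?thesis by (simp add: distrib_right)
    qed
    have "\<bar>Im ?z\<bar> \<le> (\<integral>\<xi>. c0 / 8 * G \<xi> + 8 * C1 / A * G2 \<xi> \<partial>lborel)"
      unfolding Re_z
      by (rule order_trans[OF integral_abs_bound integral_mono[OF integrable_abs[OF intRI(2)] bounds_int(1)]]) (rule up)
    then have 2: "\<bar>Im ?z\<bar> \<le> c0 / 8 * (2 * pi) ^ CARD('n) + c0 / 8 * (2 * pi) ^ CARD('n)"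
      unfolding bounds_int small .
    have P: "0 \<le> c0 * (2 * pi) ^ CARD('n)" using c0 by simp
    show "integrable lborel (\<lambda>\<xi>. W \<xi> * (cis (phase s \<xi>) * fourier (packet s (R powr (2 - s) / A) p) \<xi>))"
      using int unfolding c_def .
    show "(2 * pi) ^ CARD('n) * (c0 / 2) \<le> Re (\<integral>\<xi>. W \<xi> * (cis (phase s \<xi>) * fourier (packet s (R powr (2 - s) / A) p) \<xi>) \<partial>lborel)"
      using 1 P unfolding c_def[symmetric] by (simp add: mult.commute)
    show "\<bar>Im (\<integral>\<xi>. W \<xi> * (cis (phase s \<xi>) * fourier (packet s (R powr (2 - s) / A) p) \<xi>) \<partial>lborel)\<bar> \<le> (2 * pi) ^ CARD('n) * (c0 / 4)"
      using 2 unfolding c_def[symmetric] by (simp add: mult.commute)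
  qed
qed

text \<open>In every coordinate, about \<kappa> R^(s/2) steps of length R^(1-s/2) make up a side of
  length \<kappa>R. The number of packets, of order R^(ns/2), is the size of their sum at the
  focus.\<close>

definition packet_index :: "real \<Rightarrow> real \<Rightarrow> real \<Rightarrow> ('n::finite \<Rightarrow> nat) set" where
  "packet_index \<kappa> s R = PiE UNIV (\<lambda>_. {..nat \<lfloor>\<kappa> * R powr (s / 2)\<rfloor>})"

text \<open>At frequencies of size \<open>R\<close> the phase is linear up to bounded errors on balls of radius
  \<open>R\<^bsup>1-s/2\<^esup>\<close>, which explains the spacing.\<close>

definition packet_freq :: "real^'n \<Rightarrow> real \<Rightarrow> real \<Rightarrow> ('n \<Rightarrow> nat) \<Rightarrow> real^'n" where
  "packet_freq e s R k = R *\<^sub>R e + R powr (1 - s / 2) *\<^sub>R (\<chi> i. real (k i))"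

definition packet_sum :: "real \<Rightarrow> real \<Rightarrow> real \<Rightarrow> real^'n \<Rightarrow> real \<Rightarrow> real^'n \<Rightarrow> complex" where
  "packet_sum s A \<kappa> e R x =
    (\<Sum>k\<in>packet_index \<kappa> s R. packet s (R powr (2 - s) / A) (packet_freq e s R k) x)"

lemma finite_packet_index [simp]: "finite (packet_index \<kappa> s R)"
  by (simp add: packet_index_def finite_PiE)

lemma card_packet_index:
  assumes "0 < \<kappa>" "\<kappa> \<le> 1" "R \<ge> 1" "s > 0"
  shows "\<kappa> ^ CARD('n) * R powr (real CARD('n) * s / 2) \<le> real (card (packet_index \<kappa> s R :: ('n::finite \<Rightarrow> nat) set))"
    and "real (card (packet_index \<kappa> s R :: ('n \<Rightarrow> nat) set)) \<le> 2 ^ CARD('n) * R powr (real CARD('n) * s / 2)"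
proof -
  let ?y = "R powr (s / 2)"
  have y: "?y \<ge> 1" using assms by (simp add: ge_one_powr_ge_zero)
  have yn: "?y ^ CARD('n) = R powr (real CARD('n) * s / 2)"
    using assms by (simp add: powr_power mult.commute)
  have card: "real (card (packet_index \<kappa> s R :: ('n \<Rightarrow> nat) set)) = (real (nat \<lfloor>\<kappa> * ?y\<rfloor>) + 1) ^ CARD('n)"
    by (simp add: packet_index_def card_PiE add.commute)
  have "\<kappa> * ?y \<ge> 0" using assms by simp
  then have fl: "\<kappa> * ?y \<le> real (nat \<lfloor>\<kappa> * ?y\<rfloor>) + 1" "real (nat \<lfloor>\<kappa> * ?y\<rfloor>) \<le> \<kappa> * ?y"
    by linarith+
  have "(\<kappa> * ?y) ^ CARD('n) \<le> (real (nat \<lfloor>\<kappa> * ?y\<rfloor>) + 1) ^ CARD('n)"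
    using fl assms by (intro power_mono) auto
  then show "\<kappa> ^ CARD('n) * R powr (real CARD('n) * s / 2) \<le> real (card (packet_index \<kappa> s R :: ('n \<Rightarrow> nat) set))"
    unfolding card power_mult_distrib yn .
  have "\<kappa> * ?y \<le> ?y" using assms by (simp add: mult_left_le_one_le)
  then have "real (nat \<lfloor>\<kappa> * ?y\<rfloor>) + 1 \<le> 2 * ?y" using fl y by linarith
  then have "(real (nat \<lfloor>\<kappa> * ?y\<rfloor>) + 1) ^ CARD('n) \<le> (2 * ?y) ^ CARD('n)"
    by (intro power_mono) auto
  then show "real (card (packet_index \<kappa> s R :: ('n \<Rightarrow> nat) set)) \<le> 2 ^ CARD('n) * R powr (real CARD('n) * s / 2)"
    unfolding card power_mult_distrib yn .
qed

lemma packet_freq_near: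
  fixes e :: "real^'n"
  assumes "0 < \<kappa>" "R \<ge> 1" "k \<in> packet_index \<kappa> s R"
  shows "norm (packet_freq e s R k - R *\<^sub>R e) \<le> real CARD('n) * \<kappa> * R"
proof -
  have k: "real (k i) \<le> \<kappa> * R powr (s / 2)" for i
  proof -
    have "k i \<le> nat \<lfloor>\<kappa> * R powr (s / 2)\<rfloor>" using assms(3) by (auto simp: packet_index_def)
    moreover have "\<kappa> * R powr (s / 2) \<ge> 0" using assms by simp
    ultimately show ?thesis by linarith
  qed
  have "norm ((\<chi> i. real (k i)) :: real^'n) \<le> (\<Sum>i\<in>UNIV. \<bar>real (k i)\<bar>)"
    using norm_le_l1_cart[of "(\<chi> i. real (k i)) :: real^'n"] by simp
  also have "\<dots> \<le> (\<Sum>i\<in>(UNIV::'n set). \<kappa> * R powr (s / 2))" using k by (intro sum_mono) auto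
  also have "\<dots> = real CARD('n) * \<kappa> * R powr (s / 2)" by simp
  finally have "R powr (1 - s / 2) * norm ((\<chi> i. real (k i)) :: real^'n) \<le> R powr (1 - s / 2) * (real CARD('n) * \<kappa> * R powr (s / 2))"
    by (intro mult_left_mono) auto
  also have "\<dots> = real CARD('n) * \<kappa> * (R powr (1 - s / 2) * R powr (s / 2))" by simp
  also have "R powr (1 - s / 2) * R powr (s / 2) = R" using assms by (simp flip: powr_add)
  finally show ?thesis by (simp add: packet_freq_def)
qed

text \<open>On either side of k the distances are distinct natural numbers with d \<le> d^2, so that
  each side is dominated by a geometric series.\<close>

lemma sum_exp_neg_le:
  fixes \<beta> :: real
  assumes b: "\<beta> > 0" and S: "finite S"
  shows "(\<Sum>l\<in>S. exp (- \<beta> * (real k - real l)\<^sup>2)) \<le> 2 / (1 - exp (- \<beta>))"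
proof -
  let ?q = "exp (- \<beta>)"
  have q: "0 < ?q" "?q < 1" using b by auto
  have sm: "summable (\<lambda>j. ?q ^ j)" using q by (intro summable_geometric) auto
  have part: "(\<Sum>l\<in>T. ?q ^ f l) \<le> 1 / (1 - ?q)" if "finite T" "inj_on f T" for T and f :: "nat \<Rightarrow> nat"
  proof -
    have "(\<Sum>l\<in>T. ?q ^ f l) = (\<Sum>j\<in>f ` T. ?q ^ j)" using that by (simp add: sum.reindex)
    also have "\<dots> \<le> (\<Sum>j. ?q ^ j)" using that q by (intro sum_le_suminf sm) auto
    finally show ?thesis using q by (simp add: suminf_geometric)
  qed
  have le: "exp (- \<beta> * (real k - real l)\<^sup>2) \<le> ?q ^ (if l \<le> k then k - l else l - k)" for l
  proof -
    let ?d = "if l \<le> k then k - l else l - k"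
    have "(real k - real l)\<^sup>2 = real (?d\<^sup>2)" by (auto simp: power2_commute)
    moreover have "real ?d \<le> real (?d\<^sup>2)" by (simp only: of_nat_le_iff) (simp add: power2_eq_square)
    ultimately have "\<beta> * real ?d \<le> \<beta> * (real k - real l)\<^sup>2" using b by (intro mult_left_mono) auto
    then have "exp (- \<beta> * (real k - real l)\<^sup>2) \<le> exp (real ?d * - \<beta>)" by (simp add: mult.commute)
    then show ?thesis unfolding exp_of_nat_mult .
  qed
  have "(\<Sum>l\<in>S. exp (- \<beta> * (real k - real l)\<^sup>2)) \<le> (\<Sum>l\<in>S. ?q ^ (if l \<le> k then k - l else l - k))"
    by (intro sum_mono le)
  also have "\<dots> = (\<Sum>l\<in>{l\<in>S. l \<le> k} \<union> {l\<in>S. \<not> l \<le> k}. ?q ^ (if l \<le> k then k - l else l - k))"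
    by (intro sum.cong) auto
  also have "\<dots> = (\<Sum>l\<in>{l\<in>S. l \<le> k}. ?q ^ (k - l)) + (\<Sum>l\<in>{l\<in>S. \<not> l \<le> k}. ?q ^ (l - k))"
    using S by (subst sum.union_disjoint) (auto intro!: arg_cong2[where f = "(+)"] sum.cong)
  also have "\<dots> \<le> 1 / (1 - ?q) + 1 / (1 - ?q)"
    using S by (intro add_mono part) (auto simp: inj_on_def)
  finally show ?thesis by simp
qed

lemma sum_exp_neg_lattice_le:
  fixes \<beta> :: real and k :: "'n::finite \<Rightarrow> nat"
  assumes b: "\<beta> > 0" and S: "finite S"
  shows "(\<Sum>l\<in>PiE UNIV (\<lambda>_. S). exp (- \<beta> * (norm ((\<chi> i. real (k i)) - (\<chi> i. real (l i)) :: real^'n))\<^sup>2))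
    \<le> (2 / (1 - exp (- \<beta>))) ^ CARD('n)"
proof -
  have "exp (- \<beta> * (norm ((\<chi> i. real (k i)) - (\<chi> i. real (l i)) :: real^'n))\<^sup>2)
      = (\<Prod>i\<in>UNIV. exp (- \<beta> * (real (k i) - real (l i))\<^sup>2))" for l :: "'n \<Rightarrow> nat"
    unfolding power2_norm_eq_inner
    by (simp add: inner_vec_def exp_sum[symmetric] sum_distrib_left sum_negf power2_eq_square)
  then have "(\<Sum>l\<in>PiE UNIV (\<lambda>_. S). exp (- \<beta> * (norm ((\<chi> i. real (k i)) - (\<chi> i. real (l i)) :: real^'n))\<^sup>2))
      = (\<Sum>l\<in>PiE UNIV (\<lambda>_. S). \<Prod>i\<in>UNIV. exp (- \<beta> * (real (k i) - real (l i))\<^sup>2))"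
    by simp
  also have "\<dots> = (\<Prod>i\<in>UNIV. \<Sum>l\<in>S. exp (- \<beta> * (real (k i) - real l)\<^sup>2))"
    using S by (subst prod_sum_PiE) auto
  also have "\<dots> \<le> (\<Prod>i\<in>(UNIV::'n set). 2 / (1 - exp (- \<beta>)))"
    using sum_exp_neg_le[OF b S] by (intro prod_mono) (auto intro: sum_nonneg)
  finally show ?thesis by simp
qed

text \<open>The packets move with distinct group velocities, so their sum is bounded like a single one.\<close>

lemma packet_sum_bounded:
  fixes e :: "real^'n"
  assumes s: "s > 0" "s \<noteq> 1" and A: "A > 0" and kappa: "0 < \<kappa>" "real CARD('n) * \<kappa> \<le> 1 / 2" and e: "norm e = 1"
  shows "\<exists>C>0. \<forall>R\<ge>1. \<forall>x. (\<Sum>k\<in>packet_index \<kappa> s R. norm (packet s (R powr (2 - s) / A) (packet_freq e s R k) x)) \<le> C"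
proof -
  obtain c where c: "c > 0" "\<And>R (a::real^'n) b. R > 0 \<Longrightarrow> R / 2 \<le> norm a \<Longrightarrow> norm a \<le> 2 * R \<Longrightarrow>
    R / 2 \<le> norm b \<Longrightarrow> norm b \<le> 2 * R \<Longrightarrow> c * R powr (s - 2) * norm (a - b) \<le> norm (phase_grad s a - phase_grad s b)"
    using phase_grad_separation[OF s] by blast
  define \<beta> where "\<beta> = c\<^sup>2 / (4 * A)"
  have b: "\<beta> > 0" using c A by (simp add: \<beta>_def)
  show ?thesis
  proof (intro exI[of _ "(2 / (1 - exp (- \<beta>))) ^ CARD('n)"] conjI allI impI)
    show "(2 / (1 - exp (- \<beta>))) ^ CARD('n) > 0" using b by simp
    fix R :: real and x :: "real^'n"
    assume R: "R \<ge> 1"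
    let ?K = "packet_index \<kappa> s R :: ('n \<Rightarrow> nat) set"
    let ?p = "packet_freq e s R"
    let ?c = "R powr (2 - s) / A"
    let ?v = "\<lambda>k::'n \<Rightarrow> nat. (\<chi> i. real (k i)) :: real^'n"
    have K: "?K \<noteq> {}" by (simp add: packet_index_def PiE_eq_empty_iff)
    \<comment> \<open>The packet centred nearest to x. For any other packet, its distance to x is at
      least half the distance between the two centres, which turns the separation of the centres
      into decay at x.\<close>
    obtain k0 where k0: "k0 \<in> ?K" "\<And>k. k \<in> ?K \<Longrightarrow> norm (x - phase_grad s (?p k0)) \<le> norm (x - phase_grad s (?p k))"
      using ex_is_arg_min_if_finite[OF finite_packet_index K, of "\<lambda>k. norm (x - phase_grad s (?p k))"]
      by (auto simp: is_arg_min_linorder)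
    have p: "R / 2 \<le> norm (?p k)" "norm (?p k) \<le> 2 * R" if "k \<in> ?K" for k
    proof -
      have "norm (?p k - R *\<^sub>R e) \<le> 1 / 2 * R"
        using packet_freq_near[OF kappa(1) R that, of e] kappa R
        by (smt (verit) mult_right_mono)
      moreover have "norm (R *\<^sub>R e) = R" using e R by simp
      ultimately show "R / 2 \<le> norm (?p k)" "norm (?p k) \<le> 2 * R"
        using norm_triangle_ineq2[of "R *\<^sub>R e" "?p k"] norm_triangle_ineq2[of "?p k" "R *\<^sub>R e"] R
        by (auto simp: norm_minus_commute)
    qed
    have sep: "\<beta> * (norm (?v k0 - ?v k))\<^sup>2 \<le> ?c * (norm (x - phase_grad s (?p k)))\<^sup>2" if k: "k \<in> ?K" for k
    proof -
      have d: "norm (?p k0 - ?p k) = R powr (1 - s / 2) * norm (?v k0 - ?v k)"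
        by (simp add: packet_freq_def flip: scaleR_diff_right)
      have "c * R powr (s - 2) * norm (?p k0 - ?p k) \<le> norm (phase_grad s (?p k0) - phase_grad s (?p k))"
        using R p k k0 by (intro c(2)) auto
      also have "\<dots> \<le> norm (x - phase_grad s (?p k0)) + norm (x - phase_grad s (?p k))"
        using norm_triangle_ineq4[of "x - phase_grad s (?p k)" "x - phase_grad s (?p k0)"] by (simp add: norm_minus_commute)
      also have "\<dots> \<le> 2 * norm (x - phase_grad s (?p k))" using k0(2)[OF k] by simp
      finally have "c * R powr (s - 2) * (R powr (1 - s / 2) * norm (?v k0 - ?v k)) \<le> 2 * norm (x - phase_grad s (?p k))"
        unfolding d .
      then have sq: "(c * R powr (s - 2) * (R powr (1 - s / 2) * norm (?v k0 - ?v k)))\<^sup>2 \<le> (2 * norm (x - phase_grad s (?p k)))\<^sup>2"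
        using c by (intro power_mono) auto
      \<comment> \<open>The squared separation of neighbouring centres, of order R^(s-2), is
        reciprocal to the exponent R^(2-s) of a packet; hence the decay rate \<beta> does not depend
        on R.\<close>
      have PQ: "(R powr (s - 2) * R powr (1 - s / 2))\<^sup>2 = R powr (s - 2)"
        using R by (simp add: powr_power flip: powr_add)
      have "c\<^sup>2 * R powr (s - 2) * (norm (?v k0 - ?v k))\<^sup>2 \<le> 4 * (norm (x - phase_grad s (?p k)))\<^sup>2"
      proof -
        have h: "(c * R powr (s - 2) * (R powr (1 - s / 2) * norm (?v k0 - ?v k)))\<^sup>2
            = c\<^sup>2 * (R powr (s - 2) * R powr (1 - s / 2))\<^sup>2 * (norm (?v k0 - ?v k))\<^sup>2"
          by (simp only: power_mult_distrib mult_ac)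
        show ?thesis using sq unfolding h PQ by (simp only: power_mult_distrib) simp
      qed
      then have "?c / 4 * (c\<^sup>2 * R powr (s - 2) * (norm (?v k0 - ?v k))\<^sup>2)
          \<le> ?c / 4 * (4 * (norm (x - phase_grad s (?p k)))\<^sup>2)"
        using A by (intro mult_left_mono) auto
      also have "\<dots> = ?c * (norm (x - phase_grad s (?p k)))\<^sup>2" by (simp only: times_divide_eq_left) simp
      finally have *: "?c / 4 * (c\<^sup>2 * R powr (s - 2) * (norm (?v k0 - ?v k))\<^sup>2)
          \<le> ?c * (norm (x - phase_grad s (?p k)))\<^sup>2" .
      have "R powr (2 - s) * R powr (s - 2) = 1" using R by (simp flip: powr_add)
      then have "?c / 4 * (c\<^sup>2 * R powr (s - 2) * t) = \<beta> * t" for t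
        unfolding \<beta>_def using A by (simp add: field_simps)
      with * show ?thesis by simp
    qed
    have "(\<Sum>k\<in>?K. norm (packet s ?c (?p k) x)) \<le> (\<Sum>k\<in>?K. exp (- \<beta> * (norm (?v k0 - ?v k))\<^sup>2))"
      unfolding norm_packet using sep by (intro sum_mono) simp
    also have "\<dots> \<le> (2 / (1 - exp (- \<beta>))) ^ CARD('n)"
      unfolding packet_index_def by (rule sum_exp_neg_lattice_le[OF b]) simp
    finally show "(\<Sum>k\<in>?K. norm (packet s ?c (?p k) x)) \<le> (2 / (1 - exp (- \<beta>))) ^ CARD('n)" .
  qed
qed

text \<open>A condition on the Fourier transforms of the test functions: all frequency integrals
  converge absolutely, also against symbols of order up to 1.\<close>

definition gaussian_decay :: "(real^'n \<Rightarrow> complex) \<Rightarrow> bool" where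
  "gaussian_decay F \<longleftrightarrow> F \<in> borel_measurable borel \<and>
     (\<exists>K c. c > 0 \<and> (\<forall>\<xi>. norm (F \<xi>) \<le> K * exp (- c * (norm \<xi>)\<^sup>2)))"

lemma gaussian_decay_sum:
  assumes "finite I" "\<And>i. i \<in> I \<Longrightarrow> gaussian_decay (F i)"
  shows "gaussian_decay (\<lambda>\<xi>. \<Sum>i\<in>I. F i \<xi>)"
  using assms
proof (induction I rule: finite_induct)
  case empty
  show ?case unfolding gaussian_decay_def by (intro conjI exI[of _ "0::real"] exI[of _ "1::real"]) auto
next
  case (insert i I)
  then have Fi: "gaussian_decay (F i)" and FI: "gaussian_decay (\<lambda>\<xi>. \<Sum>i\<in>I. F i \<xi>)" by auto
  obtain K c where F: "F i \<in> borel_measurable borel" "c > 0" "\<And>\<xi>. norm (F i \<xi>) \<le> K * exp (- c * (norm \<xi>)\<^sup>2)"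
    using Fi unfolding gaussian_decay_def by blast
  obtain L d where G: "(\<lambda>\<xi>. \<Sum>i\<in>I. F i \<xi>) \<in> borel_measurable borel" "d > 0"
      "\<And>\<xi>. norm (\<Sum>i\<in>I. F i \<xi>) \<le> L * exp (- d * (norm \<xi>)\<^sup>2)"
    using FI unfolding gaussian_decay_def by blast
  have mono: "J * exp (- a * (norm \<xi>)\<^sup>2) \<le> \<bar>J\<bar> * exp (- min c d * (norm \<xi>)\<^sup>2)" if "a \<ge> min c d" for J a and \<xi> :: "real^'n"
  proof -
    have "min c d * (norm \<xi>)\<^sup>2 \<le> a * (norm \<xi>)\<^sup>2" using that by (intro mult_right_mono) auto
    then have "\<bar>J\<bar> * exp (- a * (norm \<xi>)\<^sup>2) \<le> \<bar>J\<bar> * exp (- min c d * (norm \<xi>)\<^sup>2)" by (intro mult_left_mono) auto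
    moreover have "J * exp (- a * (norm \<xi>)\<^sup>2) \<le> \<bar>J\<bar> * exp (- a * (norm \<xi>)\<^sup>2)" by (intro mult_right_mono) auto
    ultimately show ?thesis by linarith
  qed
  have "norm (\<Sum>i\<in>insert i I. F i \<xi>) \<le> (\<bar>K\<bar> + \<bar>L\<bar>) * exp (- min c d * (norm \<xi>)\<^sup>2)" for \<xi>
  proof -
    have "norm (\<Sum>i\<in>insert i I. F i \<xi>) \<le> norm (F i \<xi>) + norm (\<Sum>i\<in>I. F i \<xi>)"
      using insert by (simp add: norm_triangle_ineq)
    then show ?thesis
      using F(3)[of \<xi>] G(3)[of \<xi>] mono[of c K \<xi>] mono[of d L \<xi>] by (simp add: distrib_right)
  qed
  then have "\<exists>J a. a > 0 \<and> (\<forall>\<xi>. norm (\<Sum>i\<in>insert i I. F i \<xi>) \<le> J * exp (- a * (norm \<xi>)\<^sup>2))"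
    using F(2) G(2) by - (rule exI[of _ "\<bar>K\<bar> + \<bar>L\<bar>"], rule exI[of _ "min c d"], simp)
  moreover have "(\<lambda>\<xi>. \<Sum>i\<in>insert i I. F i \<xi>) \<in> borel_measurable borel"
    using insert F(1) G(1) by simp
  ultimately show ?case unfolding gaussian_decay_def by blast
qed

lemma gaussian_decay_translate:
  assumes [measurable]: "F \<in> borel_measurable borel" and c: "c > 0"
    and F: "\<And>\<xi>. norm (F \<xi>) \<le> K * exp (- c * (norm (\<xi> - p))\<^sup>2)"
  shows "gaussian_decay F"
  unfolding gaussian_decay_def
proof (intro conjI exI allI)
  show "c / 2 > 0" using c by simp
  fix \<xi>
  have K: "K \<ge> 0"
    using order_trans[OF norm_ge_zero F[of p]] by simp
  have "(norm \<xi>)\<^sup>2 \<le> (norm (\<xi> - p) + norm p)\<^sup>2"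
    using norm_triangle_ineq[of "\<xi> - p" p] by (intro power_mono) auto
  also have "\<dots> \<le> 2 * (norm (\<xi> - p))\<^sup>2 + 2 * (norm p)\<^sup>2"
    using sum_squares_bound[of "norm (\<xi> - p)" "norm p"] by (simp add: power2_sum)
  finally have "c / 2 * (norm \<xi>)\<^sup>2 \<le> c / 2 * (2 * (norm (\<xi> - p))\<^sup>2 + 2 * (norm p)\<^sup>2)"
    using c by (intro mult_left_mono) auto
  then have "exp (- c * (norm (\<xi> - p))\<^sup>2) \<le> exp (c * (norm p)\<^sup>2 + - (c / 2) * (norm \<xi>)\<^sup>2)"
    by (simp add: algebra_simps)
  then have "K * exp (- c * (norm (\<xi> - p))\<^sup>2) \<le> K * (exp (c * (norm p)\<^sup>2) * exp (- (c / 2) * (norm \<xi>)\<^sup>2))"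
    using K unfolding exp_add by (intro mult_left_mono)
  with F[of \<xi>] show "norm (F \<xi>) \<le> (K * exp (c * (norm p)\<^sup>2)) * exp (- (c / 2) * (norm \<xi>)\<^sup>2)"
    by (simp add: mult.assoc)
qed simp

lemma gaussian_decay_integrable:
  assumes F: "gaussian_decay F" and [measurable]: "m \<in> borel_measurable borel" and m: "\<And>\<xi>. norm (m \<xi>) \<le> 1"
  shows "integrable lborel (\<lambda>\<xi>. m \<xi> * F \<xi>)"
proof -
  obtain K c where [measurable]: "F \<in> borel_measurable borel" and c: "c > 0"
    and K: "\<And>\<xi>. norm (F \<xi>) \<le> K * exp (- c * (norm \<xi>)\<^sup>2)"
    using F unfolding gaussian_decay_def by blast
  have "integrable lborel (\<lambda>\<xi>::real^'a. K * exp (- c * (norm \<xi>)\<^sup>2))"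
    using gaussian_integral(1)[OF c, of 0] by (intro integrable_mult_right) simp
  then show ?thesis
  proof (rule Bochner_Integration.integrable_bound)
    show "AE \<xi> in lborel. norm (m \<xi> * F \<xi>) \<le> norm (K * exp (- c * (norm \<xi>)\<^sup>2))"
    proof (intro AE_I2)
      fix \<xi>
      have "norm (m \<xi> * F \<xi>) \<le> norm (F \<xi>)"
        unfolding norm_mult using m[of \<xi>] by (intro mult_left_le_one_le) auto
      with K[of \<xi>] show "norm (m \<xi> * F \<xi>) \<le> norm (K * exp (- c * (norm \<xi>)\<^sup>2))" by simp
    qed
  qed simp
qed

lemma gaussian_decay_fourier_packet:
  assumes c: "c > 0"
  shows "gaussian_decay (fourier (packet s c p))"
proof (rule gaussian_decay_translate)
  have [measurable]: "packet s c p \<in> borel_measurable borel"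
    using borel_measurable_integrable[OF fourier_packet(1)[OF c]] by simp
  show "fourier (packet s c p) \<in> borel_measurable borel"
    unfolding fourier_eq_cis[abs_def] by measurable
  show "1 / (4 * c) > 0" using c by simp
  show "norm (fourier (packet s c p) \<xi>) \<le> sqrt (pi / c) ^ CARD('a) * exp (- (1 / (4 * c)) * (norm (\<xi> - p))\<^sup>2)" for \<xi>
    unfolding fourier_packet(2)[OF c] norm_mult norm_cis norm_of_real using c by simp
qed

lemma fourier_sum:
  assumes "finite I" "\<And>i. i \<in> I \<Longrightarrow> integrable lborel (f i)"
  shows "fourier (\<lambda>x. \<Sum>i\<in>I. f i x) \<xi> = (\<Sum>i\<in>I. fourier (f i) \<xi>)"
proof -
  have "integrable lborel (\<lambda>x. f i x * cis (- \<xi> \<bullet> x))" if "i \<in> I" for i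
    using assms(2)[OF that] borel_measurable_integrable[OF assms(2)[OF that]]
    by (intro Bochner_Integration.integrable_bound[OF assms(2)[OF that]]) (auto simp: norm_mult)
  then show ?thesis
    unfolding fourier_eq_cis sum_distrib_right by (rule Bochner_Integration.integral_sum)
qed

lemma exp_decay_le:
  fixes y b :: real
  assumes "y > 0" "b \<ge> 1"
  shows "y ^ N * exp (- b * y) \<le> fact N / b ^ N"
proof -
  have "(b * y) ^ N / fact N \<le> exp (b * y)" using assms by (intro power_div_fact_le_exp) auto
  then have "y ^ N * b ^ N \<le> fact N * exp (b * y)" by (simp add: field_simps power_mult_distrib)
  then have "y ^ N * b ^ N * exp (- b * y) \<le> fact N * exp (b * y) * exp (- b * y)" by (intro mult_right_mono) auto
  then have "y ^ N * b ^ N * exp (- b * y) \<le> fact N" by (simp add: mult.assoc flip: exp_add)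
  then show ?thesis using assms by (simp add: pos_le_divide_eq mult_ac)
qed

text \<open>The two uses differ in W. For focusing, W is the cutoff times a modulation, and the
  pairing is a value of the propagated sum near the origin. For spreading, W is the profile of a
  bump, and the pairing tests the spread bump against the packets. The size of the tail is dictated
  by the second use: multiplied by R^n, the trivial bound for a function with frequencies up to
  about R, it is a small fraction of R^(ns/2).\<close>

lemma packets_exist:
  fixes e :: "real^'n" and s \<eta> c0 :: real
  assumes s: "s > 0" "s \<noteq> 1" and eta: "0 < \<eta>" "\<eta> \<le> 1 / 2" and c0: "c0 > 0" and e: "norm e = 1"
  shows "\<exists>(v :: real \<Rightarrow> real^'n \<Rightarrow> complex) C. C > 0 \<and>
    (\<forall>R\<ge>1. gauss_poly (v R) \<and> gaussian_decay (fourier (v R)) \<and> integrable lborel (v R) \<and>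
      (\<forall>x. norm (v R x) \<le> C) \<and>
      (\<integral>x. norm (v R x) \<partial>lborel) \<le> C * R powr (real CARD('n) * (s - 1)) \<and>
      (\<forall>W. W \<in> borel_measurable borel \<longrightarrow> (\<forall>\<xi>. norm (W \<xi>) \<le> 1) \<longrightarrow>
        (\<forall>\<xi>. norm (\<xi> - R *\<^sub>R e) \<le> \<eta> * R \<longrightarrow> c0 \<le> Re (W \<xi>) \<and> \<bar>Im (W \<xi>)\<bar> \<le> c0 / 8) \<longrightarrow>
        R powr (real CARD('n) * s / 2) / C \<le> Re (\<integral>\<xi>. W \<xi> * (cis (phase s \<xi>) * fourier (v R) \<xi>) \<partial>lborel) \<and>
        \<bar>Im (\<integral>\<xi>. W \<xi> * (cis (phase s \<xi>) * fourier (v R) \<xi>) \<partial>lborel)\<bar>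
          \<le> Re (\<integral>\<xi>. W \<xi> * (cis (phase s \<xi>) * fourier (v R) \<xi>) \<partial>lborel) / 2)) \<and>
    (\<forall>\<delta>>0. \<exists>D>0. \<forall>R\<ge>1. (\<integral>x. norm (v R x) * indicator {x. norm x > D * R powr (s - 1)} x \<partial>lborel)
      \<le> \<delta> * R powr (real CARD('n) * s / 2 - real CARD('n)))"
proof -
  let ?n = "CARD('n)"
  obtain A where A: "A > 0" and pair: "\<And>R (p::real^'n) W. R \<ge> 1 \<Longrightarrow> R / 2 \<le> norm p \<Longrightarrow> norm p \<le> 2 * R \<Longrightarrow>
    W \<in> borel_measurable borel \<Longrightarrow> (\<forall>\<xi>. norm (W \<xi>) \<le> 1) \<Longrightarrow>
    (\<forall>\<xi>. norm (\<xi> - p) \<le> \<eta> / 2 * R \<longrightarrow> c0 \<le> Re (W \<xi>) \<and> \<bar>Im (W \<xi>)\<bar> \<le> c0 / 8) \<Longrightarrow>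
    integrable lborel (\<lambda>\<xi>. W \<xi> * (cis (phase s \<xi>) * fourier (packet s (R powr (2 - s) / A) p) \<xi>)) \<and>
    (2 * pi) ^ ?n * (c0 / 2) \<le> Re (\<integral>\<xi>. W \<xi> * (cis (phase s \<xi>) * fourier (packet s (R powr (2 - s) / A) p) \<xi>) \<partial>lborel) \<and>
    \<bar>Im (\<integral>\<xi>. W \<xi> * (cis (phase s \<xi>) * fourier (packet s (R powr (2 - s) / A) p) \<xi>) \<partial>lborel)\<bar> \<le> (2 * pi) ^ ?n * (c0 / 4)"
    using packet_pairing[OF s(1) half_gt_zero[OF eta(1)] c0] by blast
  \<comment> \<open>All packet frequencies stay within \<eta>R/2 of R e. The other half of \<eta>R
    is the neighbourhood of each frequency on which \<open>packet_pairing\<close> requires control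
    of W.\<close>
  define \<kappa> where "\<kappa> = \<eta> / (2 * real ?n)"
  have n: "real ?n \<ge> 1" by (simp add: Suc_leI)
  have kappa: "0 < \<kappa>" "real ?n * \<kappa> = \<eta> / 2" "real ?n * \<kappa> \<le> 1 / 2" using eta n by (auto simp: \<kappa>_def)
  have kappa1: "\<kappa> \<le> 1"
    using kappa n mult_right_mono[OF n, of \<kappa>] by linarith
  obtain C1 where C1: "C1 > 0" "\<And>R (x::real^'n). R \<ge> 1 \<Longrightarrow>
    (\<Sum>k\<in>packet_index \<kappa> s R. norm (packet s (R powr (2 - s) / A) (packet_freq e s R k) x)) \<le> C1"
    using packet_sum_bounded[OF s A kappa(1,3) e] by blast
  define v where "v = packet_sum s A \<kappa> e"
  define C2 where "C2 = 2 ^ ?n * sqrt (pi * A) ^ ?n"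
  define C3 where "C3 = 1 / (\<kappa> ^ ?n * ((2 * pi) ^ ?n * (c0 / 2)))"
  define D1 where "D1 = s * 2 powr \<bar>s - 1\<bar>"
  have C23: "C2 > 0" "C3 > 0" using A kappa c0 by (auto simp: C2_def C3_def)
  have D1: "D1 > 0" using s by (simp add: D1_def)
  define c where "c R = R powr (2 - s) / A" for R
  have c: "c R > 0" if "R \<ge> 1" for R using that A by (simp add: c_def)
  have v: "v R = (\<lambda>x. \<Sum>k\<in>packet_index \<kappa> s R. packet s (c R) (packet_freq e s R k) x)" for R
    by (simp add: v_def packet_sum_def c_def fun_eq_iff)
  have near: "norm (packet_freq e s R k - R *\<^sub>R e) \<le> \<eta> / 2 * R" if "R \<ge> 1" "k \<in> packet_index \<kappa> s R" for R k
    using packet_freq_near[OF kappa(1) that, of e] unfolding kappa(2) .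
  have p: "R / 2 \<le> norm (packet_freq e s R k)" "norm (packet_freq e s R k) \<le> 2 * R"
    if R: "R \<ge> 1" and k: "k \<in> packet_index \<kappa> s R" for R k
  proof -
    have "\<eta> / 2 * R \<le> 1 / 2 * R" using eta R by (intro mult_right_mono) auto
    then have "norm (packet_freq e s R k - R *\<^sub>R e) \<le> R / 2" using near[OF R k] by linarith
    moreover have "norm (R *\<^sub>R e) = R" using e R by simp
    ultimately show "R / 2 \<le> norm (packet_freq e s R k)" "norm (packet_freq e s R k) \<le> 2 * R"
      using norm_triangle_ineq2[of "R *\<^sub>R e" "packet_freq e s R k"] norm_triangle_ineq2[of "packet_freq e s R k" "R *\<^sub>R e"] R
      by (auto simp: norm_minus_commute)
  qed
  have cardU: "real (card (packet_index \<kappa> s R :: ('n \<Rightarrow> nat) set)) \<le> 2 ^ ?n * R powr (real ?n * s / 2)"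
    and cardL: "\<kappa> ^ ?n * R powr (real ?n * s / 2) \<le> real (card (packet_index \<kappa> s R :: ('n \<Rightarrow> nat) set))" if "R \<ge> 1" for R
    using card_packet_index[where 'n = 'n, OF kappa(1) kappa1 that s(1)] by auto
  have vint: "integrable lborel (v R)" if "R \<ge> 1" for R
    unfolding v using c[OF that] by (intro Bochner_Integration.integrable_sum fourier_packet(1))
  have fv: "fourier (v R) \<xi> = (\<Sum>k\<in>packet_index \<kappa> s R. fourier (packet s (c R) (packet_freq e s R k)) \<xi>)" if "R \<ge> 1" for R \<xi>
    unfolding v using c[OF that] by (intro fourier_sum fourier_packet(1) finite_packet_index)
  have sq: "sqrt (pi / c R) ^ ?n = sqrt (pi * A) ^ ?n * R powr (real ?n * (s - 2) / 2)" if "R \<ge> 1" for R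
  proof -
    have "pi / c R = (pi * A) * R powr (s - 2)" using that A by (simp add: c_def powr_diff field_simps)
    moreover have "sqrt (R powr (s - 2)) = R powr ((s - 2) / 2)"
      using that by (simp add: powr_half_sqrt[symmetric] powr_powr)
    ultimately show ?thesis using that by (simp add: real_sqrt_mult power_mult_distrib powr_power mult.commute)
  qed
  have G1: "gauss_poly (v R)" "gaussian_decay (fourier (v R))" if R: "R \<ge> 1" for R
  proof -
    show "gauss_poly (v R)"
      unfolding v by (intro gauss_poly_sum finite_packet_index gauss_poly_packet c R)
    have "fourier (v R) = (\<lambda>\<xi>. \<Sum>k\<in>packet_index \<kappa> s R. fourier (packet s (c R) (packet_freq e s R k)) \<xi>)"
      by (rule ext) (rule fv[OF R])
    then show "gaussian_decay (fourier (v R))"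
      by (simp only:) (intro gaussian_decay_sum finite_packet_index gaussian_decay_fourier_packet c R)
  qed
  have G2: "norm (v R x) \<le> C1" if "R \<ge> 1" for R x
    using norm_sum[of "\<lambda>k. packet s (c R) (packet_freq e s R k) x" "packet_index \<kappa> s R"] C1(2)[OF that, of x]
    unfolding v c_def by (rule order_trans)
  have gint: "integrable lborel (\<lambda>x. norm (packet s (c R) p x))" "(\<integral>x. norm (packet s (c R) p x) \<partial>lborel) = sqrt (pi / c R) ^ ?n"
    if "R \<ge> 1" for R and p :: "real^'n"
    unfolding norm_packet using gaussian_integral[OF c[OF that], of "phase_grad s p"] by simp_all
  \<comment> \<open>The number of packets times the order of the L^1 norm of a single one.\<close>
  have pw: "R powr (real ?n * s / 2) * R powr (real ?n * (s - 2) / 2) = R powr (real ?n * (s - 1))" for R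
    by (simp add: algebra_simps add_divide_distrib diff_divide_distrib flip: powr_add)
  have G3: "(\<integral>x. norm (v R x) \<partial>lborel) \<le> C2 * R powr (real ?n * (s - 1))" if R: "R \<ge> 1" for R
  proof -
    have "(\<integral>x. norm (v R x) \<partial>lborel) \<le> (\<integral>x. (\<Sum>k\<in>packet_index \<kappa> s R. norm (packet s (c R) (packet_freq e s R k) x)) \<partial>lborel)"
      unfolding v by (rule integral_mono) (auto intro!: norm_sum gint[OF R] integrable_norm vint[OF R, unfolded v])
    also have "\<dots> = real (card (packet_index \<kappa> s R :: ('n \<Rightarrow> nat) set)) * sqrt (pi / c R) ^ ?n"
      using gint[OF R] by (subst Bochner_Integration.integral_sum) auto
    also have "\<dots> \<le> (2 ^ ?n * R powr (real ?n * s / 2)) * (sqrt (pi * A) ^ ?n * R powr (real ?n * (s - 2) / 2))"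
      unfolding sq[OF R] using A by (intro mult_right_mono cardU R) auto
    also have "\<dots> = C2 * (R powr (real ?n * s / 2) * R powr (real ?n * (s - 2) / 2))"
      by (simp add: C2_def mult_ac)
    finally show ?thesis unfolding pw .
  qed
  have G4: "R powr (real ?n * s / 2) / C3 \<le> Re (\<integral>\<xi>. W \<xi> * (cis (phase s \<xi>) * fourier (v R) \<xi>) \<partial>lborel) \<and>
        \<bar>Im (\<integral>\<xi>. W \<xi> * (cis (phase s \<xi>) * fourier (v R) \<xi>) \<partial>lborel)\<bar>
          \<le> Re (\<integral>\<xi>. W \<xi> * (cis (phase s \<xi>) * fourier (v R) \<xi>) \<partial>lborel) / 2"
    if R: "R \<ge> 1" and W: "W \<in> borel_measurable borel" "\<forall>\<xi>. norm (W \<xi>) \<le> 1"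
      "\<forall>\<xi>. norm (\<xi> - R *\<^sub>R e) \<le> \<eta> * R \<longrightarrow> c0 \<le> Re (W \<xi>) \<and> \<bar>Im (W \<xi>)\<bar> \<le> c0 / 8" for R W
  proof -
    let ?K = "packet_index \<kappa> s R :: ('n \<Rightarrow> nat) set"
    let ?g = "\<lambda>k \<xi>. W \<xi> * (cis (phase s \<xi>) * fourier (packet s (c R) (packet_freq e s R k)) \<xi>)"
    have W': "\<forall>\<xi>. norm (\<xi> - packet_freq e s R k) \<le> \<eta> / 2 * R \<longrightarrow> c0 \<le> Re (W \<xi>) \<and> \<bar>Im (W \<xi>)\<bar> \<le> c0 / 8"
      if "k \<in> ?K" for k
    proof (intro allI impI)
      fix \<xi> assume "norm (\<xi> - packet_freq e s R k) \<le> \<eta> / 2 * R"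
      with near[OF R that] have "norm (\<xi> - R *\<^sub>R e) \<le> \<eta> * R"
        using norm_triangle_ineq[of "\<xi> - packet_freq e s R k" "packet_freq e s R k - R *\<^sub>R e"] by simp
      then show "c0 \<le> Re (W \<xi>) \<and> \<bar>Im (W \<xi>)\<bar> \<le> c0 / 8" using W(3) by blast
    qed
    have each: "integrable lborel (?g k)" "(2 * pi) ^ ?n * (c0 / 2) \<le> Re (\<integral>\<xi>. ?g k \<xi> \<partial>lborel)"
      "\<bar>Im (\<integral>\<xi>. ?g k \<xi> \<partial>lborel)\<bar> \<le> (2 * pi) ^ ?n * (c0 / 4)" if "k \<in> ?K" for k
      using pair[OF R p[OF R that] W(1,2) W'[OF that]] unfolding c_def by blast+
    have "(\<integral>\<xi>. W \<xi> * (cis (phase s \<xi>) * fourier (v R) \<xi>) \<partial>lborel) = (\<integral>\<xi>. (\<Sum>k\<in>?K. ?g k \<xi>) \<partial>lborel)"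
      unfolding fv[OF R] sum_distrib_left ..
    also have "\<dots> = (\<Sum>k\<in>?K. \<integral>\<xi>. ?g k \<xi> \<partial>lborel)"
      by (rule Bochner_Integration.integral_sum) (rule each(1))
    finally have z: "(\<integral>\<xi>. W \<xi> * (cis (phase s \<xi>) * fourier (v R) \<xi>) \<partial>lborel) = (\<Sum>k\<in>?K. \<integral>\<xi>. ?g k \<xi> \<partial>lborel)" .
    let ?P = "(2 * pi) ^ ?n * (c0 / 2)"
    have lo: "real (card ?K) * ?P \<le> (\<Sum>k\<in>?K. Re (\<integral>\<xi>. ?g k \<xi> \<partial>lborel))"
      using sum_bounded_below[of ?K ?P "\<lambda>k. Re (\<integral>\<xi>. ?g k \<xi> \<partial>lborel)"] each(2) by simp
    have "\<bar>\<Sum>k\<in>?K. Im (\<integral>\<xi>. ?g k \<xi> \<partial>lborel)\<bar> \<le> (\<Sum>k\<in>?K. (2 * pi) ^ ?n * (c0 / 4))"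
      by (rule order_trans[OF sum_abs sum_mono]) (rule each(3))
    also have "\<dots> = real (card ?K) * ?P / 2" by simp
    finally have hi: "\<bar>\<Sum>k\<in>?K. Im (\<integral>\<xi>. ?g k \<xi> \<partial>lborel)\<bar> \<le> real (card ?K) * ?P / 2" .
    have "R powr (real ?n * s / 2) / C3 = (\<kappa> ^ ?n * R powr (real ?n * s / 2)) * ?P"
      by (simp add: C3_def mult_ac)
    also have "\<dots> \<le> real (card ?K) * ?P" using c0 by (intro mult_right_mono cardL R) auto
    finally have "R powr (real ?n * s / 2) / C3 \<le> real (card ?K) * ?P" .
    then show ?thesis using lo hi unfolding z Re_sum Im_sum by linarith
  qed
  have G5: "\<exists>D>0. \<forall>R\<ge>1. (\<integral>x. norm (v R x) * indicator {x. norm x > D * R powr (s - 1)} x \<partial>lborel)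
      \<le> \<delta> * R powr (real ?n * s / 2 - real ?n)" if delta: "\<delta> > 0" for \<delta> :: real
  proof -
    define C4 where "C4 = C2 * sqrt 2 ^ ?n"
    have C4: "C4 > 0" using C23 by (simp add: C4_def)
    define b where "b = max 1 (C4 * fact ?n / \<delta>)"
    have b: "b \<ge> 1" "C4 * fact ?n / \<delta> \<le> b" by (auto simp: b_def)
    \<comment> \<open>D \<ge> 2 D1 keeps all centres within half the radius; D^2 \<ge> 8 A b turns
      half of the Gaussian exponent into the gain e^(-b R^s), while the other half is left for
      integration.\<close>
    define D where "D = max (2 * D1) (sqrt (8 * A * b))"
    have D: "D > 0" "D \<ge> 2 * D1" "8 * A * b \<le> D\<^sup>2"
    proof -
      show "D > 0" "D \<ge> 2 * D1" using D1 by (auto simp: D_def)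
      have "8 * A * b = (sqrt (8 * A * b))\<^sup>2" using A b by simp
      also have "\<dots> \<le> D\<^sup>2" using A b by (intro power_mono) (auto simp: D_def)
      finally show "8 * A * b \<le> D\<^sup>2" .
    qed
    have "(\<integral>x. norm (v R x) * indicator {x. norm x > D * R powr (s - 1)} x \<partial>lborel)
      \<le> \<delta> * R powr (real ?n * s / 2 - real ?n)" if R: "R \<ge> 1" for R
    proof -
      let ?K = "packet_index \<kappa> s R :: ('n \<Rightarrow> nat) set"
      let ?r = "D * R powr (s - 1)"
      let ?x = "\<lambda>k. phase_grad s (packet_freq e s R k)"
      let ?h = "\<lambda>k x. exp (- b * R powr s) * exp (- (c R / 2) * (norm (x - ?x k))\<^sup>2)"
      have pos: "norm (?x k) \<le> D1 * R powr (s - 1)" if k: "k \<in> ?K" for k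
      proof -
        have "packet_freq e s R k \<noteq> 0" using p(1)[OF R k] R by auto
        then have "norm (?x k) = s * norm (packet_freq e s R k) powr (s - 1)" using s by (intro norm_phase_grad)
        also have "\<dots> \<le> s * (2 powr \<bar>s - 1\<bar> * R powr (s - 1))"
          using s powr_comparable(1)[of R 2 "norm (packet_freq e s R k)" "s - 1"] p[OF R k] R by (intro mult_left_mono) auto
        finally show ?thesis by (simp add: D1_def mult.assoc)
      qed
      have pt: "norm (packet s (c R) (packet_freq e s R k) x) * indicator {x. norm x > ?r} x \<le> ?h k x" if k: "k \<in> ?K" for k x
      proof (cases "norm x > ?r")
        case True
        have "2 * (D1 * R powr (s - 1)) \<le> ?r" using D(2) mult_right_mono[of "2 * D1" D "R powr (s - 1)"] by simp
        then have "?r / 2 \<le> norm (x - ?x k)"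
          using True pos[OF k] norm_triangle_ineq2[of x "?x k"] by linarith
        then have "(?r / 2)\<^sup>2 \<le> (norm (x - ?x k))\<^sup>2" using D by (intro power_mono) auto
        then have "c R / 2 * (?r / 2)\<^sup>2 \<le> c R / 2 * (norm (x - ?x k))\<^sup>2"
          using c[OF R] by (intro mult_left_mono) auto
        moreover have "b * R powr s \<le> c R / 2 * (?r / 2)\<^sup>2"
        proof -
          have "R powr (2 - s) * (R powr (s - 1))\<^sup>2 = R powr s" using R by (simp add: powr_power flip: powr_add)
          then have "c R / 2 * (?r / 2)\<^sup>2 = D\<^sup>2 / (8 * A) * R powr s"
            using A by (simp add: c_def power_mult_distrib power_divide field_simps)
          moreover have "b * R powr s \<le> D\<^sup>2 / (8 * A) * R powr s"
            using D(3) A by (intro mult_right_mono) (simp_all add: pos_le_divide_eq mult_ac)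
          ultimately show ?thesis by linarith
        qed
        ultimately have "- c R * (norm (x - ?x k))\<^sup>2 \<le> - b * R powr s + - (c R / 2) * (norm (x - ?x k))\<^sup>2" by simp
        then show ?thesis using True unfolding norm_packet by (simp flip: exp_add)
      qed simp
      have hI: "integrable lborel (?h k)" "(\<integral>x. ?h k x \<partial>lborel) = exp (- b * R powr s) * (sqrt 2 ^ ?n * sqrt (pi / c R) ^ ?n)" for k
      proof -
        have "c R / 2 > 0" using c[OF R] by simp
        note g = gaussian_integral[OF this, of "?x k"]
        show "integrable lborel (?h k)" by (intro integrable_mult_right g(1))
        have "sqrt (pi / (c R / 2)) = sqrt 2 * sqrt (pi / c R)" by (simp flip: real_sqrt_mult)
        then show "(\<integral>x. ?h k x \<partial>lborel) = exp (- b * R powr s) * (sqrt 2 ^ ?n * sqrt (pi / c R) ^ ?n)"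
          using g(2) by (simp add: power_mult_distrib)
      qed
      have "(\<integral>x. norm (v R x) * indicator {x. norm x > ?r} x \<partial>lborel) \<le> (\<integral>x. (\<Sum>k\<in>?K. ?h k x) \<partial>lborel)"
      proof (rule integral_mono')
        show "integrable lborel (\<lambda>x. \<Sum>k\<in>?K. ?h k x)" by (intro Bochner_Integration.integrable_sum hI)
        fix x
        have "norm (v R x) * indicator {x. norm x > ?r} x
            \<le> (\<Sum>k\<in>?K. norm (packet s (c R) (packet_freq e s R k) x)) * indicator {x. norm x > ?r} x"
          unfolding v by (intro mult_right_mono norm_sum) auto
        also have "\<dots> \<le> (\<Sum>k\<in>?K. ?h k x)" unfolding sum_distrib_right by (intro sum_mono pt)
        finally show "norm (v R x) * indicator {x. norm x > ?r} x \<le> (\<Sum>k\<in>?K. ?h k x)" .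
        show "0 \<le> (\<Sum>k\<in>?K. ?h k x)" by (intro sum_nonneg) auto
      qed
      also have "\<dots> = real (card ?K) * (exp (- b * R powr s) * (sqrt 2 ^ ?n * sqrt (pi / c R) ^ ?n))"
        by (subst Bochner_Integration.integral_sum[OF hI(1)]) (simp only: hI(2) sum_constant)
      also have "\<dots> \<le> (2 ^ ?n * R powr (real ?n * s / 2)) * (exp (- b * R powr s) * (sqrt 2 ^ ?n * sqrt (pi / c R) ^ ?n))"
        using c[OF R] by (intro mult_right_mono cardU R) auto
      also have "\<dots> = C4 * (R powr (real ?n * s / 2) * R powr (real ?n * (s - 2) / 2)) * exp (- b * R powr s)"
        unfolding sq[OF R] C4_def C2_def by (simp only: mult_ac)
      \<comment> \<open>R^(ns/2) is enlarged to (R^s)^n, a power that e^(-b R^s) absorbs with the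
        factor n! / b^n. The choice of b brings this below \<delta>.\<close>
      also have "\<dots> \<le> C4 * ((R powr s) ^ ?n * R powr (real ?n * s / 2 - real ?n)) * exp (- b * R powr s)"
      proof -
        have "R powr (real ?n * (s - 2) / 2) = R powr (real ?n * s / 2 - real ?n)"
          by (simp add: algebra_simps diff_divide_distrib)
        moreover have "R powr (real ?n * s / 2) \<le> R powr (real ?n * s)" using R s by (intro powr_mono) auto
        moreover have "R powr (real ?n * s) = (R powr s) ^ ?n" using R by (simp add: powr_power mult.commute)
        ultimately show ?thesis using C4 by (intro mult_right_mono mult_left_mono mult_mono) auto
      qed
      also have "\<dots> = C4 * ((R powr s) ^ ?n * exp (- b * R powr s)) * R powr (real ?n * s / 2 - real ?n)"
        by (simp only: mult_ac)
      also have "\<dots> \<le> C4 * (fact ?n / b ^ ?n) * R powr (real ?n * s / 2 - real ?n)"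
        using C4 b R by (intro mult_right_mono mult_left_mono exp_decay_le) auto
      also have "\<dots> \<le> \<delta> * R powr (real ?n * s / 2 - real ?n)"
      proof (rule mult_right_mono)
        have "b \<le> b ^ ?n" using b power_increasing[of 1 ?n b] by (simp add: Suc_leI)
        then have "C4 * fact ?n \<le> \<delta> * b ^ ?n" using b(2) delta by (simp add: divide_le_eq) (smt (verit) mult_left_mono mult.commute)
        then show "C4 * (fact ?n / b ^ ?n) \<le> \<delta>" using b by (simp add: divide_le_eq)
      qed simp
      finally show ?thesis .
    qed
    with D(1) show ?thesis by blast
  qed
  define C where "C = max C1 (max C2 C3)"
  have C: "C > 0" "C1 \<le> C" "C2 \<le> C" "C3 \<le> C" using C1 C23 by (auto simp: C_def)
  show ?thesis
  proof (rule exI[of _ v], rule exI[of _ C], intro conjI allI impI C(1))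
    fix R :: real assume R: "R \<ge> 1"
    show "gauss_poly (v R)" "gaussian_decay (fourier (v R))" using G1[OF R] by auto
    show "integrable lborel (v R)" by (rule vint[OF R])
    show "norm (v R x) \<le> C" for x using G2[OF R, of x] C by linarith
    have "C2 * R powr (real ?n * (s - 1)) \<le> C * R powr (real ?n * (s - 1))" using C by (intro mult_right_mono) auto
    with G3[OF R] show "(\<integral>x. norm (v R x) \<partial>lborel) \<le> C * R powr (real ?n * (s - 1))" by linarith
    fix W :: "real^'n \<Rightarrow> complex"
    assume W: "W \<in> borel_measurable borel" "\<forall>\<xi>. norm (W \<xi>) \<le> 1"
      "\<forall>\<xi>. norm (\<xi> - R *\<^sub>R e) \<le> \<eta> * R \<longrightarrow> c0 \<le> Re (W \<xi>) \<and> \<bar>Im (W \<xi>)\<bar> \<le> c0 / 8"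
    have "R powr (real ?n * s / 2) / C \<le> R powr (real ?n * s / 2) / C3"
      using C C23 by (intro divide_left_mono) auto
    with G4[OF R W] show "R powr (real ?n * s / 2) / C \<le> Re (\<integral>\<xi>. W \<xi> * (cis (phase s \<xi>) * fourier (v R) \<xi>) \<partial>lborel)"
      by linarith
    show "\<bar>Im (\<integral>\<xi>. W \<xi> * (cis (phase s \<xi>) * fourier (v R) \<xi>) \<partial>lborel)\<bar>
          \<le> Re (\<integral>\<xi>. W \<xi> * (cis (phase s \<xi>) * fourier (v R) \<xi>) \<partial>lborel) / 2"
      using G4[OF R W] by blast
  next
    fix \<delta> :: real assume "\<delta> > 0"
    then show "\<exists>D>0. \<forall>R\<ge>1. (\<integral>x. norm (v R x) * indicator {x. norm x > D * R powr (s - 1)} x \<partial>lborel)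
      \<le> \<delta> * R powr (real ?n * s / 2 - real ?n)" by (rule G5)
  qed
qed

section \<open>Spreading of a concentrated function\<close>

lemma lborel_integral_reflect:
  fixes f :: "'a::euclidean_space \<Rightarrow> 'b::{banach,second_countable_topology}"
  assumes [measurable]: "f \<in> borel_measurable borel"
  shows "integrable lborel (\<lambda>x. f (- x)) \<longleftrightarrow> integrable lborel f"
    and "(\<integral>x. f (- x) \<partial>lborel) = (\<integral>x. f x \<partial>lborel)"
proof -
  have eq: "lborel = distr lborel borel (\<lambda>x::'a. - x)"
    using lborel_affine[of "-1" "0::'a"] by (simp add: density_1)
  show "integrable lborel (\<lambda>x. f (- x)) \<longleftrightarrow> integrable lborel f"
    by (subst (2) eq, subst integrable_distr_eq) auto
  show "(\<integral>x. f (- x) \<partial>lborel) = (\<integral>x. f x \<partial>lborel)"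
    by (subst (2) eq, subst integral_distr) auto
qed

text \<open>Pairing with a sum of packets shows that \<open>u\<close> has the expected mass on the expected ball,
  and the local \<open>L\<^sup>2\<close> bound shows that this mass cannot be concentrated on a smaller set.\<close>

lemma dispersion_lower_bound:
  fixes e :: "real^'n" and s \<eta> c0 K a :: real and \<omega> :: "real^'n \<Rightarrow> real"
  assumes s: "s > 0" "s \<noteq> 1" and eta: "0 < \<eta>" "\<eta> \<le> 1 / 2" and c0: "c0 > 0" and e: "norm e = 1"
    and meas [measurable]: "\<omega> \<in> borel_measurable borel"
    and om1: "\<And>y. \<bar>\<omega> y\<bar> \<le> 1" and a: "a > 0" and omK: "\<And>y. \<bar>\<omega> y\<bar> \<le> K * exp (- a * (norm y)\<^sup>2)"
    and om0: "\<And>y. norm (y - e) \<le> \<eta> \<Longrightarrow> c0 \<le> \<omega> y"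
  shows "\<exists>b>0. \<exists>c>0. \<exists>D>0. \<forall>R\<ge>1. ennreal (c * R powr (real CARD('n) * (s - 1))) \<le>
    emeasure lborel {x. norm x \<le> D * R powr (s - 1) \<and> b * R powr (real CARD('n) - real CARD('n) * s / 2)
      \<le> norm (\<integral>\<xi>. cis (x \<bullet> \<xi>) * (cis (phase s \<xi>) * complex_of_real (\<omega> (\<xi> /\<^sub>R R))) \<partial>lborel)}"
proof -
  let ?n = "CARD('n)"
  obtain v :: "real \<Rightarrow> real^'n \<Rightarrow> complex" and C where C: "C > 0" and
    vint: "\<And>R. R \<ge> 1 \<Longrightarrow> integrable lborel (v R)" and
    vsup: "\<And>R x. R \<ge> 1 \<Longrightarrow> norm (v R x) \<le> C" and
    vL1: "\<And>R. R \<ge> 1 \<Longrightarrow> (\<integral>x. norm (v R x) \<partial>lborel) \<le> C * R powr (real ?n * (s - 1))" and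
    vpair: "\<And>R W. R \<ge> 1 \<Longrightarrow> W \<in> borel_measurable borel \<Longrightarrow> (\<forall>\<xi>. norm (W \<xi>) \<le> 1) \<Longrightarrow>
        (\<forall>\<xi>. norm (\<xi> - R *\<^sub>R e) \<le> \<eta> * R \<longrightarrow> c0 \<le> Re (W \<xi>) \<and> \<bar>Im (W \<xi>)\<bar> \<le> c0 / 8) \<Longrightarrow>
        R powr (real ?n * s / 2) / C \<le> Re (\<integral>\<xi>. W \<xi> * (cis (phase s \<xi>) * fourier (v R) \<xi>) \<partial>lborel)" and
    vtail: "\<And>\<delta>. \<delta> > 0 \<Longrightarrow> \<exists>D>0. \<forall>R\<ge>1. (\<integral>x. norm (v R x) * indicator {x. norm x > D * R powr (s - 1)} x \<partial>lborel)
      \<le> \<delta> * R powr (real ?n * s / 2 - real ?n)"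
    using packets_exist[OF s eta c0 e] by blast
  have K: "K > 0"
  proof -
    have "0 < c0" by (rule c0)
    also have "c0 \<le> \<omega> e" using om0[of e] eta by simp
    also have "\<dots> \<le> K * exp (- a * (norm e)\<^sup>2)" using omK[of e] by simp
    finally show ?thesis by (simp add: zero_less_mult_iff)
  qed
  define M where "M = K * sqrt (pi / a) ^ ?n"
  have M: "M > 0" using K a by (simp add: M_def)
  \<comment> \<open>The pairing with the packets is at least Y/C with Y = R^(ns/2). By the choice of
    \<delta>, b and t, the tail of the packets, the small values and the large values of u
    contribute at most Y/(4C) each. The last quarter must come from the set E, and c is the measure
    that this forces.\<close>
  define \<delta> where "\<delta> = 1 / (4 * C * M)"
  define b where "b = 1 / (4 * C * C)"
  define t where "t = 4 * C * C * exp 1 * M * (2 * pi) ^ ?n"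
  define c where "c = 1 / (4 * C * C * t)"
  have pos: "\<delta> > 0" "b > 0" "t > 0" "c > 0" using C M by (auto simp: \<delta>_def b_def t_def c_def)
  obtain D where D: "D > 0" "\<And>R. R \<ge> 1 \<Longrightarrow> (\<integral>x. norm (v R x) * indicator {x. norm x > D * R powr (s - 1)} x \<partial>lborel)
      \<le> \<delta> * R powr (real ?n * s / 2 - real ?n)"
    using vtail[OF pos(1)] by blast
  show ?thesis
  proof (rule exI[of _ b], intro conjI pos(2), rule exI[of _ c], intro conjI pos(4), rule exI[of _ D],
      intro conjI D(1) allI impI)
    fix R :: real assume R: "R \<ge> 1"
    define w where "w \<xi> = cis (phase s \<xi>) * complex_of_real (\<omega> (\<xi> /\<^sub>R R))" for \<xi> :: "real^'n"
    define u where "u x = (\<integral>\<xi>. cis (x \<bullet> \<xi>) * w \<xi> \<partial>lborel)" for x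
    define u0 where "u0 = R powr (real ?n - real ?n * s / 2)"
    define r where "r = D * R powr (s - 1)"
    define E where "E = {x. norm x \<le> r \<and> b * u0 \<le> norm (u x)}"
    have u0: "u0 > 0" and r: "r > 0" using R D by (auto simp: u0_def r_def)
    have [measurable]: "w \<in> borel_measurable borel" unfolding w_def phase_def by measurable
    have [measurable]: "u \<in> borel_measurable borel" unfolding u_def by measurable
    have [measurable]: "v R \<in> borel_measurable borel" using borel_measurable_integrable[OF vint[OF R]] by simp
    have wle: "norm (w \<xi>) \<le> K * exp (- (a / R\<^sup>2) * (norm (\<xi> - 0))\<^sup>2)" for \<xi>
      using omK[of "\<xi> /\<^sub>R R"] R by (simp add: w_def norm_mult power_mult_distrib field_simps)
    have w1: "norm (w \<xi>) \<le> 1" for \<xi> using om1 by (simp add: w_def norm_mult)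
    have aR: "a / R\<^sup>2 > 0" using a R by simp
    note gK = integrable_mult_right[OF gaussian_integral(1)[OF aR, of "0::real^'n"], of K]
    have wint: "integrable lborel w"
      by (rule Bochner_Integration.integrable_bound[OF gK]) (use wle in \<open>auto intro!: order_trans[OF _ abs_ge_self]\<close>)
    have wL1: "(\<integral>\<xi>. norm (w \<xi>) \<partial>lborel) \<le> M * R ^ ?n"
    proof -
      have "(\<integral>\<xi>. norm (w \<xi>) \<partial>lborel) \<le> (\<integral>\<xi>. K * exp (- (a / R\<^sup>2) * (norm (\<xi> - (0::real^'n)))\<^sup>2) \<partial>lborel)"
        by (rule integral_mono[OF integrable_norm[OF wint] gK wle])
      also have "\<dots> = K * sqrt (pi / (a / R\<^sup>2)) ^ ?n"
        unfolding integral_mult_right_zero gaussian_integral(2)[OF aR] by simp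
      also have "sqrt (pi / (a / R\<^sup>2)) = sqrt (pi / a) * R" using R by (simp add: real_sqrt_mult real_sqrt_divide)
      finally show ?thesis by (simp add: M_def power_mult_distrib mult_ac)
    qed
    have uM: "norm (u x) \<le> M * R ^ ?n" for x
      unfolding u_def using fourier_integral_bound[of x w] wL1 by linarith
    have vrint: "integrable lborel (\<lambda>x. v R (- x))" using vint[OF R] by (simp add: lborel_integral_reflect(1))
    \<comment> \<open>Reflecting the packets turns e^(ix\<bullet>\<xi>) into the kernel of their
      Fourier transform. The pairing then has the form treated in \<open>packets_exist\<close>, with
      W = \<omega>(\<xi>/R).\<close>
    have J: "(\<integral>x. u x * v R (- x) \<partial>lborel) = (\<integral>\<xi>. complex_of_real (\<omega> (\<xi> /\<^sub>R R)) * (cis (phase s \<xi>) * fourier (v R) \<xi>) \<partial>lborel)"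
    proof -
      have "(\<integral>x. cis (x \<bullet> \<xi>) * v R (- x) \<partial>lborel) = fourier (v R) \<xi>" for \<xi>
        unfolding fourier_eq_cis
        by (subst lborel_integral_reflect(2)[symmetric]) (auto simp: inner_commute mult.commute)
      then show ?thesis
        using fourier_pairing[OF wint vrint] unfolding u_def w_def by (simp only: mult_ac)
    qed
    have "R powr (real ?n * s / 2) / C \<le> Re (\<integral>x. u x * v R (- x) \<partial>lborel)"
      unfolding J
    proof (rule vpair[OF R])
      show "\<forall>\<xi>. norm (\<xi> - R *\<^sub>R e) \<le> \<eta> * R \<longrightarrow>
        c0 \<le> Re (complex_of_real (\<omega> (\<xi> /\<^sub>R R))) \<and> \<bar>Im (complex_of_real (\<omega> (\<xi> /\<^sub>R R)))\<bar> \<le> c0 / 8"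
      proof (intro allI impI conjI)
        fix \<xi> assume \<xi>: "norm (\<xi> - R *\<^sub>R e) \<le> \<eta> * R"
        have "\<xi> /\<^sub>R R - e = (\<xi> - R *\<^sub>R e) /\<^sub>R R" using R by (simp add: scaleR_diff_right)
        then have "norm (\<xi> /\<^sub>R R - e) = norm (\<xi> - R *\<^sub>R e) / R" using R by (simp add: divide_inverse mult.commute)
        also have "\<dots> \<le> \<eta>" using \<xi> R by (simp add: divide_le_eq)
        finally show "c0 \<le> Re (complex_of_real (\<omega> (\<xi> /\<^sub>R R)))" using om0 by simp
      qed (use c0 in simp)
    qed (use om1 in \<open>auto\<close>)
    also have "\<dots> \<le> norm (\<integral>x. u x * v R (- x) \<partial>lborel)" by (rule complex_Re_le_cmod)
    also have "\<dots> \<le> (\<integral>x. norm (u x * v R (- x)) \<partial>lborel)" by (rule integral_norm_bound)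
    finally have low: "R powr (real ?n * s / 2) / C \<le> (\<integral>x. norm (u x) * norm (v R (- x)) \<partial>lborel)"
      by (simp add: norm_mult)
    \<comment> \<open>With this weight at least 1/e on the ball of radius r, the local L^2 bound
      costs the factor \<open>exp 1\<close>.\<close>
    define \<epsilon> where "\<epsilon> = 1 / r\<^sup>2"
    have eps: "\<epsilon> > 0" using r by (simp add: \<epsilon>_def)
    note L2 = gaussian_weighted_L2[OF wint w1 eps, folded u_def]
    \<comment> \<open>In order: the tail of the packets, small u, u of the right size on E, and
      large u, where |u| \<le> |u|^2 / (t u0) brings in the L^2 bound.\<close>
    let ?T1 = "\<lambda>x. M * R ^ ?n * (norm (v R (- x)) * indicator {x. norm x > r} (- x))"
    let ?T2 = "\<lambda>x. b * u0 * norm (v R (- x))"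
    let ?T3 = "\<lambda>x. t * u0 * C * indicator E x"
    let ?T4 = "\<lambda>x. C * exp 1 / (t * u0) * ((norm (u x))\<^sup>2 * exp (- \<epsilon> * (norm x)\<^sup>2))"
    have Em [measurable]: "E \<in> sets lborel" unfolding E_def by measurable
    have Efin: "emeasure lborel E < \<infinity>"
    proof (rule order.strict_trans1)
      show "emeasure lborel E \<le> emeasure lborel (cball (0::real^'n) r)"
        by (intro emeasure_mono) (auto simp: E_def)
      show "emeasure lborel (cball (0::real^'n) r) < \<infinity>" using emeasure_bounded_finite[of "cball (0::real^'n) r"] by auto
    qed
    have pt: "norm (u x) * norm (v R (- x)) \<le> ?T1 x + ?T2 x + ?T3 x + ?T4 x" for x
    proof -
      have nn: "0 \<le> ?T1 x" "0 \<le> ?T2 x" "0 \<le> ?T3 x" "0 \<le> ?T4 x"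
        using M R pos u0 C by (auto simp: indicator_def)
      consider "norm x > r" | "norm x \<le> r" "norm (u x) < b * u0"
        | "norm x \<le> r" "b * u0 \<le> norm (u x)" "norm (u x) \<le> t * u0"
        | "norm x \<le> r" "t * u0 < norm (u x)" by linarith
      then show ?thesis
      proof cases
        case 1
        then have "norm (u x) * norm (v R (- x)) \<le> ?T1 x" using uM[of x] by (simp add: mult_right_mono)
        with nn show ?thesis by linarith
      next
        case 2
        then have "norm (u x) * norm (v R (- x)) \<le> ?T2 x" by (intro mult_right_mono) auto
        with nn show ?thesis by linarith
      next
        case 3
        then have "norm (u x) * norm (v R (- x)) \<le> t * u0 * C" using vsup[OF R] pos u0 by (intro mult_mono) auto
        also have "\<dots> = ?T3 x" using 3 by (simp add: E_def)
        finally show ?thesis using nn by linarith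
      next
        case 4
        have "(norm x)\<^sup>2 \<le> r\<^sup>2" using 4(1) by (intro power_mono) auto
        then have "\<epsilon> * (norm x)\<^sup>2 \<le> 1" using r by (simp add: \<epsilon>_def divide_le_eq)
        then have ex: "1 \<le> exp 1 * exp (- \<epsilon> * (norm x)\<^sup>2)" by (simp flip: exp_add)
        have "norm (u x) \<le> (norm (u x))\<^sup>2 / (t * u0)"
          using 4(2) pos u0 by (simp add: pos_le_divide_eq power2_eq_square mult_left_mono)
        then have "norm (u x) * norm (v R (- x)) \<le> (norm (u x))\<^sup>2 / (t * u0) * C"
          using vsup[OF R] by (intro mult_mono) (use pos u0 in auto)
        also have "\<dots> \<le> (norm (u x))\<^sup>2 / (t * u0) * C * (exp 1 * exp (- \<epsilon> * (norm x)\<^sup>2))"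
          using mult_left_mono[OF ex, of "(norm (u x))\<^sup>2 / (t * u0) * C"] pos u0 C by simp
        also have "\<dots> = ?T4 x" by simp
        finally show ?thesis using nn by linarith
      qed
    qed
    have int2: "integrable lborel (\<lambda>x. norm (v R (- x)))" "(\<integral>x. norm (v R (- x)) \<partial>lborel) \<le> C * R powr (real ?n * (s - 1))"
      using integrable_norm[OF vrint] lborel_integral_reflect(2)[of "\<lambda>x. norm (v R x)"] vL1[OF R] by auto
    have int1: "integrable lborel (\<lambda>x. norm (v R (- x)) * indicator {x. norm x > r} (- x))"
      "(\<integral>x. norm (v R (- x)) * indicator {x. norm x > r} (- x) \<partial>lborel) \<le> \<delta> * R powr (real ?n * s / 2 - real ?n)"
    proof -
      show "integrable lborel (\<lambda>x. norm (v R (- x)) * indicator {x. norm x > r} (- x))"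
        by (rule Bochner_Integration.integrable_bound[OF int2(1)]) (auto simp: indicator_def)
      show "(\<integral>x. norm (v R (- x)) * indicator {x. norm x > r} (- x) \<partial>lborel) \<le> \<delta> * R powr (real ?n * s / 2 - real ?n)"
        using lborel_integral_reflect(2)[of "\<lambda>x. norm (v R x) * indicator {x. norm x > r} x"] D(2)[OF R]
        unfolding r_def by simp
    qed
    have int3: "integrable lborel (indicator E :: _ \<Rightarrow> real)" using Efin Em by (simp add: integrable_indicator_iff)
    note ints = integrable_mult_right[OF int1(1), of "M * R ^ ?n"] integrable_mult_right[OF int2(1), of "b * u0"]
      integrable_mult_right[OF int3, of "t * u0 * C"] integrable_mult_right[OF L2(1), of "C * exp 1 / (t * u0)"]
    have "(\<integral>x. norm (u x) * norm (v R (- x)) \<partial>lborel) \<le> (\<integral>x. ?T1 x + ?T2 x + ?T3 x + ?T4 x \<partial>lborel)"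
    proof (rule integral_mono')
      show "integrable lborel (\<lambda>x. ?T1 x + ?T2 x + ?T3 x + ?T4 x)"
        by (intro Bochner_Integration.integrable_add ints)
      show "0 \<le> ?T1 x + ?T2 x + ?T3 x + ?T4 x" for x using pt[of x] by (meson norm_ge_zero mult_nonneg_nonneg order_trans)
    qed (rule pt)
    also have "\<dots> = (\<integral>x. ?T1 x \<partial>lborel) + (\<integral>x. ?T2 x \<partial>lborel) + (\<integral>x. ?T3 x \<partial>lborel) + (\<integral>x. ?T4 x \<partial>lborel)"
      by (simp only: Bochner_Integration.integral_add ints Bochner_Integration.integrable_add)
    finally have up: "(\<integral>x. norm (u x) * norm (v R (- x)) \<partial>lborel)
      \<le> (\<integral>x. ?T1 x \<partial>lborel) + (\<integral>x. ?T2 x \<partial>lborel) + (\<integral>x. ?T3 x \<partial>lborel) + (\<integral>x. ?T4 x \<partial>lborel)" .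
    let ?Y = "R powr (real ?n * s / 2)"
    have Rn: "R ^ ?n = R powr real ?n" using R by (simp add: powr_realpow)
    have Y1: "(\<integral>x. ?T1 x \<partial>lborel) \<le> ?Y / (4 * C)"
    proof -
      have "(\<integral>x. ?T1 x \<partial>lborel) \<le> M * R ^ ?n * (\<delta> * R powr (real ?n * s / 2 - real ?n))"
        unfolding integral_mult_right_zero using M R by (intro mult_left_mono int1(2)) auto
      also have "\<dots> = M * \<delta> * (R powr real ?n * R powr (real ?n * s / 2 - real ?n))" unfolding Rn by (simp only: mult_ac)
      also have "R powr real ?n * R powr (real ?n * s / 2 - real ?n) = ?Y" by (simp flip: powr_add)
      finally show ?thesis using C M by (simp add: \<delta>_def)
    qed
    have Y2: "(\<integral>x. ?T2 x \<partial>lborel) \<le> ?Y / (4 * C)"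
    proof -
      have "(\<integral>x. ?T2 x \<partial>lborel) \<le> b * u0 * (C * R powr (real ?n * (s - 1)))"
        unfolding integral_mult_right_zero using pos u0 by (intro mult_left_mono int2(2)) auto
      also have "\<dots> = b * C * (u0 * R powr (real ?n * (s - 1)))" by (simp only: mult_ac)
      also have "u0 * R powr (real ?n * (s - 1)) = ?Y"
        unfolding u0_def by (simp add: algebra_simps flip: powr_add)
      finally show ?thesis using C by (simp add: b_def)
    qed
    have Y4: "(\<integral>x. ?T4 x \<partial>lborel) \<le> ?Y / (4 * C)"
    proof -
      have "(\<integral>x. (norm (u x))\<^sup>2 * exp (- \<epsilon> * (norm x)\<^sup>2) \<partial>lborel) \<le> M * R ^ ?n * (2 * pi) ^ ?n"
      proof -
        have "(\<integral>\<xi>. norm (w \<xi>) \<partial>lborel) * (2 * pi) ^ ?n \<le> M * R ^ ?n * (2 * pi) ^ ?n"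
          by (intro mult_right_mono wL1) simp
        with L2(2) show ?thesis unfolding mult_1_left DIM_cart DIM_real mult_1_right by (rule order_trans)
      qed
      then have "(\<integral>x. ?T4 x \<partial>lborel) \<le> C * exp 1 / (t * u0) * (M * R ^ ?n * (2 * pi) ^ ?n)"
        unfolding integral_mult_right_zero using pos u0 C by (intro mult_left_mono) auto
      also have "\<dots> = (C * exp 1 * M * (2 * pi) ^ ?n / t) * (R powr real ?n / u0)" unfolding Rn by simp
      also have "R powr real ?n / u0 = ?Y" unfolding u0_def using R by (simp flip: powr_diff)
      finally show ?thesis using C M by (simp add: t_def)
    qed
    have Y3: "(\<integral>x. ?T3 x \<partial>lborel) = t * u0 * C * measure lborel E" by simp
    have "?Y / (4 * C) \<le> t * u0 * C * measure lborel E"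
    proof -
      have "?Y / C = 4 * (?Y / (4 * C))" by simp
      then show ?thesis using low up Y1 Y2 Y3 Y4 by linarith
    qed
    then have "?Y / (4 * C) / (t * u0 * C) \<le> measure lborel E"
      using pos u0 C by (simp add: pos_divide_le_eq mult_ac)
    moreover have "?Y / (4 * C) / (t * u0 * C) = c * (?Y / u0)" by (simp add: c_def)
    moreover have "?Y / u0 = R powr (real ?n * (s - 1))"
      unfolding u0_def using R by (simp add: algebra_simps flip: powr_diff)
    ultimately have "c * R powr (real ?n * (s - 1)) \<le> measure lborel E" by simp
    then have "ennreal (c * R powr (real ?n * (s - 1))) \<le> emeasure lborel E"
      using Efin by (simp add: emeasure_eq_ennreal_measure)
    then show "ennreal (c * R powr (real ?n * (s - 1))) \<le>
      emeasure lborel {x. norm x \<le> D * R powr (s - 1) \<and> b * R powr (real ?n - real ?n * s / 2)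
      \<le> norm (\<integral>\<xi>. cis (x \<bullet> \<xi>) * (cis (phase s \<xi>) * complex_of_real (\<omega> (\<xi> /\<^sub>R R))) \<partial>lborel)}"
      unfolding E_def u_def w_def u0_def r_def .
  qed
qed

section \<open>Norm estimates\<close>

lemma ennreal_powr_ennreal: "x \<ge> 0 \<Longrightarrow> ennreal_powr (ennreal x) a = ennreal (x powr a)"
  by (simp add: ennreal_powr_def)

lemma ennreal_powr_mono:
  assumes "u \<le> v" "a \<ge> 0"
  shows "ennreal_powr u a \<le> ennreal_powr v a"
proof (cases "v = \<infinity>")
  case False
  then have "u \<noteq> \<infinity>" using assms(1) by (auto simp: top_unique)
  then show ?thesis using False assms
    by (auto simp: ennreal_powr_def top.not_eq_extremum intro!: ennreal_leI powr_mono2 enn2real_mono)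
qed (simp add: ennreal_powr_def)

lemma ennreal_powr_one [simp]: "ennreal_powr u 1 = u"
  by (cases u) (auto simp: ennreal_powr_def)

lemma enn2real_one_divide: "P > 0 \<Longrightarrow> enn2real (1 / ennreal P) = 1 / P"
  by (simp add: divide_ennreal[of 1, simplified])

text \<open>Interpolation between L^1 and L^\<infinity>, from |f|^P \<le> K^(P-1) |f|. K is the
  height of f and V the volume of its essential support.\<close>

lemma Lp_norm_le:
  fixes f :: "'a::euclidean_space \<Rightarrow> complex"
  assumes [measurable]: "f \<in> borel_measurable borel" and p: "1 \<le> p" and K: "K > 0" and V: "V > 0"
    and sup: "\<And>x. norm (f x) \<le> K" and L1: "(\<integral>\<^sup>+x. ennreal (norm (f x)) \<partial>lborel) \<le> ennreal (K * V)"
  shows "Lp_norm p f \<le> ennreal (K * V powr enn2real (1 / p))"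
proof (cases p)
  case top
  have "esssup lborel (\<lambda>x. ennreal (norm (f x))) \<le> ennreal K"
    by (rule esssup_I) (auto intro!: ennreal_leI sup)
  then show ?thesis using top V by (simp add: Lp_norm_def Lp_norm_nonneg_def)
next
  case (real P)
  then have P: "P \<ge> 1" using p by (simp add: ennreal_ge_1)
  have "(\<integral>\<^sup>+x. ennreal_powr (ennreal (norm (f x))) P \<partial>lborel) \<le> (\<integral>\<^sup>+x. ennreal (K powr (P - 1)) * ennreal (norm (f x)) \<partial>lborel)"
  proof (rule nn_integral_mono)
    fix x
    have "norm (f x) powr P = norm (f x) powr (P - 1) * norm (f x)"
      by (cases "f x = 0") (simp_all add: powr_diff)
    also have "\<dots> \<le> K powr (P - 1) * norm (f x)"
      using P sup by (intro mult_right_mono powr_mono2) auto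
    finally show "ennreal_powr (ennreal (norm (f x))) P \<le> ennreal (K powr (P - 1)) * ennreal (norm (f x))"
      by (simp add: ennreal_powr_ennreal ennreal_leI flip: ennreal_mult)
  qed
  also have "\<dots> = ennreal (K powr (P - 1)) * (\<integral>\<^sup>+x. ennreal (norm (f x)) \<partial>lborel)"
    by (rule nn_integral_cmult) simp
  also have "\<dots> \<le> ennreal (K powr (P - 1)) * ennreal (K * V)" by (rule mult_left_mono[OF L1]) simp
  also have "\<dots> = ennreal (K powr P * V)"
    using K V by (simp add: powr_diff flip: ennreal_mult)
  finally have "ennreal_powr (\<integral>\<^sup>+x. ennreal_powr (ennreal (norm (f x))) P \<partial>lborel) (1 / P) \<le> ennreal_powr (ennreal (K powr P * V)) (1 / P)"
    using P by (intro ennreal_powr_mono) auto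
  also have "\<dots> = ennreal (K * V powr (1 / P))"
    using K V P by (simp add: ennreal_powr_ennreal powr_mult powr_powr)
  finally show ?thesis
    using real P by (simp add: Lp_norm_def Lp_norm_nonneg_def enn2real_one_divide)
qed

text \<open>Chebyshev's inequality. Exponents r < 1 are included, as 1/r = 1/p + 1/q may exceed
  1.\<close>

lemma Lp_norm_ge:
  fixes f :: "'a::euclidean_space \<Rightarrow> complex"
  assumes r: "0 < r" "r < \<infinity>" and E: "E \<in> sets lborel" and mu: "\<mu> > 0" "ennreal \<mu> \<le> emeasure lborel E"
    and tau: "\<tau> > 0" "\<And>x. x \<in> E \<Longrightarrow> \<tau> \<le> norm (f x)"
  shows "ennreal (\<tau> * \<mu> powr enn2real (1 / r)) \<le> Lp_norm r f"
proof (cases r)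
  case (real P)
  then have P: "P > 0" using r by (simp add: ennreal_less_zero_iff)
  have "ennreal (\<tau> powr P * \<mu>) \<le> ennreal (\<tau> powr P) * emeasure lborel E"
    using mu tau by (simp add: ennreal_mult mult_left_mono)
  also have "\<dots> = (\<integral>\<^sup>+x. ennreal (\<tau> powr P) * indicator E x \<partial>lborel)"
    by (rule nn_integral_cmult_indicator[symmetric]) (rule E)
  also have "\<dots> \<le> (\<integral>\<^sup>+x. ennreal_powr (ennreal (norm (f x))) P \<partial>lborel)"
    using tau P by (intro nn_integral_mono)
      (auto simp: ennreal_powr_ennreal indicator_def intro!: ennreal_leI powr_mono2)
  finally have "ennreal_powr (ennreal (\<tau> powr P * \<mu>)) (1 / P)
      \<le> ennreal_powr (\<integral>\<^sup>+x. ennreal_powr (ennreal (norm (f x))) P \<partial>lborel) (1 / P)"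
    using P by (intro ennreal_powr_mono) auto
  moreover have "ennreal_powr (ennreal (\<tau> powr P * \<mu>)) (1 / P) = ennreal (\<tau> * \<mu> powr (1 / P))"
    using mu tau P by (simp add: ennreal_powr_ennreal powr_mult powr_powr)
  ultimately show ?thesis
    using real P by (simp add: Lp_norm_def Lp_norm_nonneg_def enn2real_one_divide)
qed (use r in simp)

text \<open>The mean of \<open>hardy_bump R\<close> is zero, so that its Hardy norm for \<open>p = 1\<close> is finite.\<close>

definition hardy_bump :: "real \<Rightarrow> real^'n \<Rightarrow> complex" where
  "hardy_bump R x = complex_of_real (R ^ CARD('n) *
    (2 ^ CARD('n) * exp (- (4 * R\<^sup>2) * (norm x)\<^sup>2) - exp (- R\<^sup>2 * (norm x)\<^sup>2)))"

section \<open>The bump of mean zero: Fourier transform and Hardy norm\<close>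

lemma gauss_poly_gaussian: "c > 0 \<Longrightarrow> gauss_poly (\<lambda>x. complex_of_real (exp (- c * (norm x)\<^sup>2)))"
  using gauss_poly.gauss[of c 0 0] by (simp add: power2_norm_eq_inner exp_of_real flip: of_real_minus of_real_mult)

lemma gauss_poly_hardy_bump:
  assumes R: "R > 0"
  shows "gauss_poly (hardy_bump R)"
proof -
  have eq: "hardy_bump R = (\<lambda>x::real^'n. complex_of_real (R ^ CARD('n) * 2 ^ CARD('n)) * complex_of_real (exp (- (4 * R\<^sup>2) * (norm x)\<^sup>2))
    + complex_of_real (- (R ^ CARD('n))) * complex_of_real (exp (- (R\<^sup>2) * (norm x)\<^sup>2)))"
    by (simp add: hardy_bump_def fun_eq_iff algebra_simps)
  show ?thesis unfolding eq
    by (intro gauss_poly.add gauss_poly.cmult gauss_poly_gaussian) (use R in simp_all)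
qed

lemma gaussian_fourier_transform:
  assumes c: "c > 0"
  shows "integrable lborel (\<lambda>x::real^'n. complex_of_real (exp (- c * (norm x)\<^sup>2)))"
    and "fourier (\<lambda>x::real^'n. complex_of_real (exp (- c * (norm x)\<^sup>2))) \<xi>
      = complex_of_real (sqrt (pi / c) ^ CARD('n) * exp (- (1 / (4 * c)) * (norm \<xi>)\<^sup>2))"
  using gaussian_fourier(1)[OF c, of "0::real^'n"] gaussian_fourier(2)[OF c, of "- \<xi>"]
  by (simp_all add: fourier_eq_cis)

lemma fourier_hardy_bump:
  assumes R: "R > 0"
  shows "integrable lborel (hardy_bump R :: real^'n \<Rightarrow> complex)"
    and "fourier (hardy_bump R) (\<xi> :: real^'n) = complex_of_real (sqrt pi ^ CARD('n) *
      (exp (- (1 / 16) * (norm (\<xi> /\<^sub>R R))\<^sup>2) - exp (- (1 / 4) * (norm (\<xi> /\<^sub>R R))\<^sup>2)))"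
proof -
  let ?n = "CARD('n)"
  let ?g = "\<lambda>c (x::real^'n). complex_of_real (exp (- c * (norm x)\<^sup>2))"
  have R2: "4 * R\<^sup>2 > 0" "R\<^sup>2 > 0" using R by auto
  note G = gaussian_fourier_transform[where 'n = 'n]
  have eq: "hardy_bump R x = of_real (R ^ ?n * 2 ^ ?n) * ?g (4 * R\<^sup>2) x - of_real (R ^ ?n) * ?g (R\<^sup>2) x" for x
    by (simp add: hardy_bump_def algebra_simps)
  show "integrable lborel (hardy_bump R :: real^'n \<Rightarrow> complex)"
    unfolding eq[abs_def] by (intro Bochner_Integration.integrable_diff integrable_mult_right G(1) R2)
  have int: "integrable lborel (\<lambda>x. ?g c x * cis (- \<xi> \<bullet> x))" if "c > 0" for c
    by (rule gaussian_fourier(1)[OF that])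
  have "fourier (hardy_bump R) \<xi> = (\<integral>x. of_real (R ^ ?n * 2 ^ ?n) * (?g (4 * R\<^sup>2) x * cis (- \<xi> \<bullet> x))
      - of_real (R ^ ?n) * (?g (R\<^sup>2) x * cis (- \<xi> \<bullet> x)) \<partial>lborel)"
    unfolding fourier_eq_cis eq by (simp only: left_diff_distrib mult.assoc)
  also have "\<dots> = of_real (R ^ ?n * 2 ^ ?n) * fourier (?g (4 * R\<^sup>2)) \<xi> - of_real (R ^ ?n) * fourier (?g (R\<^sup>2)) \<xi>"
    unfolding fourier_eq_cis
    by (subst Bochner_Integration.integral_diff[OF integrable_mult_right[OF int[OF R2(1)]] integrable_mult_right[OF int[OF R2(2)]]])
       (simp only: integral_mult_right_zero)
  also have "\<dots> = complex_of_real ((R * 2 * sqrt (pi / (4 * R\<^sup>2))) ^ ?n * exp (- (1 / (4 * (4 * R\<^sup>2))) * (norm \<xi>)\<^sup>2)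
      - (R * sqrt (pi / R\<^sup>2)) ^ ?n * exp (- (1 / (4 * R\<^sup>2)) * (norm \<xi>)\<^sup>2))"
    unfolding G(2)[OF R2(1)] G(2)[OF R2(2)] by (simp add: power_mult_distrib)
  also have "R * 2 * sqrt (pi / (4 * R\<^sup>2)) = sqrt pi"
    using R by (simp add: real_sqrt_divide real_sqrt_mult)
  also have "R * sqrt (pi / R\<^sup>2) = sqrt pi"
    using R by (simp add: real_sqrt_divide)
  also have "- (1 / (4 * (4 * R\<^sup>2))) * (norm \<xi>)\<^sup>2 = - (1 / 16) * (norm (\<xi> /\<^sub>R R))\<^sup>2"
    using R by (simp add: power_mult_distrib field_simps)
  also have "- (1 / (4 * R\<^sup>2)) * (norm \<xi>)\<^sup>2 = - (1 / 4) * (norm (\<xi> /\<^sub>R R))\<^sup>2"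
    using R by (simp add: power_mult_distrib field_simps)
  finally show "fourier (hardy_bump R) \<xi> = complex_of_real (sqrt pi ^ ?n *
      (exp (- (1 / 16) * (norm (\<xi> /\<^sub>R R))\<^sup>2) - exp (- (1 / 4) * (norm (\<xi> /\<^sub>R R))\<^sup>2)))"
    by (simp add: right_diff_distrib)
qed

text \<open>Up to normalization this is the difference of a heat kernel at two nearby times. The
  mean value theorem in \<tau> gains a factor 1/z over either term; this is the effect of the
  vanishing mean, and it makes the maximal function integrable. With j in place of z, a supremum
  over \<tau> is dominated by a sum over j.\<close>

lemma gaussian_difference_bound:
  fixes X \<tau> :: real
  assumes tau: "\<tau> \<ge> 1 / 4" and X: "X \<ge> 0"
  shows "\<exists>j::nat. \<bar>\<tau> powr (- real n / 2) * exp (- X / \<tau>) - (\<tau> + 3 / 4) powr (- real n / 2) * exp (- X / (\<tau> + 3 / 4))\<bar>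
    \<le> (real n + 2) * 2 ^ (n + 2) * ((1 / 2) ^ j) ^ (n + 2) * exp (- X / (2 * 4 ^ j))"
proof -
  let ?q = "\<lambda>\<tau>. \<tau> powr (- real n / 2) * exp (- X / \<tau>)"
  let ?q' = "\<lambda>\<tau>. (- real n / 2 * \<tau> powr (- real n / 2 - 1)) * exp (- X / \<tau>) + exp (- X / \<tau>) * (X / \<tau>\<^sup>2) * \<tau> powr (- real n / 2)"
  have "\<exists>z>\<tau>. z < \<tau> + 3 / 4 \<and> ?q (\<tau> + 3 / 4) - ?q \<tau> = (\<tau> + 3 / 4 - \<tau>) * ?q' z"
  proof (rule MVT2)
    fix x assume "\<tau> \<le> x" "x \<le> \<tau> + 3 / 4"
    then have x: "x > 0" using tau by linarith
    have "((\<lambda>x. - X / x) has_real_derivative X / x\<^sup>2) (at x)"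
      using x by (auto intro!: derivative_eq_intros simp: power2_eq_square)
    then show "(?q has_real_derivative ?q' x) (at x)"
      by (intro DERIV_mult has_real_derivative_powr x DERIV_fun_exp)
  qed simp
  then obtain z where z: "z > \<tau>" "?q (\<tau> + 3 / 4) - ?q \<tau> = 3 / 4 * ?q' z" by auto
  have z4: "z > 1 / 4" using z tau by linarith
  let ?y = "X / z"
  have y0: "?y \<ge> 0" using X z4 by simp
  have "?q' z = z powr (- real n / 2 - 1) * exp (- ?y) * (?y - real n / 2)"
  proof -
    define a where "a = - real n / 2"
    have "z powr a = z * z powr (a - 1)" using z4 by (simp add: powr_diff)
    then have "a * z powr (a - 1) * exp (- ?y) + exp (- ?y) * (X / z\<^sup>2) * z powr a
        = z powr (a - 1) * exp (- ?y) * (?y + a)"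
      using z4 by (simp add: power2_eq_square algebra_simps)
    then show ?thesis by (simp add: a_def)
  qed
  then have "\<bar>?q' z\<bar> = z powr (- real n / 2 - 1) * exp (- ?y) * \<bar>?y - real n / 2\<bar>" by (simp only: abs_mult) simp
  also have "\<dots> \<le> z powr (- real n / 2 - 1) * exp (- ?y) * (?y + real n / 2)"
  proof (intro mult_left_mono)
    show "\<bar>?y - real n / 2\<bar> \<le> ?y + real n / 2" using y0 by linarith
  qed simp
  also have "\<dots> = z powr (- real n / 2 - 1) * (?y * exp (- ?y) + real n / 2 * exp (- ?y))" by (simp add: algebra_simps)
  also have "\<dots> \<le> z powr (- real n / 2 - 1) * ((real n / 2 + 2) * exp (- ?y / 2))"
  proof (intro mult_left_mono)
    have "?y / 2 \<le> exp (?y / 2)" using exp_ge_add_one_self[of "?y / 2"] by linarith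
    then have "?y * exp (- ?y) \<le> 2 * exp (?y / 2) * exp (- ?y)" by (intro mult_right_mono) auto
    also have "\<dots> = 2 * exp (- ?y / 2)" by (simp flip: exp_add)
    finally have 1: "?y * exp (- ?y) \<le> 2 * exp (- ?y / 2)" .
    have "real n / 2 * exp (- ?y) \<le> real n / 2 * exp (- ?y / 2)" using y0 by (intro mult_left_mono) auto
    with 1 show "?y * exp (- ?y) + real n / 2 * exp (- ?y) \<le> (real n / 2 + 2) * exp (- ?y / 2)"
      by (simp add: distrib_right)
  qed simp
  finally have q': "\<bar>?q' z\<bar> \<le> z powr (- real n / 2 - 1) * ((real n / 2 + 2) * exp (- ?y / 2))" .
  \<comment> \<open>Rounding z up to a power of 4 costs only constants. For j = 0, where there is no
    smaller power to compare with, z > 1/4 gives the lower bound.\<close>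
  define j where "j = (LEAST j::nat. z \<le> 4 ^ j)"
  have ex: "\<exists>j::nat. z \<le> 4 ^ j" using real_arch_pow[of 4 z] by (auto intro: less_imp_le)
  have j1: "z \<le> 4 ^ j" unfolding j_def using ex by (rule LeastI_ex)
  have j2: "4 ^ j / 4 \<le> z"
  proof (cases j)
    case (Suc i)
    then have "\<not> z \<le> 4 ^ i" using not_less_Least[of i "\<lambda>j. z \<le> 4 ^ j"] by (simp add: j_def)
    then show ?thesis using Suc by simp
  qed (use z4 in simp)
  have "z powr (- real n / 2 - 1) \<le> (4 ^ j / 4) powr (- real n / 2 - 1)"
    using j2 by (intro powr_mono2') auto
  also have "(4 ^ j / 4) powr (- real n / 2 - 1) = 2 ^ (n + 2) * ((1 / 2) ^ j) ^ (n + 2)"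
  proof -
    have "(4 ^ j / 4 :: real) = ((2 ^ j / 2)\<^sup>2)" by (simp add: power_divide power2_eq_square flip: power_mult_distrib)
    also have "\<dots> = (2 ^ j / 2) powr 2" by simp
    finally have "(4 ^ j / 4 :: real) powr (- real n / 2 - 1) = (2 ^ j / 2) powr - real (n + 2)"
      by (simp only: powr_powr) (simp add: algebra_simps)
    also have "\<dots> = inverse ((2 ^ j / 2) ^ (n + 2))" by (simp only: powr_minus) (subst powr_realpow, auto)
    also have "\<dots> = (2 * (1 / 2) ^ j) ^ (n + 2)"
    proof -
      have "inverse (2 ^ j / 2 :: real) = 2 * (1 / 2) ^ j" by (simp add: power_one_over)
      then show ?thesis by (simp only: power_inverse[symmetric])
    qed
    finally show ?thesis by (simp only: power_mult_distrib)
  qed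
  finally have zj: "z powr (- real n / 2 - 1) \<le> 2 ^ (n + 2) * ((1 / 2) ^ j) ^ (n + 2)" .
  have ej: "exp (- ?y / 2) \<le> exp (- X / (2 * 4 ^ j))"
    using X z4 j1 by (simp add: frac_le)
  have "\<bar>?q \<tau> - ?q (\<tau> + 3 / 4)\<bar> = \<bar>?q (\<tau> + 3 / 4) - ?q \<tau>\<bar>" by (rule abs_minus_commute)
  also have "\<dots> = 3 / 4 * \<bar>?q' z\<bar>" unfolding z(2) by (simp only: abs_mult)
  also have "\<dots> \<le> 3 / 4 * (2 ^ (n + 2) * ((1 / 2) ^ j) ^ (n + 2) * ((real n / 2 + 2) * exp (- X / (2 * 4 ^ j))))"
    using zj ej by (intro mult_left_mono order_trans[OF q'] mult_mono) auto
  also have "\<dots> = 3 / 4 * (real n / 2 + 2) * (2 ^ (n + 2) * ((1 / 2) ^ j) ^ (n + 2) * exp (- X / (2 * 4 ^ j)))"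
    by (simp only: mult_ac)
  also have "\<dots> \<le> (real n + 2) * (2 ^ (n + 2) * ((1 / 2) ^ j) ^ (n + 2) * exp (- X / (2 * 4 ^ j)))"
    by (intro mult_right_mono) auto
  finally show ?thesis by (intro exI[of _ j]) (simp only: mult.assoc)
qed

lemma enn2real_one_divide_le_one:
  assumes "1 \<le> p"
  shows "0 \<le> enn2real (1 / p) \<and> enn2real (1 / p) \<le> 1"
proof (cases p)
  case (real P)
  then have "P \<ge> 1" using assms by (simp add: ennreal_ge_1)
  then show ?thesis by (simp add: real enn2real_one_divide)
qed simp

text \<open>Every scale t is dominated by a single term of the series, the one that
  \<open>gaussian_difference_bound\<close> selects. In contrast to the supremum, the sum can be
  integrated term by term.\<close>

lemma maximal_function_hardy_bump:
  fixes x :: "real^'n"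
  assumes R: "R > 0"
  shows "maximal_function (hardy_bump R) x \<le> (\<Sum>j. ennreal (R ^ CARD('n) * sqrt pi ^ CARD('n) *
    ((real CARD('n) + 2) * 2 ^ (CARD('n) + 2) * ((1 / 2) ^ j) ^ (CARD('n) + 2) * exp (- (R\<^sup>2 / (2 * 4 ^ j)) * (norm x)\<^sup>2))))"
    (is "_ \<le> (\<Sum>j. ennreal (?b j))")
  unfolding maximal_function_def
proof (rule SUP_least)
  let ?n = "CARD('n)"
  fix t :: real assume "t \<in> {0<..}"
  then have t: "t > 0" by simp
  let ?f = "\<lambda>y. complex_of_real (exp (- (norm (y /\<^sub>R t))\<^sup>2) / t ^ ?n) * hardy_bump R (x - y)"
  \<comment> \<open>In units of 1/R, the squared width of the narrow Gaussian of the bump after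
    convolution with the kernel at scale t. The wide Gaussian gives \<tau> + 3/4 instead; the two
    have the same integral.\<close>
  define \<tau> where "\<tau> = 1 / 4 + (R * t)\<^sup>2"
  define X where "X = R\<^sup>2 * (norm x)\<^sup>2"
  let ?conv = "\<lambda>b y. exp (- (1 / t\<^sup>2) * (norm y)\<^sup>2) * exp (- b * (norm (x - y))\<^sup>2)"
  have pos: "1 / t\<^sup>2 > 0" "4 * R\<^sup>2 > 0" "R\<^sup>2 > 0" using t R by auto
  note conv1 = gaussian_convolution[OF pos(1) pos(2), of x] and conv2 = gaussian_convolution[OF pos(1) pos(3), of x]
  have f: "?f y = complex_of_real (R ^ ?n * 2 ^ ?n / t ^ ?n * ?conv (4 * R\<^sup>2) y - R ^ ?n / t ^ ?n * ?conv (R\<^sup>2) y)" for y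
  proof -
    have "(norm (y /\<^sub>R t))\<^sup>2 = 1 / t\<^sup>2 * (norm y)\<^sup>2" using t by (simp add: power_mult_distrib field_simps)
    then show ?thesis unfolding hardy_bump_def of_real_mult[symmetric] of_real_eq_iff
      by (simp add: right_diff_distrib left_diff_distrib diff_divide_distrib mult_ac)
  qed
  have I: "(\<integral>y. ?f y \<partial>lborel) = complex_of_real (R ^ ?n * 2 ^ ?n / t ^ ?n * (\<integral>y. ?conv (4 * R\<^sup>2) y \<partial>lborel)
      - R ^ ?n / t ^ ?n * (\<integral>y. ?conv (R\<^sup>2) y \<partial>lborel))"
    unfolding f integral_complex_of_real
    by (subst Bochner_Integration.integral_diff[OF integrable_mult_right[OF conv1(1)] integrable_mult_right[OF conv2(1)]])
       (simp only: integral_mult_right_zero)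
  have half: "sqrt (1 / z) ^ ?n = z powr (- real ?n / 2)" if "z > 0" for z
  proof -
    have "sqrt (1 / z) = z powr (- 1 / 2)" using that by (simp add: real_sqrt_divide powr_minus_divide powr_half_sqrt)
    then show ?thesis using that by (simp add: powr_power)
  qed
  have tau: "\<tau> > 0" "\<tau> \<ge> 1 / 4" by (auto simp: \<tau>_def intro: add_pos_nonneg)
  have e1: "R ^ ?n * 2 ^ ?n / t ^ ?n * (\<integral>y. ?conv (4 * R\<^sup>2) y \<partial>lborel)
      = R ^ ?n * sqrt pi ^ ?n * (\<tau> powr (- real ?n / 2) * exp (- X / \<tau>))"
  proof -
    have s: "1 / t\<^sup>2 + 4 * R\<^sup>2 = 4 * \<tau> / t\<^sup>2" using t by (simp add: \<tau>_def power_mult_distrib field_simps)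
    have "2 / t * sqrt (pi / (4 * \<tau> / t\<^sup>2)) = sqrt pi * sqrt (1 / \<tau>)"
      using t tau by (simp add: real_sqrt_divide real_sqrt_mult)
    then have "2 ^ ?n / t ^ ?n * sqrt (pi / (1 / t\<^sup>2 + 4 * R\<^sup>2)) ^ ?n = (sqrt pi * sqrt (1 / \<tau>)) ^ ?n"
      unfolding s by (simp only: power_divide[symmetric] power_mult_distrib[symmetric])
    also have "\<dots> = sqrt pi ^ ?n * \<tau> powr (- real ?n / 2)" unfolding power_mult_distrib half[OF tau(1)] ..
    finally have A: "2 ^ ?n / t ^ ?n * sqrt (pi / (1 / t\<^sup>2 + 4 * R\<^sup>2)) ^ ?n = sqrt pi ^ ?n * \<tau> powr (- real ?n / 2)" .
    have B: "- (1 / t\<^sup>2 * (4 * R\<^sup>2) / (1 / t\<^sup>2 + 4 * R\<^sup>2)) * (norm x)\<^sup>2 = - X / \<tau>"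
      unfolding s X_def using t tau by (simp add: field_simps)
    have "R ^ ?n * 2 ^ ?n / t ^ ?n * (\<integral>y. ?conv (4 * R\<^sup>2) y \<partial>lborel)
      = R ^ ?n * (2 ^ ?n / t ^ ?n * sqrt (pi / (1 / t\<^sup>2 + 4 * R\<^sup>2)) ^ ?n) * exp (- X / \<tau>)"
      unfolding conv1(2) B by simp
    then show ?thesis unfolding A by (simp only: mult_ac)
  qed
  have e2: "R ^ ?n / t ^ ?n * (\<integral>y. ?conv (R\<^sup>2) y \<partial>lborel)
      = R ^ ?n * sqrt pi ^ ?n * ((\<tau> + 3 / 4) powr (- real ?n / 2) * exp (- X / (\<tau> + 3 / 4)))"
  proof -
    have s: "1 / t\<^sup>2 + R\<^sup>2 = (\<tau> + 3 / 4) / t\<^sup>2" using t by (simp add: \<tau>_def power_mult_distrib field_simps)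
    have tau': "\<tau> + 3 / 4 > 0" using tau by simp
    have "1 / t * sqrt (pi / ((\<tau> + 3 / 4) / t\<^sup>2)) = sqrt pi * sqrt (1 / (\<tau> + 3 / 4))"
      using t tau' by (simp add: real_sqrt_divide real_sqrt_mult)
    then have "1 / t ^ ?n * sqrt (pi / (1 / t\<^sup>2 + R\<^sup>2)) ^ ?n = (sqrt pi * sqrt (1 / (\<tau> + 3 / 4))) ^ ?n"
      unfolding s by (metis power_mult_distrib power_one_over)
    also have "\<dots> = sqrt pi ^ ?n * (\<tau> + 3 / 4) powr (- real ?n / 2)" unfolding power_mult_distrib half[OF tau'] ..
    finally have A: "1 / t ^ ?n * sqrt (pi / (1 / t\<^sup>2 + R\<^sup>2)) ^ ?n = sqrt pi ^ ?n * (\<tau> + 3 / 4) powr (- real ?n / 2)" .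
    have B: "- (1 / t\<^sup>2 * R\<^sup>2 / (1 / t\<^sup>2 + R\<^sup>2)) * (norm x)\<^sup>2 = - X / (\<tau> + 3 / 4)"
      unfolding s X_def using t tau' by (simp add: field_simps)
    have "R ^ ?n / t ^ ?n * (\<integral>y. ?conv (R\<^sup>2) y \<partial>lborel)
      = R ^ ?n * (1 / t ^ ?n * sqrt (pi / (1 / t\<^sup>2 + R\<^sup>2)) ^ ?n) * exp (- X / (\<tau> + 3 / 4))"
      unfolding conv2(2) B by simp
    then show ?thesis unfolding A by (simp only: mult_ac)
  qed
  have "norm (\<integral>y. ?f y \<partial>lborel) = R ^ ?n * sqrt pi ^ ?n *
      \<bar>\<tau> powr (- real ?n / 2) * exp (- X / \<tau>) - (\<tau> + 3 / 4) powr (- real ?n / 2) * exp (- X / (\<tau> + 3 / 4))\<bar>"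
    unfolding I e1 e2 norm_of_real right_diff_distrib[symmetric] abs_mult using R by simp
  moreover obtain j where "\<bar>\<tau> powr (- real ?n / 2) * exp (- X / \<tau>) - (\<tau> + 3 / 4) powr (- real ?n / 2) * exp (- X / (\<tau> + 3 / 4))\<bar>
    \<le> (real ?n + 2) * 2 ^ (?n + 2) * ((1 / 2) ^ j) ^ (?n + 2) * exp (- X / (2 * 4 ^ j))"
    using gaussian_difference_bound[OF tau(2), of X ?n] by (auto simp: X_def)
  moreover have "- X / (2 * 4 ^ j) = - (R\<^sup>2 / (2 * 4 ^ j)) * (norm x)\<^sup>2" by (simp add: X_def)
  ultimately have "norm (\<integral>y. ?f y \<partial>lborel) \<le> ?b j"
    using R by (metis (no_types, lifting) mult_left_mono mult_nonneg_nonneg zero_le_power less_imp_le real_sqrt_ge_zero pi_ge_zero)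
  then have "ennreal (norm (\<integral>y. ?f y \<partial>lborel)) \<le> ennreal (?b j)" by (rule ennreal_leI)
  also have "\<dots> \<le> (\<Sum>j. ennreal (?b j))"
    using sum_le_suminf[of "\<lambda>j. ennreal (?b j)" "{j}"] by simp
  finally show "ennreal (norm (\<integral>y. ?f y \<partial>lborel)) \<le> (\<Sum>j. ennreal (?b j))" .
qed

lemma hardy_bump_H1:
  "\<exists>C>0. \<forall>R>0. Lp_norm_nonneg 1 (maximal_function (hardy_bump R :: real^'n \<Rightarrow> complex)) \<le> ennreal C"
proof -
  let ?n = "CARD('n)"
  define C where "C = sqrt pi ^ ?n * (real ?n + 2) * 2 ^ (?n + 2) * sqrt (2 * pi) ^ ?n"
  have C: "C > 0" by (simp add: C_def)
  have "Lp_norm_nonneg 1 (maximal_function (hardy_bump R :: real^'n \<Rightarrow> complex)) \<le> ennreal (C * (4 / 3))" if R: "R > 0" for R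
  proof -
    let ?b = "\<lambda>j (x::real^'n). R ^ ?n * sqrt pi ^ ?n *
      ((real ?n + 2) * 2 ^ (?n + 2) * ((1 / 2) ^ j) ^ (?n + 2) * exp (- (R\<^sup>2 / (2 * 4 ^ j)) * (norm x)\<^sup>2))"
    have one: "(\<integral>\<^sup>+x. ennreal (?b j x) \<partial>lborel) = ennreal (C * (1 / 4) ^ j)" for j
    proof -
      have c: "R\<^sup>2 / (2 * 4 ^ j) > 0" using R by simp
      let ?K = "R ^ ?n * sqrt pi ^ ?n * ((real ?n + 2) * 2 ^ (?n + 2) * ((1 / 2) ^ j) ^ (?n + 2))"
      have K: "?K \<ge> 0" using R by simp
      have "(\<integral>\<^sup>+x. ennreal (?b j x) \<partial>lborel) = (\<integral>\<^sup>+x. ennreal ?K * ennreal (exp (- (R\<^sup>2 / (2 * 4 ^ j)) * (norm (x - (0::real^'n)))\<^sup>2)) \<partial>lborel)"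
        using K by (intro nn_integral_cong) (simp only: ennreal_mult[symmetric] exp_ge_zero mult.assoc diff_zero)
      also have "\<dots> = ennreal ?K * ennreal (sqrt (pi / (R\<^sup>2 / (2 * 4 ^ j))) ^ ?n)"
      proof -
        have g: "(\<integral>\<^sup>+x. ennreal (exp (- (R\<^sup>2 / (2 * 4 ^ j)) * (norm (x - (0::real^'n)))\<^sup>2)) \<partial>lborel)
            = ennreal (sqrt (pi / (R\<^sup>2 / (2 * 4 ^ j))) ^ ?n)"
          using gaussian_nn_integral[OF c, of "0::real^'n"] by (simp only: DIM_cart DIM_real mult_1_right)
        show ?thesis unfolding g[symmetric] by (rule nn_integral_cmult) measurable
      qed
      also have "\<dots> = ennreal (?K * sqrt (pi / (R\<^sup>2 / (2 * 4 ^ j))) ^ ?n)"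
        by (rule ennreal_mult[symmetric]) (use K R in auto)
      also have "sqrt (pi / (R\<^sup>2 / (2 * 4 ^ j))) = sqrt (2 * pi) * 2 ^ j / R"
      proof -
        have "sqrt (4 ^ j) = (2::real) ^ j" by (simp add: real_sqrt_power)
        then show ?thesis using R by (simp add: real_sqrt_divide real_sqrt_mult)
      qed
      \<comment> \<open>The height 2^(-j(n+2)) against the volume 2^(jn): the two powers gained by
        the vanishing mean leave the convergent series of 4^(-j).\<close>
      also have "?K * (sqrt (2 * pi) * 2 ^ j / R) ^ ?n = C * (((1 / 2) ^ j) ^ (?n + 2) * (2 ^ j) ^ ?n)"
        using R by (simp add: C_def power_mult_distrib power_divide)
      also have "((1 / 2 :: real) ^ j) ^ (?n + 2) * (2 ^ j) ^ ?n = (((1 / 2) ^ j) ^ 2) * (((1 / 2) ^ j * 2 ^ j) ^ ?n)"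
        by (simp only: power_add power_mult_distrib mult_ac)
      also have "\<dots> = (1 / 4) ^ j"
      proof -
        have "(1 / 2 :: real) ^ j * 2 ^ j = 1" by (simp flip: power_mult_distrib)
        moreover have "((1 / 2 :: real) ^ j)\<^sup>2 = (1 / 4) ^ j"
        proof -
          have "((1 / 2 :: real) ^ j)\<^sup>2 = ((1 / 2)\<^sup>2) ^ j" by (simp only: power_mult[symmetric] mult.commute)
          then show ?thesis by (simp add: power_divide)
        qed
        ultimately show ?thesis by simp
      qed
      finally show ?thesis .
    qed
    have "(\<integral>\<^sup>+x. maximal_function (hardy_bump R) (x :: real^'n) \<partial>lborel) \<le> (\<integral>\<^sup>+x. (\<Sum>j. ennreal (?b j x)) \<partial>lborel)"
      by (intro nn_integral_mono maximal_function_hardy_bump R)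
    also have "\<dots> = (\<Sum>j. \<integral>\<^sup>+x. ennreal (?b j x) \<partial>lborel)"
      by (rule nn_integral_suminf) measurable
    also have "\<dots> = (\<Sum>j. ennreal (C * (1 / 4) ^ j))" unfolding one ..
    also have "\<dots> = ennreal (\<Sum>j. C * (1 / 4) ^ j)"
      using C by (intro suminf_ennreal2) (auto intro!: summable_mult summable_geometric)
    also have "(\<Sum>j. C * (1 / 4) ^ j) = C * (4 / 3)"
      by (subst suminf_mult) (auto simp: suminf_geometric summable_geometric)
    finally show ?thesis by (simp add: Lp_norm_nonneg_def)
  qed
  then show ?thesis using C by (intro exI[of _ "C * (4 / 3)"]) auto
qed

lemma hardy_bump_Hp:
  "\<exists>C>0. \<forall>R>0. \<forall>p\<ge>1. Hp_norm p (hardy_bump R :: real^'n \<Rightarrow> complex)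
    \<le> ennreal (C * R powr (real CARD('n) - real CARD('n) * enn2real (1 / p)))"
proof -
  let ?n = "CARD('n)"
  obtain C1 where C1: "C1 > 0" "\<And>R. R > 0 \<Longrightarrow> Lp_norm_nonneg 1 (maximal_function (hardy_bump R :: real^'n \<Rightarrow> complex)) \<le> ennreal C1"
    using hardy_bump_H1 by blast
  \<comment> \<open>The summand 1 ensures V \<ge> 1, so that V^(1/p) \<le> V and the constant is the
    same for all p.\<close>
  define V where "V = sqrt pi ^ ?n + 1"
  define C where "C = max C1 (2 ^ (?n + 1) * V)"
  have V: "V \<ge> 1" by (simp add: V_def)
  have C: "C > 0" "C1 \<le> C" "2 ^ (?n + 1) * V \<le> C" using C1 by (auto simp: C_def)
  have "Hp_norm p (hardy_bump R :: real^'n \<Rightarrow> complex) \<le> ennreal (C * R powr (real ?n - real ?n * enn2real (1 / p)))"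
    if R: "R > 0" and p: "p \<ge> 1" for R p
  proof (cases "p \<le> 1")
    case True
    then have "p = 1" using p by simp
    moreover have "ennreal C1 \<le> ennreal C" using C by (intro ennreal_leI) auto
    moreover have "Lp_norm_nonneg 1 (maximal_function (hardy_bump R :: real^'n \<Rightarrow> complex)) \<le> ennreal C1" by (rule C1(2)[OF R])
    ultimately show ?thesis using R by (simp add: Hp_norm_def)
  next
    case False
    let ?K = "2 ^ (?n + 1) * R ^ ?n"
    have bound: "norm (hardy_bump R x) \<le> ?K * exp (- R\<^sup>2 * (norm (x - 0))\<^sup>2)" for x :: "real^'n"
    proof -
      have "exp (- (4 * R\<^sup>2) * (norm x)\<^sup>2) \<le> exp (- R\<^sup>2 * (norm x)\<^sup>2)" by (simp add: mult_right_mono)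
      then have "2 ^ ?n * exp (- (4 * R\<^sup>2) * (norm x)\<^sup>2) \<le> 2 ^ ?n * exp (- R\<^sup>2 * (norm x)\<^sup>2)" by (intro mult_left_mono) auto
      moreover have "exp (- R\<^sup>2 * (norm x)\<^sup>2) \<le> 2 ^ ?n * exp (- R\<^sup>2 * (norm x)\<^sup>2)"
        using mult_right_mono[of 1 "2 ^ ?n" "exp (- R\<^sup>2 * (norm x)\<^sup>2)"] by simp
      ultimately have "\<bar>2 ^ ?n * exp (- (4 * R\<^sup>2) * (norm x)\<^sup>2) - exp (- R\<^sup>2 * (norm x)\<^sup>2)\<bar> \<le> 2 ^ (?n + 1) * exp (- R\<^sup>2 * (norm x)\<^sup>2)"
      proof -
        have "0 \<le> 2 ^ ?n * exp (- (4 * R\<^sup>2) * (norm x)\<^sup>2)" "0 \<le> exp (- R\<^sup>2 * (norm x)\<^sup>2)" by simp_all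
        moreover have "2 ^ (?n + 1) * exp (- R\<^sup>2 * (norm x)\<^sup>2) = 2 * (2 ^ ?n * exp (- R\<^sup>2 * (norm x)\<^sup>2))" by simp
        ultimately show ?thesis
          using \<open>2 ^ ?n * exp (- (4 * R\<^sup>2) * (norm x)\<^sup>2) \<le> _\<close> \<open>exp (- R\<^sup>2 * (norm x)\<^sup>2) \<le> _\<close> by linarith
      qed
      then have "R ^ ?n * \<bar>2 ^ ?n * exp (- (4 * R\<^sup>2) * (norm x)\<^sup>2) - exp (- R\<^sup>2 * (norm x)\<^sup>2)\<bar> \<le> R ^ ?n * (2 ^ (?n + 1) * exp (- R\<^sup>2 * (norm x)\<^sup>2))"
        using R by (intro mult_left_mono) auto
      then show ?thesis using R unfolding hardy_bump_def norm_of_real abs_mult by (simp add: mult_ac)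
    qed
    have K: "?K > 0" using R by simp
    have "Lp_norm p (hardy_bump R :: real^'n \<Rightarrow> complex) \<le> ennreal (?K * (V * R powr - real ?n) powr enn2real (1 / p))"
    proof (rule Lp_norm_le[OF _ p K])
      show "hardy_bump R \<in> borel_measurable borel"
        using borel_measurable_integrable[OF fourier_hardy_bump(1)[OF R]] by simp
      show "V * R powr - real ?n > 0" using V R by simp
      show "norm (hardy_bump R x) \<le> ?K" for x :: "real^'n"
      proof (rule order_trans[OF bound])
        have "exp (- R\<^sup>2 * (norm (x - 0))\<^sup>2) \<le> 1" by simp
        then show "?K * exp (- R\<^sup>2 * (norm (x - 0))\<^sup>2) \<le> ?K" using K by (intro mult_left_le) auto
      qed
      have "(\<integral>\<^sup>+x. ennreal (norm (hardy_bump R (x :: real^'n))) \<partial>lborel) \<le> (\<integral>\<^sup>+x. ennreal ?K * ennreal (exp (- R\<^sup>2 * (norm (x - (0::real^'n)))\<^sup>2)) \<partial>lborel)"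
        using bound K by (intro nn_integral_mono) (simp add: ennreal_leI flip: ennreal_mult)
      also have "\<dots> = ennreal ?K * ennreal (sqrt (pi / R\<^sup>2) ^ ?n)"
      proof -
        have g: "(\<integral>\<^sup>+x. ennreal (exp (- R\<^sup>2 * (norm (x - (0::real^'n)))\<^sup>2)) \<partial>lborel) = ennreal (sqrt (pi / R\<^sup>2) ^ ?n)"
          using gaussian_nn_integral[of "R\<^sup>2" "0::real^'n"] R by (simp only: DIM_cart DIM_real mult_1_right) simp
        show ?thesis unfolding g[symmetric] by (rule nn_integral_cmult) measurable
      qed
      also have "\<dots> = ennreal (?K * sqrt (pi / R\<^sup>2) ^ ?n)" by (rule ennreal_mult[symmetric]) (use K R in auto)
      also have "\<dots> \<le> ennreal (?K * (V * R powr - real ?n))"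
      proof (intro ennreal_leI mult_left_mono)
        have "sqrt (pi / R\<^sup>2) ^ ?n = sqrt pi ^ ?n * R powr - real ?n"
          using R by (simp add: real_sqrt_divide power_divide powr_minus_divide powr_realpow)
        also have "\<dots> \<le> V * R powr - real ?n" by (intro mult_right_mono) (auto simp: V_def)
        finally show "sqrt (pi / R\<^sup>2) ^ ?n \<le> V * R powr - real ?n" .
      qed (use K in simp)
      finally show "(\<integral>\<^sup>+x. ennreal (norm (hardy_bump R (x :: real^'n))) \<partial>lborel) \<le> ennreal (?K * (V * R powr - real ?n))" .
    qed
    also have "\<dots> \<le> ennreal (C * R powr (real ?n - real ?n * enn2real (1 / p)))"
    proof (rule ennreal_leI)
      let ?i = "enn2real (1 / p)"
      have i: "0 \<le> ?i" "?i \<le> 1" using enn2real_one_divide_le_one[OF p] by auto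
      have "V powr ?i \<le> V powr 1" using V i by (intro powr_mono) auto
      then have "V powr ?i \<le> V" using V by simp
      have "?K * (V * R powr - real ?n) powr ?i = 2 ^ (?n + 1) * V powr ?i * R powr (real ?n - real ?n * ?i)"
      proof -
        have "(V * R powr - real ?n) powr ?i = V powr ?i * R powr (- real ?n * ?i)"
          using R V by (simp add: powr_mult powr_powr)
        moreover have "R ^ ?n * R powr (- real ?n * ?i) = R powr (real ?n - real ?n * ?i)"
          using R by (simp add: powr_realpow[symmetric] flip: powr_add)
        ultimately show ?thesis by (simp only: mult.assoc mult.left_commute[of "R ^ ?n"])
      qed
      also have "\<dots> \<le> 2 ^ (?n + 1) * V * R powr (real ?n - real ?n * ?i)"
        using \<open>V powr ?i \<le> V\<close> by (intro mult_right_mono mult_left_mono) auto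
      also have "\<dots> \<le> C * R powr (real ?n - real ?n * ?i)" by (intro mult_right_mono C) auto
      finally show "?K * (V * R powr - real ?n) powr ?i \<le> C * R powr (real ?n - real ?n * ?i)" .
    qed
    finally show ?thesis using False by (simp add: Hp_norm_def)
  qed
  then show ?thesis using C by blast
qed

section \<open>Uniform boundedness\<close>

text \<open>Since x\<bullet>(\<xi> + \<eta>) is the inner product with the diagonal point (x, x),
  the operator is a Fourier integral on the product space and inherits the general bounds for
  these.\<close>

lemma bilinear_fio_eq_fourier_integral:
  fixes \<sigma> :: "(real^'n) \<times> (real^'n) \<Rightarrow> complex"
  shows "bilinear_fio s \<sigma> f g x = complex_of_real (1 / (2 * pi) ^ (2 * CARD('n))) *
    (\<integral>p. cis ((x, x) \<bullet> p) * (cis (phase s (fst p) + phase s (snd p)) * \<sigma> p * fourier f (fst p) * fourier g (snd p)) \<partial>lborel)"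
  unfolding bilinear_fio_def
  by (intro arg_cong2[where f = "(*)"] refl Bochner_Integration.integral_cong)
     (auto simp: phase_def cis_conv_exp inner_Pair inner_add_right mult.assoc)

lemma borel_measurable_fio_integrand:
  fixes \<sigma> :: "(real^'n) \<times> (real^'n) \<Rightarrow> complex"
  assumes "\<sigma> \<in> borel_measurable borel" and [measurable]: "F \<in> borel_measurable borel" "G \<in> borel_measurable borel"
  shows "(\<lambda>p. cis (phase s (fst p) + phase s (snd p)) * \<sigma> p * F (fst p) * G (snd p)) \<in> borel_measurable borel"
proof -
  have [measurable]: "\<sigma> \<in> borel_measurable (borel \<Otimes>\<^sub>M borel)" using assms(1) by (simp add: borel_prod)
  have "(\<lambda>p. cis (phase s (fst p) + phase s (snd p)) * \<sigma> p * F (fst p) * G (snd p)) \<in> borel_measurable (borel \<Otimes>\<^sub>M borel)"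
    unfolding phase_def by measurable
  then show ?thesis by (simp only: borel_prod)
qed

lemma smooth_imp_differentiable: "smooth f \<Longrightarrow> f differentiable (at x)"
  unfolding smooth_def by (auto dest: spec[of _ "[]"])

lemma smooth_imp_measurable: "smooth f \<Longrightarrow> f \<in> borel_measurable borel"
  by (intro borel_measurable_continuous_onI continuous_at_imp_continuous_on ballI
    differentiable_imp_continuous_within smooth_imp_differentiable)

lemma gaussian_decay_weight:
  assumes "gaussian_decay F"
  shows "integrable lborel (\<lambda>\<xi>. complex_of_real (1 + norm \<xi>) * F \<xi>)"
proof -
  obtain K c where [measurable]: "F \<in> borel_measurable borel" and c: "c > 0"
    and K: "\<And>\<xi>. norm (F \<xi>) \<le> K * exp (- c * (norm \<xi>)\<^sup>2)"
    using assms unfolding gaussian_decay_def by blast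
  have K0: "K \<ge> 0" using order_trans[OF norm_ge_zero K[of 0]] by simp
  define L where "L = K * exp (1 + 1 / (2 * c))"
  have "norm (complex_of_real (1 + norm \<xi>) * F \<xi>) \<le> L * exp (- (c / 2) * (norm \<xi>)\<^sup>2)" for \<xi>
  proof -
    let ?y = "norm \<xi>"
    have "?y \<le> 1 / (2 * c) + c / 2 * ?y\<^sup>2"
      using zero_le_power2[of "c * ?y - 1"] c by (simp add: field_simps power2_eq_square)
    then have "exp (1 + ?y) * exp (- c * ?y\<^sup>2) \<le> exp (1 + 1 / (2 * c)) * exp (- (c / 2) * ?y\<^sup>2)"
      unfolding exp_add[symmetric] by (simp add: algebra_simps)
    moreover have "1 + ?y \<le> exp (1 + ?y)" using exp_ge_add_one_self[of "1 + ?y"] by linarith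
    then have "(1 + ?y) * (K * exp (- c * ?y\<^sup>2)) \<le> exp (1 + ?y) * (K * exp (- c * ?y\<^sup>2))"
      using K0 by (intro mult_right_mono) auto
    ultimately have "(1 + ?y) * (K * exp (- c * ?y\<^sup>2)) \<le> K * (exp (1 + 1 / (2 * c)) * exp (- (c / 2) * ?y\<^sup>2))"
      using K0 mult_left_mono[of "exp (1 + ?y) * exp (- c * ?y\<^sup>2)" "exp (1 + 1 / (2 * c)) * exp (- (c / 2) * ?y\<^sup>2)" K]
      by (simp add: mult_ac)
    moreover have "norm (complex_of_real (1 + ?y) * F \<xi>) \<le> (1 + ?y) * (K * exp (- c * ?y\<^sup>2))"
      unfolding norm_mult norm_of_real using K[of \<xi>] by (intro mult_mono) auto
    ultimately show ?thesis by (simp add: L_def mult.assoc)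
  qed
  then have "gaussian_decay (\<lambda>\<xi>. complex_of_real (1 + norm \<xi>) * F \<xi>)"
    unfolding gaussian_decay_def using c by (intro conjI exI[of _ L] exI[of _ "c / 2"]) auto
  from gaussian_decay_integrable[OF this, of "\<lambda>_. 1"] show ?thesis by simp
qed

text \<open>For fixed f and g, the operator depends continuously on the symbol in a weighted
  supremum norm. The weight covers all orders m \<le> 1, and 1 + |\<xi>| + |\<eta>| \<le> (1 +
  |\<xi>|)(1 + |\<eta>|) distributes it over the two transforms.\<close>

lemma bilinear_fio_bound:
  fixes f g :: "real^'n \<Rightarrow> complex"
  assumes f: "gaussian_decay (fourier f)" and g: "gaussian_decay (fourier g)"
  shows "\<exists>D>0. \<forall>\<sigma> M. \<sigma> \<in> borel_measurable borel \<longrightarrow> (\<forall>\<xi> \<eta>. norm (\<sigma> (\<xi>, \<eta>)) \<le> M * (1 + norm \<xi> + norm \<eta>)) \<longrightarrow>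
    integrable lborel (\<lambda>p. cis (phase s (fst p) + phase s (snd p)) * \<sigma> p * fourier f (fst p) * fourier g (snd p)) \<and>
    (\<forall>x. norm (bilinear_fio s \<sigma> f g x) \<le> D * M)"
proof -
  let ?F = "\<lambda>\<xi>. complex_of_real (1 + norm \<xi>) * fourier f \<xi>"
  let ?G = "\<lambda>\<xi>. complex_of_real (1 + norm \<xi>) * fourier g \<xi>"
  let ?cn = "1 / (2 * pi) ^ (2 * CARD('n))"
  have [measurable]: "fourier f \<in> borel_measurable borel" "fourier g \<in> borel_measurable borel"
    using f g by (auto simp: gaussian_decay_def)
  have FG: "integrable lborel (\<lambda>p. ?F (fst p) * ?G (snd p))"
    using integral_lborel_pair_mult(1)[OF gaussian_decay_weight[OF f] gaussian_decay_weight[OF g]]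
    by (simp only: case_prod_unfold)
  define D where "D = (\<integral>p. norm (?F (fst p) * ?G (snd p)) \<partial>lborel)"
  have D0: "D \<ge> 0" by (simp add: D_def)
  show ?thesis
  proof (intro exI[of _ "?cn * (D + 1)"] conjI allI impI)
    show "?cn * (D + 1) > 0" using D0 by (intro mult_pos_pos) auto
    fix \<sigma> :: "(real^'n) \<times> (real^'n) \<Rightarrow> complex" and M
    assume [measurable]: "\<sigma> \<in> borel_measurable borel" and M: "\<forall>\<xi> \<eta>. norm (\<sigma> (\<xi>, \<eta>)) \<le> M * (1 + norm \<xi> + norm \<eta>)"
    let ?w = "\<lambda>p. cis (phase s (fst p) + phase s (snd p)) * \<sigma> p * fourier f (fst p) * fourier g (snd p)"
    have M0: "M \<ge> 0" using M[rule_format, of 0 0] order_trans[OF norm_ge_zero] by fastforce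
    have le: "norm (?w p) \<le> M * norm (?F (fst p) * ?G (snd p))" for p
    proof -
      obtain \<xi> \<eta> where p: "p = (\<xi>, \<eta>)" by (cases p)
      have "norm (\<sigma> p) \<le> M * (1 + norm \<xi> + norm \<eta>)" using M p by simp
      also have "\<dots> \<le> M * ((1 + norm \<xi>) * (1 + norm \<eta>))"
        using M0 by (intro mult_left_mono) (auto simp: algebra_simps)
      finally have "norm (\<sigma> p) * (norm (fourier f \<xi>) * norm (fourier g \<eta>))
          \<le> M * ((1 + norm \<xi>) * (1 + norm \<eta>)) * (norm (fourier f \<xi>) * norm (fourier g \<eta>))"
        by (intro mult_right_mono) auto
      moreover have "norm (complex_of_real (1 + norm \<xi>)) = 1 + norm \<xi>" for \<xi> :: "real^'n"
        unfolding norm_of_real by simp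
      ultimately show ?thesis unfolding p norm_mult norm_cis by (simp add: mult_ac)
    qed
    have wm: "?w \<in> borel_measurable borel" by (rule borel_measurable_fio_integrand) measurable
    show int: "integrable lborel ?w"
      by (rule Bochner_Integration.integrable_bound[OF integrable_mult_right[OF integrable_norm[OF FG], of M]])
         (use wm le in \<open>auto intro!: order_trans[OF _ abs_ge_self]\<close>)
    fix x
    have "norm (bilinear_fio s \<sigma> f g x) = ?cn * norm (\<integral>p. cis ((x, x) \<bullet> p) * ?w p \<partial>lborel)"
      unfolding bilinear_fio_eq_fourier_integral norm_mult norm_of_real by simp
    also have "\<dots> \<le> ?cn * (\<integral>p. norm (?w p) \<partial>lborel)"
      by (intro mult_left_mono fourier_integral_bound) simp
    also have "\<dots> \<le> ?cn * (\<integral>p. M * norm (?F (fst p) * ?G (snd p)) \<partial>lborel)"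
      by (intro mult_left_mono integral_mono[OF integrable_norm[OF int] _ le] integrable_mult_right integrable_norm FG) simp
    also have "\<dots> = ?cn * (M * D)" by (simp only: integral_mult_right_zero D_def)
    also have "\<dots> \<le> ?cn * (M * (D + 1))" using M0 by (intro mult_left_mono) auto
    finally show "norm (bilinear_fio s \<sigma> f g x) \<le> ?cn * (D + 1) * M" by (simp only: mult_ac)
  qed
qed

lemma borel_measurable_bilinear_fio:
  assumes f: "gaussian_decay (fourier f)" and g: "gaussian_decay (fourier g)" and s: "\<sigma> \<in> borel_measurable borel"
  shows "bilinear_fio s \<sigma> f g \<in> borel_measurable borel"
proof -
  note s [measurable]
  have [measurable]: "fourier f \<in> borel_measurable borel" "fourier g \<in> borel_measurable borel"
    using f g by (auto simp: gaussian_decay_def)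
  let ?w = "\<lambda>p. cis (phase s (fst p) + phase s (snd p)) * \<sigma> p * fourier f (fst p) * fourier g (snd p)"
  have wm: "?w \<in> borel_measurable borel" by (rule borel_measurable_fio_integrand) measurable
  have "(\<lambda>x. \<integral>p. cis ((x, x) \<bullet> p) * ?w p \<partial>lborel) \<in> borel_measurable borel"
    by (rule measurable_compose[of "\<lambda>x. (x, x)", OF _ borel_measurable_fourier_integral[OF wm]]) simp
  then show ?thesis unfolding bilinear_fio_eq_fourier_integral[abs_def] by measurable
qed

text \<open>What the Baire argument uses of the target space: a quasi-triangle inequality, for
  passing from a ball around some b0 to differences, and lower semicontinuity under uniform
  convergence, for closedness. Bounded measurable functions suffice, because the images of the test
  functions are of this kind.\<close>

definition quasi_norm_like :: "((real^'n \<Rightarrow> complex) \<Rightarrow> ennreal) \<Rightarrow> bool" where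
  "quasi_norm_like Z \<longleftrightarrow>
    (\<exists>K>0. \<forall>F G. F \<in> borel_measurable borel \<longrightarrow> G \<in> borel_measurable borel \<longrightarrow> bounded (range F) \<longrightarrow> bounded (range G) \<longrightarrow>
      Z (\<lambda>x. F x - G x) \<le> ennreal K * (Z F + Z G)) \<and>
    (\<forall>H F c. (\<forall>n::nat. H n \<in> borel_measurable borel \<and> bounded (range (H n)) \<and> Z (H n) \<le> c) \<longrightarrow>
      F \<in> borel_measurable borel \<longrightarrow> bounded (range F) \<longrightarrow> uniform_limit UNIV H F sequentially \<longrightarrow> Z F \<le> c)"

text \<open>This replaces the closed graph theorem: the symbols \<open>lacunary_symbol m \<epsilon> h b\<close> with bounded
  \<open>b\<close> form a Banach space, and Baire's theorem makes the bounds of the operators uniform on its unit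
  ball, in particular for the individual terms of the series.\<close>

lemma lacunary_uniform_bound:
  fixes h :: "(real^'n) \<times> (real^'n) \<Rightarrow> complex"
  assumes h: "gauss_poly h" and m: "m \<le> 1" and eps: "\<epsilon> > 0"
    and vanish: "0 < m \<Longrightarrow> \<exists>C. \<forall>z. norm (h z) \<le> C * norm z powr m"
    and hyp: "\<And>\<sigma>. \<sigma> \<in> symbol_class m \<Longrightarrow> bounded_from_to (bilinear_fio s \<sigma>) X Y Z"
    and Z: "quasi_norm_like Z"
  shows "\<exists>L>0. \<exists>\<delta>>0. \<forall>k f g. schwartz f \<longrightarrow> schwartz g \<longrightarrow> X f < \<infinity> \<longrightarrow> Y g < \<infinity> \<longrightarrow>
    gaussian_decay (fourier f) \<longrightarrow> gaussian_decay (fourier g) \<longrightarrow>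
    Z (\<lambda>x. complex_of_real (\<delta> * 2 powr (- \<epsilon> * real k)) * bilinear_fio s (lacunary_term m h k) f g x)
      \<le> ennreal L * X f * Y g"
proof -
  define P where "P f g \<longleftrightarrow> schwartz f \<and> schwartz g \<and> X f < \<infinity> \<and> Y g < \<infinity> \<and>
    gaussian_decay (fourier f) \<and> gaussian_decay (fourier g)" for f g
  \<comment> \<open>Sequences are encoded as bounded continuous functions on the line, evaluated at
    the natural numbers: the type of these functions is a Banach space.\<close>
  define S where "S b = lacunary_symbol m \<epsilon> h (\<lambda>k. apply_bcontfun b (real k))" for b :: "real \<Rightarrow>\<^sub>C real"
  define T where "T b f g = bilinear_fio s (S b) f g" for b f g
  obtain Kz where Kz: "Kz > 0" "\<And>F G. F \<in> borel_measurable borel \<Longrightarrow> G \<in> borel_measurable borel \<Longrightarrow>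
      bounded (range F) \<Longrightarrow> bounded (range G) \<Longrightarrow> Z (\<lambda>x. F x - G x) \<le> ennreal Kz * (Z F + Z G)"
    using Z unfolding quasi_norm_like_def by blast
  have Zlim: "Z F \<le> c" if "\<And>n::nat. H n \<in> borel_measurable borel" "\<And>n. bounded (range (H n))" "\<And>n. Z (H n) \<le> c"
    "F \<in> borel_measurable borel" "bounded (range F)" "uniform_limit UNIV H F sequentially" for H F c
    using Z that unfolding quasi_norm_like_def by blast
  obtain C where C: "C \<ge> 0" and Cb: "\<And>b B \<xi> \<eta>. (\<forall>k. \<bar>b k\<bar> \<le> B) \<Longrightarrow>
    summable (\<lambda>k. of_real (b k * 2 powr (- \<epsilon> * real k)) * lacunary_term m h k (\<xi>, \<eta>)) \<and>
    norm (lacunary_symbol m \<epsilon> h b (\<xi>, \<eta>)) \<le> C * B * (1 + norm \<xi> + norm \<eta>) powr m"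
    using lacunary_symbol_bound[OF h m eps vanish] by blast
  have nb: "\<forall>k. \<bar>apply_bcontfun b (real k)\<bar> \<le> norm b" for b :: "real \<Rightarrow>\<^sub>C real"
    using norm_bounded[of b] by (simp only: real_norm_def) simp
  have Sc: "S b \<in> symbol_class m" for b
    unfolding S_def
    by (rule lacunary_symbol_symbol_class[OF h m eps vanish, where B = "norm b"]) (use nb[of b] in auto)
  have Sm [measurable]: "S b \<in> borel_measurable borel" for b
    using Sc[of b] smooth_imp_measurable[of "S b"] by (simp add: symbol_class_def)
  have Sb: "norm (S b (\<xi>, \<eta>)) \<le> C * norm b * (1 + norm \<xi> + norm \<eta>)" for b \<xi> \<eta>
  proof -
    have "(1 + norm \<xi> + norm \<eta>) powr m \<le> (1 + norm \<xi> + norm \<eta>) powr 1" using m by (intro powr_mono) auto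
    then have "C * norm b * (1 + norm \<xi> + norm \<eta>) powr m \<le> C * norm b * (1 + norm \<xi> + norm \<eta>)"
      using C by (intro mult_left_mono) (auto simp: add_nonneg_nonneg)
    with Cb[OF nb[of b], of \<xi> \<eta>] show ?thesis unfolding S_def by linarith
  qed
  have Sdiff: "S b z - S b' z = S (b - b') z" for b b' z
  proof -
    obtain \<xi> \<eta> where z: "z = (\<xi>, \<eta>)" by (cases z)
    note sm = Cb[OF nb, THEN conjunct1, of _ \<xi> \<eta>]
    show ?thesis unfolding S_def lacunary_symbol_def z
      by (subst suminf_diff[OF sm sm]) (simp add: minus_bcontfun.rep_eq left_diff_distrib)
  qed
  have Tdiff: "T b f g x - T b' f g x = T (b - b') f g x" if "P f g" for b b' f g x
  proof -
    obtain D where D: "\<And>\<sigma> M. \<sigma> \<in> borel_measurable borel \<Longrightarrow> (\<forall>\<xi> \<eta>. norm (\<sigma> (\<xi>, \<eta>)) \<le> M * (1 + norm \<xi> + norm \<eta>)) \<Longrightarrow>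
      integrable lborel (\<lambda>p. cis (phase s (fst p) + phase s (snd p)) * \<sigma> p * fourier f (fst p) * fourier g (snd p))"
      using bilinear_fio_bound[of f g s] \<open>P f g\<close> unfolding P_def by blast
    let ?w = "\<lambda>b p. cis ((x, x) \<bullet> p) * (cis (phase s (fst p) + phase s (snd p)) * S b p * fourier f (fst p) * fourier g (snd p))"
    have "integrable lborel (?w b)" for b
    proof (rule Bochner_Integration.integrable_bound[OF D[OF Sm, of b "C * norm b"]])
      have "integrable lborel (\<lambda>p. cis (phase s (fst p) + phase s (snd p)) * S b p * fourier f (fst p) * fourier g (snd p))"
        using D[OF Sm, of b "C * norm b"] Sb by blast
      from borel_measurable_integrable[OF this]
      show "?w b \<in> borel_measurable lborel" by (rule borel_measurable_times[rotated]) measurable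
    qed (use Sb in \<open>auto simp: norm_mult\<close>)
    then have "(\<integral>p. ?w b p \<partial>lborel) - (\<integral>p. ?w b' p \<partial>lborel) = (\<integral>p. ?w b p - ?w b' p \<partial>lborel)"
      by (intro Bochner_Integration.integral_diff[symmetric])
    also have "\<dots> = (\<integral>p. ?w (b - b') p \<partial>lborel)"
      by (intro Bochner_Integration.integral_cong refl) (simp add: Sdiff[symmetric] algebra_simps)
    finally show ?thesis
      unfolding T_def bilinear_fio_eq_fourier_integral right_diff_distrib[symmetric] by simp
  qed
  have Tb: "\<exists>D>0. \<forall>b x. norm (T b f g x) \<le> D * norm b" if "P f g" for f g
  proof -
    obtain D where D: "D > 0" "\<And>\<sigma> M x. \<sigma> \<in> borel_measurable borel \<Longrightarrow> (\<forall>\<xi> \<eta>. norm (\<sigma> (\<xi>, \<eta>)) \<le> M * (1 + norm \<xi> + norm \<eta>)) \<Longrightarrow>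
      norm (bilinear_fio s \<sigma> f g x) \<le> D * M"
      using bilinear_fio_bound[of f g s] \<open>P f g\<close> unfolding P_def by blast
    have "norm (T b f g x) \<le> (D * C + 1) * norm b" for b x
    proof -
      have "norm (T b f g x) \<le> D * (C * norm b)" unfolding T_def using D(2)[OF Sm, of b "C * norm b"] Sb by blast
      also have "\<dots> \<le> (D * C + 1) * norm b" by (simp add: algebra_simps)
      finally show ?thesis .
    qed
    then show ?thesis using D(1) C by (intro exI[of _ "D * C + 1"]) (auto intro: add_nonneg_pos)
  qed
  have Tm: "T b f g \<in> borel_measurable borel" if "P f g" for b f g
    unfolding T_def using that by (intro borel_measurable_bilinear_fio Sm) (auto simp: P_def)
  have Tbd: "bounded (range (T b f g))" if "P f g" for b f g
    using Tb[OF that] unfolding bounded_iff by blast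
  \<comment> \<open>The bound is to hold for all admissible f and g with one constant. By the
    hypothesis each b lies in some \<open>A L\<close>, and by Baire's theorem one of these closed
    sets has interior points.\<close>
  define A where "A L = {b. \<forall>f g. P f g \<longrightarrow> Z (T b f g) \<le> ennreal (real L) * X f * Y g}" for L :: nat
  have AU: "(\<Union>L. A L) = UNIV"
  proof -
    have "\<exists>L. b \<in> A L" for b
    proof -
      obtain C where C: "C > 0" "\<And>f g. schwartz f \<and> X f < \<infinity> \<and> schwartz g \<and> Y g < \<infinity> \<Longrightarrow>
          Z (T b f g) \<le> ennreal C * X f * Y g"
        using hyp[OF Sc[of b]] unfolding bounded_from_to_def T_def by blast
      obtain L :: nat where L: "C \<le> real L" using real_arch_simple by blast
      have "Z (T b f g) \<le> ennreal (real L) * X f * Y g" if "P f g" for f g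
        using C(2)[of f g] that L unfolding P_def
        by (meson ennreal_leI mult_right_mono order_trans zero_le)
      then show ?thesis unfolding A_def by blast
    qed
    then show ?thesis by blast
  qed
  \<comment> \<open>For fixed f and g, convergence of the sequences b in norm implies uniform
    convergence of the images, so that the lower semicontinuity of Z applies.\<close>
  have Acl: "closed (A L)" for L
    unfolding closed_sequential_limits
  proof (intro allI impI, elim conjE)
    fix bs b assume bs: "\<forall>n. bs n \<in> A L" and lim: "bs \<longlonglongrightarrow> b"
    have "Z (T b f g) \<le> ennreal (real L) * X f * Y g" if Pfg: "P f g" for f g
    proof (rule Zlim[where H = "\<lambda>n. T (bs n) f g"])
      show "uniform_limit UNIV (\<lambda>n. T (bs n) f g) (T b f g) sequentially"
        unfolding uniform_limit_iff
      proof (intro allI impI)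
        fix e :: real assume e: "e > 0"
        obtain D where D: "D > 0" "\<And>b x. norm (T b f g x) \<le> D * norm b" using Tb[OF Pfg] by blast
        have "\<forall>\<^sub>F n in sequentially. dist (bs n) b < e / D"
          using lim e D(1) by (intro tendstoD) auto
        then show "\<forall>\<^sub>F n in sequentially. \<forall>x\<in>UNIV. dist (T (bs n) f g x) (T b f g x) < e"
        proof eventually_elim
          case (elim n)
          have "dist (T (bs n) f g x) (T b f g x) \<le> D * dist (bs n) b" for x
            unfolding dist_norm Tdiff[OF Pfg] by (rule D(2))
          moreover have "D * dist (bs n) b < e" using elim D(1) by (simp add: field_simps)
          ultimately show ?case by (meson order_le_less_trans)
        qed
      qed
    qed (use bs Tm[OF Pfg] Tbd[OF Pfg] Pfg in \<open>auto simp: A_def\<close>)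
    then show "b \<in> A L" unfolding A_def by blast
  qed
  have "\<exists>L. interior (A L) \<noteq> {}"
  proof (rule ccontr)
    assume "\<not> (\<exists>L. interior (A L) \<noteq> {})"
    then have empty: "interior (A L) = {}" for L by blast
    have mc: "Met_TC.mcomplete TYPE(real \<Rightarrow>\<^sub>C real)"
    proof -
      have "convergent \<sigma>" if "Cauchy \<sigma>" for \<sigma> :: "nat \<Rightarrow> (real \<Rightarrow>\<^sub>C real)"
        using that by (rule Cauchy_convergent)
      then show ?thesis unfolding Met_TC.mcomplete_def by (auto simp: convergent_def)
    qed
    have eo: "euclidean interior_of S = interior S" for S :: "(real \<Rightarrow>\<^sub>C real) set"
      by (auto simp: interior_of_def interior_def)
    have "Met_TC.mtopology interior_of (\<Union>(range A)) = {}"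
      by (rule Met_TC.metric_Baire_category_alt[OF mc]) (auto simp: Acl empty eo)
    then show False using AU by (simp add: eo)
  qed
  then obtain L b0 where "b0 \<in> interior (A L)" by blast
  then obtain \<delta> where d: "\<delta> > 0" "ball b0 \<delta> \<subseteq> A L" unfolding mem_interior by blast
  \<comment> \<open>The summand 1 keeps the constant positive if L = 0.\<close>
  show ?thesis
  proof (rule exI[of _ "Kz * (2 * real L) + 1"], intro conjI, goal_cases)
    case 1
    show ?case using Kz(1) by (auto intro: add_nonneg_pos)
  next
    case 2
    show ?case
    proof (rule exI[of _ \<delta>], intro conjI d(1) allI impI)
      fix k :: nat and f g :: "real^'n \<Rightarrow> complex"
      assume "schwartz f" "schwartz g" "X f < \<infinity>" "Y g < \<infinity>" "gaussian_decay (fourier f)" "gaussian_decay (fourier g)"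
      then have Pfg: "P f g" by (simp add: P_def)
      \<comment> \<open>A tent at k of height \<delta>/2, vanishing at all other integers. Both b0 +
        e and b0 - e lie in the ball, and the difference of their operators is exactly the k-th term
        with coefficient \<delta>.\<close>
      define e where "e = Bcontfun (\<lambda>x::real. \<delta> / 2 * max 0 (1 - \<bar>x - real k\<bar>))"
      have "(\<lambda>x::real. \<delta> / 2 * max 0 (1 - \<bar>x - real k\<bar>)) \<in> bcontfun"
        unfolding bcontfun_def bounded_iff using d(1)
        by (auto intro!: continuous_intros exI[of _ "\<delta> / 2"] simp: abs_mult)
      then have e: "apply_bcontfun e = (\<lambda>x. \<delta> / 2 * max 0 (1 - \<bar>x - real k\<bar>))"
        unfolding e_def by (simp add: Bcontfun_inverse)
      have ej: "apply_bcontfun e (real j) = (if j = k then \<delta> / 2 else 0)" for j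
        by (cases j k rule: linorder_cases) (auto simp: e)
      have ne: "norm e \<le> \<delta> / 2"
        by (rule norm_bound) (use d(1) in \<open>auto simp: e abs_mult\<close>)
      have "b0 + e \<in> ball b0 \<delta>" "b0 - e \<in> ball b0 \<delta>" using ne d(1) by (auto simp: dist_norm)
      then have bA: "b0 + e \<in> A L" "b0 - e \<in> A L" using d(2) by auto
      have "T (b0 + e) f g x - T (b0 - e) f g x = complex_of_real (\<delta> * 2 powr (- \<epsilon> * real k)) * bilinear_fio s (lacunary_term m h k) f g x" for x
      proof -
        have "S (b0 + e - (b0 - e)) z = of_real (\<delta> * 2 powr (- \<epsilon> * real k)) * lacunary_term m h k z" for z
        proof -
          have "apply_bcontfun (b0 + e - (b0 - e)) (real j) = (if j = k then \<delta> else 0)" for j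
            by (simp add: ej)
          then have "S (b0 + e - (b0 - e)) z = (\<Sum>j. if j = k then of_real (\<delta> * 2 powr (- \<epsilon> * real j)) * lacunary_term m h j z else 0)"
            unfolding S_def lacunary_symbol_def by (intro arg_cong[where f = suminf]) (auto simp: fun_eq_iff)
          also have "\<dots> = of_real (\<delta> * 2 powr (- \<epsilon> * real k)) * lacunary_term m h k z"
            by (subst suminf_finite[of "{k}"]) auto
          finally show ?thesis .
        qed
        then have S: "S (b0 + e - (b0 - e)) = (\<lambda>z. of_real (\<delta> * 2 powr (- \<epsilon> * real k)) * lacunary_term m h k z)" by (rule ext)
        have "T (b0 + e - (b0 - e)) f g x = of_real (\<delta> * 2 powr (- \<epsilon> * real k)) * bilinear_fio s (lacunary_term m h k) f g x"
          unfolding T_def S bilinear_fio_eq_fourier_integral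
          by (subst mult.left_commute, subst integral_mult_right_zero[symmetric]) (simp add: mult_ac)
        then show ?thesis by (simp only: Tdiff[OF Pfg])
      qed
      then have "Z (\<lambda>x. complex_of_real (\<delta> * 2 powr (- \<epsilon> * real k)) * bilinear_fio s (lacunary_term m h k) f g x)
          = Z (\<lambda>x. T (b0 + e) f g x - T (b0 - e) f g x)" by simp
      also have "\<dots> \<le> ennreal Kz * (Z (T (b0 + e) f g) + Z (T (b0 - e) f g))"
        by (intro Kz(2) Tm Tbd Pfg)
      also have "\<dots> \<le> ennreal Kz * (ennreal (real L) * X f * Y g + ennreal (real L) * X f * Y g)"
        using bA Pfg unfolding A_def by (intro mult_left_mono add_mono) auto
      also have "\<dots> = ennreal (Kz * (2 * real L)) * X f * Y g"
        using Kz(1) by (simp add: ennreal_mult' mult.assoc distrib_left flip: mult_2)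
      also have "\<dots> \<le> ennreal (Kz * (2 * real L) + 1) * X f * Y g"
        by (intro mult_right_mono ennreal_leI) auto
      finally show "Z (\<lambda>x. complex_of_real (\<delta> * 2 powr (- \<epsilon> * real k)) * bilinear_fio s (lacunary_term m h k) f g x)
          \<le> ennreal (Kz * (2 * real L) + 1) * X f * Y g" .
    qed
  qed
qed

section \<open>Quasi-norm properties of Lebesgue spaces\<close>

lemma ennreal_powr_cmult:
  assumes "c > 0" "a > 0"
  shows "ennreal_powr (ennreal c * u) a = ennreal (c powr a) * ennreal_powr u a"
proof (cases u)
  case (real x)
  then show ?thesis using assms by (simp add: ennreal_powr_ennreal powr_mult flip: ennreal_mult)
next
  case top
  then show ?thesis using assms by (simp add: ennreal_powr_def ennreal_mult_top)
qed

lemma ennreal_powr_powr_inverse: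
  assumes "a > 0"
  shows "ennreal_powr (ennreal_powr u a) (1 / a) = u"
proof (cases u)
  case (real x)
  then show ?thesis using assms by (simp add: ennreal_powr_ennreal powr_powr)
qed (simp add: ennreal_powr_def)

lemma ennreal_powr_max_le:
  assumes "a > 0"
  shows "ennreal_powr (max u v) a \<le> ennreal_powr u a + ennreal_powr v a"
  by (cases "u \<le> v") (auto simp: max_def add_increasing add_increasing2)

text \<open>From |F - G| \<le> 2 max(|F|, |G|) a quasi-triangle inequality follows for all exponents
  at once, including r < 1, where the triangle inequality fails. The limit property is Fatou's
  lemma.\<close>

lemma quasi_norm_like_Lp_norm:
  assumes r: "0 < r" "r < \<infinity>"
  shows "quasi_norm_like (Lp_norm r :: (real^'n \<Rightarrow> complex) \<Rightarrow> ennreal)"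
proof -
  obtain P where P: "P > 0" "r = ennreal P" using r by (cases r) (auto simp: ennreal_less_zero_iff)
  define I where "I F = (\<integral>\<^sup>+x. ennreal (norm (F x) powr P) \<partial>lborel)" for F :: "real^'n \<Rightarrow> complex"
  have Lp: "Lp_norm r F = ennreal_powr (I F) (1 / P)" for F :: "real^'n \<Rightarrow> complex"
    using P by (simp add: Lp_norm_def Lp_norm_nonneg_def I_def ennreal_powr_ennreal)
  show ?thesis
    unfolding quasi_norm_like_def
  proof (intro conjI allI impI)
    define K where "K = (2 powr (P + 1)) powr (1 / P)"
    have "Lp_norm r (\<lambda>x. F x - G x) \<le> ennreal K * (Lp_norm r F + Lp_norm r G)"
      if [measurable]: "F \<in> borel_measurable borel" "G \<in> borel_measurable borel" for F G :: "real^'n \<Rightarrow> complex"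
    proof -
      have pt: "ennreal (norm (F x - G x) powr P) \<le> ennreal (2 powr P) * (ennreal (norm (F x) powr P) + ennreal (norm (G x) powr P))" for x
      proof -
        let ?m = "max (norm (F x)) (norm (G x))"
        have "norm (F x - G x) \<le> 2 * ?m" using norm_triangle_ineq4[of "F x" "G x"] by linarith
        then have "norm (F x - G x) powr P \<le> (2 * ?m) powr P" using P by (intro powr_mono2) auto
        also have "\<dots> = 2 powr P * ?m powr P" by (rule powr_mult)
        also have "\<dots> \<le> 2 powr P * (norm (F x) powr P + norm (G x) powr P)"
          by (intro mult_left_mono) (auto simp: max_def)
        finally show ?thesis by (simp add: ennreal_leI flip: ennreal_plus ennreal_mult)
      qed
      have "I (\<lambda>x. F x - G x) \<le> (\<integral>\<^sup>+x. ennreal (2 powr P) * (ennreal (norm (F x) powr P) + ennreal (norm (G x) powr P)) \<partial>lborel)"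
        unfolding I_def by (intro nn_integral_mono pt)
      also have "\<dots> = ennreal (2 powr P) * (I F + I G)"
        unfolding I_def by (subst nn_integral_cmult, measurable) (subst nn_integral_add, auto)
      also have "\<dots> \<le> ennreal (2 powr P) * (ennreal 2 * max (I F) (I G))"
      proof (rule mult_left_mono)
        have "I F + I G \<le> max (I F) (I G) + max (I F) (I G)" by (intro add_mono) auto
        then show "I F + I G \<le> ennreal 2 * max (I F) (I G)" by (simp add: mult_2)
      qed simp
      also have "\<dots> = ennreal (2 powr (P + 1)) * max (I F) (I G)"
        by (simp add: powr_add ennreal_mult mult.assoc)
      finally have "ennreal_powr (I (\<lambda>x. F x - G x)) (1 / P) \<le> ennreal_powr (ennreal (2 powr (P + 1)) * max (I F) (I G)) (1 / P)"
        using P by (intro ennreal_powr_mono) auto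
      also have "\<dots> = ennreal K * ennreal_powr (max (I F) (I G)) (1 / P)"
        unfolding K_def using P by (intro ennreal_powr_cmult) auto
      also have "\<dots> \<le> ennreal K * (ennreal_powr (I F) (1 / P) + ennreal_powr (I G) (1 / P))"
        using P by (intro mult_left_mono ennreal_powr_max_le) auto
      finally show ?thesis unfolding Lp .
    qed
    moreover have "K > 0" by (simp add: K_def)
    ultimately show "\<exists>K>0. \<forall>F G. F \<in> borel_measurable borel \<longrightarrow> G \<in> borel_measurable borel \<longrightarrow> bounded (range F) \<longrightarrow>
      bounded (range G) \<longrightarrow> Lp_norm r (\<lambda>x. F x - G x :: complex) \<le> ennreal K * (Lp_norm r (F :: real^'n \<Rightarrow> complex) + Lp_norm r G)"
      by blast
  next
    fix H :: "nat \<Rightarrow> real^'n \<Rightarrow> complex" and F c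
    assume H: "\<forall>n. H n \<in> borel_measurable borel \<and> bounded (range (H n)) \<and> Lp_norm r (H n) \<le> c"
      and lim: "uniform_limit UNIV H F sequentially"
    have [measurable]: "H n \<in> borel_measurable borel" for n using H by blast
    have IH: "I (H n) \<le> ennreal_powr c P" for n
    proof -
      have "ennreal_powr (ennreal_powr (I (H n)) (1 / P)) P \<le> ennreal_powr c P"
        using H P unfolding Lp by (intro ennreal_powr_mono) auto
      then show ?thesis using ennreal_powr_powr_inverse[of "1 / P" "I (H n)"] P by simp
    qed
    have conv: "(\<lambda>n. ennreal (norm (H n x) powr P)) \<longlonglongrightarrow> ennreal (norm (F x) powr P)" for x
      using tendsto_uniform_limitI[OF lim, of x] P
      by (intro tendsto_ennrealI tendsto_powr' tendsto_norm) auto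
    have "I F = (\<integral>\<^sup>+x. liminf (\<lambda>n. ennreal (norm (H n x) powr P)) \<partial>lborel)"
      unfolding I_def by (intro nn_integral_cong lim_imp_Liminf[symmetric] conv) simp
    also have "\<dots> \<le> liminf (\<lambda>n. I (H n))"
      unfolding I_def by (rule nn_integral_liminf) measurable
    also have "\<dots> \<le> liminf (\<lambda>n::nat. ennreal_powr c P)"
      by (intro Liminf_mono always_eventually allI IH)
    also have "\<dots> = ennreal_powr c P" by (simp add: Liminf_const)
    finally have "ennreal_powr (I F) (1 / P) \<le> ennreal_powr (ennreal_powr c P) (1 / P)"
      using P by (intro ennreal_powr_mono) auto
    then show "Lp_norm r F \<le> c" unfolding Lp using P by (simp add: ennreal_powr_powr_inverse)
  qed
qed

section \<open>Bounded mean oscillation\<close>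

definition cube_osc :: "(real^'n) set \<Rightarrow> (real^'n \<Rightarrow> complex) \<Rightarrow> ennreal" where
  "cube_osc Q F = (\<integral>\<^sup>+x\<in>Q. ennreal (norm (F x - mean_on Q F)) \<partial>lborel) / emeasure lborel Q"

lemma BMO_norm_le_iff:
  "BMO_norm F \<le> c \<longleftrightarrow> (\<forall>a l. 0 < l \<longrightarrow> cube_osc (cbox a (a + l *\<^sub>R One)) F \<le> c)"
  by (auto simp: BMO_norm_def cube_osc_def SUP_le_iff)

lemma cube_emeasure:
  fixes a :: "real^'n"
  assumes "l > 0"
  shows "emeasure lborel (cbox a (a + l *\<^sub>R One)) = ennreal (l ^ CARD('n))"
  using assms by (simp add: emeasure_lborel_cbox_eq inner_simps)

lemma set_integrable_bounded_cbox:
  fixes F :: "real^'n \<Rightarrow> complex"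
  assumes [measurable]: "F \<in> borel_measurable borel" and "bounded (range F)"
  shows "set_integrable lborel (cbox a b) F"
proof -
  obtain B where "\<And>x. norm (F x) \<le> B" using assms(2) by (auto simp: bounded_iff)
  then show ?thesis
    unfolding set_integrable_def
    by (intro integrableI_bounded_set_indicator[where B = B]) (auto simp: emeasure_lborel_cbox_eq)
qed

lemma mean_on_diff:
  fixes F G :: "real^'n \<Rightarrow> complex"
  assumes "set_integrable lborel Q F" "set_integrable lborel Q G"
  shows "mean_on Q (\<lambda>x. F x - G x) = mean_on Q F - mean_on Q G"
  unfolding mean_on_def using set_integral_diff(2)[OF assms] by (simp add: scaleR_diff_right)

lemma norm_mean_on_le:
  fixes F :: "real^'n \<Rightarrow> complex"
  assumes l: "l > 0" and F: "set_integrable lborel (cbox a (a + l *\<^sub>R One)) F" and e: "\<And>x. norm (F x) \<le> e"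
  shows "norm (mean_on (cbox a (a + l *\<^sub>R One)) F) \<le> e"
proof -
  let ?Q = "cbox a (a + l *\<^sub>R One)"
  have fin: "emeasure lborel ?Q < \<infinity>" unfolding cube_emeasure[OF l] by simp
  have m: "measure lborel ?Q = l ^ CARD('n)" using cube_emeasure[OF l, of a] l by (simp add: measure_def)
  have "norm (LINT y:?Q|lborel. F y) \<le> (LINT y:?Q|lborel. norm (F y))"
    by (rule set_integral_norm_bound[OF F])
  also have "\<dots> \<le> (LINT y:?Q|lborel. e)"
    using F fin e by (intro set_integral_mono set_integrable_norm) (auto simp: set_integrable_def)
  also have "\<dots> = measure lborel ?Q * e" by (simp add: set_lebesgue_integral_def)
  finally have "norm (LINT y:?Q|lborel. F y) / l ^ CARD('n) \<le> e"
    using l unfolding m by (simp add: pos_divide_le_eq mult.commute)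
  moreover have "norm (mean_on ?Q F) = norm (LINT y:?Q|lborel. F y) / l ^ CARD('n)"
    using l by (simp add: mean_on_def m divide_inverse mult.commute)
  ultimately show ?thesis by simp
qed

text \<open>Bounded measurable functions are integrable over cubes, so that their means are true
  integrals, additive and stable under uniform convergence.\<close>

lemma quasi_norm_like_BMO_norm: "quasi_norm_like (BMO_norm :: (real^'n \<Rightarrow> complex) \<Rightarrow> ennreal)"
  unfolding quasi_norm_like_def
proof (intro conjI exI[of _ "1::real"] allI impI)
  fix F G :: "real^'n \<Rightarrow> complex"
  assume [measurable]: "F \<in> borel_measurable borel" "G \<in> borel_measurable borel" and bd: "bounded (range F)" "bounded (range G)"
  have "BMO_norm (\<lambda>x. F x - G x) \<le> BMO_norm F + BMO_norm G"
    unfolding BMO_norm_le_iff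
  proof (intro allI impI)
    fix a :: "real^'n" and l :: real assume l: "l > 0"
    let ?Q = "cbox a (a + l *\<^sub>R One)"
    have "cube_osc ?Q (\<lambda>x. F x - G x) \<le> cube_osc ?Q F + cube_osc ?Q G"
    proof -
      have mean: "mean_on ?Q (\<lambda>x. F x - G x) = mean_on ?Q F - mean_on ?Q G"
        by (intro mean_on_diff set_integrable_bounded_cbox bd) auto
      have "norm (F x - G x - (mean_on ?Q F - mean_on ?Q G)) \<le> norm (F x - mean_on ?Q F) + norm (G x - mean_on ?Q G)" for x
        using norm_triangle_ineq4[of "F x - mean_on ?Q F" "G x - mean_on ?Q G"] by (simp add: algebra_simps)
      then have "(\<integral>\<^sup>+x\<in>?Q. ennreal (norm (F x - G x - mean_on ?Q (\<lambda>x. F x - G x))) \<partial>lborel)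
        \<le> (\<integral>\<^sup>+x\<in>?Q. ennreal (norm (F x - mean_on ?Q F)) + ennreal (norm (G x - mean_on ?Q G)) \<partial>lborel)"
        unfolding mean by (intro nn_integral_mono mult_right_mono) (auto simp flip: ennreal_plus intro: ennreal_leI)
      also have "\<dots> = (\<integral>\<^sup>+x\<in>?Q. ennreal (norm (F x - mean_on ?Q F)) \<partial>lborel) + (\<integral>\<^sup>+x\<in>?Q. ennreal (norm (G x - mean_on ?Q G)) \<partial>lborel)"
        unfolding distrib_right by (rule nn_integral_add) measurable
      finally show ?thesis unfolding cube_osc_def add_divide_distrib_ennreal[symmetric]
        by (rule divide_right_mono_ennreal)
    qed
    also have "\<dots> \<le> BMO_norm F + BMO_norm G"
      using l BMO_norm_le_iff[of F "BMO_norm F"] BMO_norm_le_iff[of G "BMO_norm G"] by (intro add_mono) auto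
    finally show "cube_osc ?Q (\<lambda>x. F x - G x) \<le> BMO_norm F + BMO_norm G" .
  qed
  then show "BMO_norm (\<lambda>x. F x - G x) \<le> ennreal 1 * (BMO_norm F + BMO_norm G)" by simp
next
  fix H :: "nat \<Rightarrow> real^'n \<Rightarrow> complex" and F c
  assume H: "\<forall>n. H n \<in> borel_measurable borel \<and> bounded (range (H n)) \<and> BMO_norm (H n) \<le> c"
    and Fm [measurable]: "F \<in> borel_measurable borel" and bd: "bounded (range F)" and lim: "uniform_limit UNIV H F sequentially"
  show "BMO_norm F \<le> c"
    unfolding BMO_norm_le_iff
  proof (intro allI impI)
    fix a :: "real^'n" and l :: real assume l: "l > 0"
    let ?Q = "cbox a (a + l *\<^sub>R One)"
    show "cube_osc ?Q F \<le> c"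
    proof (rule ennreal_le_epsilon)
      fix e :: real assume e: "0 < e"
      have "\<forall>\<^sub>F n in sequentially. \<forall>x\<in>UNIV. dist (H n x) (F x) < e / 2"
        using lim[unfolded uniform_limit_iff, rule_format, of "e / 2"] e by simp
      then obtain n where n: "\<And>x. norm (H n x - F x) < e / 2"
        unfolding eventually_sequentially dist_norm by auto
      have Hn [measurable]: "H n \<in> borel_measurable borel" and Hb: "bounded (range (H n))" and Hc: "cube_osc ?Q (H n) \<le> c"
        using H l BMO_norm_le_iff[of "H n" c] by auto
      have si: "set_integrable lborel ?Q F" "set_integrable lborel ?Q (H n)"
        by (intro set_integrable_bounded_cbox Fm bd Hn Hb)+
      have "norm (mean_on ?Q (\<lambda>x. H n x - F x)) \<le> e / 2"
        using set_integral_diff(1)[OF si(2,1)] n by (intro norm_mean_on_le[OF l]) (auto intro: less_imp_le)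
      then have mean: "norm (mean_on ?Q (H n) - mean_on ?Q F) \<le> e / 2" by (simp add: mean_on_diff[OF si(2,1)])
      have "norm (F x - mean_on ?Q F) \<le> norm (H n x - mean_on ?Q (H n)) + e" for x
      proof -
        have "F x - mean_on ?Q F = (H n x - mean_on ?Q (H n)) - (H n x - F x) + (mean_on ?Q (H n) - mean_on ?Q F)" by simp
        also have "norm \<dots> \<le> norm (H n x - mean_on ?Q (H n)) + norm (H n x - F x) + norm (mean_on ?Q (H n) - mean_on ?Q F)"
          by (intro order_trans[OF norm_triangle_ineq] add_mono norm_triangle_ineq4) auto
        finally show ?thesis using n[of x] mean by linarith
      qed
      then have "(\<integral>\<^sup>+x\<in>?Q. ennreal (norm (F x - mean_on ?Q F)) \<partial>lborel)
        \<le> (\<integral>\<^sup>+x\<in>?Q. ennreal (norm (H n x - mean_on ?Q (H n))) + ennreal e \<partial>lborel)"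
        using e by (intro nn_integral_mono mult_right_mono) (auto simp flip: ennreal_plus intro: ennreal_leI)
      also have "\<dots> = (\<integral>\<^sup>+x\<in>?Q. ennreal (norm (H n x - mean_on ?Q (H n))) \<partial>lborel) + ennreal e * emeasure lborel ?Q"
        unfolding distrib_right by (subst nn_integral_add) (auto simp: nn_integral_cmult_indicator)
      finally have "cube_osc ?Q F \<le> ((\<integral>\<^sup>+x\<in>?Q. ennreal (norm (H n x - mean_on ?Q (H n))) \<partial>lborel) + ennreal e * emeasure lborel ?Q) / emeasure lborel ?Q"
        unfolding cube_osc_def by (rule divide_right_mono_ennreal)
      also have "\<dots> = cube_osc ?Q (H n) + ennreal e * emeasure lborel ?Q / emeasure lborel ?Q"
        unfolding cube_osc_def by (rule add_divide_distrib_ennreal)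
      also have "ennreal e * emeasure lborel ?Q / emeasure lborel ?Q = ennreal e"
        unfolding cube_emeasure[OF l] using l by (intro ennreal_mult_divide_eq) auto
      finally show "cube_osc ?Q F \<le> c + ennreal e" using Hc by (meson add_right_mono order_trans)
    qed
  qed
qed simp

text \<open>Comparing \<open>F\<close> with its translate by half the side length eliminates the mean.\<close>

lemma BMO_norm_ge:
  fixes F :: "real^'n \<Rightarrow> complex"
  assumes [measurable]: "F \<in> borel_measurable borel" and l: "l > 0" and z: "z \<ge> 0"
    and F: "\<And>x. x \<in> cbox 0 (l *\<^sub>R One) \<Longrightarrow> x $ i \<le> l / 2 \<Longrightarrow> 2 * z \<le> norm (F x - F (x + axis i (l / 2)))"
  shows "ennreal (z / 2) \<le> BMO_norm F"
proof -
  let ?Q = "cbox 0 (l *\<^sub>R One) :: (real^'n) set"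
  let ?t = "axis i (l / 2) :: real^'n"
  \<comment> \<open>Half of the cube. The shift maps it into the cube again, so that both terms of
    the comparison are bounded by the same oscillation integral.\<close>
  define Q1 where "Q1 = {x \<in> ?Q. x $ i \<le> l / 2}"
  define c where "c = mean_on ?Q F"
  let ?g = "\<lambda>x. ennreal (norm (F x - c))"
  let ?I = "\<integral>\<^sup>+x\<in>?Q. ?g x \<partial>lborel"
  have mem: "x \<in> ?Q \<longleftrightarrow> (\<forall>j. 0 \<le> x $ j \<and> x $ j \<le> l)" for x :: "real^'n"
  proof -
    have "(One :: real^'n) $ j = 1" for j by (simp add: cart_eq_inner_axis inner_sum_left inner_Basis)
    then show ?thesis by (simp add: mem_box_cart)
  qed
  have Q1m [measurable]: "Q1 \<in> sets lborel" unfolding Q1_def by measurable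
  have shift: "(\<integral>\<^sup>+x. ?g (x + ?t) * indicator Q1 x \<partial>lborel) \<le> ?I"
  proof -
    have "?I = (\<integral>\<^sup>+x. ?g x * indicator ?Q x \<partial>distr lborel borel ((+) ?t))" by (simp add: lborel_distr_plus)
    also have "\<dots> = (\<integral>\<^sup>+x. ?g (?t + x) * indicator ?Q (?t + x) \<partial>lborel)" by (rule nn_integral_distr) measurable
    also have "\<dots> \<ge> (\<integral>\<^sup>+x. ?g (x + ?t) * indicator Q1 x \<partial>lborel)"
    proof (rule nn_integral_mono)
      fix x
      have "?t + x \<in> ?Q" if "x \<in> Q1"
        using that l unfolding Q1_def mem mem_Collect_eq by (auto simp: axis_def)
      then show "?g (x + ?t) * indicator Q1 x \<le> ?g (?t + x) * indicator ?Q (?t + x)"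
        by (auto simp: indicator_def add.commute)
    qed
    finally show ?thesis .
  qed
  have "ennreal (2 * z) * emeasure lborel Q1 = (\<integral>\<^sup>+x. ennreal (2 * z) * indicator Q1 x \<partial>lborel)"
    by (rule nn_integral_cmult_indicator[symmetric]) (rule Q1m)
  also have "\<dots> \<le> (\<integral>\<^sup>+x. ?g x * indicator Q1 x + ?g (x + ?t) * indicator Q1 x \<partial>lborel)"
  proof (rule nn_integral_mono)
    fix x
    show "ennreal (2 * z) * indicator Q1 x \<le> ?g x * indicator Q1 x + ?g (x + ?t) * indicator Q1 x"
    proof (cases "x \<in> Q1")
      case True
      then have "2 * z \<le> norm (F x - F (x + ?t))" by (intro F) (auto simp: Q1_def)
      also have "\<dots> \<le> norm (F x - c) + norm (F (x + ?t) - c)"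
        using norm_triangle_ineq4[of "F x - c" "F (x + ?t) - c"] by simp
      finally show ?thesis using True by (simp add: ennreal_leI flip: ennreal_plus)
    qed simp
  qed
  also have "\<dots> = (\<integral>\<^sup>+x. ?g x * indicator Q1 x \<partial>lborel) + (\<integral>\<^sup>+x. ?g (x + ?t) * indicator Q1 x \<partial>lborel)"
    by (rule nn_integral_add) measurable
  also have "\<dots> \<le> ?I + ?I"
    by (intro add_mono shift nn_integral_mono) (auto simp: Q1_def indicator_def)
  finally have 1: "ennreal (2 * z) * emeasure lborel Q1 \<le> ?I + ?I" .
  have Q1: "emeasure lborel Q1 \<ge> ennreal (l ^ CARD('n) / 2)"
  proof -
    have "x \<in> Q1 \<longleftrightarrow> x \<in> cbox 0 (\<chi> j. if j = i then l / 2 else l)" for x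
    proof
      assume "x \<in> Q1"
      then have "0 \<le> x $ j \<and> x $ j \<le> l \<and> x $ i \<le> l / 2" for j unfolding Q1_def mem_Collect_eq mem by blast
      then show "x \<in> cbox 0 (\<chi> j. if j = i then l / 2 else l)" by (simp add: mem_box_cart)
    next
      assume x: "x \<in> cbox 0 (\<chi> j. if j = i then l / 2 else l)"
      then have "0 \<le> x $ j \<and> x $ j \<le> (if j = i then l / 2 else l)" for j by (simp add: mem_box_cart)
      moreover have "(if j = i then l / 2 else l) \<le> l" for j using l by simp
      ultimately show "x \<in> Q1" unfolding Q1_def mem_Collect_eq mem by (metis (full_types) order_trans)
    qed
    then have "Q1 = cbox 0 (\<chi> j. if j = i then l / 2 else l)" by blast
    moreover have "measure lborel (cbox 0 (\<chi> j. if j = i then l / 2 else l) :: (real^'n) set) = (\<Prod>j\<in>UNIV. if j = i then l / 2 else l)"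
      using l by (subst content_cbox_cart) (auto simp: interval_ne_empty_cart)
    moreover have "emeasure lborel (cbox 0 B) = ennreal (measure lborel (cbox 0 B))" for B :: "real^'n"
      by (rule emeasure_eq_ennreal_measure) (use emeasure_lborel_cbox_finite[of 0 B] in auto)
    ultimately have "emeasure lborel Q1 = ennreal (\<Prod>j\<in>UNIV. if j = i then l / 2 else l)"
      by simp
    also have "(\<Prod>j\<in>UNIV. if j = i then l / 2 else l) = l / 2 * l ^ (CARD('n) - 1)"
      by (subst prod.remove[of _ i]) (auto simp: card_Diff_singleton)
    also have "\<dots> = l ^ CARD('n) / 2"
    proof -
      obtain k where "CARD('n) = Suc k" using gr0_implies_Suc[OF zero_less_card_finite[where 'a = 'n]] by blast
      then show ?thesis by simp
    qed
    finally show ?thesis by simp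
  qed
  have Q: "emeasure lborel ?Q = ennreal (l ^ CARD('n))" using cube_emeasure[OF l, of 0] by simp
  \<comment> \<open>The constant z/2 of the conclusion: \<open>Q1\<close> has half the volume, which
    turns 2z into z, and the oscillation integral has been used twice.\<close>
  have "ennreal (z * l ^ CARD('n)) = ennreal (2 * z) * ennreal (l ^ CARD('n) / 2)"
    using z l by (simp flip: ennreal_mult)
  also have "\<dots> \<le> ?I + ?I" using mult_left_mono[OF Q1, of "ennreal (2 * z)"] 1 by (auto intro: order_trans)
  finally have 2: "ennreal (z * l ^ CARD('n)) \<le> 2 * ?I" by (simp add: mult_2)
  have "ennreal (z / 2) * ennreal (l ^ CARD('n)) \<le> ?I"
  proof (cases ?I)
    case (real y)
    have "z * l ^ CARD('n) \<le> 2 * y"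
      using 2 unfolding real(2) using real(1) by (metis ennreal_le_iff ennreal_mult' ennreal_numeral mult_nonneg_nonneg zero_le_numeral)
    then show ?thesis unfolding real(2) using z l by (simp add: ennreal_leI flip: ennreal_mult)
  qed simp
  then have "ennreal (z / 2) * ennreal (l ^ CARD('n)) / ennreal (l ^ CARD('n)) \<le> ?I / ennreal (l ^ CARD('n))"
    by (rule divide_right_mono_ennreal)
  moreover have "ennreal (z / 2) * ennreal (l ^ CARD('n)) / ennreal (l ^ CARD('n)) = ennreal (z / 2)"
    using l by (intro ennreal_mult_divide_eq) auto
  ultimately have "ennreal (z / 2) \<le> cube_osc ?Q F"
    unfolding cube_osc_def Q c_def[symmetric] by simp
  moreover have "cube_osc (cbox 0 (0 + l *\<^sub>R One)) F \<le> BMO_norm F"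
    using BMO_norm_le_iff[of F "BMO_norm F"] l by blast
  then have "cube_osc ?Q F \<le> BMO_norm F" by simp
  ultimately show ?thesis by (rule order_trans)
qed

section \<open>Reduction to products of linear operators\<close>

text \<open>The case \<open>j = 1\<close> is needed for \<open>m > 0\<close>, where the lacunary series only defines a symbol if the
  cutoff vanishes at the origin.\<close>

definition cutoff :: "nat \<Rightarrow> real^'n \<Rightarrow> real" where
  "cutoff j y = (norm y) ^ (2 * j) * exp (- (norm y)\<^sup>2)"

definition cutoff_prod :: "nat \<Rightarrow> (real^'n) \<times> (real^'n) \<Rightarrow> complex" where
  "cutoff_prod j z = complex_of_real (cutoff j (fst z) * cutoff j (snd z))"

text \<open>The inverse transform is taken without the factor (2\<pi>)^(-n); the product of the two
  missing factors reappears in \<open>bilinear_fio_lacunary_term\<close>.\<close>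

definition propagated :: "real \<Rightarrow> nat \<Rightarrow> real \<Rightarrow> (real^'n \<Rightarrow> complex) \<Rightarrow> real^'n \<Rightarrow> complex" where
  "propagated s j R f x = (\<integral>\<xi>. cis (x \<bullet> \<xi>) *
     (cis (phase s \<xi>) * (complex_of_real (cutoff j (\<xi> /\<^sub>R R)) * fourier f \<xi>)) \<partial>lborel)"

lemma cutoff_le: "0 \<le> cutoff j y" "cutoff 0 y \<le> 1" "cutoff 1 y \<le> 1" "cutoff 1 y \<le> (norm y)\<^sup>2"
proof -
  show "0 \<le> cutoff j y" "cutoff 0 y \<le> 1" by (auto simp: cutoff_def)
  have "(norm y)\<^sup>2 \<le> exp ((norm y)\<^sup>2)" using exp_ge_add_one_self[of "(norm y)\<^sup>2"] by linarith
  then have "(norm y)\<^sup>2 * exp (- (norm y)\<^sup>2) \<le> exp ((norm y)\<^sup>2) * exp (- (norm y)\<^sup>2)" by (intro mult_right_mono) auto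
  then show "cutoff 1 y \<le> 1" by (simp add: cutoff_def flip: exp_add)
  show "cutoff 1 y \<le> (norm y)\<^sup>2" by (simp add: cutoff_def mult_left_le)
qed

lemma cutoff_le_one: "j \<le> 1 \<Longrightarrow> cutoff j y \<le> 1"
  using cutoff_le(2,3)[of y] by (cases j) auto

lemma cutoff_ge:
  assumes "j \<le> 1" "norm y \<le> 2" "j = 0 \<or> 1 / 2 \<le> norm y"
  shows "exp (- 4) / 4 \<le> cutoff j y"
proof -
  have "(norm y)\<^sup>2 \<le> 2\<^sup>2" using assms by (intro power_mono) auto
  then have e: "exp (- 4) \<le> exp (- (norm y)\<^sup>2)" by simp
  have "1 / 4 \<le> (norm y) ^ (2 * j)"
  proof (cases "j = 0")
    case False
    then have "(1 / 2)\<^sup>2 \<le> (norm y)\<^sup>2" using assms by (intro power_mono) auto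
    with False assms(1) show ?thesis by (auto simp: le_Suc_eq power_divide)
  qed simp
  from mult_mono[OF this e] show ?thesis by (simp add: cutoff_def)
qed

lemma borel_measurable_cutoff [measurable]: "cutoff j \<in> borel_measurable borel"
  unfolding cutoff_def by measurable

text \<open>For j = 1 the factor |\<xi>|^2 |\<eta>|^2 is expanded into products of squared
  coordinates, since \<open>gauss_poly\<close> is built with linear factors only.\<close>

lemma gauss_poly_cutoff_prod:
  assumes "j \<le> 1"
  shows "gauss_poly (cutoff_prod j :: (real^'n) \<times> (real^'n) \<Rightarrow> complex)"
proof -
  let ?h = "\<lambda>z::(real^'n) \<times> (real^'n). exp (complex_of_real (0 \<bullet> z - 1 * (z \<bullet> z)) + \<i> * complex_of_real (0 \<bullet> z))"
  have h: "gauss_poly ?h" by (rule gauss_poly.gauss) simp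
  have h_eq: "?h z = complex_of_real (exp (- (norm (fst z))\<^sup>2) * exp (- (norm (snd z))\<^sup>2))" for z
  proof -
    have "complex_of_real (0 \<bullet> z - 1 * (z \<bullet> z)) + \<i> * complex_of_real (0 \<bullet> z)
        = complex_of_real (- (norm (fst z))\<^sup>2 + - (norm (snd z))\<^sup>2)"
      by (simp add: inner_prod_def power2_norm_eq_inner)
    then show ?thesis by (simp only: exp_of_real exp_add)
  qed
  show ?thesis
  proof (cases "j = 0")
    case True
    have "cutoff_prod j = ?h" unfolding True by (rule ext) (simp only: h_eq, simp add: cutoff_prod_def cutoff_def)
    then show ?thesis using h by simp
  next
    case False
    then have j: "j = 1" using assms by simp
    let ?g = "\<lambda>z. \<Sum>b\<in>Basis. \<Sum>c\<in>Basis. complex_of_real (z \<bullet> (b, 0)) * (complex_of_real (z \<bullet> (b, 0)) *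
      (complex_of_real (z \<bullet> (0, c)) * (complex_of_real (z \<bullet> (0, c)) * ?h z)))"
    have "gauss_poly ?g" by (intro gauss_poly_sum finite_Basis gauss_poly.inner h)
    moreover have "cutoff_prod j = ?g"
    proof
      fix z :: "(real^'n) \<times> (real^'n)"
      have "?g z = (\<Sum>b\<in>Basis. \<Sum>c\<in>Basis. complex_of_real ((fst z \<bullet> b)\<^sup>2) * (complex_of_real ((snd z \<bullet> c)\<^sup>2) * ?h z))"
        by (intro sum.cong refl) (simp add: inner_prod_def power2_eq_square)
      also have "\<dots> = complex_of_real (\<Sum>b\<in>Basis. (fst z \<bullet> b)\<^sup>2) * (complex_of_real (\<Sum>c\<in>Basis. (snd z \<bullet> c)\<^sup>2) * ?h z)"
        by (simp only: of_real_sum sum_distrib_left sum_distrib_right, subst sum.swap) (rule refl)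
      also have "\<dots> = cutoff_prod j z"
        unfolding norm_power2_eq_sum_Basis[symmetric] h_eq j by (simp add: cutoff_prod_def cutoff_def)
      finally show "cutoff_prod j z = ?g z" by simp
    qed
    ultimately show ?thesis by simp
  qed
qed

text \<open>The factor in \<xi> alone suffices: it is at most |\<xi>|^2 \<le> |\<xi>|^m for |\<xi>|
  \<le> 1, and at most 1 beyond.\<close>

lemma cutoff_prod_vanish:
  assumes "0 < m" "m \<le> 1"
  shows "\<exists>C. \<forall>z. norm (cutoff_prod 1 z) \<le> C * norm z powr m"
proof (intro exI[of _ 1] allI)
  fix z :: "(real^'n) \<times> (real^'n)"
  have "norm (cutoff_prod 1 z) = cutoff 1 (fst z) * cutoff 1 (snd z)"
    unfolding cutoff_prod_def norm_of_real by (rule abs_of_nonneg) (intro mult_nonneg_nonneg cutoff_le)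
  also have "\<dots> \<le> cutoff 1 (fst z)" by (rule mult_left_le) (rule cutoff_le)+
  also have "\<dots> \<le> norm (fst z) powr m"
  proof (cases "norm (fst z) \<le> 1")
    case True
    have "(norm (fst z))\<^sup>2 \<le> norm (fst z) powr m"
    proof (cases "fst z = 0")
      case False
      then have "norm (fst z) powr 2 \<le> norm (fst z) powr m" using True assms by (intro powr_mono') auto
      with False show ?thesis by simp
    qed simp
    with cutoff_le(4)[of "fst z"] show ?thesis by linarith
  next
    case False
    then have "1 \<le> norm (fst z) powr m" using assms by (intro ge_one_powr_ge_zero) auto
    with cutoff_le(3)[of "fst z"] show ?thesis by linarith
  qed
  also have "\<dots> \<le> norm z powr m" using assms norm_fst_le[of "fst z" "snd z"] by (intro powr_mono2) auto
  finally show "norm (cutoff_prod 1 z) \<le> 1 * norm z powr m" by simp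
qed

section \<open>Factorization of a lacunary term\<close>

lemma propagated_integrable:
  assumes j: "j \<le> 1" and f: "gaussian_decay (fourier f)"
  shows "integrable lborel (\<lambda>\<xi>. cis (phase s \<xi>) * (complex_of_real (cutoff j (\<xi> /\<^sub>R R)) * fourier f \<xi>))"
proof -
  have "integrable lborel (\<lambda>\<xi>. (cis (phase s \<xi>) * complex_of_real (cutoff j (\<xi> /\<^sub>R R))) * fourier f \<xi>)"
  proof (rule gaussian_decay_integrable[OF f])
    show "(\<lambda>\<xi>. cis (phase s \<xi>) * complex_of_real (cutoff j (\<xi> /\<^sub>R R))) \<in> borel_measurable borel"
      unfolding phase_def by measurable
    show "norm (cis (phase s \<xi>) * complex_of_real (cutoff j (\<xi> /\<^sub>R R))) \<le> 1" for \<xi>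
      using cutoff_le(1)[of j "\<xi> /\<^sub>R R"] cutoff_le_one[OF j, of "\<xi> /\<^sub>R R"] by (simp add: norm_mult)
  qed
  then show ?thesis by (simp only: mult.assoc)
qed

lemma borel_measurable_propagated:
  assumes "j \<le> 1" "gaussian_decay (fourier f)"
  shows "propagated s j R f \<in> borel_measurable borel"
  unfolding propagated_def[abs_def]
  by (rule borel_measurable_fourier_integral) (use borel_measurable_integrable[OF propagated_integrable[OF assms]] in simp)

text \<open>Phase factor and cutoff are both tensor products in (\<xi>, \<eta>), so that the double
  integral splits.\<close>

lemma bilinear_fio_lacunary_term:
  fixes f g :: "real^'n \<Rightarrow> complex"
  assumes j: "j \<le> 1" and f: "gaussian_decay (fourier f)" and g: "gaussian_decay (fourier g)"
  shows "bilinear_fio s (lacunary_term m (cutoff_prod j) k) f g x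
    = complex_of_real (1 / (2 * pi) ^ (2 * CARD('n)) * 2 powr (m * real k)) *
      (propagated s j (2 ^ k) f x * propagated s j (2 ^ k) g x)"
proof -
  let ?R = "2 ^ k :: real"
  let ?w = "\<lambda>f \<xi>. cis (phase s \<xi>) * (complex_of_real (cutoff j (\<xi> /\<^sub>R ?R)) * fourier f \<xi>)"
  let ?W = "\<lambda>f \<xi>. cis (x \<bullet> \<xi>) * ?w f \<xi>"
  have int: "integrable lborel (?W f)" if "gaussian_decay (fourier f)" for f
  proof (rule Bochner_Integration.integrable_bound[OF propagated_integrable[OF j that, of s ?R]])
    show "?W f \<in> borel_measurable lborel"
      by (rule borel_measurable_times[OF _ borel_measurable_integrable[OF propagated_integrable[OF j that]]]) measurable
  qed (simp add: norm_mult)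
  have scale: "(1 / 2 :: real) ^ k *\<^sub>R y = y /\<^sub>R ?R" for y :: "real^'n" by (simp add: power_one_over inverse_eq_divide)
  have "(\<integral>p. cis ((x, x) \<bullet> p) * (cis (phase s (fst p) + phase s (snd p)) * lacunary_term m (cutoff_prod j) k p *
      fourier f (fst p) * fourier g (snd p)) \<partial>lborel)
    = (\<integral>p. complex_of_real (2 powr (m * real k)) * (case p of (\<xi>, \<eta>) \<Rightarrow> ?W f \<xi> * ?W g \<eta>) \<partial>lborel)"
  proof (intro Bochner_Integration.integral_cong refl)
    fix p :: "(real^'n) \<times> (real^'n)"
    obtain \<xi> \<eta> where p: "p = (\<xi>, \<eta>)" by (cases p)
    have "lacunary_term m (cutoff_prod j) k p
        = complex_of_real (2 powr (m * real k)) * (complex_of_real (cutoff j (\<xi> /\<^sub>R ?R)) * complex_of_real (cutoff j (\<eta> /\<^sub>R ?R)))"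
      unfolding p lacunary_term_def cutoff_prod_def by (simp only: scaleR_Pair fst_conv snd_conv scale of_real_mult)
    moreover have "cis ((x, x) \<bullet> p) = cis (x \<bullet> \<xi>) * cis (x \<bullet> \<eta>)" unfolding p by (simp add: cis_mult)
    moreover have "cis (phase s (fst p) + phase s (snd p)) = cis (phase s \<xi>) * cis (phase s \<eta>)"
      unfolding p by (simp add: cis_mult)
    ultimately show "cis ((x, x) \<bullet> p) * (cis (phase s (fst p) + phase s (snd p)) * lacunary_term m (cutoff_prod j) k p *
        fourier f (fst p) * fourier g (snd p))
      = complex_of_real (2 powr (m * real k)) * (case p of (\<xi>, \<eta>) \<Rightarrow> ?W f \<xi> * ?W g \<eta>)"
      unfolding p by (simp only: prod.case fst_conv snd_conv mult_ac)
  qed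
  also have "\<dots> = complex_of_real (2 powr (m * real k)) * (propagated s j ?R f x * propagated s j ?R g x)"
    unfolding integral_mult_right_zero propagated_def
    by (subst integral_lborel_pair_mult(2)[OF int[OF f] int[OF g], symmetric]) simp
  finally show ?thesis unfolding bilinear_fio_eq_fourier_integral by simp
qed

text \<open>Real majorants A and B stand in for the norms of f and g, which keeps infinite values
  out of the later comparison of powers of 2^k.\<close>

definition propagation_bound ::
  "((real^'n \<Rightarrow> complex) \<Rightarrow> ennreal) \<Rightarrow> ((real^'n \<Rightarrow> complex) \<Rightarrow> ennreal) \<Rightarrow>
    ((real^'n \<Rightarrow> complex) \<Rightarrow> ennreal) \<Rightarrow> real \<Rightarrow> nat \<Rightarrow> real \<Rightarrow> bool" where
  "propagation_bound X Y Z s j \<alpha> \<longleftrightarrow> (\<exists>L>0. \<exists>\<delta>>0. \<forall>k f g A B. gauss_poly f \<longrightarrow> gauss_poly g \<longrightarrow>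
     gaussian_decay (fourier f) \<longrightarrow> gaussian_decay (fourier g) \<longrightarrow> 0 \<le> A \<longrightarrow> 0 \<le> B \<longrightarrow>
     X f \<le> ennreal A \<longrightarrow> Y g \<le> ennreal B \<longrightarrow>
     Z (\<lambda>x. complex_of_real (\<delta> * (2 ^ k) powr \<alpha>) * (propagated s j (2 ^ k) f x * propagated s j (2 ^ k) g x))
       \<le> ennreal (L * A * B))"

lemma propagation_bound_swap:
  assumes "propagation_bound X Y Z s j \<alpha>"
  shows "propagation_bound Y X Z s j \<alpha>"
proof -
  obtain L \<delta> where "L > 0" "\<delta> > 0" and *: "\<And>k f g A B. gauss_poly f \<Longrightarrow> gauss_poly g \<Longrightarrow>
     gaussian_decay (fourier f) \<Longrightarrow> gaussian_decay (fourier g) \<Longrightarrow> 0 \<le> A \<Longrightarrow> 0 \<le> B \<Longrightarrow>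
     X f \<le> ennreal A \<Longrightarrow> Y g \<le> ennreal B \<Longrightarrow>
     Z (\<lambda>x. complex_of_real (\<delta> * (2 ^ k) powr \<alpha>) * (propagated s j (2 ^ k) f x * propagated s j (2 ^ k) g x))
       \<le> ennreal (L * A * B)"
    using assms unfolding propagation_bound_def by blast
  have "Z (\<lambda>x. complex_of_real (\<delta> * (2 ^ k) powr \<alpha>) * (propagated s j (2 ^ k) f x * propagated s j (2 ^ k) g x))
      \<le> ennreal (L * A * B)"
    if "gauss_poly f" "gauss_poly g" "gaussian_decay (fourier f)" "gaussian_decay (fourier g)"
      "0 \<le> A" "0 \<le> B" "Y f \<le> ennreal A" "X g \<le> ennreal B" for k f g A B
  proof -
    have "L * B * A = L * A * B" by simp
    with *[of g f B A k] that show ?thesis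
      by (simp only: mult.commute[of "propagated s j (2 ^ k) f _" "propagated s j (2 ^ k) g _"])
  qed
  with \<open>L > 0\<close> \<open>\<delta> > 0\<close> show ?thesis unfolding propagation_bound_def by blast
qed

text \<open>Symbol classes grow with the order, so that the hypothesis for m is available for every
  m' \<le> m. Lowering the order to m' \<le> 1 meets the conditions on lacunary symbols, and m'
  \<le> 0 permits the cutoff that does not vanish at the origin.\<close>

lemma propagation_boundI:
  fixes m m' \<epsilon> :: real and Z :: "(real^'n \<Rightarrow> complex) \<Rightarrow> ennreal"
  assumes hyp: "\<And>\<sigma> :: (real^'n) \<times> (real^'n) \<Rightarrow> complex. \<sigma> \<in> symbol_class m \<Longrightarrow> bounded_from_to (bilinear_fio s \<sigma>) X Y Z"
    and Z: "quasi_norm_like Z" and eps: "\<epsilon> > 0" and m: "m' \<le> m" "m' \<le> 1" and j: "j = 1 \<or> j = 0 \<and> m' \<le> 0"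
  shows "propagation_bound X Y Z s j (m' - \<epsilon>)"
proof -
  have j1: "j \<le> 1" using j by auto
  have sub: "symbol_class m' \<subseteq> (symbol_class m :: ((real^'n) \<times> (real^'n) \<Rightarrow> complex) set)"
  proof
    fix \<sigma> :: "(real^'n) \<times> (real^'n) \<Rightarrow> complex" assume s: "\<sigma> \<in> symbol_class m'"
    have "\<exists>C. \<forall>\<xi> \<eta>. norm (D \<xi> \<eta>) \<le> C * (1 + norm \<xi> + norm \<eta>) powr (m - a - b)"
      if "\<exists>C. \<forall>\<xi> \<eta>. norm (D \<xi> \<eta>) \<le> C * (1 + norm \<xi> + norm \<eta>) powr (m' - a - b)"
      for D :: "real^'n \<Rightarrow> real^'n \<Rightarrow> complex" and a b
    proof -
      obtain C where C: "\<And>\<xi> \<eta>. norm (D \<xi> \<eta>) \<le> C * (1 + norm \<xi> + norm \<eta>) powr (m' - a - b)" using \<open>\<exists>C. _\<close> by blast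
      have "norm (D \<xi> \<eta>) \<le> \<bar>C\<bar> * (1 + norm \<xi> + norm \<eta>) powr (m - a - b)" for \<xi> \<eta>
      proof -
        have "C * (1 + norm \<xi> + norm \<eta>) powr (m' - a - b) \<le> \<bar>C\<bar> * (1 + norm \<xi> + norm \<eta>) powr (m - a - b)"
          using m by (intro mult_mono powr_mono) auto
        with C[of \<xi> \<eta>] show ?thesis by linarith
      qed
      then show ?thesis by blast
    qed
    with s show "\<sigma> \<in> symbol_class m" unfolding symbol_class_def by simp
  qed
  have vanish: "0 < m' \<Longrightarrow> \<exists>C. \<forall>z :: (real^'n) \<times> (real^'n). norm (cutoff_prod j z) \<le> C * norm z powr m'"
    using j cutoff_prod_vanish[of m'] m by auto
  obtain L \<delta> where L: "L > 0" and d: "\<delta> > 0" and *: "\<And>k f g. schwartz f \<Longrightarrow> schwartz g \<Longrightarrow> X f < \<infinity> \<Longrightarrow> Y g < \<infinity> \<Longrightarrow>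
    gaussian_decay (fourier f) \<Longrightarrow> gaussian_decay (fourier g) \<Longrightarrow>
    Z (\<lambda>x. complex_of_real (\<delta> * 2 powr (- \<epsilon> * real k)) * bilinear_fio s (lacunary_term m' (cutoff_prod j) k) f g x)
      \<le> ennreal L * X f * Y g"
    using lacunary_uniform_bound[OF gauss_poly_cutoff_prod[OF j1] m(2) eps vanish _ Z, of s X Y] hyp sub by blast
  let ?cn = "1 / (2 * pi) ^ (2 * CARD('n))"
  have "Z (\<lambda>x. complex_of_real (\<delta> * ?cn * (2 ^ k) powr (m' - \<epsilon>)) * (propagated s j (2 ^ k) f x * propagated s j (2 ^ k) g x))
      \<le> ennreal (L * A * B)"
    if f: "gauss_poly f" "gaussian_decay (fourier f)" and g: "gauss_poly g" "gaussian_decay (fourier g)"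
      and AB: "0 \<le> A" "0 \<le> B" "X f \<le> ennreal A" "Y g \<le> ennreal B" for k f g A B
  proof -
    have "2 powr (- \<epsilon> * real k) * 2 powr (m' * real k) = (2 ^ k) powr (m' - \<epsilon>)"
      by (simp add: powr_realpow[symmetric] powr_powr algebra_simps flip: powr_add)
    then have c: "complex_of_real (\<delta> * ?cn * (2 ^ k) powr (m' - \<epsilon>))
        = complex_of_real (\<delta> * 2 powr (- \<epsilon> * real k)) * complex_of_real (?cn * 2 powr (m' * real k))"
      unfolding of_real_mult[symmetric] by (simp add: mult_ac)
    have fin: "X f < \<infinity>" "Y g < \<infinity>" using AB(3,4) by (auto intro: order_le_less_trans)
    have c': "complex_of_real (\<delta> * ?cn * (2 ^ k) powr (m' - \<epsilon>)) * P
        = complex_of_real (\<delta> * 2 powr (- \<epsilon> * real k)) * (complex_of_real (?cn * 2 powr (m' * real k)) * P)" for P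
      unfolding c by (rule mult.assoc)
    from *[OF gauss_poly_schwartz[OF f(1)] gauss_poly_schwartz[OF g(1)] fin f(2) g(2), of k]
    have "Z (\<lambda>x. complex_of_real (\<delta> * ?cn * (2 ^ k) powr (m' - \<epsilon>)) * (propagated s j (2 ^ k) f x * propagated s j (2 ^ k) g x))
      \<le> ennreal L * X f * Y g"
      unfolding bilinear_fio_lacunary_term[OF j1 f(2) g(2)] c' .
    also have "\<dots> \<le> ennreal L * ennreal A * ennreal B" using AB by (intro mult_mono) auto
    also have "\<dots> = ennreal (L * A * B)" using L AB by (simp add: ennreal_mult)
    finally show ?thesis .
  qed
  moreover have "\<delta> * ?cn > 0" using d by simp
  ultimately show ?thesis unfolding propagation_bound_def using L by blast
qed

section \<open>Test functions\<close>

lemma two_powr_power: "(2 powr a) ^ k = (2 ^ k) powr (a::real)"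
  by (simp add: powr_powr mult.commute flip: powr_realpow)

lemma powr_exponent_le:
  fixes c C \<alpha> \<beta> :: real
  assumes c: "c > 0" and le: "\<And>k::nat. k \<ge> k0 \<Longrightarrow> c * (2 ^ k) powr \<alpha> \<le> C * (2 ^ k) powr \<beta>"
  shows "\<alpha> \<le> \<beta>"
proof (rule ccontr)
  assume "\<not> \<alpha> \<le> \<beta>"
  then have x: "1 < (2::real) powr (\<alpha> - \<beta>)" using powr_less_mono[of 0 "\<alpha> - \<beta>" 2] by simp
  obtain k where k: "C / c < (2 powr (\<alpha> - \<beta>)) ^ k" using real_arch_pow[OF x] by blast
  let ?k = "max k k0"
  have "C / c < (2 powr (\<alpha> - \<beta>)) ^ ?k"
    by (rule less_le_trans[OF k power_increasing]) (use x in auto)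
  also have "\<dots> = (2 ^ ?k) powr \<alpha> / (2 ^ ?k) powr \<beta>"
    by (simp only: powr_diff power_divide two_powr_power)
  finally show False using le[of ?k] c by (simp add: divide_simps mult.commute split: if_splits)
qed

text \<open>Near the origin the packets add up in phase. After removal of the carrier e^(iR
  x\<bullet>e) the remaining oscillation x\<bullet>(\<xi> - R e) is at most C0 \<eta>, hence small.
  The bound on the imaginary part keeps squares of the values from cancelling, for the BMO estimate;
  a cutoff at a larger scale R' serves the mixed regions.\<close>

lemma packet_focus:
  fixes e :: "real^'n" and s C0 :: real
  assumes s: "s > 0" "s \<noteq> 1" and e: "norm e = 1" and C0: "C0 > 0"
  shows "\<exists>(v :: real \<Rightarrow> real^'n \<Rightarrow> complex) C. C > 0 \<and> (\<forall>R\<ge>1. gauss_poly (v R) \<and> gaussian_decay (fourier (v R)) \<and>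
    (\<forall>p\<ge>1. Lp_norm p (v R) \<le> ennreal (C * R powr (real CARD('n) * (s - 1) * enn2real (1 / p)))) \<and>
    (\<forall>j R' x. j \<le> 1 \<longrightarrow> R' = R \<or> j = 0 \<and> R \<le> R' \<longrightarrow> norm x \<le> C0 / R \<longrightarrow>
      R powr (real CARD('n) * s / 2) / C \<le> Re (cis (- (R * (x \<bullet> e))) * propagated s j R' (v R) x) \<and>
      \<bar>Im (cis (- (R * (x \<bullet> e))) * propagated s j R' (v R) x)\<bar>
        \<le> Re (cis (- (R * (x \<bullet> e))) * propagated s j R' (v R) x) / 2))"
proof -
  let ?n = "CARD('n)"
  \<comment> \<open>Half of the lower bound of \<open>cutoff_ge\<close>; the other factor 1/2 is the
    lower bound of the cosine.\<close>
  define c0 where "c0 = exp (- 4) / (8::real)"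
  have "exp (- 4) \<le> (1::real)" by simp
  then have c0: "c0 > 0" "c0 / 8 \<le> 1" unfolding c0_def by (simp, linarith)
  \<comment> \<open>Makes |x\<bullet>(\<xi> - R e)| \<le> C0 \<eta> \<le> c0 / 8, which serves for
    the imaginary part and, being below \<pi>/3, for the cosine.\<close>
  define \<eta> where "\<eta> = min (1 / 2) (c0 / (8 * C0))"
  have eta: "0 < \<eta>" "\<eta> \<le> 1 / 2" "\<eta> \<le> c0 / (8 * C0)" using c0 C0 by (auto simp: \<eta>_def)
  obtain v :: "real \<Rightarrow> real^'n \<Rightarrow> complex" and C where C: "C > 0" and
    v: "\<And>R. R \<ge> 1 \<Longrightarrow> gauss_poly (v R) \<and> gaussian_decay (fourier (v R)) \<and> integrable lborel (v R) \<and>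
      (\<forall>x. norm (v R x) \<le> C) \<and> (\<integral>x. norm (v R x) \<partial>lborel) \<le> C * R powr (real ?n * (s - 1))" and
    vpair: "\<And>R W. R \<ge> 1 \<Longrightarrow> W \<in> borel_measurable borel \<Longrightarrow> (\<forall>\<xi>. norm (W \<xi>) \<le> 1) \<Longrightarrow>
        (\<forall>\<xi>. norm (\<xi> - R *\<^sub>R e) \<le> \<eta> * R \<longrightarrow> c0 \<le> Re (W \<xi>) \<and> \<bar>Im (W \<xi>)\<bar> \<le> c0 / 8) \<Longrightarrow>
        R powr (real ?n * s / 2) / C \<le> Re (\<integral>\<xi>. W \<xi> * (cis (phase s \<xi>) * fourier (v R) \<xi>) \<partial>lborel) \<and>
        \<bar>Im (\<integral>\<xi>. W \<xi> * (cis (phase s \<xi>) * fourier (v R) \<xi>) \<partial>lborel)\<bar>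
          \<le> Re (\<integral>\<xi>. W \<xi> * (cis (phase s \<xi>) * fourier (v R) \<xi>) \<partial>lborel) / 2"
    using packets_exist[OF s eta(1,2) c0(1) e] by blast
  show ?thesis
  proof (rule exI[of _ v], rule exI[of _ C], intro conjI allI impI C)
    fix R :: real assume R: "R \<ge> 1"
    show "gauss_poly (v R)" "gaussian_decay (fourier (v R))" using v[OF R] by auto
    show "Lp_norm p (v R) \<le> ennreal (C * R powr (real ?n * (s - 1) * enn2real (1 / p)))" if p: "p \<ge> 1" for p
    proof -
      have "Lp_norm p (v R) \<le> ennreal (C * (R powr (real ?n * (s - 1))) powr enn2real (1 / p))"
      proof (rule Lp_norm_le[OF _ p C])
        show "v R \<in> borel_measurable borel" using v[OF R] borel_measurable_integrable[of lborel "v R"] by simp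
        have "(\<integral>\<^sup>+x. ennreal (norm (v R x)) \<partial>lborel) = ennreal (\<integral>x. norm (v R x) \<partial>lborel)"
          using v[OF R] by (intro nn_integral_eq_integral) auto
        also have "\<dots> \<le> ennreal (C * R powr (real ?n * (s - 1)))" using v[OF R] by (intro ennreal_leI) auto
        finally show "(\<integral>\<^sup>+x. ennreal (norm (v R x)) \<partial>lborel) \<le> ennreal (C * R powr (real ?n * (s - 1)))" .
      qed (use v[OF R] R in auto)
      then show ?thesis by (simp add: powr_powr)
    qed
    fix j :: nat and R' :: real and x :: "real^'n"
    assume j: "j \<le> 1" and R': "R' = R \<or> j = 0 \<and> R \<le> R'" and x: "norm x \<le> C0 / R"
    define W where "W \<xi> = cis (x \<bullet> (\<xi> - R *\<^sub>R e)) * complex_of_real (cutoff j (\<xi> /\<^sub>R R'))" for \<xi>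
    have z: "cis (- (R * (x \<bullet> e))) * propagated s j R' (v R) x = (\<integral>\<xi>. W \<xi> * (cis (phase s \<xi>) * fourier (v R) \<xi>) \<partial>lborel)"
      unfolding propagated_def integral_mult_right_zero[symmetric]
    proof (intro Bochner_Integration.integral_cong refl)
      fix \<xi>
      have h: "cis (- (R * (x \<bullet> e))) * cis (x \<bullet> \<xi>) = cis (x \<bullet> (\<xi> - R *\<^sub>R e))"
        by (simp add: cis_mult inner_diff_right)
      show "cis (- (R * (x \<bullet> e))) * (cis (x \<bullet> \<xi>) * (cis (phase s \<xi>) * (complex_of_real (cutoff j (\<xi> /\<^sub>R R')) * fourier (v R) \<xi>)))
        = W \<xi> * (cis (phase s \<xi>) * fourier (v R) \<xi>)"
        unfolding W_def h[symmetric] by (simp only: mult_ac)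
    qed
    have "\<forall>\<xi>. norm (\<xi> - R *\<^sub>R e) \<le> \<eta> * R \<longrightarrow> c0 \<le> Re (W \<xi>) \<and> \<bar>Im (W \<xi>)\<bar> \<le> c0 / 8"
    proof (intro allI impI)
      fix \<xi> assume xi: "norm (\<xi> - R *\<^sub>R e) \<le> \<eta> * R"
      let ?t = "x \<bullet> (\<xi> - R *\<^sub>R e)" and ?c = "cutoff j (\<xi> /\<^sub>R R')"
      have "\<bar>?t\<bar> \<le> norm x * norm (\<xi> - R *\<^sub>R e)" by (rule Cauchy_Schwarz_ineq2)
      also have "\<dots> \<le> C0 / R * (\<eta> * R)" using x xi C0 R by (intro mult_mono) auto
      also have "\<dots> = C0 * \<eta>" using R by simp
      also have "\<dots> \<le> c0 / 8" using eta(3) C0 by (simp add: pos_le_divide_eq mult_ac)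
      finally have t: "\<bar>?t\<bar> \<le> c0 / 8" .
      have nR: "norm (R *\<^sub>R e) = R" using e R by simp
      have half: "\<eta> * R \<le> R / 2" using eta R mult_right_mono[of \<eta> "1 / 2" R] by simp
      have nxi: "R / 2 \<le> norm \<xi>" "norm \<xi> \<le> 2 * R"
        using norm_triangle_ineq2[of "R *\<^sub>R e" \<xi>] norm_triangle_ineq2[of \<xi> "R *\<^sub>R e"] xi half R
        unfolding nR norm_minus_commute[of "R *\<^sub>R e"] by linarith+
      have R'R: "R' \<ge> R" using R' by auto
      have ny: "norm (\<xi> /\<^sub>R R') = norm \<xi> / R'" using R R'R by (simp add: divide_inverse mult.commute)
      have c: "2 * c0 \<le> ?c"
      proof -
        have "exp (- 4) / 4 \<le> ?c"
        proof (rule cutoff_ge[OF j])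
          show "norm (\<xi> /\<^sub>R R') \<le> 2" unfolding ny using nxi R R'R by (simp add: divide_le_eq)
          show "j = 0 \<or> 1 / 2 \<le> norm (\<xi> /\<^sub>R R')" unfolding ny using nxi R R' by (auto simp: le_divide_eq)
        qed
        then show ?thesis by (simp add: c0_def)
      qed
      have "1 / 2 \<le> cos ?t"
      proof -
        have "cos (pi / 3) \<le> cos \<bar>?t\<bar>"
          using t c0(2) pi_gt3 by (intro cos_monotone_0_pi_le) auto
        then show ?thesis by (simp add: cos_60)
      qed
      then have "2 * c0 * (1 / 2) \<le> ?c * cos ?t" using c c0 by (intro mult_mono) auto
      moreover have "\<bar>?c * sin ?t\<bar> \<le> c0 / 8"
      proof -
        have "\<bar>?c * sin ?t\<bar> \<le> 1 * \<bar>?t\<bar>"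
          unfolding abs_mult using cutoff_le(1)[of j "\<xi> /\<^sub>R R'"] cutoff_le_one[OF j, of "\<xi> /\<^sub>R R'"] abs_sin_x_le_abs_x[of ?t]
          by (intro mult_mono) auto
        with t show ?thesis by simp
      qed
      ultimately show "c0 \<le> Re (W \<xi>) \<and> \<bar>Im (W \<xi>)\<bar> \<le> c0 / 8" by (simp add: W_def mult.commute)
    qed
    moreover have "\<forall>\<xi>. norm (W \<xi>) \<le> 1"
    proof
      show "norm (W \<xi>) \<le> 1" for \<xi>
        using cutoff_le(1)[of j "\<xi> /\<^sub>R R'"] cutoff_le_one[OF j, of "\<xi> /\<^sub>R R'"] by (simp add: W_def norm_mult)
    qed
    moreover have "W \<in> borel_measurable borel" unfolding W_def by measurable
    ultimately show "R powr (real ?n * s / 2) / C \<le> Re (cis (- (R * (x \<bullet> e))) * propagated s j R' (v R) x)"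
      "\<bar>Im (cis (- (R * (x \<bullet> e))) * propagated s j R' (v R) x)\<bar> \<le> Re (cis (- (R * (x \<bullet> e))) * propagated s j R' (v R) x) / 2"
      unfolding z using vpair[OF R, of W] by blast+
  qed
qed

lemma gaussian_decay_hardy_bump:
  assumes R: "R > 0"
  shows "gaussian_decay (fourier (hardy_bump R :: real^'n \<Rightarrow> complex))"
proof (rule gaussian_decay_translate[where p = 0])
  show "fourier (hardy_bump R :: real^'n \<Rightarrow> complex) \<in> borel_measurable borel"
    unfolding fourier_hardy_bump(2)[OF R] by measurable
  show "1 / 16 / R\<^sup>2 > 0" using R by simp
  show "norm (fourier (hardy_bump R) \<xi>) \<le> sqrt pi ^ CARD('n) * exp (- (1 / 16 / R\<^sup>2) * (norm (\<xi> - 0))\<^sup>2)" for \<xi> :: "real^'n"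
  proof -
    let ?a = "exp (- (1 / 16) * (norm (\<xi> /\<^sub>R R))\<^sup>2)" and ?b = "exp (- (1 / 4) * (norm (\<xi> /\<^sub>R R))\<^sup>2)"
    have "0 \<le> ?a - ?b" "?a - ?b \<le> ?a" by auto
    then have "norm (fourier (hardy_bump R) \<xi>) \<le> sqrt pi ^ CARD('n) * ?a"
      unfolding fourier_hardy_bump(2)[OF R] norm_of_real abs_mult by (intro mult_mono) auto
    also have "- (1 / 16) * (norm (\<xi> /\<^sub>R R))\<^sup>2 = - (1 / 16 / R\<^sup>2) * (norm (\<xi> - 0))\<^sup>2"
      using R by (simp add: power_mult_distrib field_simps)
    finally show ?thesis .
  qed
qed

text \<open>The transform of the bump is a fixed profile dilated by R. Although it vanishes at the
  origin, it is bounded below near a unit vector, and that is enough for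
  \<open>dispersion_lower_bound\<close>.\<close>

lemma hardy_bump_spread:
  fixes s :: real
  assumes s: "s > 0" "s \<noteq> 1" and j: "j \<le> 1"
  shows "\<exists>b>0. \<exists>c>0. \<exists>D>0. \<forall>R\<ge>1. ennreal (c * R powr (real CARD('n) * (s - 1))) \<le>
    emeasure lborel {x :: real^'n. norm x \<le> D * R powr (s - 1) \<and>
      b * R powr (real CARD('n) - real CARD('n) * s / 2) \<le> norm (propagated s j R (hardy_bump R) x)}"
proof -
  let ?n = "CARD('n)"
  define e :: "real^'n" where "e = axis undefined 1"
  have e: "norm e = 1" by (simp add: e_def)
  define \<omega> :: "real^'n \<Rightarrow> real" where "\<omega> y = cutoff j y * (exp (- (1 / 16) * (norm y)\<^sup>2) - exp (- (1 / 4) * (norm y)\<^sup>2))" for y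
  \<comment> \<open>For t = |y|^2 between 1/4 and 9/4, the difference of Gaussians is e^(-t/4)
    (e^(3t/16) - 1), at least e^(-1) times 3/64; the cutoff contributes e^(-4)/4.\<close>
  define c0 where "c0 = exp (- 4) / 4 * (exp (- 1) * (3 / 64) :: real)"
  have d: "0 \<le> exp (- (1 / 16) * (norm y)\<^sup>2) - exp (- (1 / 4) * (norm y)\<^sup>2)" for y :: "real^'n" by auto
  have omK: "\<bar>\<omega> y\<bar> \<le> 1 * exp (- (1 / 16) * (norm y)\<^sup>2)" for y
    unfolding \<omega>_def abs_mult
    using cutoff_le(1)[of j y] cutoff_le_one[OF j, of y] d[of y] by (intro mult_mono) auto
  have om1: "\<bar>\<omega> y\<bar> \<le> 1" for y by (rule order_trans[OF omK]) simp
  have om0: "c0 \<le> \<omega> y" if y: "norm (y - e) \<le> 1 / 2" for y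
  proof -
    have ny: "1 / 2 \<le> norm y" "norm y \<le> 3 / 2"
      using norm_triangle_ineq2[of e y] norm_triangle_ineq2[of y e] y e by (auto simp: norm_minus_commute)
    have q: "1 / 4 \<le> (norm y)\<^sup>2" "(norm y)\<^sup>2 \<le> 9 / 4"
      using power_mono[OF ny(1), of 2] power_mono[OF ny(2), of 2] by (auto simp: power_divide)
    let ?t = "(norm y)\<^sup>2"
    have "exp (- (1 / 16) * ?t) - exp (- (1 / 4) * ?t) = exp (- (1 / 4) * ?t) * (exp (3 / 16 * ?t) - 1)"
      by (simp add: right_diff_distrib flip: exp_add)
    moreover have "3 / 64 \<le> exp (3 / 16 * ?t) - 1" using exp_ge_add_one_self[of "3 / 16 * ?t"] q by linarith
    moreover have "exp (- 1) \<le> exp (- (1 / 4) * ?t)" using q by simp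
    ultimately have "exp (- 1) * (3 / 64) \<le> exp (- (1 / 16) * ?t) - exp (- (1 / 4) * ?t)"
      by (metis mult_mono exp_ge_zero divide_nonneg_nonneg zero_le_numeral)
    moreover have "exp (- 4) / 4 \<le> cutoff j y" using ny by (intro cutoff_ge[OF j]) auto
    ultimately show ?thesis unfolding c0_def \<omega>_def using cutoff_le(1)[of j y] by (intro mult_mono) auto
  qed
  have c0: "c0 > 0" by (simp add: c0_def)
  have om_meas: "\<omega> \<in> borel_measurable borel" unfolding \<omega>_def by measurable
  obtain b c D where bcD: "b > 0" "c > 0" "D > 0" and *: "\<And>R. R \<ge> 1 \<Longrightarrow> ennreal (c * R powr (real ?n * (s - 1))) \<le>
    emeasure lborel {x. norm x \<le> D * R powr (s - 1) \<and> b * R powr (real ?n - real ?n * s / 2)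
      \<le> norm (\<integral>\<xi>. cis (x \<bullet> \<xi>) * (cis (phase s \<xi>) * complex_of_real (\<omega> (\<xi> /\<^sub>R R))) \<partial>lborel)}"
    using dispersion_lower_bound[OF s _ _ c0 e om_meas om1 _ omK om0, of "1 / 2"] by (auto simp del: scaleR_complex.simps)
  have P: "sqrt pi ^ ?n > 0" by simp
  have prp: "norm (propagated s j R (hardy_bump R) x) = sqrt pi ^ ?n *
      norm (\<integral>\<xi>. cis (x \<bullet> \<xi>) * (cis (phase s \<xi>) * complex_of_real (\<omega> (\<xi> /\<^sub>R R))) \<partial>lborel)" if R: "R \<ge> 1" for R and x :: "real^'n"
  proof -
    have R0: "R > 0" using R by simp
    have "propagated s j R (hardy_bump R) x = (\<integral>\<xi>. complex_of_real (sqrt pi ^ ?n) *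
        (cis (x \<bullet> \<xi>) * (cis (phase s \<xi>) * complex_of_real (\<omega> (\<xi> /\<^sub>R R)))) \<partial>lborel)"
      unfolding propagated_def fourier_hardy_bump(2)[OF R0] \<omega>_def of_real_mult
      by (intro Bochner_Integration.integral_cong refl) (simp only: mult_ac)
    also have "\<dots> = complex_of_real (sqrt pi ^ ?n) * (\<integral>\<xi>. cis (x \<bullet> \<xi>) * (cis (phase s \<xi>) * complex_of_real (\<omega> (\<xi> /\<^sub>R R))) \<partial>lborel)"
      by (rule integral_mult_right_zero)
    finally show ?thesis using P by (simp only: norm_mult norm_of_real abs_of_pos)
  qed
  show ?thesis
  proof (rule exI[of _ "sqrt pi ^ ?n * b"], intro conjI, goal_cases)
    case 2
    show ?case
    proof (rule exI[of _ c], intro conjI bcD(2), rule exI[of _ D], intro conjI bcD(3) allI impI)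
      fix R :: real assume R: "R \<ge> 1"
      show "ennreal (c * R powr (real ?n * (s - 1))) \<le> emeasure lborel {x :: real^'n. norm x \<le> D * R powr (s - 1) \<and>
        sqrt pi ^ ?n * b * R powr (real ?n - real ?n * s / 2) \<le> norm (propagated s j R (hardy_bump R) x)}"
        unfolding prp[OF R] mult.assoc using *[OF R] P by (simp only: mult_le_cancel_left_pos)
    qed
  qed (use bcD in simp)
qed

text \<open>For s < 1 the frequency \<rho> = c1 R^(1-s) tends to infinity, so that packets of this
  frequency are available, and their focus of radius 1/\<rho> covers the ball. The cutoff stays at
  the scale R \<ge> \<rho>, hence the choice j = 0.\<close>

lemma slow_test_lt_one:
  fixes s :: real
  assumes s: "0 < s" "s < 1" and q: "1 \<le> q" and D: "D > 0"
  shows "\<exists>C>0. \<exists>c>0. \<exists>k0. \<forall>k\<ge>k0. \<exists>g :: real^'n \<Rightarrow> complex. gauss_poly g \<and> gaussian_decay (fourier g) \<and>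
    Lp_norm q g \<le> ennreal (C * (2 ^ k) powr (- ((1 - s) * (1 - s)) * real CARD('n) * enn2real (1 / q))) \<and>
    (\<forall>x. norm x \<le> D * (2 ^ k) powr (s - 1) \<longrightarrow>
      c * (2 ^ k) powr ((1 - s) * s * real CARD('n) / 2) \<le> norm (propagated s 0 (2 ^ k) g x))"
proof -
  let ?n = "CARD('n)"
  let ?i = "enn2real (1 / q)"
  define e :: "real^'n" where "e = axis undefined 1"
  have e: "norm e = 1" by (simp add: e_def)
  obtain v :: "real \<Rightarrow> real^'n \<Rightarrow> complex" and C where C: "C > 0" and
    v: "\<And>R. R \<ge> 1 \<Longrightarrow> gauss_poly (v R) \<and> gaussian_decay (fourier (v R))" and
    vL: "\<And>R p. R \<ge> 1 \<Longrightarrow> p \<ge> 1 \<Longrightarrow> Lp_norm p (v R) \<le> ennreal (C * R powr (real ?n * (s - 1) * enn2real (1 / p)))" and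
    vU: "\<And>R j R' x. R \<ge> 1 \<Longrightarrow> j \<le> 1 \<Longrightarrow> R' = R \<or> j = 0 \<and> R \<le> R' \<Longrightarrow> norm x \<le> 1 / R \<Longrightarrow>
      R powr (real ?n * s / 2) / C \<le> Re (cis (- (R * (x \<bullet> e))) * propagated s j R' (v R) x)"
    using packet_focus[OF s(1) _ e zero_less_one] s by (metis less_irrefl)
  \<comment> \<open>c1 D \<le> 1 places the ball inside the focus, and c1 \<le> 1 ensures \<rho>
    \<le> R.\<close>
  define c1 where "c1 = min 1 (1 / D)"
  have c1: "c1 > 0" "c1 \<le> 1" "c1 * D \<le> 1" using D by (auto simp: c1_def min_def field_simps)
  have "1 < (2::real) powr (1 - s)" using s powr_less_mono[of 0 "1 - s" 2] by simp
  \<comment> \<open>From k0 on, \<rho> \<ge> 1, as the packets require.\<close>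
  then obtain k0 where k0: "1 / c1 < (2 powr (1 - s)) ^ k0" using real_arch_pow by blast
  show ?thesis
  proof (rule exI[of _ "C * c1 powr (real ?n * (s - 1) * ?i)"], intro conjI, goal_cases)
    case 2
    show ?case
    proof (rule exI[of _ "c1 powr (real ?n * s / 2) / C"], intro conjI, goal_cases)
      case 2
      show ?case
      proof (rule exI[of _ k0], intro allI impI)
        fix k assume k: "k0 \<le> k"
        let ?R = "2 ^ k :: real"
        define \<rho> where "\<rho> = c1 * ?R powr (1 - s)"
        have R1: "?R \<ge> 1" by simp
        have Rk: "?R powr (1 - s) = (2 powr (1 - s)) ^ k" by (rule two_powr_power[symmetric])
        have rho1: "\<rho> \<ge> 1"
        proof -
          have "(2 powr (1 - s)) ^ k0 \<le> (2 powr (1 - s)) ^ k" using k s by (intro power_increasing) (auto simp: ge_one_powr_ge_zero)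
          with k0 have "1 / c1 \<le> ?R powr (1 - s)" unfolding Rk by linarith
          then show ?thesis using c1 by (simp add: \<rho>_def pos_divide_le_eq mult.commute)
        qed
        have rhoR: "\<rho> \<le> ?R"
        proof -
          have "?R powr (1 - s) \<le> ?R powr 1" using s by (intro powr_mono) auto
          then have "c1 * ?R powr (1 - s) \<le> 1 * ?R" using c1 by (intro mult_mono) auto
          then show ?thesis by (simp add: \<rho>_def)
        qed
        have rho_powr: "\<rho> powr a = c1 powr a * ?R powr ((1 - s) * a)" for a
          using c1 by (simp add: \<rho>_def powr_mult powr_powr)
        show "\<exists>g :: real^'n \<Rightarrow> complex. gauss_poly g \<and> gaussian_decay (fourier g) \<and>
          Lp_norm q g \<le> ennreal (C * c1 powr (real ?n * (s - 1) * ?i) * ?R powr (- ((1 - s) * (1 - s)) * real ?n * ?i)) \<and>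
          (\<forall>x. norm x \<le> D * ?R powr (s - 1) \<longrightarrow>
            c1 powr (real ?n * s / 2) / C * ?R powr ((1 - s) * s * real ?n / 2) \<le> norm (propagated s 0 ?R g x))"
        proof (intro exI[of _ "v \<rho>"] conjI allI impI)
          show "gauss_poly (v \<rho>)" "gaussian_decay (fourier (v \<rho>))" using v[OF rho1] by auto
          have "(1 - s) * (real ?n * (s - 1) * ?i) = - ((1 - s) * (1 - s)) * real ?n * ?i" by (simp add: algebra_simps)
          then show "Lp_norm q (v \<rho>) \<le> ennreal (C * c1 powr (real ?n * (s - 1) * ?i) * ?R powr (- ((1 - s) * (1 - s)) * real ?n * ?i))"
            using vL[OF rho1 q] unfolding rho_powr by (simp only: mult.assoc)
          fix x :: "real^'n" assume x: "norm x \<le> D * ?R powr (s - 1)"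
          have "norm x * \<rho> \<le> D * ?R powr (s - 1) * \<rho>" using x rho1 by (intro mult_right_mono) auto
          also have "\<dots> = c1 * D * (?R powr (s - 1) * ?R powr (1 - s))" by (simp add: \<rho>_def)
          also have "?R powr (s - 1) * ?R powr (1 - s) = 1" by (simp flip: powr_add)
          finally have "norm x * \<rho> \<le> 1" using c1(3) by simp
          then have "norm x \<le> 1 / \<rho>" using rho1 by (simp add: pos_le_divide_eq)
          from vU[OF rho1 _ _ this, of 0 ?R] rhoR
          have "\<rho> powr (real ?n * s / 2) / C \<le> Re (cis (- (\<rho> * (x \<bullet> e))) * propagated s 0 ?R (v \<rho>) x)" by simp
          also have "\<dots> \<le> norm (cis (- (\<rho> * (x \<bullet> e))) * propagated s 0 ?R (v \<rho>) x)" by (rule complex_Re_le_cmod)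
          also have "\<dots> = norm (propagated s 0 ?R (v \<rho>) x)" by (simp only: norm_mult norm_cis mult_1_left)
          finally have "\<rho> powr (real ?n * s / 2) / C \<le> norm (propagated s 0 ?R (v \<rho>) x)" .
          moreover have "(1 - s) * (real ?n * s / 2) = (1 - s) * s * real ?n / 2" by simp
          ultimately show "c1 powr (real ?n * s / 2) / C * ?R powr ((1 - s) * s * real ?n / 2) \<le> norm (propagated s 0 ?R (v \<rho>) x)"
            unfolding rho_powr by (simp add: mult_ac)
        qed
      qed
    qed (use c1 C in simp)
  qed (use c1 C in simp)
qed

text \<open>For s > 1 the frequency \<rho> = c1 R^(1-s) tends to 0. The phase |\<eta>|^s is small
  there, and so are x\<bullet>\<eta> on the ball and the deviation of the cutoff from 1. The
  propagated Gaussian therefore differs from (2\<pi>)^n by at most half of it.\<close>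

lemma slow_test_gt_one:
  fixes s :: real
  assumes s: "1 < s" and q: "1 \<le> q" and D: "D > 0"
  shows "\<exists>C>0. \<exists>c>0. \<exists>k0. \<forall>k\<ge>k0. \<exists>g :: real^'n \<Rightarrow> complex. gauss_poly g \<and> gaussian_decay (fourier g) \<and>
    Lp_norm q g \<le> ennreal (C * (2 ^ k) powr ((s - 1) * real CARD('n) * enn2real (1 / q))) \<and>
    (\<forall>x. norm x \<le> D * (2 ^ k) powr (s - 1) \<longrightarrow>
      c * (2 ^ k) powr 0 \<le> norm (propagated s 0 (2 ^ k) g x))"
proof -
  let ?n = "CARD('n)"
  let ?i = "enn2real (1 / q)"
  let ?P = "(2 * pi) ^ ?n :: real"
  \<comment> \<open>The relative error will be at most c1 (D + 3) M: the summand 1 comes from the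
    frequencies below \<rho>, the other one from the second moment of the transform. The choice of
    c1 makes this 1/2.\<close>
  define M where "M = 1 + 8 * sqrt 2 ^ ?n"
  have M: "M \<ge> 1" by (simp add: M_def)
  define c1 where "c1 = 1 / (2 * (D + 3) * M)"
  have DM: "2 * (D + 3) * M \<ge> 1" using D M mult_mono[of 1 "2 * (D + 3)" 1 M] by simp
  have c1: "c1 > 0" "c1 \<le> 1" "c1 * (D + 3) * M = 1 / 2" using D M DM by (auto simp: c1_def)
  define V where "V = sqrt pi ^ ?n"
  have V: "V > 0" by (simp add: V_def)
  have main: "\<exists>g :: real^'n \<Rightarrow> complex. gauss_poly g \<and> gaussian_decay (fourier g) \<and>
      Lp_norm q g \<le> ennreal ((V * c1 powr - real ?n) powr ?i * R powr ((s - 1) * real ?n * ?i)) \<and>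
      (\<forall>x. norm x \<le> D * R powr (s - 1) \<longrightarrow> ?P / 2 * R powr 0 \<le> norm (propagated s 0 R g x))"
    if R: "R \<ge> 1" for R
  proof -
    define \<rho> where "\<rho> = c1 * R powr (1 - s)"
    have rho: "\<rho> > 0" "\<rho> \<le> c1"
    proof -
      show "\<rho> > 0" using c1 R by (simp add: \<rho>_def)
      have "R powr (1 - s) \<le> R powr 0" using R s by (intro powr_mono) auto
      then show "\<rho> \<le> c1" using c1 R by (simp add: \<rho>_def mult_left_le)
    qed
    have rho2: "\<rho>\<^sup>2 > 0" using rho by simp
    let ?g = "\<lambda>x::real^'n. complex_of_real (exp (- (\<rho>\<^sup>2) * (norm x)\<^sup>2))"
    define a where "a = 1 / (4 * \<rho>\<^sup>2)"
    have a: "a > 0" using rho by (simp add: a_def)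
    define S where "S = sqrt (pi / \<rho>\<^sup>2) ^ ?n"
    have S: "S > 0" using rho by (simp add: S_def)
    define G where "G \<eta> = S * exp (- a * (norm (\<eta> - 0))\<^sup>2)" for \<eta> :: "real^'n"
    define G2 where "G2 \<eta> = S * exp (- (a / 2) * (norm (\<eta> - 0))\<^sup>2)" for \<eta> :: "real^'n"
    have fg: "fourier ?g \<eta> = complex_of_real (G \<eta>)" for \<eta>
      using gaussian_fourier_transform(2)[OF rho2, of \<eta>] by (simp add: G_def S_def a_def)
    have a2: "a / 2 > 0" using a by simp
    have Gint: "integrable lborel G" "integrable lborel G2"
      unfolding G_def[abs_def] G2_def[abs_def]
      by (rule integrable_mult_right[OF gaussian_integral(1)[OF a]], rule integrable_mult_right[OF gaussian_integral(1)[OF a2]])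
    have sqc: "sqrt (pi / \<rho>\<^sup>2) * sqrt (pi / a) = 2 * pi"
    proof -
      have "sqrt (pi / \<rho>\<^sup>2) * sqrt (pi / a) = sqrt ((2 * pi)\<^sup>2)"
        unfolding real_sqrt_mult[symmetric] using rho by (simp add: a_def power2_eq_square)
      then show ?thesis by (simp only: real_sqrt_abs) simp
    qed
    have GI: "(\<integral>\<eta>. G \<eta> \<partial>lborel) = ?P"
      unfolding G_def integral_mult_right_zero gaussian_integral(2)[OF a] S_def
      by (simp only: sqc DIM_cart DIM_real mult_1_right flip: power_mult_distrib)
    have G2I: "(\<integral>\<eta>. G2 \<eta> \<partial>lborel) = sqrt 2 ^ ?n * ?P"
    proof -
      have "(\<integral>\<eta>. G2 \<eta> \<partial>lborel) = S * sqrt (pi / (a / 2)) ^ ?n"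
        unfolding G2_def integral_mult_right_zero gaussian_integral(2)[OF a2] by simp
      also have "sqrt (pi / (a / 2)) = sqrt 2 * sqrt (pi / a)" by (simp flip: real_sqrt_mult)
      also have "S * (sqrt 2 * sqrt (pi / a)) ^ ?n = sqrt 2 ^ ?n * (sqrt (pi / \<rho>\<^sup>2) * sqrt (pi / a)) ^ ?n"
        by (simp only: S_def power_mult_distrib mult_ac)
      finally show ?thesis unfolding sqc .
    qed
    \<comment> \<open>The second moment is of order \<rho>^2 = 1 / (4a), at the price of a Gaussian
      with half the exponent.\<close>
    have moment: "(norm \<eta>)\<^sup>2 * G \<eta> \<le> 8 * \<rho>\<^sup>2 * G2 \<eta>" for \<eta>
    proof -
      let ?y = "a * (norm \<eta>)\<^sup>2"
      have "?y / 2 \<le> exp (?y / 2)" using exp_ge_add_one_self[of "?y / 2"] by linarith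
      then have "?y * exp (- ?y) \<le> 2 * exp (?y / 2) * exp (- ?y)" by (intro mult_right_mono) auto
      also have "\<dots> = 2 * exp (- (?y / 2))" by (simp flip: exp_add)
      finally have "?y * exp (- ?y) \<le> 2 * exp (- (?y / 2))" .
      then have le: "4 * \<rho>\<^sup>2 * S * (?y * exp (- ?y)) \<le> 4 * \<rho>\<^sup>2 * S * (2 * exp (- (?y / 2)))"
        using rho S by (intro mult_left_mono) auto
      have "4 * \<rho>\<^sup>2 * a = 1" using rho by (simp add: a_def)
      then have "(norm \<eta>)\<^sup>2 * G \<eta> = (4 * \<rho>\<^sup>2 * a) * ((norm \<eta>)\<^sup>2 * G \<eta>)" by simp
      also have "\<dots> = 4 * \<rho>\<^sup>2 * S * (?y * exp (- ?y))" by (simp add: G_def)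
      also note le
      also have "4 * \<rho>\<^sup>2 * S * (2 * exp (- (?y / 2))) = 8 * \<rho>\<^sup>2 * G2 \<eta>" by (simp add: G2_def)
      finally show ?thesis .
    qed
    have G0: "G \<eta> \<ge> 0" for \<eta> using S by (simp add: G_def)
    have dec: "gaussian_decay (fourier ?g)"
    proof (rule gaussian_decay_translate[where p = 0, OF _ a])
      show "fourier ?g \<in> borel_measurable borel" unfolding fg G_def by measurable
      show "norm (fourier ?g \<eta>) \<le> S * exp (- a * (norm (\<eta> - 0))\<^sup>2)" for \<eta>
        unfolding fg norm_of_real using G0[of \<eta>] by (simp add: G_def)
    qed
    have prp: "?P / 2 \<le> norm (propagated s 0 R ?g x)" if x: "norm x \<le> D * R powr (s - 1)" for x
    proof -
      let ?w = "\<lambda>\<eta>. cis (x \<bullet> \<eta>) * (cis (phase s \<eta>) * complex_of_real (cutoff 0 (\<eta> /\<^sub>R R)))"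
      have xr: "norm x * \<rho> \<le> D * c1"
      proof -
        have "norm x * \<rho> \<le> D * R powr (s - 1) * \<rho>" using x rho by (intro mult_right_mono) auto
        also have "\<dots> = D * c1 * (R powr (s - 1) * R powr (1 - s))" by (simp add: \<rho>_def)
        also have "R powr (s - 1) * R powr (1 - s) = 1" using R by (simp flip: powr_add)
        finally show ?thesis by simp
      qed
      have wd: "norm (?w \<eta> - 1) \<le> (norm x + 2) * norm \<eta> + (norm \<eta>)\<^sup>2" for \<eta>
      proof -
        let ?A = "cis (x \<bullet> \<eta>)" and ?B = "cis (phase s \<eta>)" and ?c = "complex_of_real (cutoff 0 (\<eta> /\<^sub>R R))"
        have "?w \<eta> - 1 = (?A - 1) + ?A * ((?B - 1) + ?B * (?c - 1))" by (simp add: algebra_simps)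
        also have "norm \<dots> \<le> norm (?A - 1) + norm ((?B - 1) + ?B * (?c - 1))"
          by (rule order_trans[OF norm_triangle_ineq]) (simp add: norm_mult)
        also have "norm ((?B - 1) + ?B * (?c - 1)) \<le> norm (?B - 1) + norm (?c - 1)"
          by (rule order_trans[OF norm_triangle_ineq]) (simp add: norm_mult)
        also have "norm (?A - 1) \<le> norm x * norm \<eta>"
          using norm_cis_diff_le[of "x \<bullet> \<eta>"] Cauchy_Schwarz_ineq2[of x \<eta>] by linarith
        \<comment> \<open>For |\<eta>| \<le> 1 the condition s > 1 gives |\<eta>|^s \<le> |\<eta>|;
          for larger \<eta> the trivial bound 2 suffices.\<close>
        also have "norm (?B - 1) \<le> 2 * norm \<eta>"
        proof (cases "norm \<eta> \<le> 1")
          case True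
          have "norm \<eta> powr s \<le> norm \<eta> powr 1"
            by (rule powr_mono') (use True s in auto)
          then have "norm \<eta> powr s \<le> norm \<eta>" by simp
          moreover have "norm (?B - 1) \<le> norm \<eta> powr s"
            using norm_cis_diff_le[of "phase s \<eta>"] by (simp add: phase_def)
          moreover have "0 \<le> norm \<eta>" by simp
          ultimately show ?thesis by linarith
        next
          case False
          then show ?thesis using norm_triangle_ineq4[of ?B 1] by simp
        qed
        also have "norm (?c - 1) \<le> (norm \<eta>)\<^sup>2"
        proof -
          have "norm (?c - 1) = 1 - exp (- (norm (\<eta> /\<^sub>R R))\<^sup>2)"
          proof -
            have "?c - 1 = complex_of_real (exp (- (norm (\<eta> /\<^sub>R R))\<^sup>2) - 1)" by (simp add: cutoff_def)
            then have "norm (?c - 1) = \<bar>exp (- (norm (\<eta> /\<^sub>R R))\<^sup>2) - 1\<bar>" by (simp only: norm_of_real)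
            also have "\<dots> = - (exp (- (norm (\<eta> /\<^sub>R R))\<^sup>2) - 1)" by (rule abs_of_nonpos) simp
            finally show ?thesis by simp
          qed
          also have "\<dots> \<le> (norm (\<eta> /\<^sub>R R))\<^sup>2" using exp_ge_add_one_self[of "- (norm (\<eta> /\<^sub>R R))\<^sup>2"] by linarith
          also have "\<dots> \<le> (norm \<eta>)\<^sup>2"
            using R by (intro power_mono) (auto simp: mult_left_le_one_le inverse_le_1_iff)
          finally show ?thesis .
        qed
        finally show ?thesis by (simp add: algebra_simps)
      qed
      \<comment> \<open>Trades the first moment for the second, the only one that has been
        estimated.\<close>
      have lin: "norm \<eta> \<le> \<rho> + (norm \<eta>)\<^sup>2 / \<rho>" for \<eta> :: "real^'n"
      proof (cases "norm \<eta> \<le> \<rho>")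
        case False
        then have "norm \<eta> * \<rho> \<le> norm \<eta> * norm \<eta>" by (intro mult_left_mono) auto
        then have "norm \<eta> \<le> (norm \<eta>)\<^sup>2 / \<rho>" using rho by (simp add: pos_le_divide_eq power2_eq_square)
        then show ?thesis using rho by linarith
      next
        case True
        moreover have "0 \<le> (norm \<eta>)\<^sup>2 / \<rho>" using rho by simp
        ultimately show ?thesis by linarith
      qed
      let ?X = "norm x + 2"
      have X: "?X \<ge> 0" by simp
      have pt: "norm (?w \<eta> * complex_of_real (G \<eta>) - complex_of_real (G \<eta>)) \<le> ?X * \<rho> * G \<eta> + (?X / \<rho> + 1) * (8 * \<rho>\<^sup>2) * G2 \<eta>" for \<eta>
      proof -
        have "norm (?w \<eta> * complex_of_real (G \<eta>) - complex_of_real (G \<eta>)) = norm (?w \<eta> - 1) * G \<eta>"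
        proof -
          have "?w \<eta> * complex_of_real (G \<eta>) - complex_of_real (G \<eta>) = (?w \<eta> - 1) * complex_of_real (G \<eta>)"
            by (simp only: left_diff_distrib mult_1_left)
          then show ?thesis using G0[of \<eta>] by (simp only: norm_mult norm_of_real abs_of_nonneg)
        qed
        also have "\<dots> \<le> (?X * (\<rho> + (norm \<eta>)\<^sup>2 / \<rho>) + (norm \<eta>)\<^sup>2) * G \<eta>"
          using wd[of \<eta>] mult_left_mono[OF lin[of \<eta>] X] G0[of \<eta>] by (intro mult_right_mono) auto
        also have "\<dots> = ?X * \<rho> * G \<eta> + (?X / \<rho> + 1) * ((norm \<eta>)\<^sup>2 * G \<eta>)" by (simp add: algebra_simps)
        also have "\<dots> \<le> ?X * \<rho> * G \<eta> + (?X / \<rho> + 1) * (8 * \<rho>\<^sup>2 * G2 \<eta>)"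
          using moment[of \<eta>] X rho by (intro add_left_mono mult_left_mono) auto
        finally show ?thesis by (simp only: mult.assoc)
      qed
      have wint: "integrable lborel (\<lambda>\<eta>. ?w \<eta> * complex_of_real (G \<eta>))"
      proof (rule Bochner_Integration.integrable_bound[OF Gint(1)])
        have [measurable]: "G \<in> borel_measurable borel" using borel_measurable_integrable[OF Gint(1)] by simp
        show "(\<lambda>\<eta>. ?w \<eta> * complex_of_real (G \<eta>)) \<in> borel_measurable lborel"
          unfolding phase_def by measurable
        show "AE \<eta> in lborel. norm (?w \<eta> * complex_of_real (G \<eta>)) \<le> norm (G \<eta>)"
          by (intro AE_I2) (auto simp: norm_mult abs_of_nonneg[OF cutoff_le(1)] cutoff_le intro!: mult_left_le_one_le)
      qed
      have Gc: "integrable lborel (\<lambda>\<eta>. complex_of_real (G \<eta>))" using Gint(1) by (simp add: complex_of_real_integrable_eq)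
      have prop_eq: "propagated s 0 R ?g x = (\<integral>\<eta>. ?w \<eta> * complex_of_real (G \<eta>) \<partial>lborel)"
        unfolding propagated_def fg by (simp only: mult.assoc)
      have "propagated s 0 R ?g x - complex_of_real ?P = (\<integral>\<eta>. ?w \<eta> * complex_of_real (G \<eta>) - complex_of_real (G \<eta>) \<partial>lborel)"
        unfolding prop_eq Bochner_Integration.integral_diff[OF wint Gc] integral_complex_of_real GI ..
      then have "norm (propagated s 0 R ?g x - complex_of_real ?P)
          \<le> (\<integral>\<eta>. norm (?w \<eta> * complex_of_real (G \<eta>) - complex_of_real (G \<eta>)) \<partial>lborel)"
        by (simp only:) (rule integral_norm_bound)
      also have "\<dots> \<le> (\<integral>\<eta>. ?X * \<rho> * G \<eta> + (?X / \<rho> + 1) * (8 * \<rho>\<^sup>2) * G2 \<eta> \<partial>lborel)"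
        by (rule integral_mono[OF integrable_norm[OF Bochner_Integration.integrable_diff[OF wint Gc]] _ pt])
           (intro Bochner_Integration.integrable_add integrable_mult_right Gint)
      also have "\<dots> = ?X * \<rho> * ?P + (?X / \<rho> + 1) * (8 * \<rho>\<^sup>2) * (sqrt 2 ^ ?n * ?P)"
        by (subst Bochner_Integration.integral_add[OF integrable_mult_right[OF Gint(1)] integrable_mult_right[OF Gint(2)]])
           (simp only: integral_mult_right_zero GI G2I)
      also have "\<dots> = (?X * \<rho> + (?X * \<rho> + \<rho>\<^sup>2) * (8 * sqrt 2 ^ ?n)) * ?P"
        using rho by (simp add: power2_eq_square field_simps)
      also have "\<dots> \<le> (1 / 2) * ?P"
      proof (rule mult_right_mono)
        have "\<rho>\<^sup>2 \<le> \<rho>" using rho c1 by (simp add: power2_eq_square mult_left_le)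
        then have "?X * \<rho> + \<rho>\<^sup>2 \<le> norm x * \<rho> + 3 * \<rho>" by (simp add: distrib_right)
        also have "\<dots> \<le> c1 * (D + 3)" using xr rho by (simp add: algebra_simps)
        finally have b: "?X * \<rho> + \<rho>\<^sup>2 \<le> c1 * (D + 3)" .
        have "?X * \<rho> + (?X * \<rho> + \<rho>\<^sup>2) * (8 * sqrt 2 ^ ?n) \<le> (?X * \<rho> + \<rho>\<^sup>2) * M"
          by (simp add: M_def algebra_simps)
        also have "\<dots> \<le> c1 * (D + 3) * M" using b M by (intro mult_right_mono) auto
        finally show "?X * \<rho> + (?X * \<rho> + \<rho>\<^sup>2) * (8 * sqrt 2 ^ ?n) \<le> 1 / 2" unfolding c1(3) .
      qed simp
      finally have "norm (propagated s 0 R ?g x - complex_of_real ?P) \<le> ?P / 2" by simp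
      moreover have "norm (complex_of_real ?P) = ?P" unfolding norm_of_real by simp
      ultimately show ?thesis
        using norm_triangle_ineq2[of "complex_of_real ?P" "propagated s 0 R ?g x"] by (simp add: norm_minus_commute)
    qed
    have Lg: "Lp_norm q ?g \<le> ennreal (1 * (V * \<rho> powr - real ?n) powr ?i)"
    proof (rule Lp_norm_le[OF _ q zero_less_one])
      show "V * \<rho> powr - real ?n > 0" using V rho by simp
      have "(\<integral>\<^sup>+x. ennreal (norm (?g x)) \<partial>lborel) = (\<integral>\<^sup>+x. ennreal (exp (- (\<rho>\<^sup>2) * (norm (x - (0::real^'n)))\<^sup>2)) \<partial>lborel)"
        by (simp del: of_real_exp)
      also have "\<dots> = ennreal (sqrt (pi / \<rho>\<^sup>2) ^ ?n)"
        using gaussian_nn_integral[OF rho2, of "0::real^'n"] by (simp only: DIM_cart DIM_real mult_1_right)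
      also have "sqrt (pi / \<rho>\<^sup>2) ^ ?n = V * \<rho> powr - real ?n"
        using rho by (simp add: V_def real_sqrt_divide power_divide powr_minus_divide powr_realpow)
      finally show "(\<integral>\<^sup>+x. ennreal (norm (?g x)) \<partial>lborel) \<le> ennreal (1 * (V * \<rho> powr - real ?n))" by simp
      show "?g \<in> borel_measurable borel" by measurable
      show "norm (?g x) \<le> 1" for x by (simp only: norm_of_real) simp
    qed
    have "(V * \<rho> powr - real ?n) powr ?i = (V * c1 powr - real ?n) powr ?i * R powr ((s - 1) * real ?n * ?i)"
    proof -
      have "\<rho> powr - real ?n = c1 powr - real ?n * R powr ((1 - s) * - real ?n)"
        unfolding \<rho>_def using c1 R by (simp add: powr_mult powr_powr)
      then have "V * \<rho> powr - real ?n = (V * c1 powr - real ?n) * R powr ((s - 1) * real ?n)" by (simp add: algebra_simps)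
      then show ?thesis using V c1 by (simp add: powr_mult powr_powr)
    qed
    with Lg have "Lp_norm q ?g \<le> ennreal ((V * c1 powr - real ?n) powr ?i * R powr ((s - 1) * real ?n * ?i))" by simp
    moreover have "gauss_poly ?g" by (rule gauss_poly_gaussian[OF rho2])
    ultimately show ?thesis using dec prp R by (intro exI[of _ ?g]) simp
  qed
  have "(V * c1 powr - real ?n) powr ?i > 0" using V c1 by simp
  moreover have "?P / 2 > 0" by simp
  moreover have "(1::real) \<le> 2 ^ k" for k by simp
  ultimately show ?thesis using main by blast
qed

section \<open>The regions\<close>

text \<open>Chebyshev's inequality bounds the norm of the product from below, and powers of R = 2^k
  are compared as k tends to infinity. In the exponents, a and b belong to the norms of the test
  functions, h to the size of the product and w to the measure of the set where this size is
  attained.\<close>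

lemma propagation_bound_exponent:
  assumes bound: "propagation_bound X Y (Lp_norm r) s j \<alpha>" and j: "j \<le> 1" and r: "0 < r" "r < \<infinity>"
    and C: "C\<^sub>1 > 0" "C\<^sub>2 > 0" "c > 0" "\<mu> > 0"
    and test: "\<And>k. k0 \<le> k \<Longrightarrow> \<exists>f g :: real^'n \<Rightarrow> complex. gauss_poly f \<and> gauss_poly g \<and>
      gaussian_decay (fourier f) \<and> gaussian_decay (fourier g) \<and>
      X f \<le> ennreal (C\<^sub>1 * (2 ^ k) powr a) \<and> Y g \<le> ennreal (C\<^sub>2 * (2 ^ k) powr b) \<and>
      ennreal (\<mu> * (2 ^ k) powr w) \<le>
        emeasure lborel {x. c * (2 ^ k) powr h \<le> norm (propagated s j (2 ^ k) f x * propagated s j (2 ^ k) g x)}"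
  shows "\<alpha> + h + w * enn2real (1 / r) \<le> a + b"
proof -
  let ?i = "enn2real (1 / r)"
  obtain L \<delta> where L: "L > 0" and d: "\<delta> > 0" and *: "\<And>k f g A B. gauss_poly f \<Longrightarrow> gauss_poly g \<Longrightarrow>
     gaussian_decay (fourier f) \<Longrightarrow> gaussian_decay (fourier g) \<Longrightarrow> 0 \<le> A \<Longrightarrow> 0 \<le> B \<Longrightarrow>
     X f \<le> ennreal A \<Longrightarrow> Y g \<le> ennreal B \<Longrightarrow>
     Lp_norm r (\<lambda>x. complex_of_real (\<delta> * (2 ^ k) powr \<alpha>) * (propagated s j (2 ^ k) f x * propagated s j (2 ^ k) g x))
       \<le> ennreal (L * A * B)"
    using bound unfolding propagation_bound_def by blast
  have "\<delta> * c * \<mu> powr ?i * (2 ^ k) powr (\<alpha> + h + w * ?i) \<le> L * C\<^sub>1 * C\<^sub>2 * (2 ^ k) powr (a + b)" if k: "k0 \<le> k" for k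
  proof -
    let ?R = "2 ^ k :: real"
    obtain f g :: "real^'n \<Rightarrow> complex" where fg: "gauss_poly f" "gauss_poly g" "gaussian_decay (fourier f)" "gaussian_decay (fourier g)"
      and X: "X f \<le> ennreal (C\<^sub>1 * ?R powr a)" and Y: "Y g \<le> ennreal (C\<^sub>2 * ?R powr b)"
      and mu: "ennreal (\<mu> * ?R powr w) \<le>
        emeasure lborel {x. c * ?R powr h \<le> norm (propagated s j ?R f x * propagated s j ?R g x)}" (is "_ \<le> emeasure _ ?E")
      using test[OF k] by blast
    let ?F = "\<lambda>x. complex_of_real (\<delta> * ?R powr \<alpha>) * (propagated s j ?R f x * propagated s j ?R g x)"
    have [measurable]: "propagated s j ?R f \<in> borel_measurable borel" "propagated s j ?R g \<in> borel_measurable borel"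
      using fg by (auto intro: borel_measurable_propagated[OF j])
    have "ennreal (\<delta> * ?R powr \<alpha> * (c * ?R powr h) * (\<mu> * ?R powr w) powr ?i) \<le> Lp_norm r ?F"
    proof (rule Lp_norm_ge[OF r _ _ mu])
      show "?E \<in> sets lborel" by measurable
      show "\<delta> * ?R powr \<alpha> * (c * ?R powr h) \<le> norm (?F x)" if "x \<in> ?E" for x
        using that d unfolding norm_mult norm_of_real by (simp add: abs_mult mult_left_mono)
    qed (use C d in auto)
    also have "\<dots> \<le> ennreal (L * (C\<^sub>1 * ?R powr a) * (C\<^sub>2 * ?R powr b))"
      using C by (intro *[OF fg _ _ X Y]) auto
    finally have "\<delta> * ?R powr \<alpha> * (c * ?R powr h) * (\<mu> * ?R powr w) powr ?i \<le> L * (C\<^sub>1 * ?R powr a) * (C\<^sub>2 * ?R powr b)"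
      using L C by (subst (asm) ennreal_le_iff) auto
    then show ?thesis using C by (simp add: powr_mult powr_powr powr_add mult_ac)
  qed
  then show ?thesis by (rule powr_exponent_le[where ?k0.0 = k0, rotated]) (use d C in auto)
qed

lemma norm_le_of_mem_cbox_One:
  fixes x :: "real^'n"
  assumes x: "x \<in> cbox 0 (l *\<^sub>R One)"
  shows "norm x \<le> real CARD('n) * l"
proof -
  have "norm x \<le> (\<Sum>b\<in>Basis. \<bar>x \<bullet> b\<bar>)" by (rule norm_le_l1)
  also have "\<dots> \<le> (\<Sum>b\<in>(Basis :: (real^'n) set). l)" using x by (intro sum_mono) (auto simp: mem_box inner_simps)
  finally show ?thesis by simp
qed

text \<open>Region I: the packets have norms R^(n(s-1)/p) and R^(n(s-1)/q), and the product is of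
  size R^(ns) on a cube of side 1/(nR), which lies in the focus of radius 1/R.\<close>

lemma propagation_bound_packets:
  assumes s: "s > 0" "s \<noteq> 1" and p: "1 \<le> p" "1 \<le> q"
    and bound: "propagation_bound (Lp_norm p :: (real^'n \<Rightarrow> complex) \<Rightarrow> ennreal) (Lp_norm q) (Lp_norm r) s 1 \<alpha>"
    and r: "0 < r" "r < \<infinity>"
  shows "\<alpha> + real CARD('n) * s - real CARD('n) * enn2real (1 / r)
    \<le> real CARD('n) * (s - 1) * (enn2real (1 / p) + enn2real (1 / q))"
proof -
  let ?n = "CARD('n)"
  define e :: "real^'n" where "e = axis undefined 1"
  have e: "norm e = 1" by (simp add: e_def)
  obtain v :: "real \<Rightarrow> real^'n \<Rightarrow> complex" and C where C: "C > 0" and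
    v: "\<And>R. R \<ge> 1 \<Longrightarrow> gauss_poly (v R) \<and> gaussian_decay (fourier (v R))" and
    vL: "\<And>R p. R \<ge> 1 \<Longrightarrow> p \<ge> 1 \<Longrightarrow> Lp_norm p (v R) \<le> ennreal (C * R powr (real ?n * (s - 1) * enn2real (1 / p)))" and
    vU: "\<And>R j R' x. R \<ge> 1 \<Longrightarrow> j \<le> 1 \<Longrightarrow> R' = R \<or> j = 0 \<and> R \<le> R' \<Longrightarrow> norm x \<le> 1 / R \<Longrightarrow>
      R powr (real ?n * s / 2) / C \<le> Re (cis (- (R * (x \<bullet> e))) * propagated s j R' (v R) x)"
    using packet_focus[OF s e zero_less_one] by metis
  have "\<alpha> + real ?n * s + (- real ?n) * enn2real (1 / r)
      \<le> real ?n * (s - 1) * enn2real (1 / p) + real ?n * (s - 1) * enn2real (1 / q)"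
  proof (rule propagation_bound_exponent[OF bound _ r C C, where ?k0.0 = 0 and c = "1 / (C * C)" and \<mu> = "(1 / real ?n) ^ ?n"])
    fix k :: nat
    let ?R = "2 ^ k :: real"
    have R: "?R \<ge> 1" by simp
    show "\<exists>f g :: real^'n \<Rightarrow> complex. gauss_poly f \<and> gauss_poly g \<and>
      gaussian_decay (fourier f) \<and> gaussian_decay (fourier g) \<and>
      Lp_norm p f \<le> ennreal (C * ?R powr (real ?n * (s - 1) * enn2real (1 / p))) \<and>
      Lp_norm q g \<le> ennreal (C * ?R powr (real ?n * (s - 1) * enn2real (1 / q))) \<and>
      ennreal ((1 / real ?n) ^ ?n * ?R powr - real ?n) \<le>
        emeasure lborel {x. 1 / (C * C) * ?R powr (real ?n * s) \<le> norm (propagated s 1 ?R f x * propagated s 1 ?R g x)}"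
    proof (intro exI[of _ "v ?R"] conjI)
      let ?P = "propagated s 1 ?R (v ?R)"
      let ?l = "1 / (real ?n * ?R)"
      have [measurable]: "?P \<in> borel_measurable borel" using v[OF R] by (intro borel_measurable_propagated) auto
      have "cbox 0 (0 + ?l *\<^sub>R One) \<subseteq> {x. 1 / (C * C) * ?R powr (real ?n * s) \<le> norm (?P x * ?P x)}"
      proof
        fix x :: "real^'n" assume "x \<in> cbox 0 (0 + ?l *\<^sub>R One)"
        then have x: "norm x \<le> 1 / ?R" using norm_le_of_mem_cbox_One[of x ?l] by simp
        have "?R powr (real ?n * s / 2) / C \<le> Re (cis (- (?R * (x \<bullet> e))) * ?P x)" using R x by (intro vU) auto
        also have "\<dots> \<le> norm (cis (- (?R * (x \<bullet> e))) * ?P x)" by (rule complex_Re_le_cmod)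
        also have "\<dots> = norm (?P x)" by (simp only: norm_mult norm_cis mult_1_left)
        finally have N: "?R powr (real ?n * s / 2) / C \<le> norm (?P x)" .
        have "1 / (C * C) * ?R powr (real ?n * s) = (?R powr (real ?n * s / 2) / C) * (?R powr (real ?n * s / 2) / C)"
        proof -
          have "?R powr (real ?n * s) = ?R powr (real ?n * s / 2) * ?R powr (real ?n * s / 2)"
            by (simp only: powr_add[symmetric] field_sum_of_halves)
          then show ?thesis by simp
        qed
        also have "\<dots> \<le> norm (?P x) * norm (?P x)" using N C by (intro mult_mono) auto
        finally show "x \<in> {x. 1 / (C * C) * ?R powr (real ?n * s) \<le> norm (?P x * ?P x)}" by (simp add: norm_mult)
      qed
      then have "emeasure lborel (cbox (0::real^'n) (0 + ?l *\<^sub>R One))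
          \<le> emeasure lborel {x. 1 / (C * C) * ?R powr (real ?n * s) \<le> norm (?P x * ?P x)}"
        by (rule emeasure_mono) measurable
      moreover have "?l ^ ?n = (1 / real ?n) ^ ?n * ?R powr - real ?n"
        by (simp add: powr_minus_divide powr_realpow power_divide power_mult_distrib)
      moreover have "?l > 0" by simp
      ultimately show "ennreal ((1 / real ?n) ^ ?n * ?R powr - real ?n)
          \<le> emeasure lborel {x. 1 / (C * C) * ?R powr (real ?n * s) \<le> norm (?P x * ?P x)}"
        unfolding cube_emeasure[OF \<open>?l > 0\<close>] by simp
    qed (use v[OF R] vL[OF R] p in auto)
  qed (use C in auto)
  then show ?thesis by (simp add: algebra_simps)
qed

text \<open>Since BMO does not see constants, the size at the focus is not enough. The product
  carries the oscillation e^(2iR x\<bullet>e), whose sign changes under a shift by \<pi>/(2R) along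
  e. The demodulated factors z^2 have positive real part, so that they cannot cancel in the
  difference.\<close>

lemma propagation_bound_packets_BMO:
  assumes s: "s > 0" "s \<noteq> 1"
    and bound: "propagation_bound (Lp_norm \<infinity> :: (real^'n \<Rightarrow> complex) \<Rightarrow> ennreal) (Lp_norm \<infinity>) BMO_norm s 1 \<alpha>"
  shows "\<alpha> + real CARD('n) * s \<le> 0"
proof -
  let ?n = "CARD('n)"
  define e :: "real^'n" where "e = axis undefined 1"
  have e: "norm e = 1" by (simp add: e_def)
  \<comment> \<open>The focus, in units of 1/R, must contain a cube of side \<pi>/R, which reaches
    no farther than n\<pi>/R from the origin, together with its shift by \<pi>/(2R).\<close>
  have C0: "(real ?n + 1) * pi > 0" by (simp add: add_pos_pos)
  obtain v :: "real \<Rightarrow> real^'n \<Rightarrow> complex" and C where C: "C > 0" and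
    v: "\<And>R. R \<ge> 1 \<Longrightarrow> gauss_poly (v R) \<and> gaussian_decay (fourier (v R))" and
    vL: "\<And>R p. R \<ge> 1 \<Longrightarrow> p \<ge> 1 \<Longrightarrow> Lp_norm p (v R) \<le> ennreal (C * R powr (real ?n * (s - 1) * enn2real (1 / p)))" and
    vU: "\<And>R j R' x. R \<ge> 1 \<Longrightarrow> j \<le> 1 \<Longrightarrow> R' = R \<or> j = 0 \<and> R \<le> R' \<Longrightarrow> norm x \<le> (real ?n + 1) * pi / R \<Longrightarrow>
      R powr (real ?n * s / 2) / C \<le> Re (cis (- (R * (x \<bullet> e))) * propagated s j R' (v R) x) \<and>
      \<bar>Im (cis (- (R * (x \<bullet> e))) * propagated s j R' (v R) x)\<bar>
        \<le> Re (cis (- (R * (x \<bullet> e))) * propagated s j R' (v R) x) / 2"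
    using packet_focus[OF s e C0] by metis
  obtain L \<delta> where L: "L > 0" and d: "\<delta> > 0" and *: "\<And>k (f :: real^'n \<Rightarrow> complex) g A B. gauss_poly f \<Longrightarrow> gauss_poly g \<Longrightarrow>
     gaussian_decay (fourier f) \<Longrightarrow> gaussian_decay (fourier g) \<Longrightarrow> 0 \<le> A \<Longrightarrow> 0 \<le> B \<Longrightarrow>
     Lp_norm \<infinity> f \<le> ennreal A \<Longrightarrow> Lp_norm \<infinity> g \<le> ennreal B \<Longrightarrow>
     BMO_norm (\<lambda>x. complex_of_real (\<delta> * (2 ^ k) powr \<alpha>) * (propagated s 1 (2 ^ k) f x * propagated s 1 (2 ^ k) g x))
       \<le> ennreal (L * A * B)"
    using bound unfolding propagation_bound_def by blast
  have "\<delta> / (4 * (C * C)) * (2 ^ k) powr (\<alpha> + real ?n * s) \<le> L * C * C * (2 ^ k) powr 0" for k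
  proof -
    let ?R = "2 ^ k :: real"
    have R: "?R \<ge> 1" by simp
    let ?P = "propagated s 1 ?R (v ?R)"
    define d' where "d' = \<delta> * ?R powr \<alpha>"
    have d': "d' > 0" using d by (simp add: d'_def)
    let ?F = "\<lambda>x. complex_of_real d' * (?P x * ?P x)"
    define N where "N = ?R powr (real ?n * s / 2) / C"
    have N: "N > 0" using C by (simp add: N_def)
    define z where "z x = cis (- (?R * (x \<bullet> e))) * ?P x" for x
    \<comment> \<open>From |Im z| \<le> Re z / 2 it follows that Re (z^2) \<ge> (3/4) (Re
      z)^2.\<close>
    have zz: "3 / 4 * N\<^sup>2 \<le> Re (z x * z x)" if "norm x \<le> (real ?n + 1) * pi / ?R" for x
    proof -
      have z: "N \<le> Re (z x)" "\<bar>Im (z x)\<bar> \<le> Re (z x) / 2" unfolding z_def N_def using vU[OF R _ _ that, of 1 ?R] by auto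
      then have "\<bar>Im (z x)\<bar>\<^sup>2 \<le> (Re (z x) / 2)\<^sup>2" by (intro power_mono) auto
      moreover have "N\<^sup>2 \<le> (Re (z x))\<^sup>2" using z N by (intro power_mono) auto
      ultimately show ?thesis by (simp add: power2_eq_square)
    qed
    have F: "?F x = complex_of_real d' * cis (2 * ?R * (x \<bullet> e)) * (z x * z x)" for x
    proof -
      have "?P x = cis (?R * (x \<bullet> e)) * z x" by (simp add: z_def cis_mult flip: mult.assoc)
      then have "?F x = complex_of_real d' * (cis (?R * (x \<bullet> e)) * cis (?R * (x \<bullet> e))) * (z x * z x)" by (simp only: mult_ac)
      then show ?thesis by (simp only: cis_mult mult_2[symmetric] mult.assoc)
    qed
    let ?l = "pi / ?R"
    let ?t = "axis undefined (?l / 2) :: real^'n"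
    have [measurable]: "?P \<in> borel_measurable borel" using v[OF R] by (intro borel_measurable_propagated) auto
    have "ennreal (d' * N\<^sup>2 / 2 / 2) \<le> BMO_norm ?F"
    proof (rule BMO_norm_ge[where l = ?l and i = undefined])
      show "?F \<in> borel_measurable borel" by measurable
      fix x :: "real^'n" assume "x \<in> cbox 0 (?l *\<^sub>R One)"
      then have x: "norm x \<le> real ?n * ?l" by (rule norm_le_of_mem_cbox_One)
      have nt: "norm ?t = ?l / 2" by (simp only: norm_eq_sqrt_inner inner_axis_axis if_True refl inner_real_def real_sqrt_abs2) simp
      have "norm (x + ?t) \<le> real ?n * ?l + ?l / 2" using x norm_triangle_ineq[of x ?t] nt by linarith
      also have "\<dots> \<le> (real ?n + 1) * pi / ?R" by (simp add: field_simps)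
      finally have xt: "norm (x + ?t) \<le> (real ?n + 1) * pi / ?R" .
      have "norm x \<le> (real ?n + 1) * pi / ?R" using x by (rule order_trans) (simp add: divide_right_mono)
      note re = zz[OF this] zz[OF xt]
      have "2 * ?R * ((x + ?t) \<bullet> e) = 2 * ?R * (x \<bullet> e) + pi"
        by (simp add: inner_add_left e_def inner_axis_axis algebra_simps)
      then have "cis (2 * ?R * ((x + ?t) \<bullet> e)) = - cis (2 * ?R * (x \<bullet> e))" by (simp add: cis_conv_exp exp_add distrib_left)
      then have "?F x - ?F (x + ?t) = complex_of_real d' * cis (2 * ?R * (x \<bullet> e)) * (z x * z x + z (x + ?t) * z (x + ?t))"
        unfolding F by (simp add: algebra_simps)
      then have F_eq: "norm (?F x - ?F (x + ?t)) = d' * norm (z x * z x + z (x + ?t) * z (x + ?t))"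
        using d' by (simp only: norm_mult norm_cis norm_of_real abs_of_pos mult_1_right)
      have "N\<^sup>2 \<le> Re (z x * z x + z (x + ?t) * z (x + ?t))"
        unfolding plus_complex.sel using re zero_le_power2[of N] by linarith
      also have "\<dots> \<le> norm (z x * z x + z (x + ?t) * z (x + ?t))" by (rule complex_Re_le_cmod)
      finally have "d' * N\<^sup>2 \<le> norm (?F x - ?F (x + ?t))" unfolding F_eq using d' by (intro mult_left_mono) auto
      then show "2 * (d' * N\<^sup>2 / 2) \<le> norm (?F x - ?F (x + ?t))" by simp
    qed (use d' in auto)
    also have "\<dots> \<le> ennreal (L * C * C)"
      unfolding d'_def using v[OF R] vL[OF R, of \<infinity>] C by (intro *) auto
    finally have "d' * N\<^sup>2 / 4 \<le> L * C * C" using L C by (subst (asm) ennreal_le_iff) auto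
    moreover have "N\<^sup>2 = ?R powr (real ?n * s) / (C * C)"
    proof -
      have "?R powr (real ?n * s) = ?R powr (real ?n * s / 2) * ?R powr (real ?n * s / 2)"
        by (simp only: powr_add[symmetric] field_sum_of_halves)
      then show ?thesis by (simp add: N_def power2_eq_square)
    qed
    ultimately show ?thesis by (simp add: d'_def powr_add mult_ac)
  qed
  then show ?thesis by (rule powr_exponent_le[where ?k0.0 = 0, rotated]) (use d C in simp)
qed

text \<open>Region II: both test functions are the same bump, so that both factors are large on the
  same set and no intersection of sets has to be measured.\<close>

lemma propagation_bound_spread:
  assumes s: "s > 0" "s \<noteq> 1" and p: "1 \<le> p" "1 \<le> q"
    and bound: "propagation_bound (Hp_norm p :: (real^'n \<Rightarrow> complex) \<Rightarrow> ennreal) (Hp_norm q) (Lp_norm r) s 1 \<alpha>"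
    and r: "0 < r" "r < \<infinity>"
  shows "\<alpha> - real CARD('n) * s + real CARD('n) * (s - 1) * enn2real (1 / r)
    \<le> - real CARD('n) * (enn2real (1 / p) + enn2real (1 / q))"
proof -
  let ?n = "CARD('n)"
  obtain C where C: "C > 0" and H: "\<And>R p. R > 0 \<Longrightarrow> p \<ge> 1 \<Longrightarrow> Hp_norm p (hardy_bump R :: real^'n \<Rightarrow> complex)
    \<le> ennreal (C * R powr (real ?n - real ?n * enn2real (1 / p)))"
    using hardy_bump_Hp by blast
  obtain b c D where bc: "b > 0" "c > 0" and spread: "\<And>R. R \<ge> 1 \<Longrightarrow> ennreal (c * R powr (real ?n * (s - 1))) \<le>
    emeasure lborel {x :: real^'n. norm x \<le> D * R powr (s - 1) \<and>
      b * R powr (real ?n - real ?n * s / 2) \<le> norm (propagated s 1 R (hardy_bump R) x)}"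
    using hardy_bump_spread[OF s, of 1] by blast
  have "\<alpha> + 2 * (real ?n - real ?n * s / 2) + real ?n * (s - 1) * enn2real (1 / r)
      \<le> (real ?n - real ?n * enn2real (1 / p)) + (real ?n - real ?n * enn2real (1 / q))"
  proof (rule propagation_bound_exponent[OF bound _ r C C, where ?k0.0 = 0 and c = "b * b" and \<mu> = c])
    fix k :: nat
    let ?R = "2 ^ k :: real"
    have R: "?R > 0" "?R \<ge> 1" by auto
    show "\<exists>f g :: real^'n \<Rightarrow> complex. gauss_poly f \<and> gauss_poly g \<and>
      gaussian_decay (fourier f) \<and> gaussian_decay (fourier g) \<and>
      Hp_norm p f \<le> ennreal (C * ?R powr (real ?n - real ?n * enn2real (1 / p))) \<and>
      Hp_norm q g \<le> ennreal (C * ?R powr (real ?n - real ?n * enn2real (1 / q))) \<and>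
      ennreal (c * ?R powr (real ?n * (s - 1))) \<le> emeasure lborel
        {x. b * b * ?R powr (2 * (real ?n - real ?n * s / 2)) \<le> norm (propagated s 1 ?R f x * propagated s 1 ?R g x)}"
    proof (intro exI[of _ "hardy_bump ?R"] conjI gauss_poly_hardy_bump gaussian_decay_hardy_bump R H p)
      let ?P = "propagated s 1 ?R (hardy_bump ?R) :: real^'n \<Rightarrow> complex"
      let ?h = "real ?n - real ?n * s / 2"
      have [measurable]: "?P \<in> borel_measurable borel"
        using gaussian_decay_hardy_bump[OF R(1)] by (intro borel_measurable_propagated) auto
      have "{x. norm x \<le> D * ?R powr (s - 1) \<and> b * ?R powr ?h \<le> norm (?P x)} \<subseteq>
          {x. b * b * ?R powr (2 * ?h) \<le> norm (?P x * ?P x)}"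
      proof safe
        fix x assume N: "b * ?R powr ?h \<le> norm (?P x)"
        have "?R powr (2 * ?h) = ?R powr ?h * ?R powr ?h" by (simp only: powr_add[symmetric] mult_2)
        then have "b * b * ?R powr (2 * ?h) = (b * ?R powr ?h) * (b * ?R powr ?h)" by simp
        also have "\<dots> \<le> norm (?P x) * norm (?P x)" using N bc by (intro mult_mono) auto
        finally show "b * b * ?R powr (2 * ?h) \<le> norm (?P x * ?P x)" by (simp only: norm_mult)
      qed
      from emeasure_mono[OF this, of lborel] spread[OF R(2)]
      show "ennreal (c * ?R powr (real ?n * (s - 1))) \<le> emeasure lborel {x. b * b * ?R powr (2 * ?h) \<le> norm (?P x * ?P x)}"
        by (rule order_trans[rotated]) measurable
    qed
  qed (use bc in auto)
  then show ?thesis by (simp add: algebra_simps)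
qed

text \<open>The spread bump is known to be large only on some part of a ball. The other factor is
  therefore required to be large on the whole ball, for whatever constant D the spreading yields;
  \<beta> is the exponent of its norm and \<gamma> that of its size.\<close>

lemma propagation_bound_spread_slow:
  assumes s: "s > 0" "s \<noteq> 1" and p: "1 \<le> p" "1 \<le> q"
    and bound: "propagation_bound (Hp_norm p :: (real^'n \<Rightarrow> complex) \<Rightarrow> ennreal) (Lp_norm q) (Lp_norm r) s 0 \<alpha>"
    and r: "0 < r" "r < \<infinity>"
    and slow: "\<And>D. D > 0 \<Longrightarrow> \<exists>C>0. \<exists>c>0. \<exists>k0. \<forall>k\<ge>k0. \<exists>g :: real^'n \<Rightarrow> complex. gauss_poly g \<and> gaussian_decay (fourier g) \<and>
      Lp_norm q g \<le> ennreal (C * (2 ^ k) powr \<beta>) \<and>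
      (\<forall>x. norm x \<le> D * (2 ^ k) powr (s - 1) \<longrightarrow> c * (2 ^ k) powr \<gamma> \<le> norm (propagated s 0 (2 ^ k) g x))"
  shows "\<alpha> - real CARD('n) * s / 2 + \<gamma> + real CARD('n) * (s - 1) * enn2real (1 / r)
    \<le> \<beta> - real CARD('n) * enn2real (1 / p)"
proof -
  let ?n = "CARD('n)"
  obtain C where C: "C > 0" and H: "\<And>R p. R > 0 \<Longrightarrow> p \<ge> 1 \<Longrightarrow> Hp_norm p (hardy_bump R :: real^'n \<Rightarrow> complex)
    \<le> ennreal (C * R powr (real ?n - real ?n * enn2real (1 / p)))"
    using hardy_bump_Hp by blast
  obtain b c D where bc: "b > 0" "c > 0" "D > 0" and spread: "\<And>R. R \<ge> 1 \<Longrightarrow> ennreal (c * R powr (real ?n * (s - 1))) \<le>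
    emeasure lborel {x :: real^'n. norm x \<le> D * R powr (s - 1) \<and>
      b * R powr (real ?n - real ?n * s / 2) \<le> norm (propagated s 0 R (hardy_bump R) x)}"
    using hardy_bump_spread[OF s, of 0] by blast
  obtain C' c' k0 where C': "C' > 0" "c' > 0" and slow': "\<And>k. k \<ge> k0 \<Longrightarrow> \<exists>g :: real^'n \<Rightarrow> complex. gauss_poly g \<and> gaussian_decay (fourier g) \<and>
      Lp_norm q g \<le> ennreal (C' * (2 ^ k) powr \<beta>) \<and>
      (\<forall>x. norm x \<le> D * (2 ^ k) powr (s - 1) \<longrightarrow> c' * (2 ^ k) powr \<gamma> \<le> norm (propagated s 0 (2 ^ k) g x))"
    using slow[OF bc(3)] by blast
  have "\<alpha> + (real ?n - real ?n * s / 2 + \<gamma>) + real ?n * (s - 1) * enn2real (1 / r)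
      \<le> (real ?n - real ?n * enn2real (1 / p)) + \<beta>"
  proof (rule propagation_bound_exponent[OF bound _ r C C'(1), where ?k0.0 = k0 and c = "b * c'" and \<mu> = c])
    fix k assume k: "k0 \<le> k"
    let ?R = "2 ^ k :: real"
    have R: "?R > 0" "?R \<ge> 1" by auto
    obtain g :: "real^'n \<Rightarrow> complex" where g: "gauss_poly g" "gaussian_decay (fourier g)" "Lp_norm q g \<le> ennreal (C' * ?R powr \<beta>)"
      and gx: "\<And>x. norm x \<le> D * ?R powr (s - 1) \<Longrightarrow> c' * ?R powr \<gamma> \<le> norm (propagated s 0 ?R g x)"
      using slow'[OF k] by blast
    show "\<exists>f g :: real^'n \<Rightarrow> complex. gauss_poly f \<and> gauss_poly g \<and>
      gaussian_decay (fourier f) \<and> gaussian_decay (fourier g) \<and>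
      Hp_norm p f \<le> ennreal (C * ?R powr (real ?n - real ?n * enn2real (1 / p))) \<and>
      Lp_norm q g \<le> ennreal (C' * ?R powr \<beta>) \<and>
      ennreal (c * ?R powr (real ?n * (s - 1))) \<le> emeasure lborel
        {x. b * c' * ?R powr (real ?n - real ?n * s / 2 + \<gamma>) \<le> norm (propagated s 0 ?R f x * propagated s 0 ?R g x)}"
    proof (rule exI[of _ "hardy_bump ?R"], rule exI[of _ g], intro conjI gauss_poly_hardy_bump gaussian_decay_hardy_bump R H p g)
      let ?P = "propagated s 0 ?R (hardy_bump ?R) :: real^'n \<Rightarrow> complex"
      let ?h = "real ?n - real ?n * s / 2"
      have [measurable]: "?P \<in> borel_measurable borel" "propagated s 0 ?R g \<in> borel_measurable borel"
        using gaussian_decay_hardy_bump[OF R(1)] g(2) by (auto intro!: borel_measurable_propagated)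
      have "{x. norm x \<le> D * ?R powr (s - 1) \<and> b * ?R powr ?h \<le> norm (?P x)} \<subseteq>
          {x. b * c' * ?R powr (?h + \<gamma>) \<le> norm (?P x * propagated s 0 ?R g x)}"
      proof safe
        fix x assume x: "norm x \<le> D * ?R powr (s - 1)" and N: "b * ?R powr ?h \<le> norm (?P x)"
        have "b * c' * ?R powr (?h + \<gamma>) = (b * ?R powr ?h) * (c' * ?R powr \<gamma>)" by (simp only: powr_add mult_ac)
        also have "\<dots> \<le> norm (?P x) * norm (propagated s 0 ?R g x)" using N gx[OF x] bc C' by (intro mult_mono) auto
        finally show "b * c' * ?R powr (?h + \<gamma>) \<le> norm (?P x * propagated s 0 ?R g x)" by (simp only: norm_mult)
      qed
      from emeasure_mono[OF this, of lborel] spread[OF R(2)]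
      show "ennreal (c * ?R powr (real ?n * (s - 1))) \<le> emeasure lborel
          {x. b * c' * ?R powr (?h + \<gamma>) \<le> norm (?P x * propagated s 0 ?R g x)}"
        by (rule order_trans[rotated]) measurable
    qed
  qed (use bc C' in auto)
  then show ?thesis by simp
qed

section \<open>From the exponent inequalities to the critical order\<close>

lemma one_divide_eq_ennreal:
  assumes "1 \<le> p"
  shows "1 / p = ennreal (enn2real (1 / p))"
proof (cases p)
  case (real P)
  then have "P \<ge> 1" using assms by (simp add: ennreal_ge_1)
  then show ?thesis by (simp add: real divide_ennreal[of 1, simplified])
qed simp

lemma two_le_ennreal_iff:
  assumes "1 \<le> p"
  shows "2 \<le> p \<Longrightarrow> enn2real (1 / p) \<le> 1 / 2" "p \<le> 2 \<Longrightarrow> 1 / 2 \<le> enn2real (1 / p)"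
    "p < 2 \<Longrightarrow> 1 / 2 < enn2real (1 / p)"
proof -
  have two: "(2::ennreal) = ennreal 2" by simp
  have "(2 \<le> p \<longrightarrow> enn2real (1 / p) \<le> 1 / 2) \<and> (p \<le> 2 \<longrightarrow> 1 / 2 \<le> enn2real (1 / p)) \<and> (p < 2 \<longrightarrow> 1 / 2 < enn2real (1 / p))"
  proof (cases p)
    case (real P)
    then have P: "P \<ge> 1" using assms by (simp add: ennreal_ge_1)
    then have i: "enn2real (1 / p) = 1 / P" by (simp add: real enn2real_one_divide)
    have "2 \<le> p \<longleftrightarrow> 2 \<le> P" "p \<le> 2 \<longleftrightarrow> P \<le> 2" "p < 2 \<longleftrightarrow> P < 2"
      unfolding real two using P by (auto simp: ennreal_less_iff simp del: ennreal_numeral)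
    then show ?thesis unfolding i using P by (auto simp: field_simps)
  qed (simp add: top_unique)
  then show "2 \<le> p \<Longrightarrow> enn2real (1 / p) \<le> 1 / 2" "p \<le> 2 \<Longrightarrow> 1 / 2 \<le> enn2real (1 / p)"
    "p < 2 \<Longrightarrow> 1 / 2 < enn2real (1 / p)" by auto
qed

lemma Hp_norm_eq_Lp_norm:
  assumes "2 \<le> p"
  shows "Hp_norm p = Lp_norm p"
proof -
  have "1 < (2::ennreal)" by simp
  then have "\<not> p \<le> 1" using assms by (simp only: not_le less_le_trans)
  then show ?thesis by (simp add: Hp_norm_def fun_eq_iff)
qed

text \<open>For s > 1 the norm of the slow Gaussian just cancels the share of 1/q in the measure of
  the ball, and q disappears. For s < 1 the focusing of the slow packets leaves the gain with the
  factor s(1 - s).\<close>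

lemma propagation_bound_mixed:
  assumes s: "0 < s" "s \<noteq> 1" and p: "1 \<le> p" "1 \<le> q" and r: "0 < r" "r < \<infinity>"
    and ir: "enn2real (1 / r) = enn2real (1 / p) + enn2real (1 / q)"
    and bound: "propagation_bound (Hp_norm p :: (real^'n \<Rightarrow> complex) \<Rightarrow> ennreal) (Lp_norm q) (Lp_norm r) s 0 \<alpha>"
  shows "\<alpha> \<le> - real CARD('n) * s * (enn2real (1 / p) - 1 / 2)
    - (if s < 1 then real CARD('n) * s * (1 - s) * (1 / 2 - enn2real (1 / q)) else 0)"
proof (cases "s < 1")
  case True
  from propagation_bound_spread_slow[OF s p bound r slow_test_lt_one[OF s(1) True p(2)]]
  show ?thesis using True unfolding ir by (simp add: field_simps)
next
  case False
  then have "1 < s" using s by simp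
  from propagation_bound_spread_slow[OF s p bound r slow_test_gt_one[OF this p(2)]]
  show ?thesis using False unfolding ir by (simp add: field_simps)
qed

theorem theorem1p4:
  fixes s m :: real and p q r :: ennreal
  assumes "0 < s \<and> s < 1 \<or> 1 < s"
    and "(p, q) \<in> region_I \<union> region_II \<union> region_IV \<union> region_VI"
    and "1 / r = 1 / p + 1 / q"
    and "\<And>\<sigma> :: (real^'n) \<times> (real^'n) \<Rightarrow> complex. \<sigma> \<in> symbol_class m \<Longrightarrow>
           bounded_from_to (bilinear_fio s \<sigma>) (Hp_norm p) (Hp_norm q)
             (if r = \<infinity> then BMO_norm else Lp_norm r)"
  shows "m \<le> crit_order CARD('n) s p q"
proof -
  let ?n = "real CARD('n)"
  let ?Z = "(if r = \<infinity> then BMO_norm else Lp_norm r) :: (real^'n \<Rightarrow> complex) \<Rightarrow> ennreal"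
  define ip iq where "ip = enn2real (1 / p)" and "iq = enn2real (1 / q)"
  have s: "0 < s" "s \<noteq> 1" using assms(1) by auto
  have ns: "?n * s > 0" using s by simp
  have "1 \<le> a" if "2 \<le> a" for a :: ennreal by (rule order_trans[OF _ that]) simp
  then have p: "1 \<le> p" "1 \<le> q"
    using assms(2) by (auto simp: region_I_def region_II_def region_IV_def region_VI_def)
  have ip: "1 / p = ennreal ip" "1 / q = ennreal iq" "0 \<le> ip" "0 \<le> iq"
    unfolding ip_def iq_def by (fact one_divide_eq_ennreal[OF p(1)], fact one_divide_eq_ennreal[OF p(2)], simp, simp)
  have r1: "1 / r = ennreal (ip + iq)" unfolding assms(3) ip using ip by simp
  have ir: "enn2real (1 / r) = ip + iq" unfolding r1 by (rule enn2real_ennreal) (use ip in simp)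
  have r0: "0 < r"
  proof (rule ccontr)
    assume "\<not> 0 < r"
    then have "r = 0" by (simp add: zero_less_iff_neq_zero)
    with r1 show False by simp
  qed
  have r_inf: "r = \<infinity> \<Longrightarrow> ip = 0 \<and> iq = 0" using r1 ip by auto
  have Z: "quasi_norm_like ?Z"
    using quasi_norm_like_BMO_norm quasi_norm_like_Lp_norm[OF r0] by (auto simp: less_top)
  note bound = propagation_boundI[OF assms(4) Z]
  show ?thesis
  proof (cases "(p, q) \<in> region_I \<union> region_II")
    case True
    have crit: "crit_order CARD('n) s p q = - ?n * s * (\<bar>ip - 1 / 2\<bar> + \<bar>iq - 1 / 2\<bar>)"
      using True by (simp add: crit_order_def Let_def ip_def iq_def)
    \<comment> \<open>The truncation is at 1 because the critical order is 0 at p = q = 2, where a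
      bound on min m 0 would say nothing. As the critical order is at most 0, the bound on min m 1
      passes to m.\<close>
    have "min m 1 \<le> crit_order CARD('n) s p q"
    proof (rule field_le_epsilon)
      fix \<epsilon> :: real assume eps: "\<epsilon> > 0"
      have pb: "propagation_bound (Hp_norm p :: (real^'n \<Rightarrow> complex) \<Rightarrow> ennreal) (Hp_norm q) ?Z s 1 (min m 1 - \<epsilon>)"
        by (rule bound[OF _ eps]) auto
      show "min m 1 \<le> crit_order CARD('n) s p q + \<epsilon>"
      proof (cases "(p, q) \<in> region_I")
        case True
        then have pq: "2 \<le> p" "2 \<le> q" by (auto simp: region_I_def)
        note half = two_le_ennreal_iff(1)[OF p(1) pq(1), folded ip_def] two_le_ennreal_iff(1)[OF p(2) pq(2), folded iq_def]
        note pb' = pb[unfolded Hp_norm_eq_Lp_norm[OF pq(1)] Hp_norm_eq_Lp_norm[OF pq(2)]]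
        show ?thesis
        proof (cases "r = \<infinity>")
          case True
          then have i: "ip = 0" "iq = 0" using r_inf by auto
          then have "p = \<infinity>" "q = \<infinity>" using ip by (auto simp: ennreal_divide_eq_0_iff)
          then have "min m 1 - \<epsilon> + ?n * s \<le> 0" using pb' True by (intro propagation_bound_packets_BMO[OF s]) simp
          then show ?thesis unfolding crit i by simp
        next
          case False
          then have "r < \<infinity>" by (simp add: less_top)
          from propagation_bound_packets[OF s p _ r0 this, where 'n = 'n] pb' False
          have "min m 1 - \<epsilon> + ?n * s - ?n * (ip + iq) \<le> ?n * (s - 1) * (ip + iq)"
            unfolding ir ip_def[symmetric] iq_def[symmetric] by simp
          moreover have "\<bar>ip - 1 / 2\<bar> + \<bar>iq - 1 / 2\<bar> = 1 - (ip + iq)" using half by linarith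
          ultimately show ?thesis unfolding crit by (simp add: algebra_simps)
        qed
      next
        case False
        then have pq: "p \<le> 2" "q \<le> 2" using \<open>(p, q) \<in> region_I \<union> region_II\<close> by (auto simp: region_II_def)
        note half = two_le_ennreal_iff(2)[OF p(1) pq(1), folded ip_def] two_le_ennreal_iff(2)[OF p(2) pq(2), folded iq_def]
        then have r: "r \<noteq> \<infinity>" using r_inf by auto
        then have "r < \<infinity>" by (simp add: less_top)
        from propagation_bound_spread[OF s p _ r0 this, where 'n = 'n] pb r
        have "min m 1 - \<epsilon> - ?n * s + ?n * (s - 1) * (ip + iq) \<le> - ?n * (ip + iq)"
          unfolding ir ip_def[symmetric] iq_def[symmetric] by simp
        moreover have "\<bar>ip - 1 / 2\<bar> + \<bar>iq - 1 / 2\<bar> = (ip + iq) - 1" using half by linarith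
        ultimately show ?thesis unfolding crit by (simp add: algebra_simps)
      qed
    qed
    moreover have "crit_order CARD('n) s p q \<le> 0" unfolding crit using ns by (simp add: mult_nonpos_nonneg)
    ultimately show ?thesis by linarith
  next
    case False
    \<comment> \<open>The critical order is negative in the remaining cases, so that truncation at 0
      is harmless: min m 0 \<le> c < 0 forces m \<le> c.\<close>
    have conclude: "m \<le> c" if "c < 0" "\<And>\<epsilon>. \<epsilon> > 0 \<Longrightarrow> min m 0 - \<epsilon> \<le> c" for c :: real
    proof -
      have "min m 0 \<le> c" by (rule field_le_epsilon) (use that(2) in \<open>simp add: diff_le_eq\<close>)
      then show ?thesis using that(1) by linarith
    qed
    have pb: "propagation_bound (Hp_norm p :: (real^'n \<Rightarrow> complex) \<Rightarrow> ennreal) (Hp_norm q) ?Z s 0 (min m 0 - \<epsilon>)"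
      if "\<epsilon> > 0" for \<epsilon>
      by (rule bound[OF _ that]) auto
    \<comment> \<open>The common form of both regions: a belongs to the factor tested by the bump, b
      to the slow one.\<close>
    define e where "e a b = - ?n * s * (a - 1 / 2) - (if s < 1 then ?n * s * (1 - s) * (1 / 2 - b) else 0)" for a b
    have e_neg: "e a b < 0" if "1 / 2 < a" "b \<le> 1 / 2" for a b
    proof -
      have "0 < ?n * s * (a - 1 / 2)" using ns that by simp
      moreover have "0 \<le> (if s < 1 then ?n * s * (1 - s) * (1 / 2 - b) else 0)" using ns that by simp
      ultimately show ?thesis unfolding e_def by linarith
    qed
    consider "(p, q) \<in> region_IV" | "(p, q) \<in> region_VI" using assms(2) False by auto
    then show ?thesis
    proof cases
      case 1
      then have pq: "p \<le> 2" "2 \<le> q" by (auto simp: region_IV_def)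
      \<comment> \<open>p = 2 would put the pair into region I. The strict inequality makes the
        critical order negative.\<close>
      with False have p2: "p < 2" by (auto simp: region_I_def not_le[symmetric])
      note half = two_le_ennreal_iff(3)[OF p(1) p2, folded ip_def] two_le_ennreal_iff(1)[OF p(2) pq(2), folded iq_def]
      have VI: "(p, q) \<notin> region_VI" using p2 by (auto simp: region_VI_def)
      have eq: "ip + iq = 1" if "(p, q) \<in> region_III"
      proof -
        have "1 / r = 1" using that 1 assms(3) by (auto simp: region_III_def region_IV_def intro: antisym)
        then show ?thesis using ir by simp
      qed
      have crit: "crit_order CARD('n) s p q = e ip iq"
      proof (cases "(p, q) \<in> region_III")
        case True
        then have iq: "iq = 1 - ip" using eq by simp
        then have "\<bar>iq - 1 / 2\<bar> = ip - 1 / 2" "\<bar>ip - 1 / 2\<bar> = ip - 1 / 2" using half by auto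
        then have "crit_order CARD('n) s p q = (if s < 1 then - ?n * s * (1 - s) * (ip - 1 / 2) - ?n * s * (ip - 1 / 2)
            else - ?n * s * (ip - 1 / 2))"
          using True False by (simp add: crit_order_def Let_def flip: ip_def iq_def)
        then show ?thesis by (simp add: e_def iq)
      next
        case nIII: False
        have "\<bar>ip - 1 / 2\<bar> = ip - 1 / 2" "\<bar>iq - 1 / 2\<bar> = 1 / 2 - iq" using half by auto
        then show ?thesis using nIII VI False by (simp add: crit_order_def Let_def e_def flip: ip_def iq_def)
      qed
      have r: "r \<noteq> \<infinity>" using r_inf half by auto
      then have r': "r < \<infinity>" by (simp add: less_top)
      have "min m 0 - \<epsilon> \<le> e ip iq" if "\<epsilon> > 0" for \<epsilon>
        unfolding e_def ip_def iq_def
        using pb[OF that] r Hp_norm_eq_Lp_norm[OF pq(2), where 'a = 'n]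
        by (intro propagation_bound_mixed[OF s p r0 r' ir[unfolded ip_def iq_def]]) simp
      then show ?thesis unfolding crit by (rule conclude[OF e_neg[OF half]])
    next
      case 2
      then have pq: "q \<le> 2" "2 \<le> p" by (auto simp: region_VI_def)
      with False have p2: "q < 2" by (auto simp: region_I_def not_le[symmetric])
      note half = two_le_ennreal_iff(3)[OF p(2) p2, folded iq_def] two_le_ennreal_iff(1)[OF p(1) pq(2), folded ip_def]
      have "\<bar>iq - 1 / 2\<bar> = iq - 1 / 2" "\<bar>ip - 1 / 2\<bar> = 1 / 2 - ip" using half by auto
      then have crit: "crit_order CARD('n) s p q = e iq ip"
        using 2 False by (simp add: crit_order_def Let_def e_def flip: ip_def iq_def)
      have r: "r \<noteq> \<infinity>" using r_inf half by auto
      then have r': "r < \<infinity>" by (simp add: less_top)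
      \<comment> \<open>The roles of f and g are exchanged: g is the bump and f the slow
        factor.\<close>
      have ir': "enn2real (1 / r) = enn2real (1 / q) + enn2real (1 / p)" unfolding ir ip_def iq_def by simp
      have "min m 0 - \<epsilon> \<le> e iq ip" if "\<epsilon> > 0" for \<epsilon>
        unfolding e_def ip_def iq_def
        using propagation_bound_swap[OF pb[OF that]] r Hp_norm_eq_Lp_norm[OF pq(2), where 'a = 'n]
        by (intro propagation_bound_mixed[OF s p(2,1) r0 r' ir']) simp
      then show ?thesis unfolding crit by (rule conclude[OF e_neg[OF half]])
    qed
  qed
qed

end
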